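(* Let $\mathcal D$ be a smooth codimension-1 distribution on $\mathbb{R}^N$ (with frame and $\Theta_0$, $L_x$, $Q$ as in the context) and let $n\ge0$. Then $T\in\Psi^n_{\mathcal D}(\mathbb{R}^N)$ if and only if there exists a tempered distribution $k_0(x,u)$ on $\mathbb{R}^N\times\mathbb{R}^N$ such that: (a) $k_0$ is smooth on $\mathbb{R}^N\times(\mathbb{R}^N\setminus\{0\})$ and $|\partial_x^I\partial_u^\gamma k_0(x,u)|\le C_{I,\gamma,M}\|u\|^{-Q-n-\|\gamma\|-M}$ for all multi-indices $I,\gamma$ and all $M\ge0$; (b) for every normalized bump function $\phi$ and every $r\in(0,1)$, $\sup_{x\in\mathbb{R}^N}|\langle\partial_x^Ik_0(x,u),\phi_r(u)\rangle|\le C_Ir^{-n}$ for all multi-indices $I$ (pairing in $u$); (c) $\langle Tf,g\rangle=\langle k_0(x,u),f(x-L_x^{-1}(u))g(x)\rangle$ for all Schwartz functions $f,g$.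
   Context: $\mathcal D$ is a smooth codimension-1 distribution on $\mathbb{R}^N$, with $X_i=\sum_jA_i^j(x)\partial_{x^j}$ ($1\le i\le N$), $X_1,\dots,X_{N-1}$ spanning $\mathcal D$, $A_i^j$ smooth with uniformly bounded $C^k$ norms, $|\det(A_i^j)|\ge c>0$. $M_x\xi=\sum_i(\sum_jA_i^j(x)\xi_j)dx^i$; $\|\xi\|=|\xi'|+|\xi_N|^{1/2}$; $\|\alpha\|=|\alpha'|+2\alpha_N$. $\Psi^n_{\mathcal D}(\mathbb{R}^N)$: operators $Tf(x)=\int a_0(x,M_x\xi)\hat f(\xi)e^{2\pi ix\cdot\xi}d\xi$ with $|\partial_x^I\partial_\xi^\alpha a_0|\le C_{I,\alpha}(1+\|\xi\|)^{n-\|\alpha\|}$. $(B_j^k)=(A_i^j)^{-1}$, $(L_xu)^k=\sum_jB^k_j(x)u^j$, $\Theta_0(x,y)=L_x(x-y)$, $Q=N+1$. A normalized bump function is a smooth $\phi$ supported in $\{\|u\|\le1\}$ with $\|\partial_u^\gamma\phi\|_{L^\infty}\le C_\gamma$ for all $\gamma$ (fixed constants), and $\phi_r(u)=\phi(r^{-1}u',r^{-2}u_N)$. $\langle\cdot,\cdot\rangle$ denotes the pairing of tempered distributions with Schwartz functions. *)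

theory Defs
  imports "HOL-Analysis.Analysis"
begin

definition dirD :: "'a::real_normed_vector \<Rightarrow> ('a \<Rightarrow> 'b::real_normed_vector) \<Rightarrow> 'a \<Rightarrow> 'b" where
  "dirD v f x = vector_derivative (\<lambda>t. f (x + t *\<^sub>R v)) (at 0)"

text \<open>Dl [v1,...,vk] f = d_{v1} ... d_{vk} f; a multi-index is represented by a list of
  coordinate directions (order is immaterial for smooth functions).\<close>
definition Dl :: "'a::real_normed_vector list \<Rightarrow> ('a \<Rightarrow> 'b::real_normed_vector) \<Rightarrow> 'a \<Rightarrow> 'b" where
  "Dl vs f = foldr dirD vs f"

definition Cinf_on :: "'a::euclidean_space set \<Rightarrow> ('a \<Rightarrow> 'b::real_normed_vector) \<Rightarrow> bool" where
  "Cinf_on U f \<longleftrightarrow>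
     (\<forall>vs. set vs \<subseteq> Basis \<longrightarrow> continuous_on U (Dl vs f) \<and>
        (\<forall>v\<in>Basis. \<forall>x\<in>U. ((\<lambda>t. Dl vs f (x + t *\<^sub>R v)) has_vector_derivative Dl (v # vs) f x) (at 0)))"

definition schwartz :: "('a::euclidean_space \<Rightarrow> complex) \<Rightarrow> bool" where
  "schwartz f \<longleftrightarrow> Cinf_on UNIV f \<and>
     (\<forall>vs (k::nat). set vs \<subseteq> Basis \<longrightarrow> (\<exists>C. \<forall>x. (1 + norm x) ^ k * norm (Dl vs f x) \<le> C))"

definition tempered :: "(('a::euclidean_space \<Rightarrow> complex) \<Rightarrow> complex) \<Rightarrow> bool" where
  "tempered K \<longleftrightarrow>
     (\<forall>f g c. schwartz f \<and> schwartz g \<longrightarrow>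
        K (\<lambda>x. f x + g x) = K f + K g \<and> K (\<lambda>x. c * f x) = c * K f) \<and>
     (\<exists>C (m::nat). \<forall>f B. schwartz f \<and>
        (\<forall>vs x. set vs \<subseteq> Basis \<and> length vs \<le> m \<longrightarrow> (1 + norm x) ^ m * norm (Dl vs f x) \<le> B)
        \<longrightarrow> norm (K f) \<le> C * B)"

definition fourier :: "(real^'n \<Rightarrow> complex) \<Rightarrow> real^'n \<Rightarrow> complex" where
  "fourier f \<xi> = (\<integral>x. f x * cis (- 2 * pi * (x \<bullet> \<xi>)) \<partial>lborel)"

section \<open>Anisotropic quantities; d is the distinguished (N-th) coordinate\<close>

definition anorm :: "'n::finite \<Rightarrow> real^'n \<Rightarrow> real" where
  "anorm d \<xi> = sqrt (\<Sum>i\<in>UNIV - {d}. (\<xi> $ i)\<^sup>2) + sqrt \<bar>\<xi> $ d\<bar>"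

definition wdeg :: "'n \<Rightarrow> 'n list \<Rightarrow> real" where
  "wdeg d \<alpha> = real (length (filter (\<lambda>i. i \<noteq> d) \<alpha>)) + 2 * real (length (filter (\<lambda>i. i = d) \<alpha>))"

definition xdir :: "'n::finite \<Rightarrow> (real^'n) \<times> (real^'n)" where
  "xdir i = (axis i 1, 0)"

definition udir :: "'n::finite \<Rightarrow> (real^'n) \<times> (real^'n)" where
  "udir i = (0, axis i 1)"

definition cdir :: "'n::finite \<Rightarrow> real^'n" where
  "cdir i = axis i 1"

text \<open>(L_x u)^k = sum_j B_j^k(x) u^j with (B_j^k) = (A_i^j)^{-1}; A x $ i $ j = A_i^j(x).\<close>
definition Lx :: "(real^'n \<Rightarrow> real^'n^'n) \<Rightarrow> real^'n \<Rightarrow> real^'n \<Rightarrow> real^'n::finite" where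
  "Lx A x u = (\<chi> k. \<Sum>j\<in>UNIV. matrix_inv (A x) $ j $ k * u $ j)"

definition dil :: "'n::finite \<Rightarrow> real \<Rightarrow> real^'n \<Rightarrow> real^'n" where
  "dil d r u = (\<chi> i. if i = d then u $ i / r\<^sup>2 else u $ i / r)"

definition normalized_bump :: "'n::finite \<Rightarrow> ('n list \<Rightarrow> real) \<Rightarrow> (real^'n \<Rightarrow> complex) \<Rightarrow> bool" where
  "normalized_bump d Cb \<phi> \<longleftrightarrow> Cinf_on UNIV \<phi> \<and> (\<forall>u. anorm d u > 1 \<longrightarrow> \<phi> u = 0) \<and>
     (\<forall>\<gamma> u. norm (Dl (map cdir \<gamma>) \<phi> u) \<le> Cb \<gamma>)"

section \<open>The class Psi^n_D; an operator T is represented by its bilinear pairing T f g = <Tf, g>\<close>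

definition PsiD :: "(real^'n \<Rightarrow> real^'n^'n) \<Rightarrow> 'n::finite \<Rightarrow> real \<Rightarrow>
    ((real^'n \<Rightarrow> complex) \<Rightarrow> (real^'n \<Rightarrow> complex) \<Rightarrow> complex) set" where
  "PsiD A d n = {T. \<exists>a0 :: (real^'n) \<times> (real^'n) \<Rightarrow> complex.
      Cinf_on UNIV a0 \<and>
      (\<forall>I \<alpha>. \<exists>C. \<forall>x \<xi>. norm (Dl (map xdir I @ map udir \<alpha>) a0 (x, \<xi>))
                           \<le> C * (1 + anorm d \<xi>) powr (n - wdeg d \<alpha>)) \<and>
      (\<forall>f g. schwartz f \<and> schwartz g \<longrightarrow>
         T f g = (\<integral>x. (\<integral>\<xi>. a0 (x, A x *v \<xi>) * fourier f \<xi> * cis (2 * pi * (x \<bullet> \<xi>)) \<partial>lborel) * g x \<partial>lborel))}"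

definition kernel_cond_a :: "'n::finite \<Rightarrow> real \<Rightarrow> (((real^'n) \<times> (real^'n) \<Rightarrow> complex) \<Rightarrow> complex) \<Rightarrow> bool" where
  "kernel_cond_a d n K \<longleftrightarrow> (\<exists>k :: (real^'n) \<times> (real^'n) \<Rightarrow> complex.
      Cinf_on (UNIV \<times> (UNIV - {0})) k \<and>
      (\<forall>\<phi>. schwartz \<phi> \<and> compact (closure {p. \<phi> p \<noteq> 0}) \<and>
            closure {p. \<phi> p \<noteq> 0} \<subseteq> UNIV \<times> (UNIV - {0})
            \<longrightarrow> K \<phi> = (\<integral>p. k p * \<phi> p \<partial>lborel)) \<and>
      (\<forall>I \<gamma> (M::real). M \<ge> 0 \<longrightarrow> (\<exists>C. \<forall>x u. u \<noteq> 0 \<longrightarrow>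
          norm (Dl (map xdir I @ map udir \<gamma>) k (x, u))
            \<le> C * anorm d u powr (- (real CARD('n) + 1) - n - wdeg d \<gamma> - M))))"

definition kernel_cond_b :: "'n::finite \<Rightarrow> real \<Rightarrow> (((real^'n) \<times> (real^'n) \<Rightarrow> complex) \<Rightarrow> complex) \<Rightarrow> bool" where
  "kernel_cond_b d n K \<longleftrightarrow> (\<forall>Cb I. \<exists>C. \<forall>\<phi> r. normalized_bump d Cb \<phi> \<and> 0 < r \<and> r < 1 \<longrightarrow>
      (\<exists>h :: real^'n \<Rightarrow> complex. h \<in> borel_measurable lborel \<and> (\<forall>x. norm (h x) \<le> C * r powr (- n)) \<and>
         (\<forall>\<psi>. schwartz \<psi> \<longrightarrow>
            (-1) ^ length I * K (\<lambda>p. Dl (map cdir I) \<psi> (fst p) * \<phi> (dil d r (snd p)))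
              = (\<integral>x. h x * \<psi> x \<partial>lborel))))"

definition kernel_cond_c :: "(real^'n \<Rightarrow> real^'n^'n) \<Rightarrow> ((real^'n \<Rightarrow> complex) \<Rightarrow> (real^'n \<Rightarrow> complex) \<Rightarrow> complex)
    \<Rightarrow> (((real^'n) \<times> (real^'n) \<Rightarrow> complex) \<Rightarrow> complex) \<Rightarrow> bool" where
  "kernel_cond_c A T K \<longleftrightarrow> (\<forall>f g. schwartz f \<and> schwartz g \<longrightarrow>
      T f g = K (\<lambda>p. f (fst p - inv (Lx A (fst p)) (snd p)) * g (fst p)))"

end

theory Submission imports Defs "HOL-Probability.Probability" begin

text \<open>Let \<open>k(x,u) = \<integral> a(x,\<eta>) e(u\<cdot>\<eta>) d\<eta>\<close> be the kernel of an amplitude \<open>a\<close>, where \<open>e(t) = exp(2\<pi>it)\<close>. After the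
changes of variables \<open>\<eta> = M\<^sub>x \<xi>\<close> and \<open>u = L\<^sub>x(x - y)\<close>, condition (c) says that \<open>T\<close> is \<open>\<Phi> \<mapsto> \<integral>\<integral> a(x,\<eta>) \<Phi>~(x,\<eta>)\<close>
evaluated at \<open>\<Phi>(x,u) = f(x - L\<^sub>x\<inverse>u) g(x)\<close>, where \<open>\<Phi>~\<close> is the Fourier transform in the second variable.

Given \<open>a\<close>, the kernel off \<open>u = 0\<close> is the limit of its truncations to \<open>\<parallel>\<eta>\<parallel> \<le> R\<close>: integrating by parts \<open>m\<close> times in a coordinate
in which \<open>u\<close> is large, the shell \<open>\<parallel>\<eta>\<parallel> ~ R\<close> contributes at most \<open>R\<close> to the power \<open>Q + n\<close> times \<open>\<parallel>u\<parallel>R\<close> to the power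
\<open>-m\<close>; the choice \<open>R = 1/\<parallel>u\<parallel>\<close> gives (a), and (b) follows by scaling.

Given \<open>K\<close>, the amplitude is \<open>a(x,\<xi>) = K(\<delta>\<^sub>x \<otimes> e(-u\<cdot>\<xi>))\<close>, made sense of by mollifying in \<open>x\<close> and truncating in \<open>u\<close>.
The symbol estimates come from splitting at \<open>\<parallel>u\<parallel> ~ 1/\<parallel>\<xi>\<parallel>\<close>: the inner part is (b) at that scale, and the outer part is (a)
with the same shell estimate, \<open>u\<close> and \<open>\<xi>\<close> having exchanged roles. The mollified amplitudes converge because convolutions
commute and one more derivative in \<open>x\<close> is bounded uniformly; Fourier inversion then identifies \<open>K\<close>.\<close>

text \<open>Condition (b) says nothing pointwise in x: the pairing of \<open>K\<close> with a bump
  in u is only a bounded density in x, with the x-derivatives moved onto the test function. Every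
  estimate of the amplitude is therefore proved weakly, as a bound times the L1 norm of a test
  function, and read off at mollifiers, whose L1 norm is 1 at every width. Condition (b) applies at
  scale r <= 1 / ||\<xi>|| because the oscillation, dilated by r, is smooth at unit scale, so the
  modulated cutoffs form one normalized family. A second obstacle is that \<open>K\<close> is
  abstract: differentiating under it and exchanging it with an integral must be derived from its
  seminorm bound alone. n >= 0 keeps low frequencies harmless: (1 + ||eta|| / r)^n <= r^(-n) (1 +
  ||eta||)^n for r < 1, and a truncation to ||eta|| <= R is dominated by its outer edge. The frame
  enters only in showing that the test functions of (c) are Schwartz and in one change of variables;
  all else concerns arbitrary Schwartz functions of (x, u).\<close>

abbreviation (input) cor :: "real => complex" where "cor x == of_real x"

text \<open>A relation, because \<open>dirD\<close> is total and its value is meaningless where the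
  derivative does not exist; \<open>dirD_eq\<close> turns each established instance into an
  equation.\<close>

definition has_dir :: "('a::real_normed_vector => 'b::real_normed_vector) => 'a => 'b => 'a => bool" where
 "has_dir f v f' x \<longleftrightarrow> ((%t. f (x + t *\<^sub>R v)) has_vector_derivative f') (at 0)"

lemma dirD_eq: "has_dir f v f' x ==> dirD v f x = f'"
 unfolding has_dir_def dirD_def by (rule vector_derivative_at)

lemma Dl_Nil [simp]: "Dl [] f = f"
 and Dl_Cons: "Dl (v # vs) f = dirD v (Dl vs f)"
 and Dl_append: "Dl (vs @ ws) f = Dl vs (Dl ws f)"
 by (simp_all add: Dl_def)

lemma has_dir_line:
 assumes "has_dir f v f' (x + s *\<^sub>R v)"
 shows "((%t. f (x + t *\<^sub>R v)) has_vector_derivative f') (at s)"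
proof -
 have "((%t. t - s) has_vector_derivative 1) (at s)"
 by (auto intro!: derivative_eq_intros)
 hence "((%t. f (x + s *\<^sub>R v + t *\<^sub>R v)) \<circ> (%t. t - s) has_vector_derivative 1 *\<^sub>R f') (at s)"
 using assms unfolding has_dir_def by (intro vector_diff_chain_at) auto
 thus ?thesis by (simp add: o_def scaleR_diff_left)
qed

lemma open_line_preimage:
 fixes U :: "'a::real_normed_vector set"
 assumes "open U" shows "open {t. x + t *\<^sub>R v : U}"
proof -
 have "open ((%t. x + t *\<^sub>R v) -` U)"
 by (rule open_vimage[OF assms]) (auto intro!: continuous_intros)
 thus ?thesis by (simp add: vimage_def)
qed

lemma has_dir_cong:
 assumes "open U" "x : U" "!!y. y : U ==> f y = g y" "has_dir f v f' x"
 shows "has_dir g v f' x"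
 using assms(4) unfolding has_dir_def
 by (rule has_vector_derivative_transform_within_open[OF _ open_line_preimage[OF assms(1), of x v]])
 (use assms in auto)

lemma dirD_cong:
 assumes "open U" "x : U" "!!y. y : U ==> f y = g y"
 shows "dirD v f x = dirD v g x"
proof -
 have "has_dir f v f' x \<longleftrightarrow> has_dir g v f' x" for f'
 using has_dir_cong[OF assms(1,2), of f g] has_dir_cong[OF assms(1,2), of g f] assms(3) by metis
 thus ?thesis by (simp add: dirD_def vector_derivative_def has_dir_def)
qed

lemma Dl_cong_on:
 assumes "open U" "!!y. y : U ==> f y = g y" "x : U"
 shows "Dl vs f x = Dl vs g x"
 using assms(3) by (induction vs arbitrary: x) (auto simp: Dl_Cons assms intro!: dirD_cong[OF assms(1)])

lemma has_dir_const: "has_dir (%x. c) v 0 x"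
 unfolding has_dir_def by (rule has_vector_derivative_const)

lemma has_dir_add:
 "has_dir f v f' x ==> has_dir g v g' x ==> has_dir (%x. f x + g x) v (f' + g') x"
 unfolding has_dir_def by (rule has_vector_derivative_add)

lemma has_dir_diff:
 "has_dir f v f' x ==> has_dir g v g' x ==> has_dir (%x. f x - g x) v (f' - g') x"
 unfolding has_dir_def by (rule has_vector_derivative_diff)

lemma has_dir_sum_list:
 "(!!p. p : set ps ==> has_dir (F p) v (F' p) x) ==>
 has_dir (%x. \<Sum>p\<leftarrow>ps. F p x) v (\<Sum>p\<leftarrow>ps. F' p) x"
 by (induction ps) (auto intro: has_dir_add has_dir_const)

lemma has_dir_bounded_linear:
 "bounded_linear T ==> has_dir f v f' x ==> has_dir (%x. T (f x)) v (T f') x"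
 unfolding has_dir_def by (rule bounded_linear.has_vector_derivative)

lemma has_dir_bilinear:
 "bounded_bilinear p ==> has_dir f v f' x ==> has_dir g v g' x ==>
 has_dir (%x. p (f x) (g x)) v (p f' (g x) + p (f x) g') x"
 unfolding has_dir_def
 by (drule (2) bounded_bilinear.has_vector_derivative) (simp add: add.commute)

lemma has_dir_linear: 
 assumes "bounded_linear L" shows "has_dir L v (L v) x"
proof -
 interpret L: bounded_linear L by fact
 have "(%t. L (x + t *\<^sub>R v)) = (%t. L x + t *\<^sub>R L v)" by (simp add: L.add L.scaleR)
 thus ?thesis unfolding has_dir_def by (auto intro!: derivative_eq_intros)
qed

subsection \<open>Smooth functions\<close>

lemma Cinf_on_iff: "Cinf_on U f \<longleftrightarrow> (ALL vs. set vs <= Basis --> continuous_on U (Dl vs f) \<and>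
  (ALL v:Basis. ALL x:U. has_dir (Dl vs f) v (Dl (v # vs) f x) x))"
 by (simp add: Cinf_on_def has_dir_def)

lemma Cinf_on_Dl_has_dir:
 "Cinf_on U f ==> set vs <= Basis ==> v : Basis ==> x : U ==> has_dir (Dl vs f) v (Dl (v # vs) f x) x"
 and Cinf_on_Dl_continuous: "Cinf_on U f ==> set vs <= Basis ==> continuous_on U (Dl vs f)"
 unfolding Cinf_on_iff by auto

lemma Cinf_on_has_dir:
 "Cinf_on U f ==> v : Basis ==> x : U ==> has_dir f v (dirD v f x) x"
 unfolding Cinf_on_iff by (auto dest!: spec[of _ "[]"] simp: Dl_Cons)

lemma Cinf_on_continuous: "Cinf_on U f ==> continuous_on U f"
 unfolding Cinf_on_iff by (auto dest!: spec[of _ "[]"])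

lemma Cinf_on_Dl: "Cinf_on U f ==> set ws <= Basis ==> Cinf_on U (Dl ws f)"
 unfolding Cinf_on_iff Dl_append[symmetric] append_Cons[symmetric] by simp

lemma Cinf_on_dirD: "Cinf_on U f ==> b : Basis ==> Cinf_on U (dirD b f)"
 using Cinf_on_Dl[of U f "[b]"] by (simp add: Dl_Cons)

lemma Cinf_on_subset: "Cinf_on U f ==> V <= U ==> Cinf_on V f"
 unfolding Cinf_on_iff by (auto intro: continuous_on_subset)

lemma Cinf_on_cong:
 assumes "open U" "!!x. x : U ==> f x = g x" "Cinf_on U f"
 shows "Cinf_on U g"
proof -
 have eq: "Dl vs f x = Dl vs g x" if "x : U" for vs x
 by (rule Dl_cong_on[OF assms(1,2) that])
 show ?thesis unfolding Cinf_on_iff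
 proof (intro allI impI conjI ballI)
 fix vs :: "'a list" assume vs: "set vs <= Basis"
 show "continuous_on U (Dl vs g)"
 using assms(3) vs eq unfolding Cinf_on_iff by (metis continuous_on_cong)
 fix v :: 'a and x assume v: "v : Basis" and x: "x : U"
 have "has_dir (Dl vs f) v (Dl (v # vs) f x) x"
 using assms(3) vs v x unfolding Cinf_on_iff by auto
 thus "has_dir (Dl vs g) v (Dl (v # vs) g x) x"
 using has_dir_cong[OF assms(1) x, of "Dl vs f" "Dl vs g"] eq x by metis
 qed
qed

lemma Cinf_on_Un: "Cinf_on U f ==> Cinf_on V f ==> open U ==> open V ==> Cinf_on (U \<union> V) f"
 unfolding Cinf_on_iff by (auto intro!: continuous_on_open_Un)

text \<open>If a guess \<open>P\<close> for all iterated derivatives is consistent under one more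
  differentiation, induction on the list identifies it with \<open>Dl\<close>. Smoothness and a
  formula for the derivatives come together; sums, products, limits and parameter integrals are
  handled in this way.\<close>

lemma Cinf_on_seqI:
 fixes f :: "'a::euclidean_space => 'b::real_normed_vector"
 assumes U: "open U"
 and d: "!!vs v x. set vs <= Basis ==> v : Basis ==> x : U ==> has_dir (P vs) v (P (v # vs) x) x"
 and c: "!!vs. set vs <= Basis ==> continuous_on U (P vs)"
 and f: "!!x. x : U ==> f x = P [] x"
 shows "Cinf_on U f" "!!vs x. set vs <= Basis ==> x : U ==> Dl vs f x = P vs x"
proof -
 show eq: "Dl vs f x = P vs x" if "set vs <= Basis" "x : U" for vs x
 using that
 proof (induction vs arbitrary: x)
 case (Cons v vs)
 have "has_dir (Dl vs f) v (P (v # vs) x) x"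
 by (rule has_dir_cong[OF U Cons.prems(2) _ d]) (use Cons in auto)
 thus ?case by (simp add: Dl_Cons dirD_eq)
 qed (use f in simp)
 show "Cinf_on U f" unfolding Cinf_on_iff
 proof (intro allI impI conjI ballI)
 fix vs :: "'a list" assume vs: "set vs <= Basis"
 show "continuous_on U (Dl vs f)"
 using c[OF vs] eq[OF vs] by (metis continuous_on_cong)
 fix v :: 'a and x assume v: "v : Basis" and x: "x : U"
 show "has_dir (Dl vs f) v (Dl (v # vs) f x) x"
 using has_dir_cong[OF U x _ d[OF vs v x]] eq[OF vs] eq[of "v # vs"] vs v x by simp
 qed
qed

section \<open>Mean value estimates from bounds on partial derivatives\<close>

lemma lip_real:
 fixes g :: "real => 'b::real_normed_vector"
 assumes "!!t. t : closed_segment 0 c ==> (g has_vector_derivative g' t) (at t)"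
 and "!!t. t : closed_segment 0 c ==> norm (g' t) <= B"
 shows "norm (g c - g 0) <= B * \<bar>c\<bar>"
proof -
 have "norm (g c - g 0) <= B * norm (c - 0)"
 proof (rule differentiable_bound[where S = "closed_segment 0 c" and f' = "%t h. h *\<^sub>R g' t"])
 fix t assume t: "t : closed_segment 0 c"
 show "(g has_derivative (%h. h *\<^sub>R g' t)) (at t within closed_segment 0 c)"
 using assms(1)[OF t] unfolding has_vector_derivative_def by (rule has_derivative_at_withinI)
 show "onorm (%h. h *\<^sub>R g' t) <= B"
 using assms(2)[OF t] by (intro onorm_le) (simp add: mult.commute[of B] mult_left_mono)
 qed auto
 thus ?thesis by simp
qed

lemma lip_step:
 assumes "!!t. t : closed_segment 0 c ==> has_dir f v (f' t) (x + t *\<^sub>R v)"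
 and "!!t. t : closed_segment 0 c ==> norm (f' t) <= B"
 shows "norm (f (x + c *\<^sub>R v) - f x) <= B * \<bar>c\<bar>"
proof -
 have "norm (f (x + c *\<^sub>R v) - f (x + 0 *\<^sub>R v)) <= B * \<bar>c\<bar>"
 by (rule lip_real[OF has_dir_line[OF assms(1)] assms(2)])
 thus ?thesis by simp
qed

text \<open>The path from x to y changes one coordinate at a time, so only partial derivatives are
  met. Its points deviate from x by no more than y does in each coordinate, which is the region to
  which the hypotheses are confined.\<close>

lemma lipschitz_of_partials:
 fixes f :: "'a::euclidean_space => 'b::real_normed_vector"
 assumes d: "!!z b. b : Basis ==> (ALL c:Basis. \<bar>(z - x) \<bullet> c\<bar> <= \<bar>(y - x) \<bullet> c\<bar>) ==> has_dir f b (g b z) z"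
 and B: "!!z b. b : Basis ==> (ALL c:Basis. \<bar>(z - x) \<bullet> c\<bar> <= \<bar>(y - x) \<bullet> c\<bar>) ==> norm (g b z) <= B"
 shows "norm (f y - f x) <= B * (\<Sum>b\<in>Basis. \<bar>(y - x) \<bullet> b\<bar>)"
proof -
 define p where "p S = x + (\<Sum>b\<in>S. ((y - x) \<bullet> b) *\<^sub>R b)" for S
 have "norm (f (p S) - f x) <= B * (\<Sum>b\<in>S. \<bar>(y - x) \<bullet> b\<bar>)" if "finite S" "S <= Basis" for S
 using that
 proof (induction S rule: finite_induct)
 case empty thus ?case by (simp add: p_def)
 next
 case (insert b S)
 define c where "c = (y - x) \<bullet> b"
 have pi: "p (insert b S) = p S + c *\<^sub>R b"
 using insert by (simp add: p_def c_def algebra_simps)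
 have near: "ALL e:Basis. \<bar>(p S + t *\<^sub>R b - x) \<bullet> e\<bar> <= \<bar>(y - x) \<bullet> e\<bar>" if t: "t : closed_segment 0 c" for t
 proof
 fix e :: 'a assume e: "e : Basis"
 have "(p S + t *\<^sub>R b - x) \<bullet> e = (\<Sum>a\<in>S. ((y - x) \<bullet> a) * (a \<bullet> e)) + t * (b \<bullet> e)"
  by (simp add: p_def inner_add_left inner_sum_left)
 also have "(\<Sum>a\<in>S. ((y - x) \<bullet> a) * (a \<bullet> e)) = (\<Sum>a\<in>S. if a = e then (y - x) \<bullet> e else 0)"
  using insert.prems e by (intro sum.cong) (auto simp: inner_Basis)
 also have "... = (if e : S then (y - x) \<bullet> e else 0)"
  using insert.hyps(1) by (simp add: sum.delta)
 finally have *: "(p S + t *\<^sub>R b - x) \<bullet> e = (if e : S then (y - x) \<bullet> e else 0) + t * (b \<bullet> e)" .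
 have "\<bar>t\<bar> <= \<bar>c\<bar>" using t by (auto simp: closed_segment_eq_real_ivl split: if_splits)
 thus "\<bar>(p S + t *\<^sub>R b - x) \<bullet> e\<bar> <= \<bar>(y - x) \<bullet> e\<bar>"
  unfolding * using insert.hyps(2) insert.prems e by (auto simp: inner_Basis c_def)
 qed
 have "norm (f (p S + c *\<^sub>R b) - f (p S)) <= B * \<bar>c\<bar>"
 using insert.prems near by (intro lip_step[where f' = "%t. g b (p S + t *\<^sub>R b)"] d B) auto
 moreover have "norm (f (p S) - f x) <= B * (\<Sum>b\<in>S. \<bar>(y - x) \<bullet> b\<bar>)" using insert by auto
 ultimately have "norm (f (p (insert b S)) - f x) <= B * \<bar>c\<bar> + B * (\<Sum>b\<in>S. \<bar>(y - x) \<bullet> b\<bar>)"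
 unfolding pi using norm_triangle_ineq[of "f (p S + c *\<^sub>R b) - f (p S)" "f (p S) - f x"] by simp
 thus ?case using insert.hyps by (simp add: c_def algebra_simps)
 qed
 from this[of Basis] have "norm (f (p Basis) - f x) <= B * (\<Sum>b\<in>Basis. \<bar>(y - x) \<bullet> b\<bar>)" by simp
 moreover have "p Basis = y" by (simp add: p_def euclidean_representation)
 ultimately show ?thesis by simp
qed

lemma sum_abs_inner_le: "(\<Sum>b\<in>Basis. \<bar>(x::'a::euclidean_space) \<bullet> b\<bar>) <= DIM('a) * norm x"
 using sum_bounded_above[of Basis "%b. \<bar>x \<bullet> b\<bar>" "norm x"] by (simp add: Basis_le_norm)

lemma lipschitz_ball:
 fixes f :: "'a::euclidean_space => 'b::real_normed_vector"
 assumes d: "!!z b. b : Basis ==> z : ball x e ==> has_dir f b (g b z) z"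
 and B: "!!z b. b : Basis ==> z : ball x e ==> norm (g b z) <= B" and y: "y : ball x e"
 shows "norm (f y - f x) <= B * DIM('a) * norm (y - x)"
proof -
 obtain b0 :: 'a where b0: "b0 : Basis" using nonempty_Basis by blast
 have "0 <= norm (g b0 y)" by simp
 also have "... <= B" using B b0 y by blast
 finally have B0: "0 <= B" .
 have near: "z : ball x e" if "ALL c:Basis. \<bar>(z - x) \<bullet> c\<bar> <= \<bar>(y - x) \<bullet> c\<bar>" for z
 using norm_le_componentwise[of "z - x" "y - x"] that y by (auto simp: dist_norm norm_minus_commute)
 have "norm (f y - f x) <= B * (\<Sum>b\<in>Basis. \<bar>(y - x) \<bullet> b\<bar>)"
 by (rule lipschitz_of_partials[where g = g]) (use d B near in auto)
 also have "... <= B * (DIM('a) * norm (y - x))"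
 using B0 by (intro mult_left_mono sum_abs_inner_le)
 finally show ?thesis by (simp add: mult.assoc)
qed

section \<open>Smoothness by coinduction\<close>

definition locally_bounded_on :: "'a::metric_space set => ('a => 'b::real_normed_vector) => bool" where
 "locally_bounded_on U f \<longleftrightarrow> (ALL x:U. EX e>0. EX B. ALL y:ball x e. norm (f y) <= B)"

lemma locally_bounded_onE:
 assumes "finite I" "!!i. i : I ==> locally_bounded_on U (f i)" "open U" "x : U"
 obtains e B where "e > 0" "ball x e <= U" "B >= 0" "!!i y. i : I ==> y : ball x e ==> norm (f i y) <= B"
proof -
 have "EX e>0. EX B>=0. ball x e <= U & (ALL i:I. ALL y:ball x e. norm (f i y) <= B)"
 using assms(1,2)
 proof (induction I rule: finite_induct)
 case empty
 obtain e where "e > 0" "ball x e <= U" using assms(3,4) by (meson openE)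
 thus ?case by (intro exI[of _ e]) auto
 next
 case (insert i I)
 then obtain e B where e: "e > 0" "B >= 0" "ball x e <= U" "ALL i:I. ALL y:ball x e. norm (f i y) <= B" by auto
 obtain e' B' where e': "e' > 0" "ALL y:ball x e'. norm (f i y) <= B'"
 using insert.prems[of i] assms(4) unfolding locally_bounded_on_def by auto
 show ?case using e e'
 by (intro exI[of _ "min e e'"] conjI exI[of _ "max B B'"]) (auto simp: le_max_iff_disj)
 qed
 thus ?thesis using that by blast
qed

lemma continuous_imp_locally_bounded:
 assumes "open U" "continuous_on U f" shows "locally_bounded_on U f"
 unfolding locally_bounded_on_def
proof
 fix x assume x: "x : U"
 hence "isCont f x" using assms by (simp add: continuous_on_eq_continuous_at)
 then obtain e where "e > 0" and e: "!!y. dist y x < e ==> dist (f y) (f x) < 1"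
 unfolding continuous_at_eps_delta by (metis zero_less_one)
 have "norm (f y) <= norm (f x) + 1" if "y : ball x e" for y
 using e[of y] norm_triangle_ineq2[of "f y" "f x"] that by (auto simp: dist_norm dist_commute norm_minus_commute)
 thus "EX e>0. EX B. ALL y:ball x e. norm (f y) <= B" using \<open>e > 0\<close> by blast
qed

text \<open>Continuity comes for free: the partial derivatives of a member of \<open>S\<close> are
  again in \<open>S\<close>, hence locally bounded, so the member is locally Lipschitz. A class of
  locally bounded functions that is closed under differentiation thus consists of smooth
  functions.\<close>

lemma Cinf_on_coinduct:
 fixes f :: "'a::euclidean_space => 'b::real_normed_vector"
 assumes U: "open U" and f: "f : S"
 and bd: "!!g. g : S ==> locally_bounded_on U g"
 and d: "!!g v. g : S ==> v : Basis ==> EX h:S. ALL x:U. has_dir g v (h x) x"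
 shows "Cinf_on U f"
proof -
 have cont: "continuous_on U g" if g: "g : S" for g
 proof (rule continuous_at_imp_continuous_on, rule ballI)
 fix x assume x: "x : U"
 obtain h where h: "!!v. v : Basis ==> h v : S & (ALL x:U. has_dir g v (h v x) x)"
 using d[OF g] by metis
 obtain e B where e: "e > 0" "ball x e <= U" and B: "B >= 0" "!!b y. b : Basis ==> y : ball x e ==> norm (h b y) <= B"
 using locally_bounded_onE[of Basis U h, OF finite_Basis _ U x] h bd by metis
 have lip: "norm (g y - g x) <= B * DIM('a) * norm (y - x)" if "y : ball x e" for y
 by (rule lipschitz_ball[where g = h, OF _ _ that]) (use h e B in auto)
 have "(g \<longlongrightarrow> g x) (at x)"
 proof (rule Lim_null_comparison[where f = "%y. g y - g x", THEN Lim_null[THEN iffD2]])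
 show "\<forall>\<^sub>F y in at x. norm (g y - g x) <= B * DIM('a) * norm (y - x)"
  using lip e(1) unfolding eventually_at
  by (intro exI[of _ e]) (auto simp: dist_commute)
 show "((%y. B * DIM('a) * norm (y - x)) \<longlongrightarrow> 0) (at x)"
  by (auto intro!: tendsto_eq_intros)
 qed
 thus "isCont g x" by (simp add: isCont_def)
 qed
 have "EX h:S. ALL x:U. Dl vs f x = h x" if "set vs <= Basis" for vs
 using that
 proof (induction vs)
 case (Cons v vs)
 then obtain h where h: "h : S" "ALL x:U. Dl vs f x = h x" by auto
 obtain h' where h': "h' : S" "ALL x:U. has_dir h v (h' x) x"
 using d[OF h(1), of v] Cons.prems by (meson list.set_intros(1) subsetD)
 have "Dl (v # vs) f x = h' x" if "x : U" for x
 using h'(2) h(2) that dirD_cong[OF U that, of "Dl vs f" h] by (simp add: Dl_Cons dirD_eq)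
 thus ?case using h'(1) by auto
 qed (use f in auto)
 note D = this
 show ?thesis unfolding Cinf_on_iff
 proof (intro allI impI conjI ballI)
 fix vs :: "'a list" assume vs: "set vs <= Basis"
 obtain h where h: "h : S" "ALL x:U. Dl vs f x = h x" using D[OF vs] by auto
 show "continuous_on U (Dl vs f)" using cont[OF h(1)] h(2) by (metis continuous_on_cong)
 fix v :: 'a and x assume v: "v : Basis" and x: "x : U"
 obtain h' where h': "h' : S" "ALL x:U. has_dir h v (h' x) x" using d[OF h(1) v] by auto
 have "has_dir (Dl vs f) v (h' x) x"
 by (rule has_dir_cong[OF U x, of h]) (use h h' x in auto)
 thus "has_dir (Dl vs f) v (Dl (v # vs) f x) x" by (simp add: Dl_Cons dirD_eq)
 qed
qed

text \<open>Subtracting the candidate linear map leaves a function whose partial derivatives are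
  small near x, by continuity of the partials; the Lipschitz bound then gives the required error.
  The factor DIM('a) lost there is compensated in \<open>e'\<close>.\<close>

lemma Cinf_has_derivative:
 fixes f :: "'a::euclidean_space => 'b::real_normed_vector"
 assumes U: "open U" and f: "Cinf_on U f" and x: "x : U"
 shows "(f has_derivative (%h. \<Sum>b\<in>Basis. (h \<bullet> b) *\<^sub>R dirD b f x)) (at x)"
 unfolding has_derivative_at_alt
proof (intro conjI allI impI)
 show "bounded_linear (%h. \<Sum>b\<in>Basis. (h \<bullet> b) *\<^sub>R dirD b f x)"
 by (intro bounded_linear_sum bounded_linear_scaleR_left bounded_linear_compose[OF bounded_linear_scaleR_left] bounded_linear_inner_left)
 fix e :: real assume e: "e > 0"
 define e' where "e' = e / (DIM('a))"
 have e': "e' > 0" using e by (simp add: e'_def)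
 have "\<forall>\<^sub>F y in nhds x. ALL b:Basis. dist (dirD b f y) (dirD b f x) < e'"
 proof (rule eventually_ball_finite)
 show "ALL b:Basis. \<forall>\<^sub>F y in nhds x. dist (dirD b f y) (dirD b f x) < e'"
 proof
 fix b :: 'a assume b: "b : Basis"
 have "isCont (dirD b f) x"
  using Cinf_on_continuous[OF Cinf_on_dirD[OF f b]] U x by (simp add: continuous_on_eq_continuous_at)
 thus "\<forall>\<^sub>F y in nhds x. dist (dirD b f y) (dirD b f x) < e'"
  using e' unfolding continuous_at_eps_delta eventually_nhds_metric by blast
 qed
 qed simp
 moreover have "\<forall>\<^sub>F y in nhds x. y : U" using U x by (simp add: eventually_nhds_in_open)
 ultimately have "\<forall>\<^sub>F y in nhds x. y : U & (ALL b:Basis. dist (dirD b f y) (dirD b f x) < e')"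
 by eventually_elim auto
 then obtain r where r: "r > 0" and rb: "!!y. dist y x < r ==> y : U & (ALL b:Basis. dist (dirD b f y) (dirD b f x) < e')"
 unfolding eventually_nhds_metric by auto
 show "EX d>0. ALL y. norm (y - x) < d -->
 norm (f y - f x - (\<Sum>b\<in>Basis. ((y - x) \<bullet> b) *\<^sub>R dirD b f x)) <= e * norm (y - x)"
 proof (intro exI[of _ r] conjI r allI impI)
 fix y assume y: "norm (y - x) < r"
 define g where "g z = f z - (\<Sum>b\<in>Basis. (z \<bullet> b) *\<^sub>R dirD b f x)" for z
 have "norm (g y - g x) <= e' * DIM('a) * norm (y - x)"
 proof (rule lipschitz_ball[where e = r and g = "%b z. dirD b f z - dirD b f x"])
 fix z b :: 'a assume b: "b : Basis" and z: "z : ball x r"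
 have zU: "z : U" using rb[of z] z by (auto simp: dist_commute)
 have "bounded_linear (%h. \<Sum>b\<in>Basis. (h \<bullet> b) *\<^sub>R dirD b f x)"
  by (intro bounded_linear_sum bounded_linear_compose[OF bounded_linear_scaleR_left] bounded_linear_inner_left)
 from has_dir_linear[OF this, of b z]
 have "has_dir (%h. \<Sum>b\<in>Basis. (h \<bullet> b) *\<^sub>R dirD b f x) b (dirD b f x) z"
  using b by (simp add: inner_Basis if_distrib[of "%c. c *\<^sub>R _"] sum.delta cong: if_cong)
 thus "has_dir g b (dirD b f z - dirD b f x) z"
  unfolding g_def by (intro has_dir_diff Cinf_on_has_dir[OF f b zU])
 show "norm (dirD b f z - dirD b f x) <= e'"
  using rb[of z] z b by (auto simp: dist_commute norm_minus_commute dist_norm intro!: less_imp_le)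
 qed (use y in "simp add: dist_norm norm_minus_commute")
 moreover have "g y - g x = f y - f x - (\<Sum>b\<in>Basis. ((y - x) \<bullet> b) *\<^sub>R dirD b f x)"
 by (simp add: g_def inner_diff_left scaleR_diff_left sum_subtractf)
 ultimately show "norm (f y - f x - (\<Sum>b\<in>Basis. ((y - x) \<bullet> b) *\<^sub>R dirD b f x)) <= e * norm (y - x)"
 by (simp add: e'_def)
 qed
qed

lemma Cinf_has_dir:
 fixes f :: "'a::euclidean_space => 'b::real_normed_vector"
 assumes "open U" "Cinf_on U f" "x : U"
 shows "has_dir f w (\<Sum>b\<in>Basis. (w \<bullet> b) *\<^sub>R dirD b f x) x"
proof -
 have "((%t. f (x + t *\<^sub>R w)) has_derivative (%t. \<Sum>b\<in>Basis. ((t *\<^sub>R w) \<bullet> b) *\<^sub>R dirD b f x)) (at 0)"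
 by (rule has_derivative_compose[of "%t. x + t *\<^sub>R w" "%t. t *\<^sub>R w"])
 (use Cinf_has_derivative[OF assms] in "auto intro!: derivative_eq_intros")
 thus ?thesis unfolding has_dir_def has_vector_derivative_def
 by (simp add: scaleR_sum_right)
qed

lemma dirD_expand:
 fixes f :: "'a::euclidean_space => 'b::real_normed_vector"
 assumes "open U" "Cinf_on U f" "x : U"
 shows "dirD w f x = (\<Sum>b\<in>Basis. (w \<bullet> b) *\<^sub>R dirD b f x)"
 by (rule dirD_eq[OF Cinf_has_dir[OF assms]])

lemma Cinf_on_add:
 assumes "open U" "Cinf_on U f" "Cinf_on U g"
 shows "Cinf_on U (%x. f x + g x)"
 "!!vs x. set vs <= Basis ==> x : U ==> Dl vs (%x. f x + g x) x = Dl vs f x + Dl vs g x"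
proof -
 define P where "P vs x = Dl vs f x + Dl vs g x" for vs x
 have d: "has_dir (P vs) v (P (v # vs) x) x" if "set vs <= Basis" "v : Basis" "x : U" for vs v x
 unfolding P_def[abs_def]
 by (rule has_dir_add[OF Cinf_on_Dl_has_dir[OF assms(2) that] Cinf_on_Dl_has_dir[OF assms(3) that]])
 have c: "continuous_on U (P vs)" if "set vs <= Basis" for vs
 unfolding P_def[abs_def]
 by (rule continuous_on_add[OF Cinf_on_Dl_continuous[OF assms(2) that] Cinf_on_Dl_continuous[OF assms(3) that]])
 show "Cinf_on U (%x. f x + g x)"
 by (rule Cinf_on_seqI(1)[OF assms(1) d c]) (auto simp: P_def)
 show "Dl vs (%x. f x + g x) x = Dl vs f x + Dl vs g x" if "set vs <= Basis" "x : U" for vs x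
 using Cinf_on_seqI(2)[OF assms(1) d c _ that, of "%x. f x + g x"] by (simp add: P_def)
qed

lemma Cinf_on_linear_image:
 assumes "bounded_linear T" "open U" "Cinf_on U f"
 shows "Cinf_on U (%x. T (f x))"
 "!!vs x. set vs <= Basis ==> x : U ==> Dl vs (%x. T (f x)) x = T (Dl vs f x)"
proof -
 define P where "P vs x = T (Dl vs f x)" for vs x
 have d: "has_dir (P vs) v (P (v # vs) x) x" if "set vs <= Basis" "v : Basis" "x : U" for vs v x
 unfolding P_def[abs_def] by (rule has_dir_bounded_linear[OF assms(1) Cinf_on_Dl_has_dir[OF assms(3) that]])
 have c: "continuous_on U (P vs)" if "set vs <= Basis" for vs
 unfolding P_def[abs_def] by (rule bounded_linear.continuous_on[OF assms(1) Cinf_on_Dl_continuous[OF assms(3) that]])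
 show "Cinf_on U (%x. T (f x))"
 by (rule Cinf_on_seqI(1)[OF assms(2) d c]) (auto simp: P_def)
 show "Dl vs (%x. T (f x)) x = T (Dl vs f x)" if "set vs <= Basis" "x : U" for vs x
 using Cinf_on_seqI(2)[OF assms(2) d c _ that, of "%x. T (f x)"] by (simp add: P_def)
qed

lemma Cinf_on_const: "open U ==> Cinf_on U (%x::'a::euclidean_space. c::'b::real_normed_vector)"
 by (rule Cinf_on_seqI(1)[where P = "%vs x. if vs = [] then c else 0"]) (auto intro: has_dir_const)

lemma Cinf_on_linear: 
 fixes L :: "'a::euclidean_space => 'b::real_normed_vector"
 assumes "bounded_linear L" "open U" shows "Cinf_on U L"
proof (rule Cinf_on_coinduct[OF assms(2), where S = "insert L (range (%c x. c))"])
 fix g assume "g : insert L (range (%c x. c))"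
 hence "continuous_on U g"
 using assms by (auto intro: linear_continuous_on)
 thus "locally_bounded_on U g"
 using assms(2) by (rule continuous_imp_locally_bounded[rotated])
 fix v :: 'a
 show "EX h:insert L (range (%c x. c)). ALL x:U. has_dir g v (h x) x"
 using \<open>g : _\<close> has_dir_linear[OF assms(1), of v] has_dir_const[of _ v] by fastforce
qed simp

lemma Cinf_on_sum:
 assumes "finite I" "open U" "!!i. i : I ==> Cinf_on U (f i)"
 shows "Cinf_on U (%x. \<Sum>i\<in>I. f i x)"
 and "!!vs x. set vs <= Basis ==> x : U ==> Dl vs (%x. \<Sum>i\<in>I. f i x) x = (\<Sum>i\<in>I. Dl vs (f i) x)"
 using assms(1,3)
proof (induction I rule: finite_induct)
 case empty
 {
 case 1 show ?case by (simp add: Cinf_on_const assms(2))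
 next
 case (2 vs x)
 show ?case using Cinf_on_seqI(2)[OF assms(2), where P = "%vs x. 0" and f = "%x. 0" and vs = vs and x = x] 2
 by (simp add: has_dir_const)
 }
next
 case (insert i I)
 {
 case 1 thus ?case using insert by (simp add: Cinf_on_add assms(2))
 next
 case (2 vs x)
 thus ?case using insert Cinf_on_add(2)[OF assms(2), of "f i" "%x. \<Sum>i\<in>I. f i x" vs x] by simp
 }
qed

section \<open>The product rule for iterated derivatives\<close>

fun splits :: "'a list => ('a list \<times> 'a list) list" where
 "splits [] = [([], [])]"
| "splits (v # vs) = map (%(a, b). (v # a, b)) (splits vs) @ map (%(a, b). (a, v # b)) (splits vs)"

lemma splits_mset: "(a, b) : set (splits vs) ==> mset a + mset b = mset vs"
 by (induction vs arbitrary: a b) auto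

lemma splits_set: "(a, b) : set (splits vs) ==> set a \<union> set b = set vs"
 by (metis splits_mset set_mset_mset set_mset_union)

text \<open>Each direction falls on one of the two factors; \<open>splits\<close> lists the
  distributions with multiplicity, so no binomial coefficients appear.\<close>

lemma Leibniz:
 fixes f :: "'a::euclidean_space => 'b::real_normed_vector"
 assumes p: "bounded_bilinear p" and U: "open U" and f: "Cinf_on U f" and g: "Cinf_on U g"
 shows "Cinf_on U (%x. p (f x) (g x))"
 "!!vs x. set vs <= Basis ==> x : U ==>
 Dl vs (%x. p (f x) (g x)) x = (\<Sum>(a, b)\<leftarrow>splits vs. p (Dl a f x) (Dl b g x))"
proof -
 define P where "P vs x = (\<Sum>(a, b)\<leftarrow>splits vs. p (Dl a f x) (Dl b g x))" for vs x
 have d: "has_dir (P vs) v (P (v # vs) x) x" if vs: "set vs <= Basis" and v: "v : Basis" and x: "x : U" for vs v x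
 proof -
 have "has_dir (%x. \<Sum>q\<leftarrow>splits vs. p (Dl (fst q) f x) (Dl (snd q) g x)) v
 (\<Sum>q\<leftarrow>splits vs. p (Dl (v # fst q) f x) (Dl (snd q) g x) + p (Dl (fst q) f x) (Dl (v # snd q) g x)) x"
 proof (rule has_dir_sum_list)
 fix q assume "q : set (splits vs)"
 hence "set (fst q) <= Basis" "set (snd q) <= Basis"
  using splits_set[of "fst q" "snd q" vs] vs by auto
 thus "has_dir (%x. p (Dl (fst q) f x) (Dl (snd q) g x)) v
  (p (Dl (v # fst q) f x) (Dl (snd q) g x) + p (Dl (fst q) f x) (Dl (v # snd q) g x)) x"
  by (rule has_dir_bilinear[OF p Cinf_on_Dl_has_dir[OF f _ v x] Cinf_on_Dl_has_dir[OF g _ v x]])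
 qed
 thus ?thesis
 unfolding P_def[abs_def] by (simp add: case_prod_unfold sum_list_addf o_def)
 qed
 have cs: "continuous_on U (%x. \<Sum>q\<leftarrow>qs. F q x)"
 if "!!q. q : set qs ==> continuous_on U (F q)" for F :: "'a list \<times> 'a list => 'a => 'd" and qs
 using that by (induction qs) (auto intro!: continuous_intros)
 have c: "continuous_on U (P vs)" if vs: "set vs <= Basis" for vs
 unfolding P_def[abs_def] case_prod_beta
 proof (rule cs)
 fix q assume "q : set (splits vs)"
 hence "set (fst q) <= Basis" "set (snd q) <= Basis"
 using splits_set[of "fst q" "snd q" vs] vs by auto
 thus "continuous_on U (%x. p (Dl (fst q) f x) (Dl (snd q) g x))"
 by (rule bounded_bilinear.continuous_on[OF p Cinf_on_Dl_continuous[OF f] Cinf_on_Dl_continuous[OF g]])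
 qed
 show "Cinf_on U (%x. p (f x) (g x))"
 by (rule Cinf_on_seqI(1)[OF U d c]) (auto simp: P_def)
 show "Dl vs (%x. p (f x) (g x)) x = (\<Sum>(a, b)\<leftarrow>splits vs. p (Dl a f x) (Dl b g x))"
 if "set vs <= Basis" "x : U" for vs x
 using Cinf_on_seqI(2)[OF U d c _ that, of "%x. p (f x) (g x)"] by (simp add: P_def)
qed

lemmas Cinf_on_mult = Leibniz(1)[OF bounded_bilinear_mult]

lemma Cinf_on_scale: 
 assumes "open U" "Cinf_on U f"
 shows "Cinf_on U (%x. c * f x :: 'b::real_normed_algebra)"
 "!!vs x. set vs <= Basis ==> x : U ==> Dl vs (%x. c * f x) x = c * Dl vs f x"
 using Cinf_on_linear_image[OF bounded_linear_mult_right assms] by auto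

lemma Cinf_on_diff:
 assumes "open U" "Cinf_on U f" "Cinf_on U g"
 shows "Cinf_on U (%x. f x - g x)"
 "!!vs x. set vs <= Basis ==> x : U ==> Dl vs (%x. f x - g x) x = Dl vs f x - Dl vs g x"
proof -
 note m = Cinf_on_linear_image[OF bounded_linear_minus[OF bounded_linear_ident] assms(1,3)]
 show "Cinf_on U (%x. f x - g x)"
 using Cinf_on_add(1)[OF assms(1,2) m(1)] by simp
 show "Dl vs (%x. f x - g x) x = Dl vs f x - Dl vs g x" if "set vs <= Basis" "x : U" for vs x
 using Cinf_on_add(2)[OF assms(1,2) m(1) that] m(2)[OF that] by simp
qed

lemma locally_bounded_add:
 assumes "locally_bounded_on U f" "locally_bounded_on U g" shows "locally_bounded_on U (%x. f x + g x)"
 unfolding locally_bounded_on_def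
proof
 fix x assume "x : U"
 then obtain e B e' B' where e: "e > 0" "ALL y:ball x e. norm (f y) <= B" "e' > 0" "ALL y:ball x e'. norm (g y) <= B'"
 using assms unfolding locally_bounded_on_def by meson
 thus "EX e>0. EX B. ALL y:ball x e. norm (f y + g y) <= B"
 by (intro exI[of _ "min e e'"] conjI exI[of _ "B + B'"]) (auto intro!: order_trans[OF norm_triangle_ineq] add_mono)
qed

lemma locally_bounded_scaleR:
 assumes "locally_bounded_on U f" "locally_bounded_on U g" shows "locally_bounded_on U (%x. f x *\<^sub>R g x)"
 unfolding locally_bounded_on_def
proof
 fix x assume "x : U"
 then obtain e B e' B' where e: "e > 0" "ALL y:ball x e. norm (f y) <= B" "e' > 0" "ALL y:ball x e'. norm (g y) <= B'"
 using assms unfolding locally_bounded_on_def by meson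
 hence "B >= 0" using norm_ge_zero order_trans by (metis centre_in_ball)
 thus "EX e>0. EX B. ALL y:ball x e. norm (f y *\<^sub>R g y) <= B" using e
 by (intro exI[of _ "min e e'"] conjI exI[of _ "B * B'"]) (auto intro!: mult_mono)
qed

inductive_set smooth_span :: "'a::euclidean_space set => ('a => 'b::real_normed_vector) set => ('a => 'b) set"
 for U S where
 base: "g : S ==> g : smooth_span U S"
| zero: "(%x. 0) : smooth_span U S"
| add: "f : smooth_span U S ==> g : smooth_span U S ==> (%x. f x + g x) : smooth_span U S"
| scale: "Cinf_on U c ==> g : smooth_span U S ==> (%x. (c x :: real) *\<^sub>R g x) : smooth_span U S"

lemma smooth_span_sum:
 "finite I ==> (!!i. i : I ==> f i : smooth_span U S) ==> (%x. \<Sum>i\<in>I. f i x) : smooth_span U S"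
 by (induction I rule: finite_induct) (auto intro: smooth_span.intros)

lemma smooth_span_scaleR_const:
 assumes "open U" "g : smooth_span U S" shows "(%x. c *\<^sub>R g x) : smooth_span U S"
 by (rule smooth_span.scale[OF Cinf_on_const[OF assms(1)] assms(2)])

text \<open>The chain rule returns members of \<open>S\<close> with smooth coefficients rather than
  members of \<open>S\<close>. By the product rule their span is closed under differentiation, so
  plain coinduction applies to it.\<close>

lemma Cinf_on_coinduct_upto:
 fixes f :: "'a::euclidean_space => 'b::real_normed_vector"
 assumes U: "open U" and f: "f : S"
 and bd: "!!g. g : S ==> locally_bounded_on U g"
 and d: "!!g v. g : S ==> v : Basis ==> EX h:smooth_span U S. ALL x:U. has_dir g v (h x) x"
 shows "Cinf_on U f"
proof (rule Cinf_on_coinduct[OF U smooth_span.base[OF f]])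
 show "locally_bounded_on U g" if "g : smooth_span U S" for g
 using that
 proof induction
 case zero
 show ?case by (rule continuous_imp_locally_bounded[OF U continuous_on_const])
 next
 case (scale c g)
 thus ?case
 using locally_bounded_scaleR[OF continuous_imp_locally_bounded[OF U Cinf_on_continuous]] by blast
 qed (auto intro: bd locally_bounded_add)
 show "EX h:smooth_span U S. ALL x:U. has_dir g v (h x) x" if "g : smooth_span U S" and v: "v : Basis" for g v
 using that(1)
 proof induction
 case (base g)
 thus ?case using d v by blast
 next
 case zero
 show ?case using smooth_span.zero has_dir_const by (intro bexI[of _ "%x. 0"]) auto
 next
 case (add f g)
 then obtain f' g' where "f' : smooth_span U S" "ALL x:U. has_dir f v (f' x) x"
 "g' : smooth_span U S" "ALL x:U. has_dir g v (g' x) x" by blast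
 thus ?case
 by (intro bexI[of _ "%x. f' x + g' x"]) (auto intro: has_dir_add smooth_span.add)
 next
 case (scale c g)
 then obtain g' where "g' : smooth_span U S" "ALL x:U. has_dir g v (g' x) x" by blast
 thus ?case using scale v
 by (intro bexI[of _ "%x. dirD v c x *\<^sub>R g x + c x *\<^sub>R g' x"])
  (auto intro!: has_dir_bilinear[OF bounded_bilinear_scaleR] Cinf_on_has_dir smooth_span.add smooth_span.scale Cinf_on_dirD)
 qed
qed

section \<open>Composition with smooth and affine maps\<close>

lemma has_dir_compose:
 fixes f :: "'a::euclidean_space => 'b::real_normed_vector"
 assumes "open V" "Cinf_on V f" "G x : V" "has_dir G v G' x"
 shows "has_dir (%x. f (G x)) v (\<Sum>b\<in>Basis. (G' \<bullet> b) *\<^sub>R dirD b f (G x)) x"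
proof -
 have "((%t. f (G (x + t *\<^sub>R v))) has_derivative (%t. \<Sum>b\<in>Basis. ((t *\<^sub>R G') \<bullet> b) *\<^sub>R dirD b f (G x))) (at 0)"
 by (rule has_derivative_compose[of "%t. G (x + t *\<^sub>R v)" "%t. t *\<^sub>R G'" 0 UNIV f])
 (use Cinf_has_derivative[OF assms(1-3)] assms(4) in "auto simp: has_dir_def has_vector_derivative_def")
 thus ?thesis unfolding has_dir_def has_vector_derivative_def
 by (simp add: scaleR_sum_right)
qed

text \<open>All compositions with \<open>G\<close> are treated at once: a derivative of h (G x) is a
  sum of components of the derivative of \<open>G\<close>, which are smooth coefficients, times
  compositions of partials of h with \<open>G\<close>.\<close>

lemma Cinf_on_compose:
 fixes f :: "'c::euclidean_space => 'b::real_normed_vector" and G :: "'a::euclidean_space => 'c"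
 assumes U: "open U" and V: "open V" and f: "Cinf_on V f" and G: "Cinf_on U G" and UV: "!!x. x : U ==> G x : V"
 shows "Cinf_on U (%x. f (G x))"
proof (rule Cinf_on_coinduct_upto[OF U, where S = "{%x. h (G x) |h. Cinf_on V h}"])
 show "(%x. f (G x)) : {%x. h (G x) |h. Cinf_on V h}" using f by auto
 fix g assume "g : {%x. h (G x) |h. Cinf_on V h}"
 then obtain h where g: "g = (%x. h (G x))" and h: "Cinf_on V h" by auto
 have "continuous_on U g" unfolding g
 by (rule continuous_on_compose2[OF Cinf_on_continuous[OF h] Cinf_on_continuous[OF G]]) (use UV in auto)
 thus "locally_bounded_on U g" by (rule continuous_imp_locally_bounded[OF U])
 fix v :: 'a assume v: "v : Basis"
 have "(%x. \<Sum>b\<in>Basis. (dirD v G x \<bullet> b) *\<^sub>R dirD b h (G x)) : smooth_span U {%x. h (G x) |h. Cinf_on V h}"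
 by (intro smooth_span_sum smooth_span.scale Cinf_on_linear_image(1)[OF bounded_linear_inner_left U] Cinf_on_dirD[OF G v])
 (auto intro!: smooth_span.base exI[of _ "dirD _ h"] Cinf_on_dirD h)
 thus "EX k:smooth_span U {%x. h (G x) |h. Cinf_on V h}. ALL x:U. has_dir g v (k x) x"
 unfolding g using has_dir_compose[OF V h UV Cinf_on_has_dir[OF G v]] by (intro bexI) auto
qed

lemma Dl_affine: "linear L ==> Dl vs (%z. f (a + L z)) = (%z. Dl (map L vs) f (a + L z))"
 by (induction vs) (auto simp: Dl_Cons dirD_def linear_add linear_scale add.assoc)

lemma Dl_affine': 
 assumes "linear L" shows "Dl vs (%z. f (L z)) = (%z. Dl (map L vs) f (L z))"
 using Dl_affine[OF assms, of vs f 0] by simp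

lemma Cinf_on_affine:
 fixes f :: "'c::euclidean_space => 'b::real_normed_vector" and L :: "'a::euclidean_space => 'c"
 assumes "Cinf_on V f" "open V" "open U" "linear L" "!!z. z : U ==> a + L z : V"
 shows "Cinf_on U (%z. f (a + L z))"
 by (rule Cinf_on_compose[OF assms(3,2,1)])
 (use assms in "auto intro!: Cinf_on_add(1)[OF assms(3) Cinf_on_const Cinf_on_linear] simp: linear_linear")

lemma Cinf_dirD_any:
 fixes f :: "'a::euclidean_space => 'b::real_normed_vector"
 assumes "open U" "Cinf_on U f" shows "Cinf_on U (dirD w f)"
proof (rule Cinf_on_cong[OF assms(1)])
 show "(\<Sum>b\<in>Basis. (w \<bullet> b) *\<^sub>R dirD b f x) = dirD w f x" if "x : U" for x
 using dirD_expand[OF assms that, of w] by simp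
 show "Cinf_on U (%x. \<Sum>b\<in>Basis. (w \<bullet> b) *\<^sub>R dirD b f x)"
 by (intro Cinf_on_sum(1) finite_Basis assms(1) Cinf_on_linear_image(1)[OF bounded_linear_scaleR_right] Cinf_on_dirD assms(2))
qed

lemma Cinf_Dl_any: "open U ==> Cinf_on U f ==> Cinf_on U (Dl ws f)"
 by (induction ws) (auto simp: Dl_Cons Cinf_dirD_any)

lemma has_dir_any: "open U ==> Cinf_on U f ==> x : U ==> has_dir f w (dirD w f x) x"
 using Cinf_has_dir[of U f x w] dirD_eq by metis

subsection \<open>Symmetry of mixed derivatives\<close>

text \<open>The second difference of f over the parallelogram spanned by t v and t w is symmetric in
  v and w, while the mean value inequality, used in either order, shows that its quotient by t^2
  tends to the mixed derivative in that order.\<close>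

lemma Dl_swap2:
 fixes f :: "'a::euclidean_space => 'b::real_normed_vector"
 assumes U: "open U" and f: "Cinf_on U f" and x: "x : U"
 shows "Dl [v, w] f x = Dl [w, v] f x"
proof -
 have half: "EX d>0. ALL t. 0 < t & t < d -->
 norm (f (x + t *\<^sub>R v + t *\<^sub>R w) - f (x + t *\<^sub>R v) - f (x + t *\<^sub>R w) + f x - t\<^sup>2 *\<^sub>R Dl [w, v] f x) <= e * t\<^sup>2"
 if e: "e > 0" for e and v w :: 'a
 proof -
 define a where "a = Dl [w, v] f x"
 have "isCont (Dl [w, v] f) x"
 using Cinf_on_continuous[OF Cinf_Dl_any[OF U f, of "[w, v]"]] U x
 by (simp add: continuous_on_eq_continuous_at)
 hence "\<forall>\<^sub>F y in nhds x. dist (Dl [w, v] f y) a < e"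
 using e unfolding continuous_at_eps_delta eventually_nhds_metric a_def by blast
 moreover have "\<forall>\<^sub>F y in nhds x. y : U" using U x by (simp add: eventually_nhds_in_open)
 ultimately have "\<forall>\<^sub>F y in nhds x. y : U & dist (Dl [w, v] f y) a < e" by eventually_elim auto
 then obtain r where r: "r > 0" and rb: "!!y. dist y x < r ==> y : U & dist (Dl [w, v] f y) a < e"
 unfolding eventually_nhds_metric by auto
 \<comment> \<open>For t < d the parallelogram stays in the ball of radius r; the summand 1 keeps
   the denominator positive when v and w vanish.\<close>
 define d where "d = r / (norm v + norm w + 1)"
 have d: "d > 0" using r by (simp add: d_def add_nonneg_pos)
 have near: "y : U & norm (Dl [w, v] f y - a) <= e"
 if "y = x + s *\<^sub>R v + u *\<^sub>R w" "0 <= s" "s <= t" "0 <= u" "u <= t" "t < d" for y s t u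
 proof -
 have "dist y x <= s * norm v + u * norm w"
  unfolding that(1) dist_norm using that norm_triangle_ineq[of "s *\<^sub>R v" "u *\<^sub>R w"] by simp
 also have "... <= t * norm v + t * norm w" using that by (intro add_mono mult_right_mono) auto
 also have "... <= t * (norm v + norm w + 1)" using that by (simp add: algebra_simps)
 also have "... < d * (norm v + norm w + 1)" using that by (intro mult_strict_right_mono) (auto simp: add_nonneg_pos)
 also have "... = r" using norm_ge_zero[of v] norm_ge_zero[of w] by (simp add: d_def add_nonneg_eq_0_iff)
 finally show ?thesis using rb[of y] by (simp add: dist_norm less_imp_le)
 qed
 show ?thesis
 proof (intro exI[of _ d] conjI d allI impI, elim conjE)
 fix t :: real assume t: "0 < t" "t < d"
 have seg: "u : closed_segment 0 t \<longleftrightarrow> 0 <= u & u <= t" for u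
  using t by (auto simp: closed_segment_eq_real_ivl)
 have lin: "((%u. u *\<^sub>R c) has_vector_derivative c) (at u)" for u and c :: 'b
  by (auto intro!: derivative_eq_intros)
 have inner: "norm (dirD v f (y + t *\<^sub>R w) - dirD v f y - t *\<^sub>R a) <= e * t"
  if "y = x + s *\<^sub>R v" "0 <= s" "s <= t" for y s
 proof -
  have "norm ((dirD v f (y + t *\<^sub>R w) - t *\<^sub>R a) - (dirD v f (y + 0 *\<^sub>R w) - 0 *\<^sub>R a)) <= e * \<bar>t\<bar>"
  proof (rule lip_real)
  fix u assume u: "u : closed_segment 0 t"
  have yU: "y + u *\<^sub>R w : U & norm (Dl [w, v] f (y + u *\<^sub>R w) - a) <= e"
   using near[of "y + u *\<^sub>R w" s u t] u that t seg by auto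
  thus "norm (Dl [w, v] f (y + u *\<^sub>R w) - a) <= e" by simp
  have "has_dir (dirD v f) w (Dl [w, v] f (y + u *\<^sub>R w)) (y + u *\<^sub>R w)"
   using has_dir_any[OF U Cinf_Dl_any[OF U f, of "[v]"], of "y + u *\<^sub>R w" w] yU by (simp add: Dl_Cons)
  from has_vector_derivative_diff[OF has_dir_line[OF this] lin[of a u]]
  show "((%u. dirD v f (y + u *\<^sub>R w) - u *\<^sub>R a) has_vector_derivative Dl [w, v] f (y + u *\<^sub>R w) - a) (at u)" .
  qed
  thus ?thesis using t by (simp add: algebra_simps)
 qed
 have "norm ((f (x + t *\<^sub>R w + t *\<^sub>R v) - f (x + t *\<^sub>R v) - t *\<^sub>R t *\<^sub>R a)
  - (f (x + t *\<^sub>R w + 0 *\<^sub>R v) - f (x + 0 *\<^sub>R v) - 0 *\<^sub>R t *\<^sub>R a)) <= (e * t) * \<bar>t\<bar>"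
 proof (rule lip_real)
  fix s assume s: "s : closed_segment 0 t"
  show "norm (dirD v f (x + s *\<^sub>R v + t *\<^sub>R w) - dirD v f (x + s *\<^sub>R v) - t *\<^sub>R a) <= e * t"
  using inner[of _ s] s seg by auto
  have "has_dir f v (dirD v f (x + s *\<^sub>R v + t *\<^sub>R w)) (x + t *\<^sub>R w + s *\<^sub>R v)"
  "has_dir f v (dirD v f (x + s *\<^sub>R v)) (x + s *\<^sub>R v)"
  using has_dir_any[OF U f, of "x + s *\<^sub>R v + t *\<^sub>R w" v] has_dir_any[OF U f, of "x + s *\<^sub>R v" v]
   near[of _ s t t] near[of _ s 0 t] s t seg by (auto simp: add.commute add.left_commute)
  from has_vector_derivative_diff[OF has_vector_derivative_diff[OF this[THEN has_dir_line]] lin[of "t *\<^sub>R a" s]]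
  show "((%s. f (x + t *\<^sub>R w + s *\<^sub>R v) - f (x + s *\<^sub>R v) - s *\<^sub>R t *\<^sub>R a) has_vector_derivative
  dirD v f (x + s *\<^sub>R v + t *\<^sub>R w) - dirD v f (x + s *\<^sub>R v) - t *\<^sub>R a) (at s)" .
 qed
 thus "norm (f (x + t *\<^sub>R v + t *\<^sub>R w) - f (x + t *\<^sub>R v) - f (x + t *\<^sub>R w) + f x - t\<^sup>2 *\<^sub>R Dl [w, v] f x) <= e * t\<^sup>2"
  using t by (simp add: a_def power2_eq_square algebra_simps)
 qed
 qed
 show ?thesis
 proof (rule ccontr)
 assume ne: "Dl [v, w] f x ~= Dl [w, v] f x"
 \<comment> \<open>A quarter of the gap: approximating the same second difference within e t^2 from
   both sides forces the gap to be at most 2 e.\<close>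
 define e where "e = norm (Dl [v, w] f x - Dl [w, v] f x) / 4"
 have e: "e > 0" using ne by (simp add: e_def)
 obtain d where d: "d > 0" "!!t. 0 < t & t < d ==>
 norm (f (x + t *\<^sub>R v + t *\<^sub>R w) - f (x + t *\<^sub>R v) - f (x + t *\<^sub>R w) + f x - t\<^sup>2 *\<^sub>R Dl [w, v] f x) <= e * t\<^sup>2"
 using half[OF e, of v w] by blast
 obtain d' where d': "d' > 0" "!!t. 0 < t & t < d' ==>
 norm (f (x + t *\<^sub>R w + t *\<^sub>R v) - f (x + t *\<^sub>R w) - f (x + t *\<^sub>R v) + f x - t\<^sup>2 *\<^sub>R Dl [v, w] f x) <= e * t\<^sup>2"
 using half[OF e, of w v] by blast
 define t where "t = min d d' / 2"
 have t: "0 < t" "t < d" "t < d'" using d(1) d'(1) by (auto simp: t_def)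
 define D where "D = f (x + t *\<^sub>R v + t *\<^sub>R w) - f (x + t *\<^sub>R v) - f (x + t *\<^sub>R w) + f x"
 have 1: "norm (D - t\<^sup>2 *\<^sub>R Dl [w, v] f x) <= e * t\<^sup>2" using d(2)[of t] t by (simp add: D_def)
 have 2: "norm (D - t\<^sup>2 *\<^sub>R Dl [v, w] f x) <= e * t\<^sup>2" using d'(2)[of t] t by (simp add: D_def algebra_simps)
 have "t\<^sup>2 * norm (Dl [v, w] f x - Dl [w, v] f x) = norm ((D - t\<^sup>2 *\<^sub>R Dl [w, v] f x) - (D - t\<^sup>2 *\<^sub>R Dl [v, w] f x))"
 by (simp add: scaleR_diff_right[symmetric])
 also have "... <= 2 * e * t\<^sup>2" using norm_triangle_ineq4[of "D - t\<^sup>2 *\<^sub>R Dl [w, v] f x" "D - t\<^sup>2 *\<^sub>R Dl [v, w] f x"] 1 2 by simp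
 finally have "norm (Dl [v, w] f x - Dl [w, v] f x) <= 2 * e" using t(1) by (simp add: mult.commute)
 thus False using e by (simp add: e_def)
 qed
qed

text \<open>Adjacent swaps move v to the front of \<open>ws\<close>; induction on the remaining list
  does the rest.\<close>

lemma Dl_perm:
 fixes f :: "'a::euclidean_space => 'b::real_normed_vector"
 assumes U: "open U" and f: "Cinf_on U f" and m: "mset vs = mset ws" and x: "x : U"
 shows "Dl vs f x = Dl ws f x"
 using m x
proof (induction vs arbitrary: ws x)
 case (Cons v vs)
 have front: "Dl (as @ v # bs) f y = Dl (v # as @ bs) f y" if "y : U" for as bs y
 using that
 proof (induction as arbitrary: y)
 case (Cons a as)
 have "Dl (a # as @ v # bs) f y = Dl (a # v # as @ bs) f y"
 unfolding Dl_Cons[of a] by (rule dirD_cong[OF U Cons.prems]) (rule Cons.IH)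
 also have "... = Dl (v # a # as @ bs) f y"
 using Dl_swap2[OF U Cinf_Dl_any[OF U f, of "as @ bs"] Cons.prems, of a v] by (simp add: Dl_Cons)
 finally show ?case by simp
 qed simp
 have "v : set ws" using Cons.prems(1) by (metis list.set_intros(1) set_mset_mset)
 then obtain as bs where ws: "ws = as @ v # bs" by (meson split_list)
 have "mset vs = mset (as @ bs)" using Cons.prems(1) ws by simp
 hence "Dl vs f y = Dl (as @ bs) f y" if "y : U" for y using Cons.IH that by blast
 hence "Dl (v # vs) f x = Dl (v # as @ bs) f x"
 unfolding Dl_Cons by (intro dirD_cong[OF U Cons.prems(2)])
 thus ?case using front[OF Cons.prems(2)] ws by simp
qed simp

subsection \<open>Integrability of rapidly decaying functions\<close>

lemma nn_integral_inverse_1_plus_square: "(\<integral>\<^sup>+t. ennreal (1 / (1 + t\<^sup>2)) \<partial>lborel) < \<infinity>"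
proof -
 have "integrable lborel (%t::real. inverse (1 + t\<^sup>2))"
 using integrable_inverse_1_plus_square by (simp add: set_integrable_def)
 thus ?thesis
 by (auto simp: integrable_iff_bounded divide_inverse)
qed

text \<open>Each 1 + (x . b)^2 is at most (1 + norm x)^2, so the function lies below a product of
  integrable functions of one variable. The resulting crude exponent 2 * DIM('a) recurs below as the
  integrability weight.\<close>

lemma decay_integrable:
 assumes "2 * DIM('a) <= k"
 shows "integrable lborel (%x::'a::euclidean_space. 1 / (1 + norm x) ^ k)"
proof (rule integrableI_bounded)
 show "(%x::'a. 1 / (1 + norm x) ^ k) : borel_measurable lborel" by simp
 have *: "1 / (1 + norm x) ^ k <= (\<Prod>b\<in>Basis. 1 / (1 + (x \<bullet> b)\<^sup>2))" for x :: 'a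
 proof -
 have "(\<Prod>b\<in>Basis. 1 + (x \<bullet> b)\<^sup>2) <= (\<Prod>b\<in>(Basis :: 'a set). (1 + norm x)\<^sup>2)"
 proof (rule prod_mono, intro conjI)
 fix b :: 'a assume b: "b : Basis"
 have "(x \<bullet> b)\<^sup>2 <= (norm x)\<^sup>2" using power_mono[OF Basis_le_norm[OF b, of x], of 2] by simp
 thus "1 + (x \<bullet> b)\<^sup>2 <= (1 + norm x)\<^sup>2" using norm_ge_zero[of x] by (simp add: power2_eq_square algebra_simps del: norm_ge_zero)
 qed (simp add: add_nonneg_nonneg)
 also have "... = (1 + norm x) ^ (2 * DIM('a))" by (simp add: power_mult)
 also have "... <= (1 + norm x) ^ k" using assms by (intro power_increasing) auto
 finally have "1 / (1 + norm x) ^ k <= 1 / (\<Prod>b\<in>Basis. 1 + (x \<bullet> b)\<^sup>2)"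
 by (intro divide_left_mono mult_pos_pos prod_pos) (auto simp: add_pos_nonneg)
 thus ?thesis by (simp add: prod_dividef)
 qed
 have "(\<integral>\<^sup>+x. ennreal (norm (1 / (1 + norm (x::'a)) ^ k)) \<partial>lborel)
 <= (\<integral>\<^sup>+x. (\<Prod>b\<in>Basis. ennreal (1 / (1 + ((x::'a) \<bullet> b)\<^sup>2))) \<partial>lborel)"
 by (intro nn_integral_mono) (use * in "auto simp: prod_ennreal intro!: ennreal_leI")
 also have "... = (\<Prod>b\<in>(Basis :: 'a set). (\<integral>\<^sup>+t. ennreal (1 / (1 + t\<^sup>2)) \<partial>lborel))"
 by (rule nn_integral_lborel_prod) auto
 also have "... < \<infinity>"
 using nn_integral_inverse_1_plus_square by (simp add: power_less_top_ennreal)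
 finally show "(\<integral>\<^sup>+x. ennreal (norm (1 / (1 + norm (x::'a)) ^ k)) \<partial>lborel) < \<infinity>" .
qed

lemma integrable_of_decay:
 fixes f :: "'a::euclidean_space => complex"
 assumes "f : borel_measurable borel" "!!x. (1 + norm x) ^ (2 * DIM('a)) * norm (f x) <= C"
 shows "integrable lborel f"
 and "norm (integral\<^sup>L lborel f) <= C * (LBINT x. 1 / (1 + norm (x::'a)) ^ (2 * DIM('a)))"
proof -
 have i: "integrable lborel (%x::'a. C * (1 / (1 + norm x) ^ (2 * DIM('a))))"
 by (intro integrable_mult_right decay_integrable) simp
 have "0 <= (1 + norm (0::'a)) ^ (2 * DIM('a)) * norm (f 0)" by simp
 hence C: "0 <= C" using assms(2)[of 0] by linarith
 have le: "norm (f x) <= C * (1 / (1 + norm x) ^ (2 * DIM('a)))" for x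
 using assms(2)[of x] by (simp add: field_simps add_pos_nonneg)
 show int: "integrable lborel f"
 by (rule Bochner_Integration.integrable_bound[OF i]) (use assms(1) C le in auto)
 have "norm (integral\<^sup>L lborel f) <= (LBINT x. norm (f x))" by (rule integral_norm_bound)
 also have "... <= (LBINT x. C * (1 / (1 + norm (x::'a)) ^ (2 * DIM('a))))"
 by (intro integral_mono i integrable_norm int le)
 finally show "norm (integral\<^sup>L lborel f) <= C * (LBINT x. 1 / (1 + norm (x::'a)) ^ (2 * DIM('a)))"
 by (simp only: integral_mult_right_zero)
qed

subsection \<open>Schwartz functions and functions of polynomial growth\<close>

lemma schwartzD:
 assumes "schwartz f"
 shows "Cinf_on UNIV f" "!!vs k. set vs <= Basis ==> EX C. ALL x. (1 + norm x) ^ k * norm (Dl vs f x) <= C"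
 using assms by (auto simp: schwartz_def)

text \<open>The multipliers of the Schwartz space, usually written O_M: every derivative grows
  polynomially, with an exponent that may depend on the derivative.\<close>

definition om :: "('a::euclidean_space => complex) => bool" where
 "om f \<longleftrightarrow> Cinf_on UNIV f \<and>
 (ALL vs. set vs <= Basis --> (EX C k. ALL x. norm (Dl vs f x) <= C * (1 + norm x) ^ k))"

text \<open>Families of Schwartz functions of the second variable, with seminorms that grow at most
 polynomially in the first.\<close>

definition PS :: "('a::euclidean_space \<times> 'b::euclidean_space => complex) => bool" where
 "PS H \<longleftrightarrow> Cinf_on UNIV H & (ALL vs k. set vs <= Basis -->
 (EX C l. ALL p q. (1 + norm q) ^ k * norm (Dl vs H (p, q)) <= C * (1 + norm p) ^ l))"

lemma sum_list_bound:
 fixes F :: "'q => 'x => real"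
 assumes "!!q. q : set qs ==> EX C. ALL x:X. F q x <= C * w x"
 shows "EX C. ALL x:X. (\<Sum>q\<leftarrow>qs. F q x) <= C * w x"
 using assms
proof (induction qs)
 case (Cons q qs)
 then obtain C D where "ALL x:X. F q x <= C * w x" "ALL x:X. (\<Sum>q\<leftarrow>qs. F q x) <= D * w x" by fastforce
 thus ?case by (intro exI[of _ "C + D"]) (auto simp: algebra_simps intro: add_mono)
qed (auto intro: exI[of _ 0])

lemma Leibniz_norm_le:
 fixes f g :: "'a::euclidean_space => complex"
 assumes "open U" "Cinf_on U f" "Cinf_on U g" "set vs <= Basis" "x : U"
 shows "norm (Dl vs (%x. f x * g x) x) <= (\<Sum>q\<leftarrow>splits vs. norm (Dl (fst q) f x) * norm (Dl (snd q) g x))"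
proof -
 have "norm (\<Sum>q\<leftarrow>qs. h q) <= (\<Sum>q\<leftarrow>qs. norm (h q))" for h :: "'a list \<times> 'a list => complex" and qs
 by (induction qs) (auto intro: order_trans[OF norm_triangle_ineq])
 from this[of "%q. Dl (fst q) f x * Dl (snd q) g x" "splits vs"] show ?thesis
 unfolding Leibniz(2)[OF bounded_bilinear_mult assms(1-3) assms(4,5)]
 by (simp add: case_prod_unfold norm_mult)
qed

text \<open>Stated for families, with points confined to sets \<open>X i\<close>, so that one
  constant serves every index and every point.\<close>

lemma Leibniz_bound:
 fixes f g :: "'i => 'a::euclidean_space => complex"
 assumes "open U" "!!i. i : I ==> Cinf_on U (f i)" "!!i. i : I ==> Cinf_on U (g i)" "set vs <= Basis"
 and "!!a b. mset a + mset b = mset vs ==> set a <= Basis ==> set b <= Basis ==>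
 EX C. ALL i:I. ALL x:X i. norm (Dl a (f i) x) * norm (Dl b (g i) x) <= C * w i x"
 and "!!i. i : I ==> X i <= U"
 shows "EX C. ALL i:I. ALL x:X i. norm (Dl vs (%x. f i x * g i x) x) <= C * w i x"
proof -
 have "EX C. ALL z:Sigma I X. (\<Sum>q\<leftarrow>splits vs. norm (Dl (fst q) (f (fst z)) (snd z)) * norm (Dl (snd q) (g (fst z)) (snd z)))
 <= C * w (fst z) (snd z)"
 proof (rule sum_list_bound)
 fix q assume q: "q : set (splits vs)"
 hence "mset (fst q) + mset (snd q) = mset vs" "set (fst q) <= Basis" "set (snd q) <= Basis"
 using splits_mset[of "fst q" "snd q" vs] splits_set[of "fst q" "snd q" vs] assms(4) by auto
 from assms(5)[OF this]
 show "EX C. ALL z:Sigma I X. norm (Dl (fst q) (f (fst z)) (snd z)) * norm (Dl (snd q) (g (fst z)) (snd z)) <= C * w (fst z) (snd z)"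
 by auto
 qed
 then obtain C where C: "!!i x. i : I ==> x : X i ==>
 (\<Sum>q\<leftarrow>splits vs. norm (Dl (fst q) (f i) x) * norm (Dl (snd q) (g i) x)) <= C * w i x" by auto
 show ?thesis
 proof (intro exI[of _ C] ballI)
 fix i x assume "i : I" "x : X i"
 thus "norm (Dl vs (%x. f i x * g i x) x) <= C * w i x"
 using Leibniz_norm_le[OF assms(1) assms(2)[of i] assms(3)[of i] assms(4), of x] C[of i x] assms(6)[of i] by fastforce
 qed
qed

text \<open>Multiplication by coordinates generates all weights, since norm x is at most the sum of
  the absolute values of the coordinates. Hence plain boundedness of the members, with the two
  closure properties, gives every seminorm.\<close>

lemma schwartz_coinduct:
 fixes f :: "'a::euclidean_space => complex"
 assumes f: "f : S" and bd: "!!g. g : S ==> EX B. ALL x. norm (g x) <= B"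
 and d: "!!g v. g : S ==> v : Basis ==> EX h:S. ALL x. has_dir g v (h x) x"
 and c: "!!g v. g : S ==> v : Basis ==> (%x. (x \<bullet> v) *\<^sub>R g x) : S"
 shows "schwartz f"
proof -
 have D: "Dl vs f : S" if "set vs <= Basis" for vs
 using that
 proof (induction vs)
 case (Cons v vs)
 then obtain h where h: "h : S" "ALL x. has_dir (Dl vs f) v (h x) x" using d[of "Dl vs f" v] by auto
 hence "Dl (v # vs) f = h" by (auto simp: Dl_Cons dirD_eq)
 thus ?case using h by simp
 qed (use f in simp)
 have w: "EX C. ALL x. (1 + norm x) ^ k * norm (g x) <= C" if "g : S" for g k
 using that
 proof (induction k arbitrary: g)
 case (Suc k)
 obtain C where C: "ALL x. (1 + norm x) ^ k * norm (g x) <= C" using Suc by blast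
 have "ALL b:Basis. EX C. ALL x. (1 + norm x) ^ k * norm ((x \<bullet> b) *\<^sub>R g x) <= C"
 using Suc.IH[OF c[OF Suc.prems]] by auto
 then obtain D where D: "!!b x. b : Basis ==> (1 + norm x) ^ k * norm ((x \<bullet> b) *\<^sub>R g x) <= D b" by metis
 have "(1 + norm x) ^ Suc k * norm (g x) <= C + (\<Sum>b\<in>Basis. D b)" for x
 proof -
 have "(1 + norm x) ^ Suc k * norm (g x) = (1 + norm x) ^ k * norm (g x) + norm x * ((1 + norm x) ^ k * norm (g x))"
  by (simp add: algebra_simps)
 also have "norm x * ((1 + norm x) ^ k * norm (g x)) <= (\<Sum>b\<in>Basis. \<bar>x \<bullet> b\<bar>) * ((1 + norm x) ^ k * norm (g x))"
  by (intro mult_right_mono norm_le_l1) simp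
 also have "... = (\<Sum>b\<in>Basis. (1 + norm x) ^ k * norm ((x \<bullet> b) *\<^sub>R g x))"
  unfolding sum_distrib_right by (intro sum.cong refl) (simp add: mult_ac)
 also have "... <= (\<Sum>b\<in>Basis. D b)" by (intro sum_mono D)
 finally show ?thesis using C by (meson add_mono order_trans order_refl)
 qed
 thus ?case by blast
 qed (use bd in simp)
 have "Cinf_on UNIV f"
 proof (rule Cinf_on_coinduct[OF open_UNIV f])
 show "locally_bounded_on UNIV g" if "g : S" for g
 using bd[OF that] unfolding locally_bounded_on_def by (meson zero_less_one)
 qed (use d in simp)
 thus ?thesis unfolding schwartz_def using D w by blast
qed

lemma schwartz_Dl: "schwartz f ==> set ws <= Basis ==> schwartz (Dl ws f)"
 unfolding schwartz_def Dl_append[symmetric] by (auto simp: Cinf_on_Dl)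

lemma om_Dl: "om f ==> set ws <= Basis ==> om (Dl ws f)"
 unfolding om_def Dl_append[symmetric] by (auto simp: Cinf_on_Dl)

lemma PS_Dl: "PS f ==> set ws <= Basis ==> PS (Dl ws f)"
 unfolding PS_def Dl_append[symmetric] by (auto simp: Cinf_on_Dl)

lemma weight_mono: "k <= l ==> (1 + norm x) ^ k <= (1 + norm x) ^ l"
 by (intro power_increasing) auto

lemma om_bound:
 assumes "om f" "set vs <= Basis"
 shows "EX C k. C >= 0 & (ALL x. norm (Dl vs f x) <= C * (1 + norm x) ^ k)"
proof -
 obtain C k where "!!x. norm (Dl vs f x) <= C * (1 + norm x) ^ k"
 using assms unfolding om_def by blast
 hence "norm (Dl vs f x) <= \<bar>C\<bar> * (1 + norm x) ^ k" for x
 using order_trans[OF _ mult_right_mono[OF abs_ge_self, of "(1 + norm x) ^ k" C]] by simp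
 thus ?thesis by (intro exI[of _ "\<bar>C\<bar>"] exI[of _ k]) simp
qed

lemma schwartz_bound:
 assumes "schwartz f" "set vs <= Basis"
 shows "EX C. C >= 0 & (ALL x. (1 + norm x) ^ k * norm (Dl vs f x) <= C)"
proof -
 obtain C where C: "!!x. (1 + norm x) ^ k * norm (Dl vs f x) <= C"
 using assms unfolding schwartz_def by blast
 have "0 <= (1 + norm (0::'a)) ^ k * norm (Dl vs f 0)" by simp
 hence "0 <= C" using C order_trans by blast
 thus ?thesis using C by blast
qed

lemma PS_bound:
 assumes "PS H" "set vs <= Basis"
 shows "EX C l. C >= 0 & (ALL p q. (1 + norm q) ^ k * norm (Dl vs H (p, q)) <= C * (1 + norm p) ^ l)"
proof -
 obtain C l where "!!p q. (1 + norm q) ^ k * norm (Dl vs H (p, q)) <= C * (1 + norm p) ^ l"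
 using assms unfolding PS_def by blast
 hence "(1 + norm q) ^ k * norm (Dl vs H (p, q)) <= \<bar>C\<bar> * (1 + norm p) ^ l" for p q
 using order_trans[OF _ mult_right_mono[OF abs_ge_self, of "(1 + norm p) ^ l" C]] by simp
 thus ?thesis by (intro exI[of _ "\<bar>C\<bar>"] exI[of _ l]) simp
qed

lemma om_const: "om (%x. c)"
proof -
 have "Dl vs (%x::'a. c) x = (if vs = [] then c else 0)" if "set vs <= Basis" for vs x
 using Cinf_on_seqI(2)[OF open_UNIV, where P = "%vs x. if vs = [] then c else 0" and f = "%x. c" and vs = vs and x = x] that
 by (cases "vs = []") (simp_all add: has_dir_const split del: if_split)
 thus ?thesis unfolding om_def
 by (intro conjI allI impI Cinf_on_const open_UNIV exI[of _ "norm c"] exI[of _ 0]) simp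
qed

lemma om_add:
 assumes "om f" "om g" shows "om (%x. f x + g x)"
 unfolding om_def
proof (intro conjI allI impI)
 show "Cinf_on UNIV (%x. f x + g x)" using assms by (simp add: om_def Cinf_on_add)
 fix vs :: "'a list" assume vs: "set vs <= Basis"
 obtain C k where C: "C >= 0" "!!x. norm (Dl vs f x) <= C * (1 + norm x) ^ k" using om_bound[OF assms(1) vs] by blast
 obtain D l where D: "D >= 0" "!!x. norm (Dl vs g x) <= D * (1 + norm x) ^ l" using om_bound[OF assms(2) vs] by blast
 have "norm (Dl vs (%x. f x + g x) x) <= (C + D) * (1 + norm x) ^ (k + l)" for x
 proof -
 have "norm (Dl vs (%x. f x + g x) x) <= norm (Dl vs f x) + norm (Dl vs g x)"
 using assms vs by (subst Cinf_on_add(2)[OF open_UNIV]) (auto simp: om_def norm_triangle_ineq)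
 also have "... <= C * (1 + norm x) ^ (k + l) + D * (1 + norm x) ^ (k + l)"
 by (intro add_mono order_trans[OF C(2)] order_trans[OF D(2)] mult_left_mono weight_mono C(1) D(1)) auto
 finally show ?thesis by (simp add: algebra_simps)
 qed
 thus "EX C k. ALL x. norm (Dl vs (%x. f x + g x) x) <= C * (1 + norm x) ^ k" by blast
qed

lemma sum_list_poly_bound:
 fixes F :: "'q => 'x => real"
 assumes "!!q. q : set qs ==> EX C k. ALL x. F q x <= C * w x * g x ^ k"
 and g: "!!x. 1 <= g x" and w: "!!x. 0 <= w x"
 shows "EX C k. ALL x. (\<Sum>q\<leftarrow>qs. F q x) <= C * w x * g x ^ k"
 using assms(1)
proof (induction qs)
 case (Cons q qs)
 obtain C k where 1: "ALL x. F q x <= C * w x * g x ^ k" using Cons.prems by fastforce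
 obtain D l where 2: "ALL x. (\<Sum>q\<leftarrow>qs. F q x) <= D * w x * g x ^ l" using Cons by fastforce
 have mono: "C * w x * g x ^ k <= \<bar>C\<bar> * w x * g x ^ (k + l)" "D * w x * g x ^ l <= \<bar>D\<bar> * w x * g x ^ (k + l)" for x
 using w[of x] g[of x] by (intro mult_mono power_increasing mult_right_mono mult_nonneg_nonneg; simp)+
 have "(\<Sum>q\<leftarrow>q # qs. F q x) <= (\<bar>C\<bar> + \<bar>D\<bar>) * w x * g x ^ (k + l)" for x
 using 1[rule_format, of x] 2[rule_format, of x] mono[of x] by (simp add: algebra_simps)
 thus ?case by blast
qed (auto intro: exI[of _ 0])

lemma Leibniz_poly_bound:
 fixes f h :: "'a::euclidean_space => complex"
 assumes "Cinf_on UNIV f" "Cinf_on UNIV h" "set vs <= Basis"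
 and "!!x. 1 <= g x" "!!x. 0 <= w x"
 and "!!a b. set a <= Basis ==> set b <= Basis ==> mset a + mset b = mset vs ==>
 EX C k. ALL x. norm (Dl a f x) * norm (Dl b h x) <= C * w x * g x ^ k"
 shows "EX C k. ALL x. norm (Dl vs (%x. f x * h x) x) <= C * w x * g x ^ k"
proof -
 have "EX C k. ALL x. (\<Sum>q\<leftarrow>splits vs. norm (Dl (fst q) f x) * norm (Dl (snd q) h x)) <= C * w x * g x ^ k"
 proof (rule sum_list_poly_bound[OF _ assms(4,5)])
 fix q assume q: "q : set (splits vs)"
 show "EX C k. ALL x. norm (Dl (fst q) f x) * norm (Dl (snd q) h x) <= C * w x * g x ^ k"
 using splits_mset[of "fst q" "snd q" vs] splits_set[of "fst q" "snd q" vs] assms(3) q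
 by (intro assms(6)) auto
 qed
 thus ?thesis
 using Leibniz_norm_le[OF open_UNIV assms(1-3)] by (meson UNIV_I order_trans)
qed

lemma om_mult:
 assumes "om f" "om g" shows "om (%x. f x * g x)"
 unfolding om_def
proof (intro conjI allI impI)
 have cf: "Cinf_on UNIV f" "Cinf_on UNIV g" using assms by (auto simp: om_def)
 thus "Cinf_on UNIV (%x. f x * g x)" by (simp add: Cinf_on_mult)
 fix vs :: "'a list" assume vs: "set vs <= Basis"
 have "EX C k. ALL x. norm (Dl vs (%x. f x * g x) x) <= C * 1 * (1 + norm x) ^ k"
 proof (rule Leibniz_poly_bound[OF cf vs, where w = "%x. 1" and g = "%x. 1 + norm x"])
 fix a b :: "'a list" assume ab: "set a <= Basis" "set b <= Basis"
 obtain C k where C: "C >= 0" "!!x. norm (Dl a f x) <= C * (1 + norm x) ^ k" using om_bound[OF assms(1) ab(1)] by blast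
 obtain D l where D: "D >= 0" "!!x. norm (Dl b g x) <= D * (1 + norm x) ^ l" using om_bound[OF assms(2) ab(2)] by blast
 have "norm (Dl a f x) * norm (Dl b g x) <= (C * (1 + norm x) ^ k) * (D * (1 + norm x) ^ l)" for x
 by (intro mult_mono C D) (auto simp: C)
 thus "EX C k. ALL x. norm (Dl a f x) * norm (Dl b g x) <= C * 1 * (1 + norm x) ^ k"
 by (intro exI[of _ "C * D"] exI[of _ "k + l"]) (auto simp: power_add mult_ac)
 qed auto
 thus "EX C k. ALL x. norm (Dl vs (%x. f x * g x) x) <= C * (1 + norm x) ^ k" by simp
qed

lemma om_sum: "finite I ==> (!!i. i : I ==> om (f i)) ==> om (%x. \<Sum>i\<in>I. f i x)"
 by (induction I rule: finite_induct) (auto intro: om_const om_add)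

lemma om_linear: 
 assumes "bounded_linear L" shows "om (%x. cor (L x))"
proof -
 have L: "bounded_linear (%x. cor (L x))"
 by (rule bounded_linear_compose[OF bounded_linear_of_real assms])
 obtain B where B: "B > 0" "!!x. \<bar>L x\<bar> <= norm x * B" using bounded_linear.pos_bounded[OF assms] by auto
 define P where "P vs x = (case vs of [] => cor (L x) | [v] => cor (L v) | _ => 0)" for vs x
 have d: "has_dir (P vs) v (P (v # vs) x) x" for vs v x
 using has_dir_linear[OF L, of v x] has_dir_const
 by (auto simp: P_def[abs_def] split: list.splits)
 have c: "continuous_on UNIV (P vs)" for vs
 using linear_continuous_on[OF L] by (cases vs rule: remdups_adj.cases) (auto simp: P_def[abs_def])
 have D: "Dl vs (%x. cor (L x)) x = P vs x" if "set vs <= Basis" for vs x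
 by (rule Cinf_on_seqI(2)[OF open_UNIV d c _ that]) (auto simp: P_def)
 have "EX C k. ALL x. norm (P vs x) <= C * (1 + norm x) ^ k" for vs
 proof (cases vs)
 case Nil
 have "\<bar>L x\<bar> <= B * (1 + norm x) ^ 1" for x using B(2)[of x] B(1) by (simp add: algebra_simps)
 thus ?thesis using Nil by (intro exI[of _ B] exI[of _ 1]) (auto simp: P_def)
 next
 case (Cons v us)
 thus ?thesis
 by (intro exI[of _ "\<bar>L v\<bar>"] exI[of _ 0]) (auto simp: P_def split: list.splits)
 qed
 thus ?thesis unfolding om_def using Cinf_on_linear[OF L open_UNIV] D by (auto simp: P_def)
qed

lemma om_inner: "om (%x. cor (x \<bullet> a))"
 by (rule om_linear[OF bounded_linear_inner_left])

text \<open>The growth of f splits by 1 + norm (p, q) <= (1 + norm p) (1 + norm q): the part in q is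
  paid for by l more powers of decay of \<open>H\<close>, the part in p is of the kind that
  \<open>PS\<close> allows.\<close>

lemma PS_om:
 assumes "PS H" "om f" shows "PS (%z. f z * H z)"
 unfolding PS_def
proof (intro conjI allI impI)
 have cf: "Cinf_on UNIV f" "Cinf_on UNIV H" using assms by (auto simp: om_def PS_def)
 thus "Cinf_on UNIV (%z. f z * H z)" by (simp add: Cinf_on_mult)
 fix vs :: "('a \<times> 'b) list" and k :: nat assume vs: "set vs <= Basis"
 have "EX C l. ALL z. norm (Dl vs (%z. f z * H z) z) <= C * (1 / (1 + norm (snd z)) ^ k) * (1 + norm (fst z)) ^ l"
 proof (rule Leibniz_poly_bound[OF cf vs])
 fix a b :: "('a \<times> 'b) list" assume ab: "set a <= Basis" "set b <= Basis"
 obtain C l where C: "C >= 0" "!!x. norm (Dl a f x) <= C * (1 + norm x) ^ l" using om_bound[OF assms(2) ab(1)] by blast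
 obtain D m where D: "D >= 0" "!!p q. (1 + norm q) ^ (k + l) * norm (Dl b H (p, q)) <= D * (1 + norm p) ^ m"
 using PS_bound[OF assms(1) ab(2)] by blast
 have "norm (Dl a f z) * norm (Dl b H z) <= (C * D) * (1 / (1 + norm (snd z)) ^ k) * (1 + norm (fst z)) ^ (l + m)" for z
 proof -
 obtain p q where z: "z = (p, q)" by (cases z)
 have "1 + norm z <= (1 + norm p) * (1 + norm q)"
  using norm_Pair_le[of p q] mult_nonneg_nonneg[OF norm_ge_zero[of p] norm_ge_zero[of q]]
  by (simp add: z algebra_simps del: mult_nonneg_nonneg)
 hence "(1 + norm z) ^ l <= ((1 + norm p) * (1 + norm q)) ^ l" by (intro power_mono) auto
 hence "norm (Dl a f z) <= C * ((1 + norm p) * (1 + norm q)) ^ l"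
  using C by (meson mult_left_mono order_trans)
 hence "norm (Dl a f z) * norm (Dl b H z) * (1 + norm q) ^ k <=
  (C * ((1 + norm p) * (1 + norm q)) ^ l) * norm (Dl b H z) * (1 + norm q) ^ k"
  by (intro mult_right_mono) auto
 also have "... = C * (1 + norm p) ^ l * ((1 + norm q) ^ (k + l) * norm (Dl b H (p, q)))"
  by (simp add: z power_add power_mult_distrib mult_ac)
 also have "... <= C * (1 + norm p) ^ l * (D * (1 + norm p) ^ m)"
  by (intro mult_left_mono D) (auto simp: C)
 finally show ?thesis by (simp add: z field_simps power_add add_pos_nonneg)
 qed
 thus "EX C l. ALL z. norm (Dl a f z) * norm (Dl b H z) <= C * (1 / (1 + norm (snd z)) ^ k) * (1 + norm (fst z)) ^ l"
 by blast
 qed auto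
 then obtain C l where "!!z. norm (Dl vs (%z. f z * H z) z) <= C * (1 / (1 + norm (snd z)) ^ k) * (1 + norm (fst z)) ^ l"
 by blast
 hence "(1 + norm q) ^ k * norm (Dl vs (%z. f z * H z) (p, q)) <= C * (1 + norm p) ^ l" for p q
 by (force simp: field_simps add_pos_nonneg dest: meta_spec[of _ "(p, q)"])
 thus "EX C l. ALL p q. (1 + norm q) ^ k * norm (Dl vs (%z. f z * H z) (p, q)) <= C * (1 + norm p) ^ l" by blast
qed

lemma schwartz_add:
 assumes "schwartz f" "schwartz g" shows "schwartz (%x. f x + g x)"
 unfolding schwartz_def
proof (intro conjI allI impI)
 show "Cinf_on UNIV (%x. f x + g x)" using assms by (simp add: schwartz_def Cinf_on_add)
 fix vs :: "'a list" and k :: nat assume vs: "set vs <= Basis"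
 obtain C where C: "!!x. (1 + norm x) ^ k * norm (Dl vs f x) <= C" using schwartz_bound[OF assms(1) vs] by blast
 obtain D where D: "!!x. (1 + norm x) ^ k * norm (Dl vs g x) <= D" using schwartz_bound[OF assms(2) vs] by blast
 have "(1 + norm x) ^ k * norm (Dl vs (%x. f x + g x) x) <= C + D" for x
 proof -
 have "norm (Dl vs (%x. f x + g x) x) <= norm (Dl vs f x) + norm (Dl vs g x)"
 using assms vs by (subst Cinf_on_add(2)[OF open_UNIV]) (auto simp: schwartz_def norm_triangle_ineq)
 hence "(1 + norm x) ^ k * norm (Dl vs (%x. f x + g x) x) <= (1 + norm x) ^ k * (norm (Dl vs f x) + norm (Dl vs g x))"
 by (intro mult_left_mono) auto
 thus ?thesis using C[of x] D[of x] by (simp add: algebra_simps)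
 qed
 thus "EX C. ALL x. (1 + norm x) ^ k * norm (Dl vs (%x. f x + g x) x) <= C" by blast
qed

lemma schwartz_om:
 assumes "schwartz h" "om f" shows "schwartz (%x. f x * h x)"
 unfolding schwartz_def
proof (intro conjI allI impI)
 have cf: "Cinf_on UNIV f" "Cinf_on UNIV h" using assms by (auto simp: om_def schwartz_def)
 thus "Cinf_on UNIV (%z. f z * h z)" by (simp add: Cinf_on_mult)
 fix vs :: "'a list" and k :: nat assume vs: "set vs <= Basis"
 have "EX C l. ALL z. norm (Dl vs (%z. f z * h z) z) <= C * (1 / (1 + norm z) ^ k) * 1 ^ l"
 proof (rule Leibniz_poly_bound[OF cf vs, where g = "%x. 1"])
 fix a b :: "'a list" assume ab: "set a <= Basis" "set b <= Basis"
 obtain C l where C: "C >= 0" "!!x. norm (Dl a f x) <= C * (1 + norm x) ^ l" using om_bound[OF assms(2) ab(1)] by blast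
 obtain D where D: "D >= 0" "!!x. (1 + norm x) ^ (k + l) * norm (Dl b h x) <= D"
 using schwartz_bound[OF assms(1) ab(2)] by blast
 have "norm (Dl a f z) * norm (Dl b h z) <= (C * D) * (1 / (1 + norm z) ^ k)" for z
 proof -
 have "norm (Dl a f z) * norm (Dl b h z) * (1 + norm z) ^ k <=
  (C * (1 + norm z) ^ l) * norm (Dl b h z) * (1 + norm z) ^ k"
  by (intro mult_right_mono C) auto
 also have "... = C * ((1 + norm z) ^ (k + l) * norm (Dl b h z))"
  by (simp add: power_add mult_ac)
 also have "... <= C * D" by (intro mult_left_mono D C)
 finally show ?thesis by (simp add: field_simps add_pos_nonneg)
 qed
 thus "EX C l. ALL z. norm (Dl a f z) * norm (Dl b h z) <= C * (1 / (1 + norm z) ^ k) * 1 ^ l" by auto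
 qed auto
 then obtain C where "!!z. norm (Dl vs (%z. f z * h z) z) <= C * (1 / (1 + norm z) ^ k)" by auto
 hence "(1 + norm z) ^ k * norm (Dl vs (%z. f z * h z) z) <= C" for z
 by (force simp: field_simps add_pos_nonneg dest: meta_spec[of _ z])
 thus "EX C. ALL z. (1 + norm z) ^ k * norm (Dl vs (%z. f z * h z) z) <= C" by blast
qed

lemma schwartz_scale: "schwartz f ==> schwartz (%x. c * f x)"
 by (rule schwartz_om[OF _ om_const])

lemma schwartz_zero: "schwartz (%x. 0)"
 by (rule schwartz_coinduct[of _ "{%x. 0}"]) (auto intro: has_dir_const)

lemma schwartz_sum: "finite I ==> (!!i. i : I ==> schwartz (f i)) ==> schwartz (%x. \<Sum>i\<in>I. f i x)"
 by (induction I rule: finite_induct) (auto intro: schwartz_add schwartz_zero)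

lemma schwartz_diff: "schwartz f ==> schwartz g ==> schwartz (%x. f x - g x)"
 using schwartz_add[OF _ schwartz_scale[of g "-1"]] by simp

lemma schwartz_imp_om: 
 assumes "schwartz f" shows "om f"
 unfolding om_def
proof (intro conjI allI impI)
 show "Cinf_on UNIV f" using assms by (simp add: schwartz_def)
 fix vs :: "'a list" assume "set vs <= Basis"
 from schwartz_bound[OF assms this, of 0] obtain C where "!!x. norm (Dl vs f x) <= C" by auto
 thus "EX C k. ALL x. norm (Dl vs f x) <= C * (1 + norm x) ^ k" by (intro exI[of _ C] exI[of _ 0]) auto
qed

lemma schwartz_dirD_any:
 assumes "schwartz f" shows "schwartz (dirD w f)"
proof -
 have "dirD w f = (%x. \<Sum>b\<in>Basis. cor (w \<bullet> b) * Dl [b] f x)"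
 by (intro ext) (simp add: dirD_expand[OF open_UNIV schwartzD(1)[OF assms], of _ w] Dl_Cons scaleR_conv_of_real)
 thus ?thesis by (auto intro!: schwartz_sum schwartz_scale schwartz_Dl assms)
qed

lemma schwartz_Dl_any: "schwartz f ==> schwartz (Dl ws f)"
 by (induction ws) (auto simp: Dl_Cons schwartz_dirD_any)

lemma schwartz_measurable [measurable_dest]: "schwartz f ==> f : borel_measurable borel"
 using Cinf_on_continuous[of UNIV f] borel_measurable_continuous_onI by (auto simp: schwartz_def)

lemma schwartz_integrable:
 fixes f :: "'a::euclidean_space => complex"
 assumes "schwartz f" shows "integrable lborel f"
proof -
 obtain C where "!!x. (1 + norm x) ^ (2 * DIM('a)) * norm (Dl [] f x) <= C"
 using schwartz_bound[OF assms, of "[]" "2 * DIM('a)"] by auto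
 thus ?thesis by (intro integrable_of_decay(1)[where C = C] schwartz_measurable[OF assms]) simp
qed

text \<open>Decay survives an affine substitution between possibly different spaces as soon as z is
  controlled by its image.\<close>

lemma schwartz_affine_gen:
 fixes \<theta> :: "'c::euclidean_space => complex" and L :: "'a::euclidean_space => 'c"
 assumes "schwartz \<theta>" "linear L" "A >= 0" "!!z. norm z <= A * (1 + norm (a + L z))"
 shows "schwartz (%z. \<theta> (a + L z))"
 unfolding schwartz_def
proof (intro conjI allI impI)
 show "Cinf_on UNIV (%z. \<theta> (a + L z))"
 by (rule Cinf_on_affine[OF schwartzD(1)[OF assms(1)]]) (use assms in auto)
 fix vs :: "'a list" and k :: nat
 obtain C where C: "C >= 0" "!!x. (1 + norm x) ^ k * norm (Dl (map L vs) \<theta> x) <= C"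
 using schwartz_bound[OF schwartz_Dl_any[OF assms(1), of "map L vs"], of "[]" k] by auto
 have "(1 + norm z) ^ k * norm (Dl vs (%z. \<theta> (a + L z)) z) <= (1 + A) ^ k * C" for z
 proof -
 have "1 + norm z <= 1 * (1 + norm (a + L z)) + A * (1 + norm (a + L z))"
 using add_mono[OF _ assms(4)[of z], of 1 "1 * (1 + norm (a + L z))"] by simp
 hence "1 + norm z <= (1 + A) * (1 + norm (a + L z))"
 by (simp only: distrib_right[of 1 A])
 hence "(1 + norm z) ^ k <= ((1 + A) * (1 + norm (a + L z))) ^ k" by (intro power_mono) auto
 hence "(1 + norm z) ^ k * norm (Dl vs (%z. \<theta> (a + L z)) z) <=
  (1 + A) ^ k * ((1 + norm (a + L z)) ^ k * norm (Dl (map L vs) \<theta> (a + L z)))"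
 unfolding Dl_affine[OF assms(2)] mult.assoc[symmetric] power_mult_distrib[symmetric]
 by (intro mult_right_mono) auto
 also have "... <= (1 + A) ^ k * C" by (intro mult_left_mono C) (use assms(3) in auto)
 finally show ?thesis .
 qed
 thus "EX C. ALL z. (1 + norm z) ^ k * norm (Dl vs (%z. \<theta> (a + L z)) z) <= C" by blast
qed

lemma schwartz_linear:
 fixes \<theta> :: "'c::euclidean_space => complex" and L :: "'a::euclidean_space => 'c"
 assumes "schwartz \<theta>" "linear L" "A >= 0" "!!z. norm z <= A * norm (L z)"
 shows "schwartz (%z. \<theta> (L z))"
proof -
 have "norm z <= A * (1 + norm (0 + L z))" for z
 using assms(4)[of z] mult_left_mono[OF _ assms(3), of "norm (L z)" "1 + norm (L z)"] by simp
 from schwartz_affine_gen[OF assms(1-3) this] show ?thesis by simp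
qed

lemma schwartz_shift:
 assumes "schwartz \<theta>" shows "schwartz (%z. \<theta> (a + z))"
proof (rule schwartz_affine_gen[OF assms, where L = "%z. z" and A = "1 + norm a"])
 fix z :: 'a
 have "norm z <= norm a + norm (a + z)" using norm_triangle_ineq4[of "a + z" a] by simp
 also have "... <= (1 + norm a) * (1 + norm (a + z))" by (simp add: algebra_simps)
 finally show "norm z <= (1 + norm a) * (1 + norm (a + z))" .
qed (auto simp: linear_id[unfolded id_def])

lemma schwartz_shift': "schwartz \<theta> ==> schwartz (%z. \<theta> (a - z))"
 using schwartz_shift[OF schwartz_linear[of \<theta> uminus 1], of "-a"]
 by (simp add: linear_uminus)

text \<open>Since p is only a parameter, q has to be controlled by the image together with p.
  Translations of q by p are the model case.\<close>

lemma PS_linear: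
 fixes \<theta> :: "'c::euclidean_space => complex" and L :: "'a::euclidean_space \<times> 'b::euclidean_space => 'c"
 assumes "schwartz \<theta>" "linear L" "A >= 0" "!!p q. norm q <= A * (norm (L (p, q)) + norm p)"
 shows "PS (%z. \<theta> (L z))"
 unfolding PS_def
proof (intro conjI allI impI)
 show "Cinf_on UNIV (%z. \<theta> (L z))"
 using Cinf_on_affine[OF schwartzD(1)[OF assms(1)] open_UNIV open_UNIV assms(2), of 0] by simp
 fix vs :: "('a \<times> 'b) list" and k :: nat
 obtain C where C: "C >= 0" "!!x. (1 + norm x) ^ k * norm (Dl (map L vs) \<theta> x) <= C"
 using schwartz_bound[OF schwartz_Dl_any[OF assms(1), of "map L vs"], of "[]" k] by auto
 have "(1 + norm q) ^ k * norm (Dl vs (%z. \<theta> (L z)) (p, q)) <= ((1 + A) ^ k * C) * (1 + norm p) ^ k" for p q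
 proof -
 have "norm (L (p, q)) + norm p <= (1 + norm p) * (1 + norm (L (p, q)))"
 by (simp add: algebra_simps)
 hence "norm q <= A * ((1 + norm p) * (1 + norm (L (p, q))))"
 using assms(4)[of q p] mult_left_mono[OF _ assms(3)] by (meson order_trans)
 moreover have "1 <= (1 + norm p) * (1 + norm (L (p, q)))"
 using mult_mono[of 1 "1 + norm p" 1 "1 + norm (L (p, q))"] by simp
 ultimately have "1 + norm q <= 1 * ((1 + norm p) * (1 + norm (L (p, q)))) + A * ((1 + norm p) * (1 + norm (L (p, q))))"
 by linarith
 hence "1 + norm q <= (1 + A) * ((1 + norm p) * (1 + norm (L (p, q))))"
 by (simp only: distrib_right[of 1 A])
 hence "(1 + norm q) ^ k <= ((1 + A) * ((1 + norm p) * (1 + norm (L (p, q))))) ^ k"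
 by (intro power_mono) auto
 hence "(1 + norm q) ^ k * norm (Dl vs (%z. \<theta> (L z)) (p, q)) <=
  ((1 + A) * ((1 + norm p) * (1 + norm (L (p, q))))) ^ k * norm (Dl (map L vs) \<theta> (L (p, q)))"
 unfolding Dl_affine'[OF assms(2)] by (intro mult_right_mono) auto
 also have "... = (1 + A) ^ k * (1 + norm p) ^ k * ((1 + norm (L (p, q))) ^ k * norm (Dl (map L vs) \<theta> (L (p, q))))"
 by (simp add: power_mult_distrib mult_ac)
 also have "... <= (1 + A) ^ k * (1 + norm p) ^ k * C" by (intro mult_left_mono C) (use assms(3) in auto)
 finally show ?thesis by (simp add: mult_ac)
 qed
 thus "EX C l. ALL p q. (1 + norm q) ^ k * norm (Dl vs (%z. \<theta> (L z)) (p, q)) <= C * (1 + norm p) ^ l" by blast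
qed

lemma schwartz_imp_PS:
 fixes \<theta> :: "'a::euclidean_space \<times> 'b::euclidean_space => complex"
 assumes "schwartz \<theta>" shows "PS \<theta>"
proof -
 have "norm q <= 1 * (norm (id (p, q)) + norm p)" for p :: 'a and q :: 'b
 using norm_snd_le[of q p] norm_ge_zero[of p] by (simp del: norm_ge_zero)
 from PS_linear[OF assms linear_id _ this] show ?thesis by simp
qed

lemma linear_Pair0: "linear (%q. (0, q))" "linear (%p. (p, 0))"
 by (auto intro!: linearI)

lemma Dl_slice: "Dl vs (%q. H (p, q)) q = Dl (map (Pair 0) vs) H (p, q)"
 using Dl_affine[OF linear_Pair0(1), of vs H "(p, 0)"] by (simp add: fun_eq_iff)

lemma Dl_slice_fst: "Dl vs (%p. H (p, q)) p = Dl (map (%v. (v, 0)) vs) H (p, q)"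
 using Dl_affine[OF linear_Pair0(2), of vs H "(0, q)"] by (simp add: fun_eq_iff)

lemma Cinf_on_slice: "Cinf_on UNIV H ==> Cinf_on UNIV (%q. H (p, q))"
 using Cinf_on_affine[OF _ open_UNIV open_UNIV linear_Pair0(1), of H "(p, 0)"] by simp

lemma Pair0_Basis: "set vs <= Basis ==> set (map (Pair 0) vs) <= (Basis :: ('a::euclidean_space \<times> 'b::euclidean_space) set)"
 "set us <= Basis ==> set (map (%v. (v, 0)) us) <= (Basis :: ('a::euclidean_space \<times> 'b::euclidean_space) set)"
 by (auto simp: Basis_prod_def)

lemma PS_slice: 
 assumes "PS H" shows "schwartz (%q. H (p, q))"
 unfolding schwartz_def
proof (intro conjI allI impI)
 show "Cinf_on UNIV (%q. H (p, q))" using assms by (simp add: PS_def Cinf_on_slice)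
 fix vs :: "'b list" and k :: nat assume "set vs <= Basis"
 obtain C l where "C >= 0"
 "!!p q. (1 + norm q) ^ k * norm (Dl (map (Pair 0) vs) H (p, q)) <= C * (1 + norm p) ^ l"
 using PS_bound[OF assms Pair0_Basis(1)[OF \<open>set vs <= Basis\<close>]] by blast
 thus "EX C. ALL q. (1 + norm q) ^ k * norm (Dl vs (%q. H (p, q)) q) <= C"
 unfolding Dl_slice by blast
qed

lemma schwartz_slice: "schwartz H ==> schwartz (%q. H (p, q))"
 by (rule PS_slice[OF schwartz_imp_PS])

lemma PS_add:
 assumes "PS f" "PS g" shows "PS (%z. f z + g z)"
 unfolding PS_def
proof (intro conjI allI impI)
 show "Cinf_on UNIV (%z. f z + g z)" using assms by (simp add: PS_def Cinf_on_add)
 fix vs :: "('a \<times> 'b) list" and k :: nat assume vs: "set vs <= Basis"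
 obtain C l where C: "C >= 0" "!!p q. (1 + norm q) ^ k * norm (Dl vs f (p, q)) <= C * (1 + norm p) ^ l"
 using PS_bound[OF assms(1) vs] by blast
 obtain D m where D: "D >= 0" "!!p q. (1 + norm q) ^ k * norm (Dl vs g (p, q)) <= D * (1 + norm p) ^ m"
 using PS_bound[OF assms(2) vs] by blast
 have "(1 + norm q) ^ k * norm (Dl vs (%z. f z + g z) (p, q)) <= (C + D) * (1 + norm p) ^ (l + m)" for p q
 proof -
 have "norm (Dl vs (%z. f z + g z) (p, q)) <= norm (Dl vs f (p, q)) + norm (Dl vs g (p, q))"
 using assms vs by (subst Cinf_on_add(2)[OF open_UNIV]) (auto simp: PS_def norm_triangle_ineq)
 hence "(1 + norm q) ^ k * norm (Dl vs (%z. f z + g z) (p, q)) <=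
  (1 + norm q) ^ k * norm (Dl vs f (p, q)) + (1 + norm q) ^ k * norm (Dl vs g (p, q))"
 unfolding distrib_left[symmetric] by (intro mult_left_mono) auto
 also have "... <= C * (1 + norm p) ^ (l + m) + D * (1 + norm p) ^ (l + m)"
 by (intro add_mono order_trans[OF C(2)] order_trans[OF D(2)] mult_left_mono weight_mono C(1) D(1)) auto
 finally show ?thesis by (simp add: algebra_simps)
 qed
 thus "EX C l. ALL p q. (1 + norm q) ^ k * norm (Dl vs (%z. f z + g z) (p, q)) <= C * (1 + norm p) ^ l" by blast
qed

lemma PS_scale: "PS H ==> PS (%z. c * H z)"
 by (rule PS_om[OF _ om_const])

lemma PS_sum: "finite I ==> (!!i. i : I ==> PS (f i)) ==> PS (%x. \<Sum>i\<in>I. f i x)"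
 by (induction I rule: finite_induct) (auto intro: PS_add schwartz_imp_PS schwartz_zero)

lemma PS_dirD_any:
 assumes "PS H" shows "PS (dirD w H)"
proof -
 have H: "Cinf_on UNIV H" using assms by (simp add: PS_def)
 have "dirD w H = (%x. \<Sum>b\<in>Basis. cor (w \<bullet> b) * Dl [b] H x)"
 by (intro ext) (simp add: dirD_expand[OF open_UNIV H, of _ w] Dl_Cons scaleR_conv_of_real)
 thus ?thesis by (auto intro!: PS_sum PS_scale PS_Dl assms)
qed

lemma PS_Dl_any: "PS H ==> PS (Dl ws H)"
 by (induction ws) (auto simp: Dl_Cons PS_dirD_any)

subsection \<open>Tempered functionals on families of Schwartz functions\<close>

lemma tempered_add: "tempered K ==> schwartz f ==> schwartz g ==> K (%x. f x + g x) = K f + K g"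
 and tempered_scale: "tempered K ==> schwartz f ==> K (%x. c * f x) = c * K f"
 unfolding tempered_def by blast+

lemma tempered_diff: 
 assumes "tempered K" "schwartz f" "schwartz g" shows "K (%x. f x - g x) = K f - K g"
 using tempered_add[OF assms(1,2) schwartz_scale[OF assms(3), of "-1"]] tempered_scale[OF assms(1,3), of "-1"] by simp

lemma tempered_zero: "tempered K ==> K (%x. 0) = 0"
 using tempered_scale[OF _ schwartz_zero, of K 0] by simp

lemma tempered_sum:
 assumes "tempered K" "finite I" "!!i. i : I ==> schwartz (f i)"
 shows "K (%x. \<Sum>i\<in>I. f i x) = (\<Sum>i\<in>I. K (f i))"
 using assms(2,3)
 by (induction I rule: finite_induct)
 (auto simp: tempered_zero[OF assms(1)] tempered_add[OF assms(1)] schwartz_sum)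

lemma tempered_bound:
 assumes "tempered K"
 shows "EX C m. C >= 0 & (ALL f B. schwartz f -->
 (ALL vs x. set vs <= Basis & length vs <= m --> (1 + norm x) ^ m * norm (Dl vs f x) <= B) --> norm (K f) <= C * B)"
proof -
 obtain C m where C: "!!f B. schwartz f ==>
 (ALL vs x. set vs <= Basis & length vs <= m --> (1 + norm x) ^ m * norm (Dl vs f x) <= B) ==> norm (K f) <= C * B"
 using assms unfolding tempered_def by (metis (no_types, lifting))
 have "norm (K f) <= \<bar>C\<bar> * B" if "schwartz f"
 and B: "ALL vs x. set vs <= Basis & length vs <= m --> (1 + norm x) ^ m * norm (Dl vs f x) <= B" for f B
 proof -
 have "0 <= (1 + norm (0::'a)) ^ m * norm (Dl [] f 0)" by simp
 also have "... <= B" using B by (metis empty_set empty_subsetI list.size(3) zero_le)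
 finally have "C * B <= \<bar>C\<bar> * B" by (intro mult_right_mono) auto
 thus ?thesis using C[OF that] by linarith
 qed
 thus ?thesis by (intro exI[of _ "\<bar>C\<bar>"] exI[of _ m]) auto
qed

lemma PS_uniform:
 fixes H :: "'a::euclidean_space \<times> 'b::euclidean_space => complex"
 assumes "PS H" "finite V"
 shows "EX C l. C >= 0 & (ALL vs:V. ALL p q. (1 + norm q) ^ k * norm (Dl vs H (p, q)) <= C * (1 + norm p) ^ l)"
 using assms(2)
proof (induction V rule: finite_induct)
 case (insert vs V)
 then obtain C l where C: "C >= 0" "!!vs p q. vs : V ==> (1 + norm q) ^ k * norm (Dl vs H (p, q)) <= C * (1 + norm p) ^ l" by blast
 obtain D m where D: "D >= 0" "!!p q. (1 + norm q) ^ k * norm (Dl vs H (p, q)) <= D * (1 + norm p) ^ m"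
 using PS_bound[OF PS_Dl_any[OF assms(1), of vs], of "[]" k] by auto
 have "C * (1 + norm p) ^ l <= (C + D) * (1 + norm p) ^ (l + m)" "D * (1 + norm p) ^ m <= (C + D) * (1 + norm p) ^ (l + m)" for p :: 'a
 using C(1) D(1) by (intro mult_mono weight_mono; simp)+
 hence "ALL us:insert vs V. ALL p q. (1 + norm q) ^ k * norm (Dl us H (p, q)) <= (C + D) * (1 + norm p) ^ (l + m)"
 using order_trans[OF C(2)] order_trans[OF D(2)] by auto
 thus ?case using C(1) D(1) by (intro exI[of _ "C + D"] exI[of _ "l + m"]) auto
qed (auto intro: exI[of _ 0])

lemma finite_short_lists: "finite {vs. set vs <= (Basis :: 'a::euclidean_space set) & length vs <= m}"
 by (rule finite_lists_length_le[OF finite_Basis])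

text \<open>A tempered functional sees finitely many derivatives, so a single constant can be chosen
  for all of them.\<close>

lemma PS_uniform_short:
 fixes H :: "'a::euclidean_space \<times> 'b::euclidean_space => complex"
 assumes "PS H"
 shows "EX C l. C >= 0 & (ALL vs p q. set vs <= Basis --> length vs <= m -->
 (1 + norm q) ^ k * norm (Dl (map (Pair 0) vs) H (p, q)) <= C * (1 + norm p) ^ l)"
proof -
 obtain C l where C: "C >= 0" and *: "ALL vs:map (Pair 0) ` {vs. set vs <= Basis & length vs <= m}. ALL p q.
 (1 + norm q) ^ k * norm (Dl vs H (p, q)) <= C * (1 + norm p) ^ l"
 using PS_uniform[OF assms finite_imageI[of _ "map (Pair 0)", OF finite_short_lists[of m]], where k = k] by blast
 show ?thesis using C * by (intro exI[of _ C] exI[of _ l] conjI allI impI) blast+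
qed

lemma tempered_PS_bound:
 fixes H :: "'a::euclidean_space \<times> 'b::euclidean_space => complex"
 assumes K: "tempered K" and H: "PS H"
 shows "EX C l. C >= 0 & (ALL p. norm (K (%q. H (p, q))) <= C * (1 + norm p) ^ l)"
proof -
 obtain C m where C: "C >= 0" "!!f B. schwartz f ==>
 (ALL vs x. set vs <= Basis & length vs <= m --> (1 + norm x) ^ m * norm (Dl vs f x) <= B) ==> norm (K f) <= C * B"
 using tempered_bound[OF K] by blast
 obtain D l where D: "D >= 0" "!!vs p q. set vs <= Basis ==> length vs <= m ==>
 (1 + norm q) ^ m * norm (Dl (map (Pair 0) vs) H (p, q)) <= D * (1 + norm p) ^ l"
 using PS_uniform_short[OF H, of m m] by blast
 have "norm (K (%q. H (p, q))) <= C * (D * (1 + norm p) ^ l)" for p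
 by (rule C(2)[OF PS_slice[OF H]]) (use D in "auto simp: Dl_slice")
 thus ?thesis using C(1) D(1) by (intro exI[of _ "C * D"] exI[of _ l]) (auto simp: mult.assoc)
qed

lemma taylor2:
 fixes J :: "'a::euclidean_space => 'b::real_normed_vector"
 assumes J: "Cinf_on UNIV J"
 and B: "!!\<tau>. \<tau> : closed_segment 0 t ==> norm (Dl [v, v] J (z + \<tau> *\<^sub>R v)) <= B"
 shows "norm (J (z + t *\<^sub>R v) - J z - t *\<^sub>R dirD v J z) <= B * t\<^sup>2"
proof -
 have B0: "0 <= B" using B[of 0] norm_ge_zero order_trans by (metis ends_in_segment(1))
 have "norm ((J (z + t *\<^sub>R v) - t *\<^sub>R dirD v J z) - (J (z + 0 *\<^sub>R v) - 0 *\<^sub>R dirD v J z)) <= (B * \<bar>t\<bar>) * \<bar>t\<bar>"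
 proof (rule lip_real)
 fix s assume s: "s : closed_segment 0 t"
 have "norm (dirD v J (z + s *\<^sub>R v) - dirD v J z) <= B * \<bar>s\<bar>"
 proof (rule lip_step)
 fix r assume r: "r : closed_segment 0 s"
 hence "r : closed_segment 0 t" using s by (auto simp: closed_segment_eq_real_ivl split: if_splits)
 thus "norm (Dl [v, v] J (z + r *\<^sub>R v)) <= B" by (rule B)
 show "has_dir (dirD v J) v (Dl [v, v] J (z + r *\<^sub>R v)) (z + r *\<^sub>R v)"
  using has_dir_any[OF open_UNIV Cinf_dirD_any[OF open_UNIV J, of v], of "z + r *\<^sub>R v" v] by (simp add: Dl_Cons)
 qed
 also have "... <= B * \<bar>t\<bar>"
 using s B0 by (intro mult_left_mono) (auto simp: closed_segment_eq_real_ivl split: if_splits)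
 finally show "norm (dirD v J (z + s *\<^sub>R v) - dirD v J z) <= B * \<bar>t\<bar>" .
 show "((%s. J (z + s *\<^sub>R v) - s *\<^sub>R dirD v J z) has_vector_derivative dirD v J (z + s *\<^sub>R v) - dirD v J z) (at s)"
 by (intro has_vector_derivative_diff has_dir_line has_dir_any[OF open_UNIV J])
  (auto intro!: derivative_eq_intros)
 qed
 moreover have "(J (z + t *\<^sub>R v) - t *\<^sub>R dirD v J z) - (J (z + 0 *\<^sub>R v) - 0 *\<^sub>R dirD v J z)
 = J (z + t *\<^sub>R v) - J z - t *\<^sub>R dirD v J z" by (simp add: diff_right_commute)
 moreover have "(B * \<bar>t\<bar>) * \<bar>t\<bar> = B * t\<^sup>2"
 by (simp add: power2_eq_square mult.assoc)
 ultimately show ?thesis by (simp only:)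
qed

text \<open>The form in which differentiability arises for functionals and for \<open>flat\<close>
  at 0, where only an inequality is available.\<close>

lemma has_vector_derivative_quadratic:
 fixes g :: "real => 'b::real_normed_vector"
 assumes "!!t. \<bar>t\<bar> <= 1 ==> norm (g t - g 0 - t *\<^sub>R g') <= M * t\<^sup>2"
 shows "(g has_vector_derivative g') (at 0)"
 unfolding has_vector_derivative_def has_derivative_at_alt
proof (intro conjI allI impI)
 show "bounded_linear (%x. x *\<^sub>R g')" by (rule bounded_linear_scaleR_left)
 fix e :: real assume e: "e > 0"
 have "0 <= norm (g 1 - g 0 - 1 *\<^sub>R g')" by (rule norm_ge_zero)
 also have "... <= M" using assms[of 1] by simp
 finally have M: "0 <= M" .
 show "EX d>0. ALL y. norm (y - 0) < d --> norm (g y - g 0 - (y - 0) *\<^sub>R g') <= e * norm (y - 0)"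
 proof (intro exI[of _ "min 1 (e / (M + 1))"] conjI allI impI)
 show "0 < min 1 (e / (M + 1))" using e M by simp
 fix y :: real assume y: "norm (y - 0) < min 1 (e / (M + 1))"
 hence "\<bar>y\<bar> * (M + 1) < e" using M by (simp add: field_simps)
 hence "M * \<bar>y\<bar> <= e" using M by (simp add: algebra_simps)
 have "norm (g y - g 0 - (y - 0) *\<^sub>R g') <= M * y\<^sup>2" using assms[of y] y by simp
 also have "... = (M * \<bar>y\<bar>) * \<bar>y\<bar>" by (simp add: power2_eq_square)
 also have "... <= e * \<bar>y\<bar>" using \<open>M * \<bar>y\<bar> <= e\<close> by (intro mult_right_mono) auto
 finally show "norm (g y - g 0 - (y - 0) *\<^sub>R g') <= e * norm (y - 0)" by simp
 qed
qed

text \<open>The difference quotient is estimated inside the seminorm that bounds \<open>K\<close>: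
  the second-order Taylor remainder of \<open>H\<close> in the direction (w, 0), together with its
  q-derivatives, is at most E t^2 with the required decay in q. The bound on \<open>K\<close> turns
  this into a quadratic remainder of the scalar function.\<close>

lemma tempered_has_dir:
 fixes H :: "'a::euclidean_space \<times> 'b::euclidean_space => complex"
 assumes K: "tempered K" and H: "PS H"
 shows "has_dir (%p. K (%q. H (p, q))) w (K (%q. dirD (w, 0) H (p, q))) p"
proof -
 obtain C m where C: "C >= 0" "!!f B. schwartz f ==>
 (ALL vs x. set vs <= Basis & length vs <= m --> (1 + norm x) ^ m * norm (Dl vs f x) <= B) ==> norm (K f) <= C * B"
 using tempered_bound[OF K] by blast
 have cH: "Cinf_on UNIV H" using H by (simp add: PS_def)
 define W :: "'a \<times> 'b" where "W = (w, 0)"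
 obtain D l where D: "D >= 0" "!!vs p q. set vs <= Basis ==> length vs <= m ==>
 (1 + norm q) ^ m * norm (Dl (map (Pair 0) vs) (Dl [W, W] H) (p, q)) <= D * (1 + norm p) ^ l"
 using PS_uniform_short[OF PS_Dl_any[OF H, of "[W, W]"], of m m] by blast
 \<comment> \<open>Bounds the second derivative along the whole segment from p to p + t w for |t| <=
   1.\<close>
 define E where "E = D * (1 + norm p + norm w) ^ l"
 have "norm (K (%q. H (p + t *\<^sub>R w, q)) - K (%q. H (p + 0 *\<^sub>R w, q)) - t *\<^sub>R K (%q. dirD W H (p, q))) <= (C * E) * t\<^sup>2"
 if t: "\<bar>t\<bar> <= 1" for t
 proof -
 have s: "schwartz (%q. H (p', q))" "schwartz (%q. cor t * dirD W H (p', q))" for p'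
 by (rule PS_slice[OF H] schwartz_scale[OF PS_slice[OF PS_dirD_any[OF H]]])+
 define G where "G q = H (p + t *\<^sub>R w, q) - H (p, q) - cor t * dirD W H (p, q)" for q
 have KG: "K G = K (%q. H (p + t *\<^sub>R w, q)) - K (%q. H (p, q)) - t *\<^sub>R K (%q. dirD W H (p, q))"
 unfolding G_def[abs_def] tempered_diff[OF K schwartz_diff[OF s(1) s(1)] s(2)] tempered_diff[OF K s(1) s(1)]
  tempered_scale[OF K PS_slice[OF PS_dirD_any[OF H]]] by (simp add: scaleR_conv_of_real)
 have "norm (K G) <= C * (E * t\<^sup>2)"
 proof (rule C(2), goal_cases)
 case 1
 show ?case unfolding G_def[abs_def] by (intro schwartz_diff s)
 next
 case 2
 show ?case
 proof (intro allI impI, elim conjE)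
  fix vs :: "'b list" and q assume vs: "set vs <= Basis" "length vs <= m"
  define ms where "ms = map (Pair (0::'a)) vs"
  define J where "J = Dl ms H"
  have J: "Cinf_on UNIV J" unfolding J_def by (rule Cinf_Dl_any[OF open_UNIV cH])
  \<comment> \<open>The q-derivatives of the seminorm must be moved past the p-derivatives before
    Taylor's formula applies to \<open>J\<close>.\<close>
  have perm: "Dl ms (dirD W H) z = dirD W J z" "Dl ms (Dl [W, W] H) z = Dl [W, W] J z" for z
  using Dl_perm[OF open_UNIV cH, of "ms @ [W]" "W # ms" z] Dl_perm[OF open_UNIV cH, of "ms @ [W, W]" "W # W # ms" z]
  by (simp_all add: J_def Dl_append Dl_Cons)
  have c: "Cinf_on UNIV (%q. H (p', q))" "Cinf_on UNIV (%q. dirD W H (p', q))" for p'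
  using schwartzD(1)[OF s(1)] Cinf_on_slice[OF Cinf_dirD_any[OF open_UNIV cH]] by auto
  have "Dl vs G q = J ((p, q) + t *\<^sub>R W) - J (p, q) - t *\<^sub>R dirD W J (p, q)"
  unfolding G_def[abs_def] using vs c
  by (simp add: Cinf_on_diff[OF open_UNIV] Cinf_on_scale[OF open_UNIV] Dl_slice ms_def[symmetric] perm J_def[symmetric] W_def[symmetric])
   (simp add: J_def W_def scaleR_conv_of_real)
  also have "norm ... <= (E / (1 + norm q) ^ m) * t\<^sup>2"
  proof (rule taylor2[OF J])
  fix \<tau> assume "\<tau> : closed_segment 0 t"
  hence "\<bar>\<tau>\<bar> <= 1" using t by (auto simp: closed_segment_eq_real_ivl split: if_splits)
  hence "norm (\<tau> *\<^sub>R w) <= norm w" by (simp add: mult_left_le_one_le)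
  hence "norm (p + \<tau> *\<^sub>R w) <= norm p + norm w" using norm_triangle_ineq[of p "\<tau> *\<^sub>R w"] by linarith
  hence "D * (1 + norm (p + \<tau> *\<^sub>R w)) ^ l <= E" unfolding E_def
   by (intro mult_left_mono power_mono D) auto
  moreover have "(1 + norm q) ^ m * norm (Dl [W, W] J (p + \<tau> *\<^sub>R w, q)) <= D * (1 + norm (p + \<tau> *\<^sub>R w)) ^ l"
   using D(2)[OF vs, of q "p + \<tau> *\<^sub>R w"] unfolding ms_def[symmetric] perm .
  ultimately have "(1 + norm q) ^ m * norm (Dl [W, W] J (p + \<tau> *\<^sub>R w, q)) <= E" by linarith
  thus "norm (Dl [W, W] J ((p, q) + \<tau> *\<^sub>R W)) <= E / (1 + norm q) ^ m"
   by (simp add: W_def field_simps add_pos_nonneg)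
  qed
  finally show "(1 + norm q) ^ m * norm (Dl vs G q) <= E * t\<^sup>2"
  by (simp add: field_simps add_pos_nonneg)
 qed
 qed
 thus ?thesis unfolding KG by (simp add: mult.assoc)
 qed
 from has_vector_derivative_quadratic[OF this] show ?thesis
 unfolding has_dir_def W_def by simp
qed

text \<open>Differentiation passes under \<open>K\<close> and stays in the class of functions p -> K
  (G (p, _)) with \<open>G\<close> in \<open>PS\<close>. Its members have polynomial growth, so they
  are locally bounded and coinduction applies.\<close>

lemma tempered_family:
 fixes H :: "'a::euclidean_space \<times> 'b::euclidean_space => complex"
 assumes K: "tempered K" and H: "PS H"
 shows "om (%p. K (%q. H (p, q)))"
 and "!!vs. set vs <= Basis ==> Dl vs (%p. K (%q. H (p, q))) = (%p. K (%q. Dl (map (%v. (v, 0)) vs) H (p, q)))"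
proof -
 define P where "P vs p = K (%q. Dl (map (%v. (v, 0)) vs) H (p, q))" for vs p
 define S where "S = {%p. K (%q. G (p, q)) |G :: 'a \<times> 'b => complex. PS G}"
 have S: "Cinf_on UNIV g" if "g : S" for g
 proof (rule Cinf_on_coinduct[OF open_UNIV that])
 fix g assume "g : S"
 then obtain G where G: "PS G" "g = (%p. K (%q. G (p, q)))" unfolding S_def by blast
 obtain C l where C: "C >= 0" "!!p. norm (g p) <= C * (1 + norm p) ^ l"
 using tempered_PS_bound[OF K G(1)] G(2) by blast
 show "locally_bounded_on UNIV g" unfolding locally_bounded_on_def
 proof
 fix x :: 'a
 have "norm (g y) <= C * (1 + (norm x + 1)) ^ l" if "y : ball x 1" for y
 proof -
  have "norm y <= norm x + 1" using that norm_triangle_ineq2[of y x] by (simp add: dist_norm norm_minus_commute)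
  thus ?thesis by (intro order_trans[OF C(2)] mult_left_mono power_mono C) auto
 qed
 thus "EX e>0. EX B. ALL y:ball x e. norm (g y) <= B" by (meson zero_less_one)
 qed
 fix v :: 'a
 show "EX h:S. ALL x:UNIV. has_dir g v (h x) x"
 unfolding G(2) using tempered_has_dir[OF K G(1)] PS_dirD_any[OF G(1)]
 by (intro bexI[of _ "%p. K (%q. dirD (v, 0) G (p, q))"]) (auto simp: S_def)
 qed
 have d: "has_dir (P vs) v (P (v # vs) x) x" for vs v x
 unfolding P_def[abs_def] using tempered_has_dir[OF K PS_Dl_any[OF H]] by (simp add: Dl_Cons)
 have c: "continuous_on UNIV (P vs)" for vs
 unfolding P_def[abs_def] by (rule Cinf_on_continuous[OF S]) (use PS_Dl_any[OF H] in "auto simp: S_def")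
 have D: "Dl vs (%p. K (%q. H (p, q))) x = P vs x" if "set vs <= Basis" for vs x
 by (rule Cinf_on_seqI(2)[OF open_UNIV d c _ that]) (auto simp: P_def)
 thus "Dl vs (%p. K (%q. H (p, q))) = (%p. K (%q. Dl (map (%v. (v, 0)) vs) H (p, q)))"
 if "set vs <= Basis" for vs using that by (auto simp: P_def)
 have "Cinf_on UNIV (%p. K (%q. H (p, q)))" by (rule S) (use H in "auto simp: S_def")
 thus "om (%p. K (%q. H (p, q)))"
 unfolding om_def using D tempered_PS_bound[OF K PS_Dl_any[OF H]] by (simp add: P_def) blast
qed

text \<open>Seen as a tempered functional, the integral inherits smooth dependence on parameters and
  differentiation under the integral sign from \<open>tempered_family\<close>.\<close>

lemma tempered_integral: "tempered (%f::'a::euclidean_space => complex. LBINT x. f x)"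
 unfolding tempered_def
proof (intro conjI allI impI, goal_cases)
 case 3
 let ?m = "2 * DIM('a)"
 have "norm (LBINT x. f x) <= (LBINT x. 1 / (1 + norm (x::'a)) ^ ?m) * B"
 if "schwartz f" "ALL vs x. set vs <= Basis & length vs <= ?m --> (1 + norm x) ^ ?m * norm (Dl vs f x) <= B" for f :: "'a => complex" and B
 proof -
 have "(1 + norm x) ^ ?m * norm (f x) <= B" for x
 using that(2)[rule_format, of "[]" x] by simp
 from integrable_of_decay(2)[OF schwartz_measurable[OF that(1)] this] show ?thesis by (simp add: mult.commute)
 qed
 thus ?case by blast
qed (auto intro!: Bochner_Integration.integral_add schwartz_integrable)

lemmas integral_has_dir = tempered_has_dir[OF tempered_integral]
lemmas integral_family = tempered_family[OF tempered_integral]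

lemma integral_translate: 
 fixes f :: "'a::euclidean_space => complex"
 assumes [measurable]: "f : borel_measurable borel"
 shows "(LBINT x. f (c + x)) = (LBINT x. f x)"
proof -
 have "(LBINT x. f x) = (\<integral>x. f x \<partial>distr lborel borel ((+) c))" by (simp add: lborel_distr_plus)
 also have "... = (LBINT x. f (c + x))" by (rule integral_distr) auto
 finally show ?thesis by simp
qed

text \<open>The integral of F(x + t b) does not depend on t, by translation invariance; its
  derivative at t = 0, taken under the integral, is the integral of the derivative.\<close>

lemma integral_dirD:
 assumes F: "schwartz F" shows "(LBINT x. dirD b F x) = 0"
proof -
 define L where "L z = snd z + fst z *\<^sub>R b" for z :: "real \<times> 'a"
 have L: "linear L" by (auto simp: L_def algebra_simps intro!: linearI)
 have "norm q <= (1 + norm b) * (norm (L (p, q)) + norm p)" for p q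
 proof -
 have "norm q <= norm (L (p, q)) + \<bar>p\<bar> * norm b"
 using norm_triangle_ineq4[of "q + p *\<^sub>R b" "p *\<^sub>R b"] by (simp add: L_def)
 also have "... <= (1 + norm b) * (norm (L (p, q)) + norm p)" by (simp add: algebra_simps)
 finally show ?thesis .
 qed
 hence "PS (%z. F (L z))" by (intro PS_linear[OF F L, of "1 + norm b"]) auto
 from integral_has_dir[OF this, of 1 0]
 have "has_dir (%p::real. LBINT q. F (L (p, q))) 1 (LBINT q. dirD b F q) 0"
 using Dl_affine'[OF L, of "[(1, 0)]" F] by (simp add: Dl_Cons L_def)
 moreover have "(%p::real. LBINT q. F (L (p, q))) = (%p. LBINT q. F q)"
 using integral_translate[OF schwartz_measurable[OF F]] by (simp add: L_def add.commute[of _ "_ *\<^sub>R _"])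
 ultimately show ?thesis using dirD_eq has_dir_const by metis
qed

subsection \<open>Fubini's theorem for tempered functionals\<close>

lemma schwartz_swap: 
 fixes H :: "'a::euclidean_space \<times> 'b::euclidean_space => complex"
 assumes "schwartz H" shows "schwartz (%z. H (prod.swap z))"
proof (rule schwartz_linear[OF assms, of _ 1])
 show "linear (prod.swap :: 'b \<times> 'a => 'a \<times> 'b)" by (auto intro!: linearI)
 show "norm z <= 1 * norm (prod.swap z)" for z :: "'b \<times> 'a"
 by (cases z) (simp add: norm_Pair add.commute)
qed simp

lemma schwartz_partial_bound:
 fixes H :: "'a::euclidean_space \<times> 'b::euclidean_space => complex"
 assumes "schwartz H"
 shows "EX C. C >= 0 & (ALL p q. (1 + norm p) ^ k * (1 + norm q) ^ l * norm (Dl vs H (p, q)) <= C)"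
proof -
 obtain C where C: "C >= 0" "!!x. (1 + norm x) ^ (k + l) * norm (Dl vs H x) <= C"
 using schwartz_bound[OF schwartz_Dl_any[OF assms, of vs], of "[]" "k + l"] by auto
 have "(1 + norm p) ^ k * (1 + norm q) ^ l * norm (Dl vs H (p, q)) <= C" for p q
 proof -
 have "(1 + norm p) ^ k * (1 + norm q) ^ l <= (1 + norm (p, q)) ^ k * (1 + norm (p, q)) ^ l"
 using norm_fst_le[of p q] norm_snd_le[of q p] by (intro mult_mono power_mono) auto
 thus ?thesis
 using C(2)[of "(p, q)"] mult_right_mono[of _ _ "norm (Dl vs H (p, q))"] unfolding power_add by (meson norm_ge_zero order_trans)
 qed
 thus ?thesis using C(1) by blast
qed

text \<open>Partial integrals form a class closed under differentiation and under coordinates in q.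
  The variables are swapped to match the convention of \<open>PS\<close>, where the parameter comes
  first.\<close>

lemma schwartz_integral_fst:
 fixes H :: "'a::euclidean_space \<times> 'b::euclidean_space => complex"
 assumes H: "schwartz H"
 shows "schwartz (%q. LBINT p. H (p, q))"
 and "!!vs q. set vs <= Basis ==> Dl vs (%q. LBINT p. H (p, q)) q = (LBINT p. Dl (map (Pair 0) vs) H (p, q))"
proof -
 define S where "S = {%q. (LBINT p. G (p, q)) |G :: 'a \<times> 'b => complex. schwartz G}"
 have ls: "linear (prod.swap :: 'b \<times> 'a => 'a \<times> 'b)" by (auto intro!: linearI)
 show "schwartz (%q. LBINT p. H (p, q))"
 proof (rule schwartz_coinduct[of _ S])
 show "(%q. LBINT p. H (p, q)) : S" using H by (auto simp: S_def)
 fix g assume "g : S"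
 then obtain G :: "'a \<times> 'b => complex" where G: "schwartz G" "g = (%q. LBINT p. G (p, q))"
 unfolding S_def by blast
 obtain C where C: "!!p q. (1 + norm p) ^ (2 * DIM('a)) * norm (G (p, q)) <= C"
 using schwartz_partial_bound[OF G(1), of "2 * DIM('a)" 0 "[]"] by auto
 have "norm (g q) <= C * (LBINT x. 1 / (1 + norm (x::'a)) ^ (2 * DIM('a)))" for q
 unfolding G(2) using schwartz_measurable[OF schwartz_slice[OF schwartz_swap[OF G(1)], of q]]
 by (intro integrable_of_decay(2) C) simp
 thus "EX B. ALL x. norm (g x) <= B" by blast
 fix v :: 'b
 have "has_dir g v (LBINT p. dirD (0, v) G (p, q)) q" for q
 using integral_has_dir[OF schwartz_imp_PS[OF schwartz_swap[OF G(1)]], of v q]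
  Dl_affine'[OF ls, of "[(v, 0)]" G] by (simp add: G(2) Dl_Cons)
 thus "EX h:S. ALL x. has_dir g v (h x) x"
 using schwartz_dirD_any[OF G(1)] by (intro bexI[of _ "%q. LBINT p. dirD (0, v) G (p, q)"]) (auto simp: S_def)
 have "(%x. (x \<bullet> v) *\<^sub>R g x) = (%q. LBINT p. cor ((p, q) \<bullet> (0, v)) * G (p, q))"
 unfolding G(2) by (simp add: scaleR_conv_of_real)
 moreover have "schwartz (%z. cor (z \<bullet> (0, v)) * G z)"
 by (rule schwartz_om[OF G(1) om_inner])
 ultimately show "(%x. (x \<bullet> v) *\<^sub>R g x) : S"
 unfolding S_def by (intro CollectI exI[of _ "%z. cor (z \<bullet> (0, v)) * G z"]) auto
 qed
 show "Dl vs (%q. LBINT p. H (p, q)) q = (LBINT p. Dl (map (Pair 0) vs) H (p, q))"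
 if vs: "set vs <= Basis" for vs q
 using integral_family(2)[OF schwartz_imp_PS[OF schwartz_swap[OF H]] vs]
 Dl_affine'[OF ls, of "map (%v. (v, 0)) vs" H] by (simp add: o_def)
qed

lemma schwartz_uniform_short:
 fixes H :: "'a::euclidean_space \<times> 'b::euclidean_space => complex"
 assumes "schwartz H" and "finite V"
 shows "EX C. C >= 0 & (ALL vs:V. ALL p q. (1 + norm q) ^ k * norm (Dl vs H (p, q)) <= C)"
 using assms(2)
proof (induction V rule: finite_induct)
 case (insert vs V)
 then obtain C where C: "C >= 0" "!!vs p q. vs : V ==> (1 + norm q) ^ k * norm (Dl vs H (p, q)) <= C" by blast
 obtain D where D: "D >= 0" "!!p q. (1 + norm q) ^ k * norm (Dl vs H (p, q)) <= D"
 using schwartz_partial_bound[OF assms(1), of 0 k vs] by auto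
 show ?case
 by (intro exI[of _ "max C D"] conjI ballI allI) (auto intro: order_trans[OF C(2)] order_trans[OF D(2)] C(1) simp: le_max_iff_disj)
qed (auto intro: exI[of _ 0])

text \<open>Along a simple map the integral is a finite sum, with which a linear functional
  commutes.\<close>

lemma integral_simple_compose:
 fixes G :: "'b::euclidean_space => complex"
 assumes "finite_measure M" and s: "simple_function M s"
 shows "(\<integral>p. G (s p) \<partial>M) = (\<Sum>y\<in>s ` space M. cor (measure M (s -` {y} \<inter> space M)) * G y)"
proof -
 interpret finite_measure M by fact
 have fin: "finite (s ` space M)" and meas: "s -` {y} \<inter> space M : sets M" for y
 using s by (auto simp: simple_functionD)
 have "(\<integral>p. G (s p) \<partial>M) = (\<integral>p. (\<Sum>y\<in>s ` space M. indicator (s -` {y} \<inter> space M) p *\<^sub>R G y) \<partial>M)"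
 proof (rule Bochner_Integration.integral_cong[OF refl])
 fix p assume p: "p : space M"
 have "(\<Sum>y\<in>s ` space M. indicator (s -` {y} \<inter> space M) p *\<^sub>R G y) = (\<Sum>y\<in>s ` space M. if y = s p then G y else 0)"
 using p by (intro sum.cong) (auto simp: indicator_def)
 thus "G (s p) = (\<Sum>y\<in>s ` space M. indicator (s -` {y} \<inter> space M) p *\<^sub>R G y)"
 using p fin by simp
 qed
 also have "... = (\<Sum>y\<in>s ` space M. \<integral>p. indicator (s -` {y} \<inter> space M) p *\<^sub>R G y \<partial>M)"
 by (rule Bochner_Integration.integral_sum) (use meas in "auto intro!: integrable_scaleR_left simp: less_top[symmetric]")
 also have "... = (\<Sum>y\<in>s ` space M. cor (measure M (s -` {y} \<inter> space M)) * G y)"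
 proof (rule sum.cong[OF refl])
 fix y
 have "(\<integral>p. indicator (s -` {y} \<inter> space M) p *\<^sub>R G y \<partial>M) = (\<integral>p. indicator (s -` {y} \<inter> space M) p \<partial>M) *\<^sub>R G y"
 by (rule integral_scaleR_left) (use meas in "auto simp: less_top[symmetric]")
 thus "(\<integral>p. indicator (s -` {y} \<inter> space M) p *\<^sub>R G y \<partial>M) = cor (measure M (s -` {y} \<inter> space M)) * G y"
 by (simp add: scaleR_conv_of_real Int_assoc)
 qed
 finally show ?thesis .
qed

text \<open>\<open>K\<close> commutes with finite sums, so the integral over p is approximated by
  sums in the seminorm that bounds \<open>K\<close>. The weight 1 / r makes the measure finite, and
  the identity map is the pointwise limit of simple maps s i. Replacing p by s i p in H' changes the
  seminorm by at most the integral of min (2 D, L' |s i p - p|), which tends to 0 by dominated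
  convergence.\<close>

theorem tempered_Fubini:
 fixes H :: "'a::euclidean_space \<times> 'b::euclidean_space => complex"
 assumes K: "tempered K" and H: "schwartz H"
 shows "K (%q. LBINT p. H (p, q)) = (LBINT p. K (%q. H (p, q)))"
proof -
 \<comment> \<open>A polynomial, so that multiplying by it keeps \<open>H\<close> Schwartz, and of
   degree high enough for 1 / r to be integrable.\<close>
 define r where "r p = (1 + (p \<bullet> p)) ^ DIM('a)" for p :: 'a
 have r1: "1 <= r p" for p by (simp add: r_def)
 hence r0: "0 < r p" for p using less_le_trans[OF zero_less_one] by blast
 have om: "om (%z::'a \<times> 'b. cor (r (fst z)))"
 proof -
 have "om (%z::'a \<times> 'b. cor (1 + fst z \<bullet> fst z) ^ k)" for k
 proof (induction k)
 case (Suc k)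
 have "(%z::'a \<times> 'b. cor (1 + fst z \<bullet> fst z)) =
  (%z. 1 + (\<Sum>b\<in>Basis. cor (z \<bullet> (b, 0)) * cor (z \<bullet> (b, 0))))"
 proof
  fix z :: "'a \<times> 'b"
  have "fst z \<bullet> fst z = (\<Sum>b\<in>Basis. (z \<bullet> (b, 0)) * (z \<bullet> (b, 0)))"
  by (cases z) (simp add: euclidean_inner[symmetric])
  thus "cor (1 + fst z \<bullet> fst z) = 1 + (\<Sum>b\<in>Basis. cor (z \<bullet> (b, 0)) * cor (z \<bullet> (b, 0)))"
  by simp
 qed
 hence "om (%z::'a \<times> 'b. cor (1 + fst z \<bullet> fst z))"
  by (simp only:) (intro om_add om_const om_sum finite_Basis om_mult om_inner)
 from om_mult[OF this Suc] show ?case by simp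
 qed (simp add: om_const)
 thus ?thesis by (simp add: r_def)
 qed
 define \<mu> where "\<mu> = density lborel (%p. ennreal (1 / r p))"
 have rm [measurable]: "r : borel_measurable borel" unfolding r_def by measurable
 have sp [simp]: "space \<mu> = UNIV" "sets \<mu> = sets borel" by (simp_all add: \<mu>_def)
 have meas [simp]: "borel_measurable \<mu> = borel_measurable borel" by (rule measurable_cong_sets) auto
 have int\<mu>: "(\<integral>p. f p \<partial>\<mu>) = (LBINT p. cor (1 / r p) * f p)" if "f : borel_measurable borel" for f
 unfolding \<mu>_def using that r0 by (subst integral_density) (auto simp: scaleR_conv_of_real less_imp_le)
 have "(1 + norm p) ^ (2 * DIM('a)) <= 2 ^ DIM('a) * r p" for p :: 'a
 proof -
 have "0 <= (1 - norm p)\<^sup>2" by simp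
 hence "(1 + norm p)\<^sup>2 <= 2 * (1 + p \<bullet> p)"
 by (simp add: dot_square_norm power2_eq_square algebra_simps)
 hence "((1 + norm p)\<^sup>2) ^ DIM('a) <= (2 * (1 + p \<bullet> p)) ^ DIM('a)" by (intro power_mono) auto
 thus ?thesis by (simp only: r_def power_mult power_mult_distrib[symmetric])
 qed
 hence "1 / r p <= 2 ^ DIM('a) * (1 / (1 + norm p) ^ (2 * DIM('a)))" for p
 using r0[of p] by (simp add: field_simps add_pos_nonneg)
 hence ir: "integrable lborel (%p. 1 / r p)"
 by (intro Bochner_Integration.integrable_bound[OF integrable_mult_right[OF decay_integrable[OF order_refl], of "2 ^ DIM('a)"]])
 (use r0 in "auto simp: less_imp_le intro!: AE_I2")
 interpret finite_measure \<mu>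
 proof
 have "emeasure \<mu> (space \<mu>) = (\<integral>\<^sup>+p. ennreal (1 / r p) \<partial>lborel)"
 unfolding \<mu>_def by (subst emeasure_density) auto
 also have "... < \<infinity>" using ir r0 by (subst (asm) integrable_iff_bounded) (auto simp: less_imp_le)
 finally show "emeasure \<mu> (space \<mu>) ~= \<infinity>" by simp
 qed
 define H' where "H' z = cor (r (fst z)) * H z" for z
 have H': "schwartz H'" unfolding H'_def[abs_def] by (rule schwartz_om[OF H om])
 have cH: "Cinf_on UNIV H" "Cinf_on UNIV H'" using schwartzD(1)[OF H] schwartzD(1)[OF H'] .
 have slice': "Dl (map (Pair 0) vs) H' (p, q) = cor (r p) * Dl (map (Pair 0) vs) H (p, q)"
 if "set vs <= Basis" for vs p q
 proof -
 have "Dl vs (%q. cor (r p) * H (p, q)) q = cor (r p) * Dl vs (%q. H (p, q)) q"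
 by (rule Cinf_on_scale(2)[OF open_UNIV Cinf_on_slice[OF cH(1)]]) (use that in auto)
 thus ?thesis unfolding Dl_slice[symmetric] by (simp add: H'_def)
 qed
 obtain C m where C: "C >= 0" "!!f B. schwartz f ==>
 (ALL vs x. set vs <= Basis & length vs <= m --> (1 + norm x) ^ m * norm (Dl vs f x) <= B) ==> norm (K f) <= C * B"
 using tempered_bound[OF K] by blast
 define V where "V = map (Pair (0::'a)) ` {vs :: 'b list. set vs <= Basis & length vs <= m}"
 have V: "finite V" unfolding V_def by (rule finite_imageI[OF finite_short_lists])
 have V': "finite ((%(b, vs). (b, 0) # vs) ` ((Basis :: 'a set) \<times> V))" using V by simp
 obtain D where D: "D >= 0" "!!vs p q. vs : V ==> (1 + norm q) ^ m * norm (Dl vs H' (p, q)) <= D"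
 using schwartz_uniform_short[OF H' V, of m] by blast
 obtain L where L: "L >= 0" "!!b vs p q. b : Basis ==> vs : V ==> (1 + norm q) ^ m * norm (Dl ((b, 0) # vs) H' (p, q)) <= L"
 proof -
 obtain L where "L >= 0" and *: "ALL ws:(%(b, vs). (b, 0) # vs) ` ((Basis :: 'a set) \<times> V). ALL p q. (1 + norm q) ^ m * norm (Dl ws H' (p, q)) <= L"
 using schwartz_uniform_short[OF H' V', of m] by blast
 have "(1 + norm q) ^ m * norm (Dl ((b, 0) # vs) H' (p, q)) <= L" if "b : Basis" "vs : V" for b vs p q
 by (rule *[rule_format]) (use that in force)
 thus ?thesis using that \<open>L >= 0\<close> by blast
 qed
 define L' where "L' = L * DIM('a)"
 have L'0: "0 <= L'" using L(1) by (simp add: L'_def)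
 \<comment> \<open>The Lipschitz bound tends to 0 with s i p - p, while the crude bound 2 D serves
   as the dominating function.\<close>
 have lip: "(1 + norm q) ^ m * norm (Dl vs H' (p', q) - Dl vs H' (p, q)) <= min (2 * D) (L' * norm (p' - p))"
 if vs: "vs : V" for vs p p' q
 proof -
 have "norm (Dl vs H' (p', q) - Dl vs H' (p, q)) <= (L / (1 + norm q) ^ m) * (\<Sum>b\<in>Basis. \<bar>(p' - p) \<bullet> b\<bar>)"
 proof (rule lipschitz_of_partials[where g = "%b p. Dl ((b, 0) # vs) H' (p, q)"])
 fix z b :: 'a assume b: "b : Basis"
 show "has_dir (%p. Dl vs H' (p, q)) b (Dl ((b, 0) # vs) H' (z, q)) z"
  using has_dir_any[OF open_UNIV Cinf_Dl_any[OF open_UNIV cH(2), of vs], of "(z, q)" "(b, 0)"]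
  by (simp add: has_dir_def Dl_Cons)
 show "norm (Dl ((b, 0) # vs) H' (z, q)) <= L / (1 + norm q) ^ m"
  using L(2)[OF b vs, of q z] by (simp add: field_simps add_pos_nonneg)
 qed
 also have "... <= (L / (1 + norm q) ^ m) * (DIM('a) * norm (p' - p))"
 using L(1) by (intro mult_left_mono sum_abs_inner_le) auto
 finally have 1: "(1 + norm q) ^ m * norm (Dl vs H' (p', q) - Dl vs H' (p, q)) <= L' * norm (p' - p)"
 by (simp add: L'_def field_simps add_pos_nonneg)
 have "(1 + norm q) ^ m * norm (Dl vs H' (p', q) - Dl vs H' (p, q)) <=
  (1 + norm q) ^ m * (norm (Dl vs H' (p', q)) + norm (Dl vs H' (p, q)))"
 by (intro mult_left_mono norm_triangle_ineq4) auto
 also have "... <= 2 * D" using D(2)[OF vs, of q p] D(2)[OF vs, of q p'] by (simp add: distrib_left)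
 finally show ?thesis using 1 by simp
 qed
 define \<kappa> where "\<kappa> p = K (%q. H' (p, q))" for p
 have \<kappa>m [measurable]: "\<kappa> : borel_measurable borel" and \<kappa>c: "continuous_on UNIV \<kappa>"
 using tempered_family(1)[OF K schwartz_imp_PS[OF H']] Cinf_on_continuous[of UNIV \<kappa>]
 by (auto simp: om_def \<kappa>_def[abs_def] intro: borel_measurable_continuous_onI)
 have \<kappa>b: "norm (\<kappa> p) <= C * D" for p unfolding \<kappa>_def
 by (rule C(2)[OF schwartz_slice[OF H']]) (use D(2) in "auto simp: Dl_slice V_def")
 obtain s where s: "!!i. simple_function \<mu> (s i)" "!!p. (%i. s i p) \<longlonglongrightarrow> p"
 using borel_measurable_implies_sequence_metric[of "%p::'a. p" \<mu> 0] by (auto simp del: dist_0_norm)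
 have sm [measurable]: "s i : borel_measurable borel" for i
 using borel_measurable_simple_function[OF s(1)[of i]] by simp
 define F where "F i q = (\<integral>p. H' (s i p, q) \<partial>\<mu>)" for i q
 define F0 where "F0 q = (LBINT p. H (p, q))" for q
 have F: "F i = (%q. \<Sum>y\<in>s i ` UNIV. cor (measure \<mu> (s i -` {y})) * H' (y, q))" for i
 using integral_simple_compose[OF finite_measure_axioms s(1)[of i], of "%y. H' (y, q)" for q] by (simp add: F_def fun_eq_iff)
 have fin: "finite (s i ` UNIV)" for i using simple_functionD(1)[OF s(1)[of i]] by simp
 have KF: "K (F i) = (\<integral>p. \<kappa> (s i p) \<partial>\<mu>)" for i
 proof -
 have "K (F i) = (\<Sum>y\<in>s i ` UNIV. cor (measure \<mu> (s i -` {y})) * \<kappa> y)"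
 unfolding F \<kappa>_def by (simp add: tempered_sum[OF K fin] tempered_scale[OF K] schwartz_scale schwartz_slice[OF H'])
 also have "... = (\<integral>p. \<kappa> (s i p) \<partial>\<mu>)"
 using integral_simple_compose[OF finite_measure_axioms s(1)[of i], of \<kappa>] by simp
 finally show ?thesis .
 qed
 have lim1: "(%i. K (F i)) \<longlonglongrightarrow> (\<integral>p. \<kappa> p \<partial>\<mu>)"
 unfolding KF
 proof (rule integral_dominated_convergence[where w = "%_. C * D"])
 show "AE p in \<mu>. (%i. \<kappa> (s i p)) \<longlonglongrightarrow> \<kappa> p"
 using s(2) \<kappa>c by (intro AE_I2 continuous_on_tendsto_compose[of UNIV \<kappa>]) auto
 qed (use \<kappa>b in auto)
 define B where "B i = (\<integral>p. min (2 * D) (L' * norm (s i p - p)) \<partial>\<mu>)" for i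
 have "B \<longlonglongrightarrow> (\<integral>p. 0 \<partial>\<mu>)" unfolding B_def[abs_def]
 proof (rule integral_dominated_convergence[where w = "%_. 2 * D"])
 show "AE p in \<mu>. (%i. min (2 * D) (L' * norm (s i p - p))) \<longlonglongrightarrow> 0"
 proof (rule AE_I2)
 fix p
 have "(%i. min (2 * D) (L' * norm (s i p - p))) \<longlonglongrightarrow> min (2 * D) (L' * norm (p - p))"
  by (intro tendsto_intros s(2))
 thus "(%i. min (2 * D) (L' * norm (s i p - p))) \<longlonglongrightarrow> 0" using D(1) by simp
 qed
 qed (use D(1) L'0 in auto)
 hence B0: "B \<longlonglongrightarrow> 0" by simp
 have sF: "schwartz (F i)" "schwartz F0" for i
 unfolding F F0_def[abs_def] by (intro schwartz_sum fin schwartz_scale schwartz_slice H' schwartz_integral_fst(1)[OF H])+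
 have diff: "norm (K (F i) - K F0) <= C * B i" for i
 unfolding tempered_diff[OF K sF, symmetric]
 proof (rule C(2)[OF schwartz_diff[OF sF]], intro allI impI, elim conjE)
 fix vs :: "'b list" and q assume vs: "set vs <= Basis" "length vs <= m"
 define ms where "ms = map (Pair (0::'a)) vs"
 have ms: "ms : V" using vs by (auto simp: ms_def V_def)
 have mm: "(%p. Dl ms H' (p, q)) : borel_measurable borel" "(%p. Dl ms H (p, q)) : borel_measurable borel"
 using schwartz_measurable[OF schwartz_slice[OF schwartz_swap[OF schwartz_Dl_any[OF H', of ms]], of q]]
  schwartz_measurable[OF schwartz_slice[OF schwartz_swap[OF schwartz_Dl_any[OF H, of ms]], of q]] by simp_all
 have "Dl vs (F i) q = (\<Sum>y\<in>s i ` UNIV. cor (measure \<mu> (s i -` {y})) * Dl ms H' (y, q))"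
 unfolding F using vs Cinf_on_slice[OF cH(2)]
 by (subst Cinf_on_sum(2)[OF fin open_UNIV])
  (auto simp: Cinf_on_scale[OF open_UNIV] Dl_slice ms_def)
 also have "... = (\<integral>p. Dl ms H' (s i p, q) \<partial>\<mu>)"
 using integral_simple_compose[OF finite_measure_axioms s(1)[of i], of "%y. Dl ms H' (y, q)"] by simp
 finally have 1: "Dl vs (F i) q = (\<integral>p. Dl ms H' (s i p, q) \<partial>\<mu>)" .
 have "Dl vs F0 q = (LBINT p. Dl ms H (p, q))"
 unfolding F0_def[abs_def] ms_def by (rule schwartz_integral_fst(2)[OF H vs(1)])
 also have "... = (LBINT p. cor (1 / r p) * Dl ms H' (p, q))"
 using r0 unfolding ms_def slice'[OF vs(1)] by (simp add: less_imp_neq[symmetric, OF r0])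
 also have "... = (\<integral>p. Dl ms H' (p, q) \<partial>\<mu>)" by (rule int\<mu>[OF mm(1), symmetric])
 finally have 2: "Dl vs F0 q = (\<integral>p. Dl ms H' (p, q) \<partial>\<mu>)" .
 have b: "norm (Dl ms H' (p, q)) <= D / (1 + norm q) ^ m" for p
 using D(2)[OF ms, of q p] by (simp add: field_simps add_pos_nonneg)
 have i1: "integrable \<mu> (%p. Dl ms H' (s i p, q))"
 by (rule integrable_const_bound[where B = "D / (1 + norm q) ^ m"]) (use b mm(1) in "auto intro: measurable_compose[OF sm]")
 have i2: "integrable \<mu> (%p. Dl ms H' (p, q))"
 by (rule integrable_const_bound[where B = "D / (1 + norm q) ^ m"]) (use b mm(1) in auto)
 have i3: "integrable \<mu> (%p. min (2 * D) (L' * norm (s i p - p)))"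
 by (rule integrable_const_bound[where B = "2 * D"]) (use D(1) L'0 in auto)
 have "norm (Dl vs (F i) q - Dl vs F0 q) = norm (\<integral>p. Dl ms H' (s i p, q) - Dl ms H' (p, q) \<partial>\<mu>)"
 unfolding 1 2 using i1 i2 by (simp add: Bochner_Integration.integral_diff)
 also have "... <= (\<integral>p. norm (Dl ms H' (s i p, q) - Dl ms H' (p, q)) \<partial>\<mu>)" by (rule integral_norm_bound)
 also have "... <= (\<integral>p. min (2 * D) (L' * norm (s i p - p)) / (1 + norm q) ^ m \<partial>\<mu>)"
 proof (rule integral_mono)
 show "norm (Dl ms H' (s i p, q) - Dl ms H' (p, q)) <= min (2 * D) (L' * norm (s i p - p)) / (1 + norm q) ^ m" for p
  using lip[OF ms, of q "s i p" p] by (simp add: pos_le_divide_eq add_pos_nonneg mult.commute)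
 qed (use i1 i2 i3 in auto)
 also have "... = B i / (1 + norm q) ^ m" by (simp add: B_def)
 finally show "(1 + norm q) ^ m * norm (Dl vs (%x. F i x - F0 x) q) <= B i"
 using vs schwartzD(1)[OF sF(1)] schwartzD(1)[OF sF(2)]
 by (simp add: Cinf_on_diff[OF open_UNIV] field_simps add_pos_nonneg)
 qed
 \<comment> \<open>The seminorm estimate \<open>diff\<close> identifies the limit with
   \<open>K F0\<close>; \<open>lim1\<close> has already identified it with the integral of
   \<open>K\<close> over the slices.\<close>
 have "(%i. K (F i)) \<longlonglongrightarrow> K F0"
 proof (rule Lim_transform_bound[where g = "%i. C * B i", THEN LIM_zero_cancel])
 show "(%i. C * B i) \<longlonglongrightarrow> 0" using tendsto_mult_left[OF B0, of C] by simp
 show "\<forall>\<^sub>F i in sequentially. norm (K (F i) - K F0) <= norm (C * B i)"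
 using diff by (intro always_eventually allI order_trans[OF diff]) simp
 qed
 from LIMSEQ_unique[OF this lim1] have "K F0 = (\<integral>p. \<kappa> p \<partial>\<mu>)" .
 also have "... = (LBINT p. cor (1 / r p) * \<kappa> p)" by (rule int\<mu>[OF \<kappa>m])
 also have "... = (LBINT p. K (%q. H (p, q)))"
 unfolding \<kappa>_def H'_def using r0 by (simp add: tempered_scale[OF K schwartz_slice[OF H]] less_imp_neq[symmetric, OF r0])
 finally show ?thesis unfolding F0_def .
qed

subsection \<open>Linear changes of variables\<close>

text \<open>The property \<open>Q\<close> is multiplicative and every matrix is a product of
  elementary ones. A zero row makes it vacuous, and diagonal matrices are stretchings; swaps and
  shears have determinant of modulus 1 and need checking on boxes only, by
  \<open>suff\<close>.\<close>

lemma measure_matrix_image: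
 fixes A :: "real^'n^'n"
 assumes "det A ~= 0" "S : lmeasurable"
 shows "(*v) A ` S : lmeasurable & measure lebesgue ((*v) A ` S) = \<bar>det A\<bar> * measure lebesgue S"
proof -
 define Q where "Q A \<longleftrightarrow> (det A ~= 0 --> (ALL S:lmeasurable. (*v) A ` S : lmeasurable \<and>
 measure lebesgue ((*v) A ` S) = \<bar>det A\<bar> * measure lebesgue S))" for A :: "real^'n^'n"
 have suff: "Q A"
 if "\<bar>det A\<bar> = 1" "!!a b. measure lebesgue ((*v) A ` cbox a b) = measure lebesgue (cbox a b)" for A :: "real^'n^'n"
 unfolding Q_def
 proof (intro impI ballI)
 fix S :: "(real^'n) set" assume S: "S : lmeasurable"
 have "measure lebesgue ((*v) A ` cbox a b) = 1 * measure lebesgue (cbox a b)" for a b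
 by (simp only: that(2) mult_1)
 from measure_linear_sufficient[OF matrix_vector_mul_linear[of A] S this]
 show "(*v) A ` S : lmeasurable & measure lebesgue ((*v) A ` S) = \<bar>det A\<bar> * measure lebesgue S"
 by (simp only: that(1))
 qed
 have "Q A"
 proof (rule induct_matrix_elementary_alt)
 fix A B :: "real^'n^'n"
 assume A: "Q A"
 and B: "Q B"
 have "(*v) (A ** B) ` S = (*v) A ` ((*v) B ` S)" for S
 by (simp add: image_image matrix_vector_mul_assoc)
 thus "Q (A ** B)"
 using A B by (simp add: Q_def det_mul abs_mult)
 next
 fix A :: "real^'n^'n" and i assume "row i A = 0"
 thus "Q A"
 unfolding Q_def using det_zero_row(1) by blast
 next
 fix A :: "real^'n^'n" assume 0: "!!i j. i ~= j ==> A $ i $ j = 0"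
 have "(*v) A = (%x. \<chi> i. A $ i $ i * x $ i)"
 proof
 fix x
 have "(\<Sum>j\<in>UNIV. A $ i $ j * x $ j) = A $ i $ i * x $ i" for i
  by (subst sum.remove[of _ i]) (auto simp: 0 intro!: sum.neutral)
 thus "A *v x = (\<chi> i. A $ i $ i * x $ i)" by (simp add: matrix_vector_mult_def vec_eq_iff)
 qed
 thus "Q A"
 by (simp add: Q_def measurable_stretch measure_stretch det_diagonal[OF 0])
 next
 fix m n :: 'n assume mn: "m ~= n"
 define \<tau> where "\<tau> = Transposition.transpose m n"
 define A :: "real^'n^'n" where "A = (\<chi> i j. mat 1 $ i $ \<tau> j)"
 have \<tau>: "\<tau> (\<tau> i) = i" for i by (simp add: \<tau>_def)
 have p: "\<tau> permutes UNIV" by (simp add: \<tau>_def permutes_swap_id)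
 have dA: "\<bar>det A\<bar> = 1" unfolding A_def
 by (subst det_permute_columns[OF p]) (simp add: abs_mult sign_def)
 have Av: "A *v x = (\<chi> i. x $ \<tau> i)" for x
 proof -
 have "(\<Sum>j\<in>UNIV. (if i = \<tau> j then 1 else 0) * x $ j) = (\<Sum>j\<in>UNIV. if j = \<tau> i then x $ j else 0)" for i
  by (intro sum.cong) (auto simp: \<tau>)
 thus ?thesis by (simp add: A_def matrix_vector_mult_def mat_def vec_eq_iff)
 qed
 have inv: "A *v (A *v x) = x" for x by (simp add: Av \<tau> vec_eq_iff)
 have "measure lebesgue ((*v) A ` cbox a b) = measure lebesgue (cbox a b)" for a b
 proof (cases "cbox a b = {}")
 case False
 have im: "(*v) A ` cbox a b = cbox (A *v a) (A *v b)"
 proof (intro equalityI subsetI)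
  show "y : cbox (A *v a) (A *v b)" if "y : (*v) A ` cbox a b" for y using that by (auto simp: mem_box_cart Av)
  show "y : (*v) A ` cbox a b" if "y : cbox (A *v a) (A *v b)" for y
  proof (rule image_eqI[of _ _ "A *v y"])
  have "y $ \<tau> (\<tau> i) : {a $ \<tau> (\<tau> i) .. b $ \<tau> (\<tau> i)} ==> a $ i <= y $ i" for i by (simp add: \<tau>)
  show "A *v y : cbox a b" using that unfolding mem_box_cart Av by (metis \<tau> vec_lambda_beta)
  qed (simp add: inv)
 qed
 hence ne: "cbox (A *v a) (A *v b) ~= {}" using False by auto
 have "(\<Prod>i\<in>UNIV. b $ \<tau> i - a $ \<tau> i) = (\<Prod>i\<in>UNIV. b $ i - a $ i)"
  using prod.permute[OF p, of "%i. b $ i - a $ i"] by (simp add: o_def)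
 thus ?thesis unfolding im using ne False by (simp add: content_cbox_cart Av)
 qed simp
 from suff[OF dA this]
 show "Q (\<chi> i j. mat 1 $ i $ Transposition.transpose m n j)"
 by (simp add: A_def \<tau>_def)
 next
 fix m n :: 'n assume mn: "m ~= n"
 define A :: "real^'n^'n" where "A = (\<chi> i j. of_bool (i = m & j = n \<or> i = j))"
 have "A = (\<chi> k. if k = m then row m (mat 1) + 1 *s row n (mat 1) else row k (mat 1))"
 using mn by (auto simp: A_def vec_eq_iff row_def mat_def)
 hence "det A = 1" using det_row_operation[OF mn, of "mat 1" 1] by simp
 hence dA: "\<bar>det A\<bar> = 1" by simp
 have Av: "A *v x = (\<chi> i. if i = m then x $ m + x $ n else x $ i)" for x
 proof -
 have "(\<Sum>j\<in>UNIV. of_bool (i = m & j = n \<or> i = j) * x $ j) = (if i = m then x $ m + x $ n else x $ i)" for i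
 proof -
  have "(\<Sum>j\<in>UNIV. of_bool (i = m & j = n \<or> i = j) * x $ j)
   = (\<Sum>j\<in>UNIV. (if j = i then x $ j else 0) + (if j = n then (if i = m then x $ n else 0) else 0))"
  using mn by (intro sum.cong) auto
  thus ?thesis by (simp add: sum.distrib)
 qed
 thus ?thesis by (simp add: A_def matrix_vector_mult_def vec_eq_iff)
 qed
 have "measure lebesgue ((*v) A ` cbox a b) = measure lebesgue (cbox a b)" for a b
 proof (cases "cbox a b = {}")
 case False
 \<comment> \<open>Translating the box so that its lower n-th coordinate becomes 0 meets the sign
   condition of \<open>measure_shear_interval\<close>.\<close>
 define t where "t = axis n (a $ n)"
 have c: "cbox a b = (+) t ` cbox (a - t) (b - t)"
  using cbox_translation[of t "a - t" "b - t"] by simp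
 have "(*v) A ` cbox a b = (+) (A *v t) ` ((*v) A ` cbox (a - t) (b - t))"
  unfolding c by (simp add: image_image matrix_vector_right_distrib)
 hence "measure lebesgue ((*v) A ` cbox a b) = measure lebesgue ((*v) A ` cbox (a - t) (b - t))"
  by (simp add: measure_translation)
 also have "... = measure lebesgue (cbox (a - t) (b - t))"
  unfolding Av[abs_def]
  by (rule measure_shear_interval[OF mn]) (use False c in "auto simp: t_def")
 also have "... = measure lebesgue (cbox a b)" unfolding c by (rule measure_translation[symmetric])
 finally show ?thesis .
 qed simp
 from suff[OF dA this]
 show "Q (\<chi> i j. of_bool (i = m & j = n \<or> i = j))"
 by (simp add: A_def)
 qed
 thus ?thesis using assms by (simp add: Q_def)
qed

text \<open>Lebesgue measure is determined on boxes; the preimage of a box is its image under the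
  inverse matrix, which scales volume by |det B| = 1 / |det A|.\<close>

lemma lborel_matrix:
 fixes A :: "real^'n^'n"
 assumes A: "det A ~= 0"
 shows "lborel = density (distr lborel borel ((*v) A)) (%_. ennreal \<bar>det A\<bar>)"
proof (rule lborel_eqI)
 have m [measurable]: "(*v) A : borel \<rightarrow>\<^sub>M borel"
 by (intro borel_measurable_continuous_onI linear_continuous_on matrix_vector_mul_bounded_linear)
 obtain B where B: "A ** B = mat 1" "B ** A = mat 1"
 using A by (metis invertible_det_nz invertible_def)
 have dB: "det A * det B = 1" using B(1) by (metis det_I det_mul)
 fix l u :: "real^'n" assume le: "!!b. b : Basis ==> l \<bullet> b <= u \<bullet> b"
 have inv: "A *v (B *v x) = x" "B *v (A *v x) = x" for x
 using B by (simp_all add: matrix_vector_mul_assoc)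
 have pre: "(*v) A -` box l u = (*v) B ` box l u"
 proof (intro equalityI subsetI)
 fix x assume "x : (*v) A -` box l u"
 thus "x : (*v) B ` box l u" using inv(2)[of x] by (intro image_eqI[of _ _ "A *v x"]) auto
 qed (auto simp: inv)
 have meas: "(*v) B ` box l u : lmeasurable" "measure lebesgue ((*v) B ` box l u) = \<bar>det B\<bar> * measure lebesgue (box l u)"
 using measure_matrix_image[of B "box l u"] dB by (cases "det B = 0"; simp)+
 have b: "(*v) B ` box l u : sets borel"
 unfolding pre[symmetric] using measurable_sets[OF m, of "box l u"] by simp
 have "emeasure lborel ((*v) B ` box l u) = emeasure lebesgue ((*v) B ` box l u)"
 using b by (simp add: emeasure_completion)
 also have "... = ennreal (measure lebesgue ((*v) B ` box l u))"
 by (rule emeasure_eq_measure2[OF meas(1)])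
 finally have e: "emeasure lborel ((*v) A -` box l u) = ennreal (\<bar>det B\<bar> * (\<Prod>b\<in>Basis. (u - l) \<bullet> b))"
 unfolding pre meas(2) using le by (simp add: measure_lborel_box_eq inner_diff_left)
 have "emeasure (density (distr lborel borel ((*v) A)) (%_. ennreal \<bar>det A\<bar>)) (box l u)
 = ennreal \<bar>det A\<bar> * emeasure lborel ((*v) A -` box l u)"
 by (simp add: emeasure_density emeasure_distr nn_integral_cmult_indicator)
 also have "... = ennreal (\<bar>det A * det B\<bar> * (\<Prod>b\<in>Basis. (u - l) \<bullet> b))"
 unfolding e by (simp add: ennreal_mult'[symmetric] abs_mult mult.assoc)
 finally show "emeasure (density (distr lborel borel ((*v) A)) (%_. ennreal \<bar>det A\<bar>)) (box l u)
 = ennreal (\<Prod>b\<in>Basis. (u - l) \<bullet> b)" by (simp add: dB)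
qed simp

lemma integral_matrix:
 fixes f :: "real^'n => complex"
 assumes "det A ~= 0" and [measurable]: "f : borel_measurable borel"
 shows "(LBINT x. f x) = \<bar>det A\<bar> * (LBINT x. f (A *v x))"
proof -
 have m [measurable]: "(*v) A : borel \<rightarrow>\<^sub>M borel"
 by (intro borel_measurable_continuous_onI linear_continuous_on matrix_vector_mul_bounded_linear)
 have "(LBINT x. f x) = (\<integral>x. f x \<partial>density (distr lborel borel ((*v) A)) (%_. ennreal \<bar>det A\<bar>))"
 by (subst lborel_matrix[OF assms(1)]) simp
 also have "... = (\<integral>x. \<bar>det A\<bar> *\<^sub>R f x \<partial>distr lborel borel ((*v) A))"
 by (rule integral_density) auto
 also have "... = (LBINT x. \<bar>det A\<bar> *\<^sub>R f (A *v x))"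
 by (rule integral_distr) auto
 finally show ?thesis by (simp add: scaleR_conv_of_real)
qed

lemma integral_scaleR_arg:
 fixes f :: "'a::euclidean_space => complex"
 assumes "c ~= 0" and [measurable]: "f : borel_measurable borel"
 shows "(LBINT x. f x) = cor (\<bar>c\<bar> ^ DIM('a)) * (LBINT x. f (c *\<^sub>R x))"
proof -
 have "(LBINT x. f x) = (\<integral>x. f x \<partial>density (distr lborel borel (%x::'a. 0 + c *\<^sub>R x)) (%_. ennreal (\<bar>c\<bar> ^ DIM('a))))"
 by (subst lborel_affine[OF assms(1), of 0]) simp
 also have "... = (\<integral>x. \<bar>c\<bar> ^ DIM('a) *\<^sub>R f x \<partial>distr lborel borel (%x::'a. 0 + c *\<^sub>R x))"
 by (rule integral_density) auto
 also have "... = (LBINT x. \<bar>c\<bar> ^ DIM('a) *\<^sub>R f (0 + c *\<^sub>R x))"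
 by (rule integral_distr) auto
 finally show ?thesis by (simp add: scaleR_conv_of_real del: of_real_power)
qed

subsection \<open>Oscillating exponentials\<close>

lemma has_dir_cis:
 assumes "has_dir q v q' x" shows "has_dir (%x. cis (q x)) v (q' *\<^sub>R (\<i> * cis (q x))) x"
proof -
 have "(cis has_vector_derivative (\<i> * cis t)) (at t)" for t
 unfolding cis_conv_exp
 by (rule has_vector_derivative_real_field[of "%z. exp (\<i> * z)"]) (auto intro!: derivative_eq_intros)
 from vector_diff_chain_at[OF assms[unfolded has_dir_def] this] show ?thesis
 by (simp add: has_dir_def o_def)
qed

lemma borel_measurable_cis [measurable]:
 "f : borel_measurable M ==> (%x. cis (f x)) : borel_measurable M"
 by (rule measurable_compose[where N = borel])
 (auto intro!: borel_measurable_continuous_onI continuous_intros simp: cis_conv_exp)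

lemma om_Cinf: "om f ==> Cinf_on UNIV f"
 by (simp add: om_def)

lemma om_cis_gen:
 fixes q :: "'a::euclidean_space => real"
 assumes q: "om (%z. cor (q z))" and p: "om p"
 shows "om (%z. p z * cis (q z))"
 and "v : Basis ==> has_dir (%z. p z * cis (q z)) v ((dirD v p x + \<i> * dirD v (%z. cor (q z)) x * p x) * cis (q x)) x"
proof -
 have dq: "has_dir q v (Re (dirD v (%z. cor (q z)) x)) x"
 "dirD v (%z. cor (q z)) x = cor (Re (dirD v (%z. cor (q z)) x))"
 if "v : Basis" for v x
 proof -
 from has_dir_bounded_linear[OF bounded_linear_Re Cinf_on_has_dir[OF om_Cinf[OF q] that UNIV_I]]
 show 1: "has_dir q v (Re (dirD v (%z. cor (q z)) x)) x" by simp
 show "dirD v (%z. cor (q z)) x = cor (Re (dirD v (%z. cor (q z)) x))"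
 using has_dir_bounded_linear[OF bounded_linear_of_real 1] by (rule dirD_eq)
 qed
 have d: "has_dir (%z. p z * cis (q z)) v ((dirD v p x + \<i> * dirD v (%z. cor (q z)) x * p x) * cis (q x)) x"
 if p: "om p" and v: "v : Basis" for p v x
 using has_dir_bilinear[OF bounded_bilinear_mult Cinf_on_has_dir[OF om_Cinf[OF p] v UNIV_I] has_dir_cis[OF dq(1)[OF v]], of x]
 by (subst dq(2)[OF v]) (simp add: scaleR_conv_of_real algebra_simps)
 from d[OF p] show "v : Basis ==> has_dir (%z. p z * cis (q z)) v ((dirD v p x + \<i> * dirD v (%z. cor (q z)) x * p x) * cis (q x)) x" .
 have om': "om (%x. dirD v p x + \<i> * dirD v (%z. cor (q z)) x * p x)" if "om p" "v : Basis" for p v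
 using om_Dl[OF that(1), of "[v]"] om_Dl[OF q, of "[v]"] that
 by (intro om_add om_mult om_const) (auto simp: Dl_Cons)
 define S where "S = {%z. p z * cis (q z) |p. om p}"
 have S: "Cinf_on UNIV g" if "g : S" for g
 proof (rule Cinf_on_coinduct[OF open_UNIV that])
 fix g assume "g : S"
 then obtain p where p: "om p" "g = (%z. p z * cis (q z))" unfolding S_def by blast
 have "locally_bounded_on UNIV p"
 by (rule continuous_imp_locally_bounded[OF open_UNIV Cinf_on_continuous[OF om_Cinf[OF p(1)]]])
 thus "locally_bounded_on UNIV g" by (simp add: locally_bounded_on_def p(2) norm_mult)
 show "EX h:S. ALL x:UNIV. has_dir g v (h x) x" if "v : Basis" for v
 unfolding p(2) using d[OF p(1) that] om'[OF p(1) that]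
 by (intro bexI[of _ "%x. (dirD v p x + \<i> * dirD v (%z. cor (q z)) x * p x) * cis (q x)"]) (auto simp: S_def)
 qed
 have "EX C k. ALL x. norm (Dl vs (%z. p z * cis (q z)) x) <= C * (1 + norm x) ^ k"
 if "set vs <= Basis" "om p" for vs p
 using that
 proof (induction vs arbitrary: p rule: rev_induct)
 case Nil
 thus ?case using om_bound[of p "[]"] by (auto simp: norm_mult)
 next
 case (snoc v vs)
 hence v: "v : Basis" by simp
 have "dirD v (%z. p z * cis (q z)) = (%x. (dirD v p x + \<i> * dirD v (%z. cor (q z)) x * p x) * cis (q x))"
 using dirD_eq[OF d[OF snoc.prems(2) v]] by blast
 thus ?case using snoc.IH[OF _ om'[OF snoc.prems(2) v]] snoc.prems by (simp add: Dl_append Dl_Cons)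
 qed
 thus "om (%z. p z * cis (q z))"
 unfolding om_def[of "%z. p z * cis (q z)"] using S[of "%z. p z * cis (q z)"] p unfolding S_def by blast
qed

lemma om_cis: "om (%z. cor (q z)) ==> om (%z. cis (q z))"
 using om_cis_gen(1)[OF _ om_const, of q 1] by simp

lemma om_cis_inner:
 fixes f g :: "'a::euclidean_space => 'b::euclidean_space"
 assumes "bounded_linear f" "bounded_linear g"
 shows "om (%z. cis (c * (f z \<bullet> g z)))"
proof (rule om_cis)
 have "cor (c * (f z \<bullet> g z)) = c * (\<Sum>b\<in>Basis. cor (f z \<bullet> b) * cor (g z \<bullet> b))" for z
 by (subst euclidean_inner) simp
 moreover have "om (%z. c * (\<Sum>b\<in>Basis. cor (f z \<bullet> b) * cor (g z \<bullet> b)))"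
 by (intro om_mult om_const om_sum finite_Basis om_linear bounded_linear_compose[OF bounded_linear_inner_left] assms)
 ultimately show "om (%z. cor (c * (f z \<bullet> g z)))" by presburger
qed

lemma has_dir_cis_inner:
 "has_dir (%et. c * cis (a * (u \<bullet> et))) v (\<i> * (a * (u \<bullet> v)) * (c * cis (a * (u \<bullet> et)))) et"
proof -
 have "bounded_linear (%et. a * (u \<bullet> et))"
 by (intro bounded_linear_const_mult bounded_linear_inner_right)
 from has_dir_bounded_linear[OF bounded_linear_mult_right[of c] has_dir_cis[OF has_dir_linear[OF this, of v et]]]
 show ?thesis by (simp add: scaleR_conv_of_real algebra_simps)
qed

subsection \<open>The Fourier transform of Schwartz functions\<close>

lemma bounded_linear_fst_snd:
 "bounded_linear (fst :: 'a::real_normed_vector \<times> 'b::real_normed_vector => 'a)"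
 "bounded_linear (snd :: 'a::real_normed_vector \<times> 'b::real_normed_vector => 'b)"
 by (rule bounded_linear_fst bounded_linear_snd)+

lemma PS_snd: 
 assumes "schwartz f" shows "PS (%z::'a::euclidean_space \<times> 'b::euclidean_space. f (snd z))"
proof -
 have "norm q <= 1 * (norm (snd (p, q)) + norm p)" for p :: 'a and q :: 'b by simp
 from PS_linear[OF assms _ _ this] show ?thesis by (simp add: linear_snd)
qed

text \<open>The sign is plus, opposite to \<open>fourier\<close>: this transform takes an amplitude
  in eta to its kernel in u. The inverse, with the minus sign, appears in
  \<open>ft_inversion\<close> and in \<open>osc\<close>.\<close>

definition ft :: "('a::euclidean_space => complex) => 'a => complex" where
 "ft f et = (LBINT u. f u * cis (2 * pi * (u \<bullet> et)))"

lemma PS_ft: 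
 assumes "schwartz f" shows "PS (%z. f (snd z) * cis (2 * pi * (snd z \<bullet> fst z)))"
 using PS_om[OF PS_snd[OF assms] om_cis_inner[OF bounded_linear_fst_snd(2) bounded_linear_fst_snd(1), of "2 * pi"]]
 by (simp add: mult.commute)

lemma ft_has_dir:
 fixes f :: "'a::euclidean_space => complex"
 assumes "schwartz f"
 shows "has_dir (ft f) v (ft (%u. \<i> * (2 * pi * (u \<bullet> v)) * f u) et) et"
proof -
 have "has_dir (%et. f u * cis (2 * pi * (u \<bullet> et))) v (\<i> * (2 * pi * (u \<bullet> v)) * f u * cis (2 * pi * (u \<bullet> et))) et" for u
 using has_dir_cis_inner[of "f u" "2 * pi" u v et] by (simp add: mult_ac)
 hence "dirD (v, 0) (%z. f (snd z) * cis (2 * pi * (snd z \<bullet> fst z))) (et, u) = \<i> * (2 * pi * (u \<bullet> v)) * f u * cis (2 * pi * (u \<bullet> et))" for u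
 using dirD_eq by (fastforce simp: dirD_def)
 thus ?thesis
 using integral_has_dir[OF PS_ft[OF assms], of v et] by (simp add: ft_def[abs_def])
qed

lemma schwartz_cis:
 assumes "schwartz f" shows "schwartz (%u. f u * cis (a * (u \<bullet> et)))"
 using schwartz_om[OF assms om_cis_gen(1)[OF om_linear om_const, of "%u. a * (u \<bullet> et)" 1]]
 by (simp add: mult.commute bounded_linear_const_mult bounded_linear_inner_left)

lemma ft_dirD:
 assumes f: "schwartz f"
 shows "ft (dirD v f) et = - (2 * pi * \<i>) * (et \<bullet> v) * ft f et"
proof -
 let ?e = "%u. cis (2 * pi * (u \<bullet> et))"
 have "has_dir (%u. f u * ?e u) v (dirD v f u * ?e u + \<i> * (2 * pi * (et \<bullet> v)) * (f u * ?e u)) u" for u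
 using has_dir_bilinear[OF bounded_bilinear_mult has_dir_any[OF open_UNIV schwartzD(1)[OF f], of u v]
  has_dir_cis_inner[of 1 "2 * pi" et v u]] by (simp add: inner_commute mult_ac)
 hence "dirD v (%u. f u * ?e u) = (%u. dirD v f u * ?e u + \<i> * (2 * pi * (et \<bullet> v)) * (f u * ?e u))"
 using dirD_eq by blast
 hence "0 = (LBINT u. dirD v f u * ?e u + \<i> * (2 * pi * (et \<bullet> v)) * (f u * ?e u))"
 using integral_dirD[OF schwartz_cis[OF f, of "2 * pi" et], of v] by simp
 also have "... = ft (dirD v f) et + \<i> * (2 * pi * (et \<bullet> v)) * ft f et"
 unfolding ft_def
 by (subst Bochner_Integration.integral_add)
 (auto intro!: schwartz_integrable schwartz_cis schwartz_scale schwartz_dirD_any f)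
 finally show ?thesis by (simp add: eq_neg_iff_add_eq_0 mult_ac)
qed

lemma ft_scale: "ft (%u. c * f u) et = c * ft f et"
 by (simp add: ft_def mult.assoc)

text \<open>\<open>ft\<close> exchanges derivatives and multiplication by coordinates, so its range
  on Schwartz functions has both closure properties.\<close>

lemma schwartz_ft:
 fixes f :: "'a::euclidean_space => complex"
 assumes "schwartz f" shows "schwartz (ft f)"
proof (rule schwartz_coinduct[of _ "{ft g |g. schwartz g}"])
 fix F :: "'a => complex" assume "F : {ft g |g. schwartz g}"
 then obtain g where g: "schwartz g" "F = ft g" by auto
 have "norm (F et) <= (LBINT u. norm (g u))" for et
 unfolding g(2) ft_def by (rule order_trans[OF integral_norm_bound]) (simp add: norm_mult)
 thus "EX B. ALL x. norm (F x) <= B" by blast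
 fix v :: 'a
 have m: "schwartz (%u. \<i> * (2 * pi * (u \<bullet> v)) * g u)"
 by (rule schwartz_om[OF g(1)]) (auto intro!: om_mult om_const om_inner)
 thus "EX h:{ft g |g. schwartz g}. ALL x. has_dir F v (h x) x"
 unfolding g(2) using ft_has_dir[OF g(1)] by blast
 have "(%x. (x \<bullet> v) *\<^sub>R F x) = ft (%u. (\<i> / (2 * pi)) * dirD v g u)"
 unfolding g(2) ft_scale ft_dirD[OF g(1)] by (auto simp: scaleR_conv_of_real field_simps)
 moreover have "schwartz (%u. (\<i> / (2 * pi)) * dirD v g u)"
 by (intro schwartz_scale schwartz_dirD_any g)
 ultimately show "(%x. (x \<bullet> v) *\<^sub>R F x) : {ft g |g. schwartz g}" by blast
qed (use assms in blast)

lemma schwartz_tensor: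
 fixes f :: "'a::euclidean_space => complex" and g :: "'b::euclidean_space => complex"
 assumes "schwartz f" "schwartz g" shows "schwartz (%z. f (fst z) * g (snd z))"
proof (rule schwartz_coinduct[of _ "{%z. f (fst z) * g (snd z) |f g. schwartz f & schwartz g}"])
 fix F :: "'a \<times> 'b => complex" assume "F : {%z. f (fst z) * g (snd z) |f g. schwartz f & schwartz g}"
 then obtain f g where F: "F = (%z. f (fst z) * g (snd z))" and f: "schwartz f" and g: "schwartz g" by blast
 obtain C where C: "C >= 0" "!!x. norm (f x) <= C" using schwartz_bound[OF f, of "[]" 0] by auto
 obtain D where D: "D >= 0" "!!x. norm (g x) <= D" using schwartz_bound[OF g, of "[]" 0] by auto
 have "norm (F z) <= C * D" for z unfolding F norm_mult by (intro mult_mono C D) auto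
 thus "EX B. ALL x. norm (F x) <= B" by blast
 fix v :: "'a \<times> 'b" assume "v : Basis"
 then consider b where "v = (b, 0)" | b where "v = (0, b)" by (auto simp: Basis_prod_def)
 hence "(EX f' g'. schwartz f' & schwartz g' & (ALL z. has_dir F v (f' (fst z) * g' (snd z)) z))
 & (EX f' g'. schwartz f' & schwartz g' & (%x. (x \<bullet> v) *\<^sub>R F x) = (%z. f' (fst z) * g' (snd z)))"
 proof cases
 case 1
 have "has_dir F v (dirD b f (fst z) * g (snd z)) z" for z
 using has_dir_bounded_linear[OF bounded_linear_mult_left[of "g (snd z)"] has_dir_any[OF open_UNIV schwartzD(1)[OF f], of "fst z" b]]
 by (simp add: has_dir_def F 1)
 moreover have "(%x. (x \<bullet> v) *\<^sub>R F x) = (%z. (cor (fst z \<bullet> b) * f (fst z)) * g (snd z))"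
 by (auto simp: F 1 inner_prod_def scaleR_conv_of_real)
 ultimately show ?thesis using schwartz_dirD_any[OF f, of b] g schwartz_om[OF f om_inner, of b] by blast
 next
 case 2
 have "has_dir F v (f (fst z) * dirD b g (snd z)) z" for z
 using has_dir_bounded_linear[OF bounded_linear_mult_right[of "f (fst z)"] has_dir_any[OF open_UNIV schwartzD(1)[OF g], of "snd z" b]]
 by (simp add: has_dir_def F 2)
 moreover have "(%x. (x \<bullet> v) *\<^sub>R F x) = (%z. f (fst z) * (cor (snd z \<bullet> b) * g (snd z)))"
 by (auto simp: F 2 inner_prod_def scaleR_conv_of_real)
 ultimately show ?thesis using schwartz_dirD_any[OF g, of b] f schwartz_om[OF g om_inner, of b] by blast
 qed
 note * = this
 from * obtain f' g' where "schwartz f'" "schwartz g'" "ALL z. has_dir F v (f' (fst z) * g' (snd z)) z" by blast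
 thus "EX h:{%z. f (fst z) * g (snd z) |f g. schwartz f & schwartz g}. ALL x. has_dir F v (h x) x"
 by (intro bexI[of _ "%z. f' (fst z) * g' (snd z)"]) auto
 from * show "(%x. (x \<bullet> v) *\<^sub>R F x) : {%z. f (fst z) * g (snd z) |f g. schwartz f & schwartz g}" by blast
qed (use assms in blast)

subsection \<open>The Gaussian and Fourier inversion\<close>

definition gauss :: "'a::euclidean_space => complex" where
 "gauss x = cor (exp (- pi * (x \<bullet> x)))"

lemma gauss_has_dir: "has_dir gauss v (- 2 * pi * (x \<bullet> v) * gauss x) x"
proof -
 have 1: "has_dir (%x. x \<bullet> x) v (2 * (x \<bullet> v)) x"
 using has_dir_bilinear[OF bounded_bilinear_inner has_dir_linear[OF bounded_linear_ident] has_dir_linear[OF bounded_linear_ident], of v x]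
 by (simp add: inner_commute)
 have "((%t. exp (- pi * t)) has_vector_derivative (- pi * exp (- pi * s))) (at s)" for s
 by (auto intro!: derivative_eq_intros simp: has_real_derivative_iff_has_vector_derivative[symmetric])
 from vector_diff_chain_at[OF 1[unfolded has_dir_def] this]
 have "has_dir (%x. exp (- pi * (x \<bullet> x))) v (- 2 * pi * (x \<bullet> v) * exp (- pi * (x \<bullet> x))) x"
 by (simp add: has_dir_def o_def mult_ac)
 from has_dir_bounded_linear[OF bounded_linear_of_real this] show ?thesis
 by (simp add: gauss_def[abs_def])
qed

lemma power_le_exp:
 assumes "0 <= (t::real)" shows "t ^ k <= real k ^ k * exp t"
proof (cases "k = 0")
 case False
 have "t / real k <= exp (t / real k)" using exp_ge_add_one_self[of "t / real k"] by linarith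
 hence "(t / real k) ^ k <= exp (t / real k) ^ k" using assms by (intro power_mono) auto
 also have "... = exp t" using False by (simp add: exp_of_nat_mult[symmetric])
 finally show ?thesis using False by (simp add: power_divide field_simps)
qed (use assms in simp)

lemma schwartz_gauss: "schwartz gauss"
proof -
 have "schwartz (%x::'a. 1 * gauss x)"
 proof (rule schwartz_coinduct[of _ "{%x. p x * gauss x |p. om p}"])
 show "(%x. 1 * gauss x) : {%x. p x * gauss x |p. om p}" by (auto intro!: exI[of _ "%x. 1"] om_const)
 fix g assume "g : {%x::'a. p x * gauss x |p. om p}"
 then obtain p where g: "g = (%x. p x * gauss x)" and p: "om p" by blast
 obtain C k where C: "C >= 0" "!!x. norm (p x) <= C * (1 + norm x) ^ k"
 using om_bound[OF p, of "[]"] by auto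
 have "norm (g x) <= C * (real k ^ k * exp 2)" for x
 proof -
 have "1 * (norm x)\<^sup>2 <= pi * (norm x)\<^sup>2" using pi_ge_two by (intro mult_right_mono) auto
 moreover have "0 <= (norm x - 1/2)\<^sup>2" by simp
 ultimately have "1 + norm x + - pi * (x \<bullet> x) <= 2"
  by (simp add: dot_square_norm power2_eq_square algebra_simps)
 hence "exp (1 + norm x) * exp (- pi * (x \<bullet> x)) <= exp 2" unfolding exp_add[symmetric] by simp
 hence "real k ^ k * exp (1 + norm x) * exp (- pi * (x \<bullet> x)) <= real k ^ k * exp 2"
  by (simp add: mult.assoc mult_left_mono)
 moreover have "(1 + norm x) ^ k * exp (- pi * (x \<bullet> x)) <= real k ^ k * exp (1 + norm x) * exp (- pi * (x \<bullet> x))"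
  using power_le_exp[of "1 + norm x" k] by (intro mult_right_mono) auto
 ultimately have "C * ((1 + norm x) ^ k * exp (- pi * (x \<bullet> x))) <= C * (real k ^ k * exp 2)"
  using C(1) by (intro mult_left_mono) linarith+
 moreover have "norm (g x) <= C * (1 + norm x) ^ k * exp (- pi * (x \<bullet> x))"
  unfolding g gauss_def norm_mult norm_of_real using C by (intro mult_mono) auto
 ultimately show ?thesis by (simp add: mult.assoc)
 qed
 thus "EX B. ALL x. norm (g x) <= B" by blast
 fix v :: 'a assume v: "v : Basis"
 have "has_dir g v ((dirD v p x + - 2 * pi * (x \<bullet> v) * p x) * gauss x) x" for x
 using has_dir_bilinear[OF bounded_bilinear_mult Cinf_on_has_dir[OF om_Cinf[OF p] v UNIV_I] gauss_has_dir, of x]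
 by (simp add: g algebra_simps)
 moreover have "om (%x. dirD v p x + - 2 * pi * (x \<bullet> v) * p x)"
 using om_Dl[OF p, of "[v]"] v
 by (intro om_add om_mult[OF om_linear[OF bounded_linear_const_mult[OF bounded_linear_inner_left]] p]) (auto simp: Dl_Cons)
 ultimately show "EX h:{%x. p x * gauss x |p. om p}. ALL x. has_dir g v (h x) x"
 by (intro bexI[of _ "%x. (dirD v p x + - 2 * pi * (x \<bullet> v) * p x) * gauss x"]) auto
 have "(%x. (x \<bullet> v) *\<^sub>R g x) = (%x. (cor (x \<bullet> v) * p x) * gauss x)"
 by (auto simp: g scaleR_conv_of_real)
 thus "(%x. (x \<bullet> v) *\<^sub>R g x) : {%x. p x * gauss x |p. om p}" using om_mult[OF om_inner p, of v] by auto
 qed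
 thus ?thesis by simp
qed

lemma integral_gauss: "(\<integral>x. gauss x \<partial>(lborel :: 'a::euclidean_space measure)) = 1"
proof -
 have 1: "(\<integral>\<^sup>+t. ennreal (exp (- pi * t\<^sup>2)) \<partial>lborel) = 1"
 proof -
 define \<sigma> where "\<sigma> = 1 / sqrt (2 * pi)"
 have s: "\<sigma> > 0" "\<sigma>\<^sup>2 = 1 / (2 * pi)" by (auto simp: \<sigma>_def power_divide)
 have "normal_density 0 \<sigma> t = exp (- pi * t\<^sup>2)" for t
 by (simp add: normal_density_def s)
 hence *: "normal_density 0 \<sigma> = (%t. exp (- pi * t\<^sup>2))" by auto
 have "integrable lborel (%t. exp (- pi * t\<^sup>2))" "(LBINT t. exp (- pi * t\<^sup>2)) = 1"
 using integrable_normal_density[OF s(1), of 0] integral_normal_density[OF s(1), of 0] by (simp_all add: *)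
 thus ?thesis by (subst nn_integral_eq_integral) auto
 qed
 have "(\<integral>\<^sup>+x. ennreal (exp (- pi * (x \<bullet> x))) \<partial>(lborel :: 'a measure)) = (\<integral>\<^sup>+x. (\<Prod>b\<in>Basis. ennreal (exp (- pi * ((x::'a) \<bullet> b)\<^sup>2))) \<partial>lborel)"
 proof (rule nn_integral_cong)
 fix x :: 'a
 have "x \<bullet> x = (\<Sum>b\<in>Basis. (x \<bullet> b)\<^sup>2)" by (subst euclidean_inner) (simp add: power2_eq_square)
 thus "ennreal (exp (- pi * (x \<bullet> x))) = (\<Prod>b\<in>Basis. ennreal (exp (- pi * (x \<bullet> b)\<^sup>2)))"
 by (simp add: prod_ennreal exp_sum[symmetric] sum_distrib_left sum_negf)
 qed
 also have "... = 1" by (subst nn_integral_lborel_prod) (use 1 in simp_all)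
 finally have "(\<integral>x. exp (- pi * (x \<bullet> x)) \<partial>(lborel :: 'a measure)) = 1"
 by (subst integral_eq_nn_integral) auto
 thus ?thesis unfolding gauss_def[abs_def] by simp
qed

text \<open>The differential equation of the Gaussian is invariant under \<open>ft\<close>. Hence on
  the ray through \<xi> the quotient of the transform by the Gaussian is constant, and at 0 it
  equals the integral, 1.\<close>

lemma ft_gauss: "ft gauss \<xi> = gauss \<xi>"
proof -
 have dg: "dirD v gauss = (%x. - 2 * pi * (x \<bullet> v) * gauss x)" for v :: 'a
 using dirD_eq[OF gauss_has_dir] by blast
 have F: "has_dir (ft gauss) w (- 2 * pi * (et \<bullet> w) * ft gauss et) et" for w et :: 'a
 proof -
 have "(%u. \<i> * (2 * pi * (u \<bullet> w)) * gauss u) = (%u. - \<i> * dirD w gauss u)"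
 unfolding dg by auto
 hence "ft (%u. \<i> * (2 * pi * (u \<bullet> w)) * gauss u) et = - 2 * pi * (et \<bullet> w) * ft gauss et"
 by (simp only: ft_scale ft_dirD[OF schwartz_gauss]) simp
 thus ?thesis using ft_has_dir[OF schwartz_gauss, of w et] by simp
 qed
 define z where "z t = ft gauss (t *\<^sub>R \<xi>) * cor (exp (pi * t\<^sup>2 * (\<xi> \<bullet> \<xi>)))" for t
 have "(z has_vector_derivative 0) (at t)" for t
 proof -
 have 1: "((%t. ft gauss (t *\<^sub>R \<xi>)) has_vector_derivative (- 2 * pi * (t * (\<xi> \<bullet> \<xi>)) * ft gauss (t *\<^sub>R \<xi>))) (at t)"
 using has_dir_line[of "ft gauss" \<xi> _ 0 t] F[where et = "t *\<^sub>R \<xi>" and w = \<xi>] by simp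
 have "((%t. exp (pi * t\<^sup>2 * (\<xi> \<bullet> \<xi>))) has_vector_derivative (2 * pi * t * (\<xi> \<bullet> \<xi>) * exp (pi * t\<^sup>2 * (\<xi> \<bullet> \<xi>)))) (at t)"
 by (auto intro!: derivative_eq_intros simp: has_real_derivative_iff_has_vector_derivative[symmetric])
 from bounded_linear.has_vector_derivative[OF bounded_linear_of_real this]
 have "((%t. cor (exp (pi * t\<^sup>2 * (\<xi> \<bullet> \<xi>)))) has_vector_derivative
 cor (2 * pi * t * (\<xi> \<bullet> \<xi>) * exp (pi * t\<^sup>2 * (\<xi> \<bullet> \<xi>)))) (at t)" .
 from has_vector_derivative_mult[OF 1 this] show ?thesis
 unfolding z_def[abs_def] by (simp add: algebra_simps)
 qed
 hence "z 1 = z 0"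
 using has_derivative_zero_unique[of UNIV z 1 0] by (auto simp: has_vector_derivative_def)
 hence "ft gauss \<xi> * cor (exp (pi * (\<xi> \<bullet> \<xi>))) = 1"
 by (simp add: z_def ft_def integral_gauss)
 hence "ft gauss \<xi> * cor (exp (pi * (\<xi> \<bullet> \<xi>))) * cor (exp (- pi * (\<xi> \<bullet> \<xi>))) = gauss \<xi>"
 by (simp add: gauss_def)
 thus ?thesis by (simp add: mult.assoc of_real_mult[symmetric] exp_add[symmetric] del: of_real_mult)
qed

text \<open>Gaussian summation: the factor gauss (ep et) makes the double integral absolutely
  convergent. Integrating over et first turns it, by invariance of the Gaussian, into an approximate
  identity acting on f, and both forms of \<open>I\<close> have limits as ep tends to 0.\<close>

theorem ft_inversion:
 assumes f: "schwartz f"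
 shows "(LBINT et. ft f et * cis (- 2 * pi * (u \<bullet> et))) = f u"
proof -
 define ep where "ep i = 1 / real (Suc i)" for i
 have e0: "ep i > 0" for i by (simp add: ep_def)
 have elim: "ep \<longlonglongrightarrow> 0" unfolding ep_def by (rule LIMSEQ_inverse_real_of_nat[unfolded inverse_eq_divide])
 have gm [measurable]: "(gauss :: 'a => complex) : borel_measurable borel" by (rule schwartz_measurable[OF schwartz_gauss])
 have fm [measurable]: "f : borel_measurable borel" by (rule schwartz_measurable[OF f])
 have ftm [measurable]: "ft f : borel_measurable borel" by (rule schwartz_measurable[OF schwartz_ft[OF f]])
 have g1: "norm (gauss x) <= 1" for x :: 'a by (simp add: gauss_def)
 have gc: "isCont gauss x" for x :: 'a
 using Cinf_on_continuous[OF schwartzD(1)[OF schwartz_gauss, where 'a = 'a]] by (simp add: continuous_on_eq_continuous_at)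
 have fc: "isCont f x" for x
 using Cinf_on_continuous[OF schwartzD(1)[OF f]] by (simp add: continuous_on_eq_continuous_at)
 define I where "I i = (LBINT et. ft f et * cis (- 2 * pi * (u \<bullet> et)) * gauss (ep i *\<^sub>R et))" for i
 have lim1: "I \<longlonglongrightarrow> (LBINT et. ft f et * cis (- 2 * pi * (u \<bullet> et)))"
 unfolding I_def
 proof (rule integral_dominated_convergence[where w = "%et. norm (ft f et)"])
 show "integrable lborel (%et. norm (ft f et))" by (intro integrable_norm schwartz_integrable schwartz_ft f)
 show "AE et in lborel. (%i. ft f et * cis (- 2 * pi * (u \<bullet> et)) * gauss (ep i *\<^sub>R et)) \<longlonglongrightarrow> ft f et * cis (- 2 * pi * (u \<bullet> et))"
 proof (rule AE_I2)
 fix et :: 'a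
 have "(%i. gauss (ep i *\<^sub>R et)) \<longlonglongrightarrow> gauss (0 *\<^sub>R et)"
  by (intro isCont_tendsto_compose[OF gc] tendsto_intros elim)
 thus "(%i. ft f et * cis (- 2 * pi * (u \<bullet> et)) * gauss (ep i *\<^sub>R et)) \<longlonglongrightarrow> ft f et * cis (- 2 * pi * (u \<bullet> et))"
  using tendsto_mult_left[of _ "1" sequentially "ft f et * cis (- 2 * pi * (u \<bullet> et))"] by (simp add: gauss_def)
 qed
 show "AE et in lborel. norm (ft f et * cis (- 2 * pi * (u \<bullet> et)) * gauss (ep i *\<^sub>R et)) <= norm (ft f et)" for i
 using g1 by (intro AE_I2) (simp add: norm_mult mult_left_le)
 qed measurable
 have I: "I i = (LBINT y. f (u + ep i *\<^sub>R y) * gauss y)" for i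
 proof -
 have "I i = (LBINT et. LBINT v. (gauss (ep i *\<^sub>R et) * f v) * (cis (2 * pi * (v \<bullet> et)) * cis (- 2 * pi * (u \<bullet> et))))"
 unfolding I_def ft_def by (simp add: integral_mult_left_zero[symmetric] integral_mult_right_zero[symmetric] mult_ac del: integral_mult_left_zero integral_mult_right_zero)
 also have "... = (LBINT v. LBINT et. (gauss (ep i *\<^sub>R et) * f v) * (cis (2 * pi * (v \<bullet> et)) * cis (- 2 * pi * (u \<bullet> et))))"
 proof -
 have "schwartz (%et::'a. gauss (ep i *\<^sub>R et))"
  by (rule schwartz_linear[OF schwartz_gauss, where A = "1 / ep i"]) (use e0[of i] in "auto intro!: linearI simp: algebra_simps")
 from schwartz_tensor[OF this f]
 have "schwartz (%z. (cis (2 * pi * (snd z \<bullet> fst z)) * cis (- 2 * pi * (u \<bullet> fst z))) * (gauss (ep i *\<^sub>R fst z) * f (snd z)))"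
  by (rule schwartz_om) (intro om_mult om_cis_inner om_cis om_linear bounded_linear_fst_snd bounded_linear_const_mult
   bounded_linear_compose[OF bounded_linear_inner_right])
 from tempered_Fubini[OF tempered_integral this] show ?thesis by (simp add: mult_ac)
 qed
 also have "... = (LBINT v. f v * (LBINT et. gauss (ep i *\<^sub>R et) * cis (2 * pi * (et \<bullet> (v - u)))))"
 by (simp add: integral_mult_right_zero[symmetric] mult_ac cis_mult inner_diff_right inner_commute algebra_simps del: integral_mult_right_zero)
 also have "... = (LBINT v. f v * (cor (1 / ep i ^ DIM('a)) * gauss ((1 / ep i) *\<^sub>R (v - u))))"
 proof -
 have "(LBINT et. gauss (ep i *\<^sub>R et) * cis (2 * pi * (et \<bullet> w))) = cor (1 / ep i ^ DIM('a)) * gauss ((1 / ep i) *\<^sub>R w)" for w :: 'a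
 proof -
  have "gauss ((1 / ep i) *\<^sub>R w) = ft gauss ((1 / ep i) *\<^sub>R w)" by (simp add: ft_gauss)
  also have "... = cor (\<bar>ep i\<bar> ^ DIM('a)) * (LBINT et. gauss (ep i *\<^sub>R et) * cis (2 * pi * ((ep i *\<^sub>R et) \<bullet> ((1 / ep i) *\<^sub>R w))))"
  unfolding ft_def using e0[of i] by (intro integral_scaleR_arg) auto
  finally show ?thesis using e0[of i] by (simp add: field_simps)
 qed
 thus ?thesis by simp
 qed
 also have "... = (LBINT v. f (u + v) * (cor (1 / ep i ^ DIM('a)) * gauss ((1 / ep i) *\<^sub>R v)))"
 by (subst integral_translate[of _ u, symmetric]) auto
 also have "... = cor (ep i ^ DIM('a)) * (LBINT v. f (u + ep i *\<^sub>R v) * (cor (1 / ep i ^ DIM('a)) * gauss v))"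
 using e0[of i] by (subst integral_scaleR_arg[of "ep i"]) auto
 also have "... = cor (ep i ^ DIM('a)) * (cor (1 / ep i ^ DIM('a)) * (LBINT y. f (u + ep i *\<^sub>R y) * gauss y))"
 by (simp only: mult.left_commute[of "f _" "cor _"] integral_mult_right_zero)
 also have "... = (LBINT y. f (u + ep i *\<^sub>R y) * gauss y)"
 using e0[of i] by simp
 finally show ?thesis .
 qed
 have lim2: "(%i. LBINT y. f (u + ep i *\<^sub>R y) * gauss y) \<longlonglongrightarrow> (LBINT y. f u * gauss (y::'a))"
 proof -
 obtain C where C: "C >= 0" "!!x. norm (f x) <= C" using schwartz_bound[OF f, of "[]" 0] by auto
 show ?thesis
 proof (rule integral_dominated_convergence[where w = "%y::'a. C * norm (gauss y)"
])
 show "integrable lborel (%y::'a. C * norm (gauss y))"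
  by (intro integrable_mult_right integrable_norm schwartz_integrable schwartz_gauss)
 show "AE y in lborel. (%i. f (u + ep i *\<^sub>R y) * gauss y) \<longlonglongrightarrow> f u * gauss y"
 proof (rule AE_I2)
  fix y
  have "(%i. f (u + ep i *\<^sub>R y) * gauss y) \<longlonglongrightarrow> f (u + 0 *\<^sub>R y) * gauss y"
  by (intro tendsto_intros isCont_tendsto_compose[OF fc] elim)
  thus "(%i. f (u + ep i *\<^sub>R y) * gauss y) \<longlonglongrightarrow> f u * gauss y" by simp
 qed
 show "AE y in lborel. norm (f (u + ep i *\<^sub>R y) * gauss y) <= C * norm (gauss y)" for i
  using C by (intro AE_I2) (auto simp: norm_mult intro: mult_right_mono)
 qed measurable
 qed
 from lim2 have "(LBINT et. ft f et * cis (- 2 * pi * (u \<bullet> et))) = (LBINT y. f u * gauss (y::'a))"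
 unfolding I[symmetric] by (rule LIMSEQ_unique[OF lim1])
 thus ?thesis by (simp add: integral_gauss)
qed

subsection \<open>The partial Fourier transform\<close>

lemma om_linear_compose:
 fixes f :: "'c::euclidean_space => complex" and L :: "'a::euclidean_space => 'c"
 assumes f: "om f" and L: "linear L" shows "om (%z. f (L z))"
proof -
 have any: "EX C k. C >= 0 & (ALL x. norm (Dl vs f x) <= C * (1 + norm x) ^ k)" for vs
 proof -
 have "om (Dl vs f)"
 proof (induction vs)
 case (Cons v vs)
 have "dirD v (Dl vs f) = (%x. \<Sum>b\<in>Basis. cor (v \<bullet> b) * Dl [b] (Dl vs f) x)"
  by (intro ext) (simp add: dirD_expand[OF open_UNIV om_Cinf[OF Cons], of _ v] Dl_Cons scaleR_conv_of_real)
 thus ?case unfolding Dl_Cons[of v]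
  by (simp only:) (intro om_sum om_mult om_const finite_Basis om_Dl[OF Cons]; simp)
 qed (use f in simp)
 from om_bound[OF this, of "[]"] show ?thesis by simp
 qed
 obtain B where B: "B > 0" "!!x. norm (L x) <= B * norm x"
 using linear_bounded_pos[OF L] by blast
 show ?thesis unfolding om_def
 proof (intro conjI allI impI)
 show "Cinf_on UNIV (%z. f (L z))"
 using Cinf_on_affine[OF om_Cinf[OF f] open_UNIV open_UNIV L, of 0] by simp
 fix vs :: "'a list"
 obtain C k where C: "C >= 0" "!!x. norm (Dl (map L vs) f x) <= C * (1 + norm x) ^ k" using any by blast
 have "norm (Dl vs (%z. f (L z)) z) <= (C * (1 + B) ^ k) * (1 + norm z) ^ k" for z
 proof -
 have "1 + norm (L z) <= (1 + B) * (1 + norm z)"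
  using B(2)[of z] B(1) by (simp add: algebra_simps add_increasing)
 hence "C * (1 + norm (L z)) ^ k <= C * ((1 + B) * (1 + norm z)) ^ k"
  by (intro mult_left_mono power_mono C) auto
 thus ?thesis using C(2)[of "L z"] unfolding Dl_affine'[OF L] by (simp add: power_mult_distrib mult.assoc)
 qed
 thus "EX C k. ALL z. norm (Dl vs (%z. f (L z)) z) <= C * (1 + norm z) ^ k" by blast
 qed
qed

definition pft :: "('a::euclidean_space \<times> 'b::euclidean_space => complex) => 'a \<times> 'b => complex" where
 "pft \<Phi> z = ft (%u. \<Phi> (fst z, u)) (snd z)"

lemma PS_compose_fst:
 fixes \<Phi> :: "'a::euclidean_space \<times> 'b::euclidean_space => complex"
 assumes \<Phi>: "PS \<Phi>" shows "PS (%z::('a \<times> 'b) \<times> 'b. \<Phi> (fst (fst z), snd z))"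
proof -
 have L: "linear (%z::('a \<times> 'b) \<times> 'b. (fst (fst z), snd z))" by (auto intro!: linearI)
 show ?thesis unfolding PS_def
 proof (intro conjI allI impI)
 show "Cinf_on UNIV (%z::('a \<times> 'b) \<times> 'b. \<Phi> (fst (fst z), snd z))"
 using Cinf_on_affine[OF _ open_UNIV open_UNIV L, of \<Phi> 0] \<Phi> by (simp add: PS_def)
 fix vs :: "(('a \<times> 'b) \<times> 'b) list" and k :: nat
 obtain C l where C: "C >= 0" "!!p q. (1 + norm q) ^ k * norm (Dl (map (%z. (fst (fst z), snd z)) vs) \<Phi> (p, q)) <= C * (1 + norm p) ^ l"
 using PS_bound[OF PS_Dl_any[OF \<Phi>, of "map (%z. (fst (fst z), snd z)) vs"], of "[]" k] by auto
 have "(1 + norm q) ^ k * norm (Dl vs (%z::('a \<times> 'b) \<times> 'b. \<Phi> (fst (fst z), snd z)) (p, q)) <= C * (1 + norm p) ^ l" for p q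
 proof -
 have "C * (1 + norm (fst p)) ^ l <= C * (1 + norm p) ^ l"
  using norm_fst_le[of "fst p" "snd p"] by (intro mult_left_mono power_mono C) auto
 thus ?thesis using order_trans[OF C(2)[of q "fst p"]] unfolding Dl_affine'[OF L] by simp
 qed
 thus "EX C l. ALL p q. (1 + norm q) ^ k * norm (Dl vs (%z::('a \<times> 'b) \<times> 'b. \<Phi> (fst (fst z), snd z)) (p, q)) <= C * (1 + norm p) ^ l"
 by blast
 qed
qed

text \<open>One formula serves both kinds of directions: the x-part of v differentiates \<Phi>, the
  frequency part brings down the factor 2 pi i (u . v).\<close>

lemma pft_PS:
 fixes \<Phi> :: "'a::euclidean_space \<times> 'b::euclidean_space => complex"
 assumes \<Phi>: "PS \<Phi>"
 shows "om (pft \<Phi>)"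
 and "has_dir (pft \<Phi>) v (pft (%z. dirD (fst v, 0) \<Phi> z + \<i> * (2 * pi * (snd z \<bullet> snd v)) * \<Phi> z) z) z"
proof -
 define H where "H z = \<Phi> (fst (fst z), snd z) * cis (2 * pi * (snd z \<bullet> snd (fst z)))" for z :: "('a \<times> 'b) \<times> 'b"
 have bl: "bounded_linear (%z::('a \<times> 'b) \<times> 'b. snd (fst z))"
 by (rule bounded_linear_compose[OF bounded_linear_snd bounded_linear_fst])
 have H: "PS H" unfolding H_def[abs_def]
 using PS_om[OF PS_compose_fst[OF \<Phi>] om_cis_inner[OF bounded_linear_fst_snd(2) bl, of "2 * pi"]] by (simp add: mult.commute)
 have F: "pft \<Phi> = (%z. LBINT u. H (z, u))"
 by (auto simp: pft_def ft_def H_def)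
 show "om (pft \<Phi>)" unfolding F by (rule integral_family(1)[OF H])
 define \<Psi> where "\<Psi> z = dirD (fst v, 0) \<Phi> z + \<i> * (2 * pi * (snd z \<bullet> snd v)) * \<Phi> z" for z
 have "has_dir H (v, 0) (\<Psi> (fst z, u) * cis (2 * pi * (u \<bullet> snd z))) (z, u)" for u
 proof -
 have 1: "has_dir (%z::('a \<times> 'b) \<times> 'b. \<Phi> (fst (fst z), snd z)) (v, 0) (dirD (fst v, 0) \<Phi> (fst z, u)) (z, u)"
 using has_dir_any[OF open_UNIV, of \<Phi> "(fst z, u)" "(fst v, 0)"] \<Phi> by (simp add: has_dir_def PS_def)
 have 2: "has_dir (%z::('a \<times> 'b) \<times> 'b. cis (2 * pi * (snd z \<bullet> snd (fst z)))) (v, 0) (\<i> * (2 * pi * (u \<bullet> snd v)) * cis (2 * pi * (u \<bullet> snd z))) (z, u)"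
 using has_dir_cis_inner[of 1 "2 * pi" u "snd v" "snd z"] by (simp add: has_dir_def)
 from has_dir_bilinear[OF bounded_bilinear_mult 1 2] show ?thesis
 unfolding H_def[abs_def] \<Psi>_def by (simp add: algebra_simps)
 qed
 hence "dirD (v, 0) H (z, u) = \<Psi> (fst z, u) * cis (2 * pi * (u \<bullet> snd z))" for u by (rule dirD_eq)
 thus "has_dir (pft \<Phi>) v (pft (%z. dirD (fst v, 0) \<Phi> z + \<i> * (2 * pi * (snd z \<bullet> snd v)) * \<Phi> z) z) z"
 using integral_has_dir[OF H, of v z] unfolding F \<Psi>_def by (simp add: pft_def ft_def)
qed

lemma schwartz_pft:
 fixes \<Phi> :: "'a::euclidean_space \<times> 'b::euclidean_space => complex"
 assumes "schwartz \<Phi>" shows "schwartz (pft \<Phi>)"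
proof (rule schwartz_coinduct[of _ "{pft \<Phi> |\<Phi>. schwartz \<Phi>}"])
 fix F :: "'a \<times> 'b => complex" assume "F : {pft \<Phi> |\<Phi>. schwartz \<Phi>}"
 then obtain \<Phi> where \<Phi>: "schwartz \<Phi>" "F = pft \<Phi>" by auto
 obtain C where C: "!!p q. (1 + norm q) ^ (2 * DIM('b)) * norm (\<Phi> (p, q)) <= C"
 using schwartz_partial_bound[OF \<Phi>(1), of 0 "2 * DIM('b)" "[]"] by auto
 have "norm (F z) <= C * (LBINT x. 1 / (1 + norm (x::'b)) ^ (2 * DIM('b)))" for z
 unfolding \<Phi>(2) pft_def ft_def
 using schwartz_measurable[OF schwartz_slice[OF \<Phi>(1), of "fst z"]]
 by (intro integrable_of_decay(2)) (auto simp: norm_mult C)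
 thus "EX B. ALL x. norm (F x) <= B" by blast
 fix v :: "'a \<times> 'b" assume v: "v : Basis"
 have om2: "om (%z::'a \<times> 'b. cor (snd z \<bullet> w))" for w
 using om_linear[OF bounded_linear_compose[OF bounded_linear_inner_left bounded_linear_snd]] .
 have s1: "schwartz (dirD (fst v, 0) \<Phi>)" by (rule schwartz_dirD_any[OF \<Phi>(1)])
 have s2: "schwartz (%z. \<i> * (2 * pi * (snd z \<bullet> snd v)) * \<Phi> z)"
 by (rule schwartz_om[OF \<Phi>(1)]) (auto intro!: om_mult om_const om2)
 show "EX h:{pft \<Phi> |\<Phi>. schwartz \<Phi>}. ALL x. has_dir F v (h x) x"
 unfolding \<Phi>(2) using schwartz_add[OF s1 s2] pft_PS(2)[OF schwartz_imp_PS[OF \<Phi>(1)], of v] by blast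
 consider b where "v = (b, 0)" | b where "v = (0, b)" using v by (auto simp: Basis_prod_def)
 thus "(%x. (x \<bullet> v) *\<^sub>R F x) : {pft \<Phi> |\<Phi>. schwartz \<Phi>}"
 proof cases
 case 1
 have "(%x. (x \<bullet> v) *\<^sub>R F x) = pft (%z. cor (z \<bullet> v) * \<Phi> z)"
 by (auto simp: \<Phi>(2) pft_def ft_scale 1 inner_prod_def scaleR_conv_of_real)
 thus ?thesis using schwartz_om[OF \<Phi>(1) om_inner, of v] by blast
 next
 case 2
 have eq: "(%u. dirD (0, b) \<Phi> (x, u)) = dirD b (%u. \<Phi> (x, u))" for x
 using Dl_slice[of "[b]" \<Phi> x] by (simp add: Dl_Cons fun_eq_iff)
 have "(%x. (x \<bullet> v) *\<^sub>R F x) = pft (%z. (\<i> / (2 * pi)) * dirD (0, b) \<Phi> z)"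
 unfolding \<Phi>(2) pft_def ft_scale eq ft_dirD[OF schwartz_slice[OF \<Phi>(1)]]
 by (auto simp: 2 inner_prod_def scaleR_conv_of_real field_simps)
 thus ?thesis using schwartz_scale[OF schwartz_dirD_any[OF \<Phi>(1)], of "\<i> / (2 * pi)" "(0, b)"] by blast
 qed
qed (use assms in blast)

text \<open>Each factor 1 + norm et is at most 1 plus the sum of the |et . b|, so it costs one
  derivative and a factor 1 + DIM('a). The constant is explicit in \<open>B\<close> because it is
  needed uniformly over all normalized bumps and inside a seminorm bound.\<close>

lemma ft_decay:
 fixes f :: "'a::euclidean_space => complex"
 assumes "schwartz f" "!!vs u. set vs <= Basis ==> length vs <= k ==> (1 + norm u) ^ (2 * DIM('a)) * norm (Dl vs f u) <= B"
 shows "(1 + norm et) ^ k * norm (ft f et) <= (1 + real DIM('a)) ^ k * (B * (LBINT x. 1 / (1 + norm (x::'a)) ^ (2 * DIM('a))))"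
 using assms
proof (induction k arbitrary: f)
 case 0
 have "(1 + norm u) ^ (2 * DIM('a)) * norm (f u) <= B" for u using "0.prems"(2)[of "[]" u] by simp
 thus ?case
 unfolding ft_def using schwartz_measurable[OF "0.prems"(1)] by (auto intro!: integrable_of_decay(2) simp: norm_mult)
next
 case (Suc k)
 define E where "E = (1 + real DIM('a)) ^ k * (B * (LBINT x. 1 / (1 + norm (x::'a)) ^ (2 * DIM('a))))"
 have 1: "(1 + norm et) ^ k * norm (ft f et) <= E" unfolding E_def by (rule Suc.IH) (use Suc.prems in auto)
 have 2: "(1 + norm et) ^ k * (\<bar>et \<bullet> b\<bar> * norm (ft f et)) <= E" if b: "b : Basis" for b
 proof -
 have "(1 + norm et) ^ k * norm (ft (dirD b f) et) <= E" unfolding E_def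
 proof (rule Suc.IH[OF schwartz_dirD_any[OF Suc.prems(1)]])
 show "(1 + norm u) ^ (2 * DIM('a)) * norm (Dl vs (dirD b f) u) <= B" if "set vs <= Basis" "length vs <= k" for vs u
  using Suc.prems(2)[of "vs @ [b]" u] that b by (simp add: Dl_append Dl_Cons)
 qed
 moreover have "norm (ft (dirD b f) et) = 2 * pi * (\<bar>et \<bullet> b\<bar> * norm (ft f et))"
 unfolding ft_dirD[OF Suc.prems(1)] by (simp add: norm_mult)
 moreover have "\<bar>et \<bullet> b\<bar> * norm (ft f et) <= 2 * pi * (\<bar>et \<bullet> b\<bar> * norm (ft f et))"
 using pi_ge_two mult_right_mono[of 1 "2 * pi" "\<bar>et \<bullet> b\<bar> * norm (ft f et)"] by simp
 ultimately show ?thesis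
 using mult_left_mono[of "\<bar>et \<bullet> b\<bar> * norm (ft f et)" "norm (ft (dirD b f) et)" "(1 + norm et) ^ k"] by simp
 qed
 have "(1 + norm et) ^ Suc k * norm (ft f et) = (1 + norm et) ^ k * norm (ft f et) + norm et * ((1 + norm et) ^ k * norm (ft f et))"
 by (simp add: algebra_simps)
 also have "norm et * ((1 + norm et) ^ k * norm (ft f et)) <= (\<Sum>b\<in>Basis. \<bar>et \<bullet> b\<bar>) * ((1 + norm et) ^ k * norm (ft f et))"
 by (intro mult_right_mono norm_le_l1) simp
 also have "... = (\<Sum>b\<in>Basis. (1 + norm et) ^ k * (\<bar>et \<bullet> b\<bar> * norm (ft f et)))"
 unfolding sum_distrib_right by (intro sum.cong refl) (simp add: mult_ac)
 also have "... <= (\<Sum>b\<in>(Basis :: 'a set). E)" by (intro sum_mono 2)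
 finally have "(1 + norm et) ^ Suc k * norm (ft f et) <= (1 + norm et) ^ k * norm (ft f et) + real DIM('a) * E" by simp
 also have "... <= (1 + real DIM('a)) * E" using 1 by (simp add: distrib_right)
 finally show ?case by (simp add: E_def mult.assoc)
qed

subsection \<open>Operators given by an amplitude\<close>

definition Kop :: "('a::euclidean_space \<times> 'b::euclidean_space => complex) => ('a \<times> 'b => complex) => complex" where
 "Kop a \<Phi> = (LBINT x. LBINT et. a (x, et) * pft \<Phi> (x, et))"

lemma schwartz_Kop: "om a ==> schwartz \<Phi> ==> schwartz (%z. a z * pft \<Phi> z)"
 by (rule schwartz_om[OF schwartz_pft])

lemma integral_lborel_prod:
 fixes f :: "'a::euclidean_space \<times> 'b::euclidean_space => complex"
 assumes "integrable lborel f"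
 shows "(LBINT z. f z) = (LBINT x. LBINT y. f (x, y))"
proof -
 have "integrable (lborel \<Otimes>\<^sub>M lborel) f" using assms by (simp add: lborel_prod)
 from lborel_pair.integral_fst'[OF this] show ?thesis by (simp add: lborel_prod)
qed

lemma Kop_eq: "om a ==> schwartz \<Phi> ==> Kop a \<Phi> = (LBINT z. a z * pft \<Phi> z)"
 unfolding Kop_def by (rule integral_lborel_prod[symmetric]) (rule schwartz_integrable[OF schwartz_Kop])

lemma pft_add: "schwartz \<Phi> ==> schwartz \<Psi> ==> pft (%z. \<Phi> z + \<Psi> z) z = pft \<Phi> z + pft \<Psi> z"
 unfolding pft_def ft_def distrib_right
 by (rule Bochner_Integration.integral_add) (auto intro!: schwartz_integrable schwartz_cis schwartz_slice)

lemma pft_scale: "pft (%z. c * \<Phi> z) z = c * pft \<Phi> z"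
 unfolding pft_def by (rule ft_scale)

lemma tempered_Kop:
 fixes a :: "'a::euclidean_space \<times> 'b::euclidean_space => complex"
 assumes a: "om a" shows "tempered (Kop a)"
 unfolding tempered_def
proof (intro conjI allI impI, goal_cases)
 case (1 f g c)
 hence "Kop a (%x. f x + g x) = (LBINT z. a z * pft f z + a z * pft g z)"
 by (simp add: Kop_eq[OF a] schwartz_add pft_add distrib_left)
 also have "... = Kop a f + Kop a g"
 using 1 by (subst Bochner_Integration.integral_add) (auto simp: Kop_eq[OF a] intro!: schwartz_integrable schwartz_Kop a)
 finally show ?case .
next
 case (2 f g c)
 thus ?case by (simp add: Kop_eq[OF a] schwartz_scale pft_scale mult.left_commute[of _ c])
next
 case 3
 obtain C l where C: "C >= 0" "!!x. norm (a x) <= C * (1 + norm x) ^ l" using om_bound[OF a, of "[]"] by auto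
 \<comment> \<open>l absorbs the growth of \<open>a\<close>, and 2 * DIM makes the product
   integrable in (x, eta); the further 2 * DIM('b) in \<open>m\<close> is spent on the u-integral
   inside \<open>pft\<close>.\<close>
 define k where "k = l + 2 * DIM('a \<times> 'b)"
 define m where "m = k + 2 * DIM('b)"
 define E where "E = (1 + real DIM('b)) ^ k * (LBINT x. 1 / (1 + norm (x::'b)) ^ (2 * DIM('b)))"
 define I where "I = (LBINT z. 1 / (1 + norm (z::'a \<times> 'b)) ^ (2 * DIM('a \<times> 'b)))"
 have "norm (Kop a \<Phi>) <= (C * E * I) * B"
 if \<Phi>: "schwartz \<Phi>" and B: "ALL vs z. set vs <= Basis & length vs <= m --> (1 + norm z) ^ m * norm (Dl vs \<Phi> z) <= B" for \<Phi> B
 proof -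
 have "(1 + norm z) ^ k * norm (pft \<Phi> z) <= E * B" for z
 proof -
 obtain x et where z: "z = (x, et)" by (cases z)
 have "(1 + norm et) ^ k * norm (ft (%u. \<Phi> (x, u)) et) <= (1 + real DIM('b)) ^ k * ((B / (1 + norm x) ^ k) * (LBINT x. 1 / (1 + norm (x::'b)) ^ (2 * DIM('b))))"
 proof (rule ft_decay[OF schwartz_slice[OF \<Phi>]])
  fix vs :: "'b list" and u :: 'b assume vs: "set vs <= Basis" "length vs <= k"
  have "(1 + norm x) ^ k * (1 + norm u) ^ (2 * DIM('b)) <= (1 + norm (x, u)) ^ k * (1 + norm (x, u)) ^ (2 * DIM('b))"
  using norm_fst_le[of x u] norm_snd_le[of u x] by (intro mult_mono power_mono) auto
  also have "... = (1 + norm (x, u)) ^ m" by (simp add: m_def power_add)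
  finally have "(1 + norm x) ^ k * (1 + norm u) ^ (2 * DIM('b)) * norm (Dl (map (Pair 0) vs) \<Phi> (x, u)) <=
   (1 + norm (x, u)) ^ m * norm (Dl (map (Pair 0) vs) \<Phi> (x, u))" by (intro mult_right_mono) auto
  also have "... <= B"
  using B[rule_format, of "map (Pair 0) vs" "(x, u)"] Pair0_Basis(1)[OF vs(1)] vs(2) by (simp add: m_def)
  finally show "(1 + norm u) ^ (2 * DIM('b)) * norm (Dl vs (%u. \<Phi> (x, u)) u) <= B / (1 + norm x) ^ k"
  unfolding Dl_slice by (simp add: pos_le_divide_eq add_pos_nonneg mult_ac)
 qed
 also have "... = E * B / (1 + norm x) ^ k" by (simp add: E_def)
 finally have 1: "(1 + norm x) ^ k * ((1 + norm et) ^ k * norm (pft \<Phi> z)) <= E * B"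
  by (simp add: pft_def z pos_le_divide_eq add_pos_nonneg mult_ac)
 have "1 + norm z <= (1 + norm x) * (1 + norm et)"
  using norm_Pair_le[of x et] mult_nonneg_nonneg[OF norm_ge_zero[of x] norm_ge_zero[of et]]
  by (simp add: z algebra_simps del: mult_nonneg_nonneg)
 hence "(1 + norm z) ^ k <= ((1 + norm x) * (1 + norm et)) ^ k" by (intro power_mono) auto
 hence "(1 + norm z) ^ k * norm (pft \<Phi> z) <= ((1 + norm x) * (1 + norm et)) ^ k * norm (pft \<Phi> z)"
  by (intro mult_right_mono) auto
 thus ?thesis using 1 by (simp add: power_mult_distrib mult.assoc)
 qed
 hence "C * ((1 + norm z) ^ k * norm (pft \<Phi> z)) <= C * (E * B)" for z by (intro mult_left_mono C)
 moreover have "(1 + norm z) ^ (2 * DIM('a \<times> 'b)) * norm (a z * pft \<Phi> z) <= C * ((1 + norm z) ^ k * norm (pft \<Phi> z))" for z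
 proof -
 have "norm (a z) * ((1 + norm z) ^ (2 * DIM('a \<times> 'b)) * norm (pft \<Phi> z)) <= (C * (1 + norm z) ^ l) * ((1 + norm z) ^ (2 * DIM('a \<times> 'b)) * norm (pft \<Phi> z))"
  by (intro mult_right_mono C) auto
 thus ?thesis by (simp add: norm_mult k_def power_add mult_ac)
 qed
 ultimately have "(1 + norm z) ^ (2 * DIM('a \<times> 'b)) * norm (a z * pft \<Phi> z) <= C * (E * B)" for z using order_trans by blast
 from integrable_of_decay(2)[OF _ this] show ?thesis
 unfolding Kop_eq[OF a \<Phi>] I_def using schwartz_measurable[OF schwartz_Kop[OF a \<Phi>]] by (simp add: mult_ac)
 qed
 thus ?case by blast
qed

lemma integral_by_parts:
 assumes f: "om f" and g: "schwartz g" and v: "v : Basis"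
 shows "(LBINT x. f x * dirD v g x) = - (LBINT x. dirD v f x * g x)"
proof -
 have "has_dir (%x. f x * g x) v (dirD v f x * g x + f x * dirD v g x) x" for x
 by (rule has_dir_bilinear[OF bounded_bilinear_mult Cinf_on_has_dir[OF om_Cinf[OF f] v UNIV_I] Cinf_on_has_dir[OF schwartzD(1)[OF g] v UNIV_I]])
 hence "dirD v (%x. f x * g x) = (%x. dirD v f x * g x + f x * dirD v g x)" using dirD_eq by blast
 hence "0 = (LBINT x. dirD v f x * g x + f x * dirD v g x)"
 using integral_dirD[OF schwartz_om[OF g f], of v] by simp
 also have "... = (LBINT x. dirD v f x * g x) + (LBINT x. f x * dirD v g x)"
 using om_Dl[OF f, of "[v]"] v
 by (intro Bochner_Integration.integral_add schwartz_integrable schwartz_om f g schwartz_dirD_any) (auto simp: Dl_Cons)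
 finally show ?thesis by (simp add: eq_neg_iff_add_eq_0 add.commute)
qed

text \<open>Integration by parts takes the outermost direction off g and puts it innermost on f;
  symmetry of derivatives restores the order.\<close>

lemma integral_by_parts_list:
 assumes "om f" "schwartz g" "set vs <= Basis"
 shows "(-1) ^ length vs * (LBINT x. f x * Dl vs g x) = (LBINT x. Dl vs f x * g x)"
 using assms
proof (induction vs arbitrary: f)
 case (Cons v vs)
 hence v: "v : Basis" and vs: "set vs <= Basis" by auto
 have "(LBINT x. f x * Dl (v # vs) g x) = - (LBINT x. dirD v f x * Dl vs g x)"
 unfolding Dl_Cons by (rule integral_by_parts[OF Cons.prems(1) schwartz_Dl[OF Cons.prems(2) vs] v])
 moreover have "om (dirD v f)" using om_Dl[OF Cons.prems(1), of "[v]"] v by (simp add: Dl_Cons)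
 from Cons.IH[OF this Cons.prems(2) vs]
 have "(-1) ^ length vs * (LBINT x. dirD v f x * Dl vs g x) = (LBINT x. Dl (vs @ [v]) f x * g x)"
 by (simp add: Dl_append Dl_Cons)
 moreover have "Dl (vs @ [v]) f x = Dl (v # vs) f x" for x
 by (rule Dl_perm[OF open_UNIV om_Cinf[OF Cons.prems(1)]]) auto
 ultimately show ?case by simp
qed simp

subsection \<open>Anisotropic dilations\<close>

text \<open>The weight of a single direction as a natural number; it is also the power of r by which
  \<open>dil\<close> divides the coordinate.\<close>

definition wt :: "'n => 'n => nat" where
 "wt d i = (if i = d then 2 else 1)"

lemma Basis_cdir: "(Basis :: (real^'n) set) = range cdir"
 by (auto simp: Basis_vec_def cdir_def)

lemma Basis_xudir: "(Basis :: ((real^'n) \<times> (real^'n)) set) = range xdir \<union> range udir"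
 by (auto simp: Basis_prod_def Basis_cdir cdir_def xdir_def udir_def)

lemma anorm_nonneg [simp]: "0 <= anorm d u"
 by (simp add: anorm_def sum_nonneg)

lemma anorm_zero [simp]: "anorm d 0 = 0"
 by (simp add: anorm_def)

lemma anorm_eq_0_iff [simp]: "anorm d u = 0 \<longleftrightarrow> u = 0"
proof
 assume "anorm d u = 0"
 hence "(\<Sum>i\<in>UNIV - {d}. (u $ i)\<^sup>2) = 0" "u $ d = 0"
 using real_sqrt_ge_zero[of "\<Sum>i\<in>UNIV - {d}. (u $ i)\<^sup>2"] real_sqrt_ge_zero[of "\<bar>u $ d\<bar>"]
 by (auto simp: anorm_def add_nonneg_eq_0_iff sum_nonneg)
 thus "u = 0" by (metis (no_types, lifting) DiffI UNIV_I finite_Diff finite_code singletonD sum_nonneg_eq_0_iff vec_eq_iff zero_eq_power2 zero_index zero_le_power2)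
qed simp

lemma anorm_pos [simp]: "0 < anorm d u \<longleftrightarrow> u ~= 0"
 using anorm_nonneg[of d u] anorm_eq_0_iff[of d u] by linarith

lemma continuous_anorm: "continuous_on UNIV (anorm d)"
 unfolding anorm_def[abs_def] by (intro continuous_intros)

lemma measurable_anorm [measurable]: "anorm d : borel_measurable borel"
 by (rule borel_measurable_continuous_onI[OF continuous_anorm])

lemma component_le_anorm: "\<bar>u $ i\<bar> <= anorm d u ^ wt d i"
proof (cases "i = d")
 case True
 have "sqrt \<bar>u $ d\<bar> <= anorm d u" by (simp add: anorm_def sum_nonneg)
 hence "(sqrt \<bar>u $ d\<bar>)\<^sup>2 <= (anorm d u)\<^sup>2" by (intro power_mono) auto
 thus ?thesis using True by (simp add: wt_def)
next
 case False
 have "(u $ i)\<^sup>2 <= (\<Sum>i\<in>UNIV - {d}. (u $ i)\<^sup>2)" using False by (intro member_le_sum) auto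
 hence "\<bar>u $ i\<bar> <= sqrt (\<Sum>i\<in>UNIV - {d}. (u $ i)\<^sup>2)" using real_sqrt_le_mono by fastforce
 also have "... <= anorm d u" by (simp add: anorm_def)
 finally show ?thesis using False by (simp add: wt_def)
qed

lemma norm_le_anorm:
 fixes u :: "real^'n"
 shows "norm u <= anorm d u + (anorm d u)\<^sup>2"
proof -
 have "(norm u)\<^sup>2 = (u $ d)\<^sup>2 + (\<Sum>i\<in>UNIV - {d}. (u $ i)\<^sup>2)"
 unfolding norm_vec_def L2_set_def by (simp add: sum_nonneg sum.remove[of UNIV d])
 hence "norm u = sqrt (...)" by (metis norm_ge_zero real_sqrt_unique)
 also have "... <= sqrt ((u $ d)\<^sup>2) + sqrt (\<Sum>i\<in>UNIV - {d}. (u $ i)\<^sup>2)"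
 by (intro sqrt_add_le_add_sqrt) (auto simp: sum_nonneg)
 also have "... <= (anorm d u)\<^sup>2 + anorm d u"
 using component_le_anorm[of u d d] by (intro add_mono) (auto simp: wt_def anorm_def)
 finally show ?thesis by simp
qed

lemma anorm_le_norm: "anorm d u <= 2 * (1 + norm (u :: real^'n))"
proof -
 have 1: "sqrt (\<Sum>i\<in>UNIV - {d}. (u $ i)\<^sup>2) <= norm u"
 unfolding norm_vec_def L2_set_def by (intro real_sqrt_le_mono) (auto intro!: sum_mono2)
 have 2: "sqrt \<bar>u $ d\<bar> <= 1 + norm u"
 proof -
 have "\<bar>u $ d\<bar> <= (1 + norm u)\<^sup>2"
 unfolding power2_sum one_power2 mult_1_right using component_le_norm_cart[of u d] zero_le_power2[of "norm u"] norm_ge_zero[of u]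
 by linarith
 hence "sqrt \<bar>u $ d\<bar> <= sqrt ((1 + norm u)\<^sup>2)" by (rule real_sqrt_le_mono)
 thus ?thesis by simp
 qed
 show ?thesis using add_mono[OF 1 2] by (simp add: anorm_def)
qed

text \<open>\<open>anorm d u\<close> is at most a sum of CARD('n) terms, |u_i| or, for the
  distinguished coordinate, its square root, and one of them is at least the mean. This is the
  coordinate in which to integrate by parts.\<close>

lemma anorm_large_component:
 fixes u :: "real^'n"
 obtains i where "(anorm d u / CARD('n)) ^ wt d i <= \<bar>u $ i\<bar>"
proof -
 define g where "g i = (if i = d then sqrt \<bar>u $ i\<bar> else \<bar>u $ i\<bar>)" for i
 have "sqrt (\<Sum>i\<in>UNIV - {d}. (u $ i)\<^sup>2) <= (\<Sum>i\<in>UNIV - {d}. \<bar>u $ i\<bar>)"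
 using L2_set_le_sum_abs[of "%i. u $ i" "UNIV - {d}"] by (simp add: L2_set_def)
 also have "... = (\<Sum>i\<in>UNIV - {d}. g i)" by (intro sum.cong) (auto simp: g_def)
 finally have sum: "anorm d u <= (\<Sum>i\<in>UNIV. g i)"
 by (simp add: anorm_def sum.remove[of UNIV d] g_def)
 have "EX i. anorm d u / CARD('n) <= g i"
 proof (rule ccontr)
 assume "\<not> ?thesis"
 hence "(\<Sum>i\<in>UNIV. g i) < (\<Sum>i\<in>(UNIV :: 'n set). anorm d u / CARD('n))"
 by (intro sum_strict_mono) (auto simp: not_le)
 thus False using sum by simp
 qed
 then obtain i where i: "anorm d u / CARD('n) <= g i" by blast
 hence "(anorm d u / CARD('n)) ^ wt d i <= g i ^ wt d i" by (intro power_mono) auto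
 also have "... = \<bar>u $ i\<bar>" by (simp add: g_def wt_def)
 finally show ?thesis using that by blast
qed

lemma dil_component: "dil d r u $ i = u $ i / r ^ wt d i"
 by (simp add: dil_def wt_def)

lemma linear_dil: "linear (dil d r)"
 by (auto intro!: linearI simp: vec_eq_iff dil_component add_divide_distrib)

lemma dil_dil: "r ~= 0 ==> dil d (1 / r) (dil d r u) = u" "r ~= 0 ==> dil d r (dil d (1 / r) u) = u"
 by (simp_all add: vec_eq_iff dil_component power_divide)

lemma dil_inner: "dil d r u \<bullet> v = u \<bullet> dil d r v"
 by (simp add: inner_vec_def dil_component)

lemma anorm_dil:
 assumes "r > 0" shows "anorm d (dil d r u) = anorm d u / r"
proof -
 have "(\<Sum>i\<in>UNIV - {d}. (dil d r u $ i)\<^sup>2) = (\<Sum>i\<in>UNIV - {d}. (u $ i)\<^sup>2) / r\<^sup>2"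
 unfolding sum_divide_distrib by (intro sum.cong) (auto simp: dil_component wt_def power_divide)
 thus ?thesis using assms
 by (simp add: anorm_def real_sqrt_divide dil_component wt_def add_divide_distrib)
qed

lemma dil_cdir: "dil d r (cdir i) = (1 / r ^ wt d i) *\<^sub>R cdir i"
 by (simp add: vec_eq_iff dil_component cdir_def axis_def)

lemma measurable_dil [measurable]: "dil d r : borel \<rightarrow>\<^sub>M borel"
 by (intro borel_measurable_continuous_onI linear_continuous_on) (use linear_dil linear_linear in blast)

text \<open>Each ordinary coordinate contributes one factor r and the distinguished one contributes
  two; this is the origin of Q = N + 1.\<close>

lemma integral_dil:
 fixes f :: "real^'n => complex"
 assumes r: "r > 0" and f: "f : borel_measurable borel"
 shows "(LBINT u. f (dil d r u)) = cor (r ^ (CARD('n) + 1)) * (LBINT u. f u)"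
proof -
 define A :: "real^'n^'n" where "A = (\<chi> i j. if i = j then 1 / r ^ wt d i else 0)"
 have "(\<Sum>j\<in>UNIV. A $ i $ j * u $ j) = dil d r u $ i" for u i
 proof -
 have "(\<Sum>j\<in>UNIV. A $ i $ j * u $ j) = (\<Sum>j\<in>UNIV. if j = i then u $ i / r ^ wt d i else 0)"
 by (intro sum.cong) (auto simp: A_def)
 thus ?thesis by (simp add: dil_component)
 qed
 hence Av: "A *v u = dil d r u" for u by (simp add: matrix_vector_mult_def vec_eq_iff)
 have "(\<Prod>i\<in>UNIV. 1 / r ^ wt d i) = 1 / r\<^sup>2 * (\<Prod>i\<in>UNIV - {d}. 1 / r)"
 by (subst prod.remove[of UNIV d]) (auto simp: wt_def intro!: prod.cong)
 also have "... = 1 / r ^ (CARD('n) + 1)"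
 proof -
 obtain m where "CARD('n) = Suc m" using card_Suc_Diff1[of UNIV d] by (metis finite_class.finite_UNIV UNIV_I)
 thus ?thesis using r by (simp add: card_Diff_singleton power2_eq_square power_one_over field_simps)
 qed
 finally have dA: "det A = 1 / r ^ (CARD('n) + 1)"
 by (subst det_diagonal) (auto simp: A_def)
 have "cor (r ^ (CARD('n) + 1)) * cor \<bar>det A\<bar> = 1"
 unfolding dA of_real_mult[symmetric] using r by simp
 moreover have "(LBINT u. f u) = cor \<bar>det A\<bar> * (LBINT u. f (dil d r u))"
 using integral_matrix[OF _ f, of A] r by (simp add: Av dA)
 ultimately show ?thesis by (metis (no_types, lifting) mult.assoc mult_1)
qed

subsection \<open>Symbol estimates\<close>

text \<open>A family \<open>F p\<close> of functions on \<open>U\<close> satisfies symbol estimates of order \<open>s\<close> with weight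
 function \<open>\<rho>\<close>, uniformly in \<open>p \<in> P\<close>; a derivative in the direction \<open>v\<close> lowers the order by
 \<open>dg v\<close>. Amplitudes, kernels away from the diagonal and the cutoff functions are all instances.\<close>

definition gsym :: "'p set => 'a::euclidean_space set => ('a => real) => ('a => real) => real => ('p => 'a => complex) => bool" where
 "gsym P U \<rho> dg s F \<longleftrightarrow> (ALL p:P. Cinf_on U (F p)) \<and>
 (ALL vs. set vs <= Basis --> (EX C. ALL p:P. ALL z:U. norm (Dl vs (F p) z) <= C * \<rho> z powr (s - (\<Sum>v\<leftarrow>vs. dg v))))"

lemma gsym_Cinf: "gsym P U \<rho> dg s F ==> p : P ==> Cinf_on U (F p)"
 by (simp add: gsym_def)

lemma gsym_bound:
 assumes "gsym P U \<rho> dg s F" "set vs <= Basis"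
 shows "EX C. C >= 0 & (ALL p:P. ALL z:U. norm (Dl vs (F p) z) <= C * \<rho> z powr (s - (\<Sum>v\<leftarrow>vs. dg v)))"
proof -
 obtain C where C: "!!p z. p : P ==> z : U ==> norm (Dl vs (F p) z) <= C * \<rho> z powr (s - (\<Sum>v\<leftarrow>vs. dg v))"
 using assms unfolding gsym_def by meson
 have "norm (Dl vs (F p) z) <= \<bar>C\<bar> * \<rho> z powr (s - (\<Sum>v\<leftarrow>vs. dg v))" if "p : P" "z : U" for p z
 by (rule order_trans[OF C[OF that]]) (intro mult_right_mono; simp)
 thus ?thesis by (intro exI[of _ "\<bar>C\<bar>"]) auto
qed

lemma gsymI:
 assumes "!!p. p : P ==> Cinf_on U (F p)"
 and "!!vs. set vs <= Basis ==> EX C. ALL p:P. ALL z:U. norm (Dl vs (F p) z) <= C * \<rho> z powr (s - (\<Sum>v\<leftarrow>vs. dg v))"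
 shows "gsym P U \<rho> dg s F"
 using assms by (simp add: gsym_def)

lemma gsym_reindex:
 "gsym P U \<rho> dg s F ==> (!!q. q : Q ==> h q : P) ==> gsym Q U \<rho> dg s (%q. F (h q))"
 unfolding gsym_def by meson

lemma gsym_dirD:
 fixes F :: "'p => 'a::euclidean_space => complex"
 assumes "gsym P U \<rho> dg s F" "v : Basis"
 shows "gsym P U \<rho> dg (s - dg v) (%p. dirD v (F p))"
proof (rule gsymI)
 show "Cinf_on U (dirD v (F p))" if "p : P" for p
 by (rule Cinf_on_dirD[OF gsym_Cinf[OF assms(1) that] assms(2)])
 fix vs :: "'a list" assume "set vs <= Basis"
 hence "set (vs @ [v]) <= Basis" using assms(2) by simp
 from gsym_bound[OF assms(1) this]
 show "EX C. ALL p:P. ALL z:U. norm (Dl vs (dirD v (F p)) z) <= C * \<rho> z powr (s - dg v - (\<Sum>v\<leftarrow>vs. dg v))"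
 by (auto simp: Dl_append Dl_Cons algebra_simps)
qed

lemma gsym_mult:
 fixes F :: "'p => 'a::euclidean_space => complex"
 assumes "open U" "gsym P U \<rho> dg s F" "gsym P U \<rho> dg t G"
 shows "gsym P U \<rho> dg (s + t) (%p z. F p z * G p z)"
proof (rule gsymI)
 show "Cinf_on U (%z. F p z * G p z)" if "p : P" for p
 by (rule Cinf_on_mult[OF assms(1) gsym_Cinf[OF assms(2) that] gsym_Cinf[OF assms(3) that]])
 fix vs :: "'a list" assume vs: "set vs <= Basis"
 show "EX C. ALL p:P. ALL z:U. norm (Dl vs (%z. F p z * G p z) z) <= C * \<rho> z powr (s + t - (\<Sum>v\<leftarrow>vs. dg v))"
 proof (rule Leibniz_bound[OF assms(1) gsym_Cinf[OF assms(2)] gsym_Cinf[OF assms(3)] vs _ order_refl])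
 fix a b assume ab: "mset a + mset b = mset vs" "set a <= Basis" "set b <= Basis"
 have deg: "(\<Sum>v\<leftarrow>vs. dg v) = (\<Sum>v\<leftarrow>a. dg v) + (\<Sum>v\<leftarrow>b. dg v)"
 by (simp add: sum_mset_sum_list[symmetric] ab(1)[symmetric])
 obtain C where C: "C >= 0" "!!p z. p : P ==> z : U ==> norm (Dl a (F p) z) <= C * \<rho> z powr (s - (\<Sum>v\<leftarrow>a. dg v))"
 using gsym_bound[OF assms(2) ab(2)] by blast
 obtain D where D: "D >= 0" "!!p z. p : P ==> z : U ==> norm (Dl b (G p) z) <= D * \<rho> z powr (t - (\<Sum>v\<leftarrow>b. dg v))"
 using gsym_bound[OF assms(3) ab(3)] by blast
 have "norm (Dl a (F p) z) * norm (Dl b (G p) z) <= (C * D) * \<rho> z powr (s + t - (\<Sum>v\<leftarrow>vs. dg v))" if "p : P" "z : U" for p z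
 proof -
 have "norm (Dl a (F p) z) * norm (Dl b (G p) z) <= (C * \<rho> z powr (s - (\<Sum>v\<leftarrow>a. dg v))) * (D * \<rho> z powr (t - (\<Sum>v\<leftarrow>b. dg v)))"
  by (intro mult_mono C D that) (auto simp: C)
 also have "... = (C * D) * \<rho> z powr ((s - (\<Sum>v\<leftarrow>a. dg v)) + (t - (\<Sum>v\<leftarrow>b. dg v)))"
  by (simp add: powr_add)
 finally show ?thesis by (simp add: deg algebra_simps)
 qed
 thus "EX C. ALL p:P. ALL z:U. norm (Dl a (F p) z) * norm (Dl b (G p) z) <= C * \<rho> z powr (s + t - (\<Sum>v\<leftarrow>vs. dg v))"
 by blast
 qed
qed

lemma gsym_diff:
 fixes F :: "'p => 'a::euclidean_space => complex"
 assumes "open U" "gsym P U \<rho> dg s F" "gsym P U \<rho> dg s G"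
 shows "gsym P U \<rho> dg s (%p z. F p z - G p z)"
proof (rule gsymI)
 show "Cinf_on U (%z. F p z - G p z)" if "p : P" for p
 by (rule Cinf_on_diff[OF assms(1) gsym_Cinf[OF assms(2) that] gsym_Cinf[OF assms(3) that]])
 fix vs :: "'a list" assume vs: "set vs <= Basis"
 obtain C where C: "C >= 0" "!!p z. p : P ==> z : U ==> norm (Dl vs (F p) z) <= C * \<rho> z powr (s - (\<Sum>v\<leftarrow>vs. dg v))"
 using gsym_bound[OF assms(2) vs] by blast
 obtain D where D: "D >= 0" "!!p z. p : P ==> z : U ==> norm (Dl vs (G p) z) <= D * \<rho> z powr (s - (\<Sum>v\<leftarrow>vs. dg v))"
 using gsym_bound[OF assms(3) vs] by blast
 have "norm (Dl vs (%z. F p z - G p z) z) <= (C + D) * \<rho> z powr (s - (\<Sum>v\<leftarrow>vs. dg v))" if "p : P" "z : U" for p z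
 unfolding Cinf_on_diff(2)[OF assms(1) gsym_Cinf[OF assms(2) that(1)] gsym_Cinf[OF assms(3) that(1)] vs that(2)] distrib_right
 by (rule order_trans[OF norm_triangle_ineq4 add_mono[OF C(2)[OF that] D(2)[OF that]]])
 thus "EX C. ALL p:P. ALL z:U. norm (Dl vs (%z. F p z - G p z) z) <= C * \<rho> z powr (s - (\<Sum>v\<leftarrow>vs. dg v))" by blast
qed

lemma gsym_const:
 fixes U :: "'a::euclidean_space set"
 assumes U: "open U" and \<rho>: "!!z. z : U ==> 0 < \<rho> z"
 shows "gsym P U \<rho> dg 0 (%p z. c)"
proof (rule gsymI)
 show "Cinf_on U (%z. c)" using U by (simp add: Cinf_on_const)
 fix vs :: "'a list" assume vs: "set vs <= Basis"
 have "Dl vs (%z. c) z = (if vs = [] then c else 0)" if "z : U" for z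
 by (rule Cinf_on_seqI(2)[OF U, where P = "%vs x. if vs = [] then c else 0", OF _ _ _ vs that])
 (auto simp: has_dir_const)
 thus "EX C. ALL p:P. ALL z:U. norm (Dl vs (%z. c) z) <= C * \<rho> z powr (0 - (\<Sum>v\<leftarrow>vs. dg v))"
 using less_imp_neq[OF \<rho>] by (intro exI[of _ "if vs = [] then norm c else 0"]) auto
qed

text \<open>Only the values on basis vectors matter: x-directions cost nothing, u-directions cost
  their weight.\<close>

definition xudeg :: "'n::finite => (real^'n) \<times> (real^'n) => real" where
 "xudeg d v = (if fst v ~= 0 then 0 else if snd v = axis d 1 then 2 else 1)"

definition udeg :: "'n::finite => real^'n => real" where
 "udeg d v = (if v = axis d 1 then 2 else 1)"

lemma xudeg_simps [simp]: "xudeg d (xdir i) = 0" "xudeg d (udir i) = wt d i"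
 and udeg_cdir [simp]: "udeg d (cdir i) = wt d i"
 by (auto simp: xudeg_def udeg_def xdir_def udir_def cdir_def axis_eq_axis wt_def)

lemma wdeg_Cons: "wdeg d (i # al) = wt d i + wdeg d al"
 by (simp add: wdeg_def wt_def)

lemma wdeg_Nil [simp]: "wdeg d [] = 0"
 by (simp add: wdeg_def)

lemma wdeg_sum: "(\<Sum>v\<leftarrow>map udir al. xudeg d v) = wdeg d al" "(\<Sum>v\<leftarrow>map cdir al. udeg d v) = wdeg d al"
 "(\<Sum>v\<leftarrow>map xdir I. xudeg d v) = 0"
 by (induction al) (auto simp: wdeg_Cons, induction I, auto)

lemma sort_directions:
 assumes "set vs <= (Basis :: ((real^'n) \<times> (real^'n)) set)"
 obtains I al where "mset vs = mset (map xdir I @ map udir al)"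
proof -
 have "EX I al. mset vs = mset (map xdir I @ map udir al)" using assms
 proof (induction vs)
 case (Cons v vs)
 then obtain I al where *: "mset vs = mset (map xdir I @ map udir al)" by auto
 consider i where "v = xdir i" | i where "v = udir i" using Cons.prems by (auto simp: Basis_xudir)
 thus ?case
 proof cases
 case 1 thus ?thesis using * by (intro exI[of _ "i # I"] exI[of _ al]) simp
 next
 case 2 thus ?thesis using * by (intro exI[of _ I] exI[of _ "i # al"]) simp
 qed
 qed auto
 thus ?thesis using that by blast
qed

lemma cdir_lists: "set vs <= (Basis :: (real^'n) set) \<longleftrightarrow> (EX al. vs = map cdir al)"
proof
 assume "set vs <= (Basis :: (real^'n) set)"
 thus "EX al. vs = map cdir al"
 by (simp add: Basis_cdir ex_map_conv subset_eq) (metis rangeE)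
qed (auto simp: Basis_cdir)

lemma set_xudir: "set (map xdir I @ map udir al) <= Basis" "set (map cdir al) <= Basis"
 by (auto simp: Basis_xudir Basis_cdir)

text \<open>Derivatives commute, so the lists used in the definition of the class, x-directions
  before u-directions, give the estimates for all lists.\<close>

lemma gsym_xudirI:
 fixes F :: "'p => (real^'n) \<times> (real^'n) => complex"
 assumes U: "open U" and "!!p. p : P ==> Cinf_on U (F p)"
 and "!!I al. EX C. ALL p:P. ALL z:U. norm (Dl (map xdir I @ map udir al) (F p) z) <= C * \<rho> z powr (s - wdeg d al)"
 shows "gsym P U \<rho> (xudeg d) s F"
proof (rule gsymI[OF assms(2)])
 fix vs :: "((real^'n) \<times> (real^'n)) list" assume vs: "set vs <= Basis"
 obtain I al where m: "mset vs = mset (map xdir I @ map udir al)" using sort_directions[OF vs] .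
 have "(\<Sum>v\<leftarrow>vs. xudeg d v) = (\<Sum>v\<leftarrow>map xdir I @ map udir al. xudeg d v)"
 by (metis m mset_map sum_mset_sum_list)
 also have "... = wdeg d al" by (simp only: map_append sum_list_append wdeg_sum)
 finally have deg: "(\<Sum>v\<leftarrow>vs. xudeg d v) = wdeg d al" .
 have "Dl vs (F p) z = Dl (map xdir I @ map udir al) (F p) z" if "p : P" "z : U" for p z
 by (rule Dl_perm[OF U assms(2)[OF that(1)] m that(2)])
 thus "EX C. ALL p:P. ALL z:U. norm (Dl vs (F p) z) <= C * \<rho> z powr (s - (\<Sum>v\<leftarrow>vs. xudeg d v))"
 using assms(3)[of I al] by (simp add: deg)
qed

abbreviation symb :: "'n::finite => real => ((real^'n) \<times> (real^'n) => complex) => bool" where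
 "symb d s b \<equiv> gsym (UNIV :: unit set) UNIV (%z. 1 + anorm d (snd z)) (xudeg d) s (%_. b)"

lemma powr_le_power:
 assumes "1 <= (x::real)" shows "x powr t <= x ^ nat \<lceil>\<bar>t\<bar>\<rceil>"
proof -
 have "x powr t <= x powr real (nat \<lceil>\<bar>t\<bar>\<rceil>)" using assms by (intro powr_mono) linarith+
 also have "... = x ^ nat \<lceil>\<bar>t\<bar>\<rceil>" using assms by (intro powr_realpow) linarith
 finally show ?thesis .
qed

lemma symb_imp_om:
 fixes d :: "'n::finite"
 assumes "symb d s b" shows "om b"
 unfolding om_def
proof (intro conjI allI impI)
 show "Cinf_on UNIV b" using gsym_Cinf[OF assms] by simp
 fix vs :: "((real^'n) \<times> (real^'n)) list" assume vs: "set vs <= Basis"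
 define t where "t = s - (\<Sum>v\<leftarrow>vs. xudeg d v)"
 define N where "N = nat \<lceil>\<bar>t\<bar>\<rceil>"
 obtain C where C: "C >= 0" "!!z. norm (Dl vs b z) <= C * (1 + anorm d (snd z)) powr t"
 using gsym_bound[OF assms vs] by (auto simp: t_def)
 have "norm (Dl vs b z) <= (C * 3 ^ N) * (1 + norm z) ^ N" for z
 proof -
 have "(1 + anorm d (snd z)) powr t <= (1 + anorm d (snd z)) ^ N"
 unfolding N_def by (rule powr_le_power) simp
 also have "... <= (3 * (1 + norm z)) ^ N"
 proof (rule power_mono)
 show "1 + anorm d (snd z) <= 3 * (1 + norm z)"
  using anorm_le_norm[of d "snd z"] norm_snd_le[of "snd z" "fst z"] norm_ge_zero[of z]
  by (simp del: norm_ge_zero)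
 qed simp
 finally have "C * (1 + anorm d (snd z)) powr t <= C * (3 * (1 + norm z)) ^ N" by (intro mult_left_mono C)
 thus ?thesis using order_trans[OF C(2)[of z]] by (simp only: power_mult_distrib mult.assoc)
 qed
 thus "EX C k. ALL x. norm (Dl vs b x) <= C * (1 + norm x) ^ k" by blast
qed

subsection \<open>The operators of the class in terms of their amplitudes\<close>

lemma det_bound:
 fixes M :: "real^'n^'n" and K :: real
 assumes "!!i j. \<bar>M $ i $ j\<bar> <= K"
 shows "\<bar>det M\<bar> <= card {p. p permutes (UNIV :: 'n set)} * K ^ CARD('n)"
proof -
 have "\<bar>det M\<bar> <= (\<Sum>p\<in>{p. p permutes UNIV}. \<bar>of_int (sign p) * (\<Prod>i\<in>UNIV. M $ i $ p i)\<bar>)" (is "_ <= ?S")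
 unfolding det_def by (rule sum_abs)
 also have "?S <= sum (%p. K ^ CARD('n)) {p. p permutes (UNIV :: 'n set)}"
 proof (rule sum_mono)
 fix p :: "'n => 'n"
 have "\<bar>of_int (sign p) * (\<Prod>i\<in>UNIV. M $ i $ p i)\<bar> = (\<Prod>i\<in>UNIV. \<bar>M $ i $ p i\<bar>)"
 by (simp add: abs_mult sign_def abs_prod)
 also have "... <= (\<Prod>i\<in>(UNIV :: 'n set). K)" by (intro prod_mono) (auto simp: assms)
 finally show "\<bar>of_int (sign p) * (\<Prod>i\<in>UNIV. M $ i $ p i)\<bar> <= K ^ CARD('n)" by simp
 qed
 finally show ?thesis by simp
qed

text \<open>Cramer's rule: if norm (M x) <= 1, replacing a column of M by M x keeps the entries
  below K, as 1 <= K, so each coordinate of x is a bounded determinant divided by det M. Homogeneity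
  does the rest.\<close>

lemma inverse_bound:
 fixes M :: "real^'n^'n" and K c :: real
 assumes M: "!!i j. \<bar>M $ i $ j\<bar> <= K" and K: "1 <= K" and c: "0 < c" "c <= \<bar>det M\<bar>"
 shows "norm w <= CARD('n) * (card {p. p permutes (UNIV :: 'n set)} * K ^ CARD('n) / c) * norm (M *v w)"
proof -
 define E where "E = card {p. p permutes (UNIV :: 'n set)} * K ^ CARD('n) / c"
 have dM: "det M ~= 0" using c by auto
 have *: "\<bar>x $ k\<bar> <= E" if "norm (M *v x) <= 1" for x k
 proof -
 have "x = (\<chi> k. det (\<chi> i j. if j = k then (M *v x) $ i else M $ i $ j) / det M)"
 using cramer[OF dM, of x "M *v x"] by simp
 hence "x $ k = det (\<chi> i j. if j = k then (M *v x) $ i else M $ i $ j) / det M"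
 by (metis (no_types, lifting) vec_lambda_beta)
 moreover have "\<bar>det (\<chi> i j. if j = k then (M *v x) $ i else M $ i $ j)\<bar> <= card {p. p permutes (UNIV :: 'n set)} * K ^ CARD('n)"
 proof (rule det_bound)
 fix i j
 have "\<bar>(M *v x) $ i\<bar> <= K" using component_le_norm_cart[of "M *v x" i] that K by linarith
 thus "\<bar>(\<chi> i j. if j = k then (M *v x) $ i else M $ i $ j) $ i $ j\<bar> <= K" using M by simp
 qed
 ultimately have "\<bar>x $ k\<bar> <= card {p. p permutes (UNIV :: 'n set)} * K ^ CARD('n) / \<bar>det M\<bar>"
 using dM by (simp add: abs_divide divide_right_mono)
 also have "... <= E" unfolding E_def using c K by (intro divide_left_mono) auto
 finally show ?thesis .
 qed
 show ?thesis
 proof (cases "M *v w = 0")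
 case True
 have "w = 0" using True dM by (metis invertible_det_nz matrix_left_invertible_ker invertible_left_inverse)
 thus ?thesis by simp
 next
 case False
 define t where "t = norm (M *v w)"
 have t: "t > 0" using False by (simp add: t_def)
 have "M *v ((1 / t) *\<^sub>R w) = (1 / t) *\<^sub>R (M *v w)" by (rule matrix_vector_mult_scaleR)
 hence "norm (M *v ((1 / t) *\<^sub>R w)) <= 1" using t by (simp add: t_def)
 from *[OF this] have "\<bar>w $ k\<bar> <= E * t" for k using t by (simp add: field_simps abs_mult)
 hence "(\<Sum>k\<in>UNIV. \<bar>w $ k\<bar>) <= (\<Sum>k\<in>(UNIV :: 'n set). E * t)" by (intro sum_mono)
 hence "norm w <= CARD('n) * (E * t)" using norm_le_l1_cart[of w] by simp
 thus ?thesis by (simp add: E_def t_def mult.assoc)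
 qed
qed

inductive_set addspan :: "('a => complex) set => ('a => complex) set" for S where
 base: "g : S ==> g : addspan S"
| zero: "(%x. 0) : addspan S"
| add: "f : addspan S ==> g : addspan S ==> (%x. f x + g x) : addspan S"

lemma addspan_sum:
 "finite I ==> (!!i. i : I ==> f i : addspan S) ==> (%x. \<Sum>i\<in>I. f i x) : addspan S"
 by (induction I rule: finite_induct) (auto intro: addspan.intros)

text \<open>Differentiating a product returns a sum, so the natural class is closed under
  derivatives only up to addition.\<close>

lemma schwartz_coinduct_upto:
 fixes f :: "'a::euclidean_space => complex"
 assumes f: "f : S" and bd: "!!g. g : S ==> EX B. ALL x. norm (g x) <= B"
 and d: "!!g v. g : S ==> v : Basis ==> EX h:addspan S. ALL x. has_dir g v (h x) x"
 and c: "!!g v. g : S ==> v : Basis ==> (%x. (x \<bullet> v) *\<^sub>R g x) : S"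
 shows "schwartz f"
proof (rule schwartz_coinduct[OF addspan.base[OF f]])
 show "EX B. ALL x. norm (g x) <= B" if "g : addspan S" for g
 using that
 proof induction
 case (add f g)
 then obtain B C where "ALL x. norm (f x) <= B" "ALL x. norm (g x) <= C" by blast
 thus ?case by (intro exI[of _ "B + C"]) (auto intro!: order_trans[OF norm_triangle_ineq] add_mono)
 qed (auto intro: bd)
 show "EX h:addspan S. ALL x. has_dir g v (h x) x" if "g : addspan S" and v: "v : Basis" for g v
 using that(1)
 proof induction
 case (add f g)
 then obtain f' g' where "f' : addspan S" "ALL x. has_dir f v (f' x) x" "g' : addspan S" "ALL x. has_dir g v (g' x) x" by blast
 thus ?case by (intro bexI[of _ "%x. f' x + g' x"]) (auto intro: has_dir_add addspan.add)
 next
 case zero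
 show ?case by (intro bexI[of _ "%x. 0"]) (auto intro: has_dir_const addspan.zero)
 qed (use d v in blast)
 show "(%x. (x \<bullet> v) *\<^sub>R g x) : addspan S" if "g : addspan S" and v: "v : Basis" for g v
 using that(1)
 proof induction
 case (add f g)
 show ?case unfolding scaleR_add_right by (rule addspan.add[OF add(3,4)])
 next
 case zero
 show ?case using addspan.zero by simp
 qed (auto intro: addspan.base c v)
qed

lemma symbI_PsiD:
 assumes "Cinf_on UNIV a"
 and "!!I al. EX C. ALL x \<xi>. norm (Dl (map xdir I @ map udir al) a (x, \<xi>)) <= C * (1 + anorm d \<xi>) powr (n - wdeg d al)"
 shows "symb d n a"
proof (rule gsym_xudirI[OF open_UNIV])
 fix I al
 obtain C where "!!x \<xi>. norm (Dl (map xdir I @ map udir al) a (x, \<xi>)) <= C * (1 + anorm d \<xi>) powr (n - wdeg d al)"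
 using assms(2) by blast
 thus "EX C. ALL p:(UNIV :: unit set). ALL z:UNIV. norm (Dl (map xdir I @ map udir al) a z) <= C * (1 + anorm d (snd z)) powr (n - wdeg d al)"
 by (intro exI[of _ C]) auto
qed (rule assms)

lemma symb_xudir_bound:
 assumes "symb d n a"
 shows "EX C. C >= 0 & (ALL x \<xi>. norm (Dl (map xdir I @ map udir al) a (x, \<xi>)) <= C * (1 + anorm d \<xi>) powr (n - wdeg d al))"
proof -
 have "(\<Sum>v\<leftarrow>map xdir I @ map udir al. xudeg d v) = wdeg d al"
 by (simp only: map_append sum_list_append wdeg_sum)
 thus ?thesis using gsym_bound[OF assms set_xudir(1)[of I al]] by auto
qed

section \<open>The geometry of the frame and the test functions of condition (c)\<close>

locale frame =
 fixes A :: "real^'n => real^'n^'n::finite" and c :: real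
 assumes smoothA: "!!i j. Cinf_on UNIV (%x. A x $ i $ j)"
 and boundedA: "!!i j vs. set vs <= Basis ==> EX C. ALL x. \<bar>Dl vs (%x. A x $ i $ j) x\<bar> <= C"
 and c_pos: "c > 0"
 and detA: "!!x. \<bar>det (A x)\<bar> >= c"
begin

lemma om_A: "om (%x. cor (A x $ i $ j))"
proof -
 have L: "Dl vs (%x. cor (A x $ i $ j)) x = cor (Dl vs (%x. A x $ i $ j) x)" if "set vs <= Basis" for vs x
 by (rule Cinf_on_linear_image(2)[OF bounded_linear_of_real open_UNIV smoothA that UNIV_I])
 show ?thesis unfolding om_def
 proof (intro conjI allI impI)
 fix vs :: "(real^'n) list" assume vs: "set vs <= Basis"
 obtain C where "!!x. \<bar>Dl vs (%x. A x $ i $ j) x\<bar> <= C" using boundedA[OF vs] by blast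
 thus "EX C k. ALL x. norm (Dl vs (%x. cor (A x $ i $ j)) x) <= C * (1 + norm x) ^ k"
 using L[OF vs] by (intro exI[of _ C] exI[of _ 0]) simp
 qed (rule Cinf_on_linear_image(1)[OF bounded_linear_of_real open_UNIV smoothA])
qed

lemma det_nz: "det (A x) ~= 0"
 using detA[of x] c_pos by auto

lemma inv_ex: "A x ** matrix_inv (A x) = mat 1" "matrix_inv (A x) ** A x = mat 1"
proof -
 have "EX B. A x ** B = mat 1 & B ** A x = mat 1"
 using det_nz[of x] unfolding invertible_det_nz[symmetric] invertible_def .
 from someI_ex[OF this] show "A x ** matrix_inv (A x) = mat 1" "matrix_inv (A x) ** A x = mat 1"
 unfolding matrix_inv_def by auto
qed

text \<open>\<open>Lx\<close> sums over the row index of the inverse matrix, whence the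
  transposes.\<close>

lemma Lx_eq: "Lx A x u = transpose (matrix_inv (A x)) *v u"
 by (simp add: Lx_def matrix_vector_mult_def transpose_def)

lemma inv_Lx: "inv (Lx A x) u = transpose (A x) *v u"
proof -
 have "transpose (matrix_inv (A x)) ** transpose (A x) = mat 1" "transpose (A x) ** transpose (matrix_inv (A x)) = mat 1"
 using inv_ex[of x] by (metis matrix_transpose_mul transpose_mat)+
 hence "inv (Lx A x) = (*v) (transpose (A x))"
 by (intro inv_unique_comp) (auto simp: Lx_eq fun_eq_iff matrix_vector_mul_assoc simp del: transpose_matrix_vector)
 thus ?thesis by simp
qed

text \<open>The point y for which u is the coordinate \<Theta>_0(x, y), that is, x - L_x^(-1) u with
  the inverse from \<open>inv_Lx\<close>.\<close>

definition Yx :: "(real^'n) \<times> (real^'n) => real^'n" where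
 "Yx z = fst z - transpose (A (fst z)) *v snd z"

definition \<Phi>fg :: "(real^'n => complex) => (real^'n => complex) => (real^'n) \<times> (real^'n) => complex" where
 "\<Phi>fg f g z = f (Yx z) * g (fst z)"

lemma om_component: "om (%z::(real^'n) \<times> (real^'n). cor (snd z $ j))" "om (%z::(real^'n) \<times> (real^'n). cor (fst z $ j))"
 by (rule om_linear, intro bounded_linear_compose[OF bounded_linear_vec_nth] bounded_linear_fst bounded_linear_snd)+

lemma om_Yx: "om (%z. cor (Yx z $ j))"
proof -
 have "cor (Yx z $ j) = cor (fst z $ j) + (\<Sum>i\<in>UNIV. (-1) * (cor (A (fst z) $ i $ j) * cor (snd z $ i)))" for z
 by (simp add: Yx_def matrix_vector_mult_def transpose_def sum_negf)
 thus ?thesis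
 by (simp only:) (intro om_add om_sum om_mult om_const finite om_component om_linear_compose[OF om_A linear_fst])
qed

lemma Cinf_Yx: "Cinf_on UNIV Yx"
proof -
 have "Cinf_on UNIV (%z. Re (cor (Yx z $ j)))" for j
 by (rule Cinf_on_linear_image(1)[OF bounded_linear_Re open_UNIV om_Cinf[OF om_Yx]])
 hence "Cinf_on UNIV (%z. \<Sum>j\<in>UNIV. (Yx z $ j) *\<^sub>R axis j (1::real))"
 by (intro Cinf_on_sum(1) Cinf_on_linear_image(1)[OF bounded_linear_scaleR_left]) auto
 moreover have "(\<Sum>j\<in>UNIV. (Yx z $ j) *\<^sub>R axis j (1::real)) = Yx z" for z
 by (simp add: vec_eq_iff axis_def if_distrib cong: if_cong)
 ultimately show ?thesis by simp
qed

text \<open>u solves A(x)^T u = x - y, and the inverses of A(x)^T are bounded uniformly in x by the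
  bounds on the entries and the lower bound on the determinant.\<close>

lemma snd_bound: "EX M>=0. ALL z. norm (snd z) <= M * (norm (fst z) + norm (Yx z))"
proof -
 have "ALL i j. EX K. ALL x. \<bar>A x $ i $ j\<bar> <= K" using boundedA[of "[]"] by simp
 then obtain K where K: "!!i j x. \<bar>A x $ i $ j\<bar> <= K i j" by metis
 define K0 where "K0 = 1 + (\<Sum>i\<in>UNIV. \<Sum>j\<in>UNIV. \<bar>K i j\<bar>)"
 have KK: "\<bar>A x $ i $ j\<bar> <= K0" for i j x
 proof -
 have "\<bar>K i j\<bar> <= (\<Sum>j\<in>UNIV. \<bar>K i j\<bar>)" by (rule member_le_sum) auto
 also have "... <= (\<Sum>i\<in>UNIV. \<Sum>j\<in>UNIV. \<bar>K i j\<bar>)" by (rule member_le_sum[of i UNIV "%i. \<Sum>j\<in>UNIV. \<bar>K i j\<bar>"]) (auto simp: sum_nonneg)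
 finally show ?thesis using K[of x i j] by (simp add: K0_def)
 qed
 have K1: "1 <= K0" by (simp add: K0_def sum_nonneg)
 define M where "M = CARD('n) * (card {p. p permutes (UNIV :: 'n set)} * K0 ^ CARD('n) / c)"
 have M: "M >= 0" using K1 c_pos by (simp add: M_def)
 have "norm (snd z) <= M * (norm (fst z) + norm (Yx z))" for z
 proof -
 have "norm (snd z) <= M * norm (transpose (A (fst z)) *v snd z)" unfolding M_def
 by (rule inverse_bound[OF _ K1 c_pos]) (auto simp: transpose_def KK det_transpose[unfolded transpose_def] detA)
 also have "transpose (A (fst z)) *v snd z = fst z - Yx z" by (simp add: Yx_def)
 also have "M * norm (fst z - Yx z) <= M * (norm (fst z) + norm (Yx z))"
 by (intro mult_left_mono norm_triangle_ineq4 M)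
 finally show ?thesis .
 qed
 thus ?thesis using M by blast
qed

text \<open>The class \<open>S\<close> admits multiplier coefficients because the derivatives of
  \<open>Yx\<close> grow with u. Boundedness holds because u is controlled by x and y, where g and f
  decay.\<close>

lemma schwartz_\<Phi>fg:
 assumes "schwartz f" "schwartz g" shows "schwartz (\<Phi>fg f g)"
proof -
 define S where "S = {%z. P z * \<Phi>fg f g z |P f g. om P & schwartz f & schwartz g}"
 have "schwartz (%z. 1 * \<Phi>fg f g z)"
 proof (rule schwartz_coinduct_upto[of _ S])
 show "(%z. 1 * \<Phi>fg f g z) : S" unfolding S_def using assms om_const[of 1]
 by (intro CollectI exI[of _ "%z. 1"] exI[of _ f] exI[of _ g]) auto
 fix F assume "F : S"
 then obtain P f g where F: "F = (%z. P z * \<Phi>fg f g z)" and P: "om P" and f: "schwartz f" and g: "schwartz g"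
 unfolding S_def by blast
 obtain C k where C: "C >= 0" "!!z. norm (P z) <= C * (1 + norm z) ^ k" using om_bound[OF P, of "[]"] by auto
 obtain M where M: "M >= 0" "!!z. norm (snd z) <= M * (norm (fst z) + norm (Yx z))" using snd_bound by blast
 obtain D where D: "D >= 0" "!!x. (1 + norm x) ^ k * norm (f x) <= D" using schwartz_bound[OF f, of "[]" k] by auto
 \<comment> \<open>g gets twice the exponent of f because 1 + norm z is bounded by (1 + M) x^2 y in
   the notation introduced next.\<close>
 obtain E where E: "E >= 0" "!!x. (1 + norm x) ^ (2 * k) * norm (g x) <= E" using schwartz_bound[OF g, of "[]" "2 * k"] by auto
 have "norm (F z) <= C * (1 + M) ^ k * (D * E)" for z
 proof -
 define x where "x = 1 + norm (fst z)"
 define y where "y = 1 + norm (Yx z)"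
 have xy: "1 <= x" "1 <= y" by (auto simp: x_def y_def)
 have "x + y - 1 <= x * y" using mult_nonneg_nonneg[of "x - 1" "y - 1"] xy by (simp add: algebra_simps)
 hence a: "norm (fst z) + norm (Yx z) <= x * y" by (simp add: x_def y_def)
 have "norm (snd z) <= M * (x * y)" by (rule order_trans[OF M(2) mult_left_mono[OF a M(1)]])
 hence "1 + norm (snd z) <= x * y + M * (x * y)"
  using mult_mono[of 1 x 1 y] xy by (intro add_mono) auto
 also have "... = (1 + M) * (x * y)" by (simp add: algebra_simps)
 finally have "1 + norm (snd z) <= (1 + M) * (x * y)" .
 have x2: "x ^ (2 * k) = x ^ k * x ^ k" by (simp add: mult_2 power_add)
 from \<open>1 + norm (snd z) <= (1 + M) * (x * y)\<close> have "x * (1 + norm (snd z)) <= x * ((1 + M) * (x * y))" using xy by (intro mult_left_mono) auto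
 moreover have "1 + norm z <= x * (1 + norm (snd z))"
  using norm_Pair_le[of "fst z" "snd z"] mult_nonneg_nonneg[OF norm_ge_zero[of "fst z"] norm_ge_zero[of "snd z"]]
  by (simp add: x_def algebra_simps del: mult_nonneg_nonneg)
 ultimately have "(1 + norm z) ^ k <= (x * ((1 + M) * (x * y))) ^ k" by (intro power_mono) auto
 hence "C * (1 + norm z) ^ k <= C * (x * ((1 + M) * (x * y))) ^ k" by (intro mult_left_mono C)
 hence "norm (P z) <= C * (x * ((1 + M) * (x * y))) ^ k" using C(2)[of z] by linarith
 hence "norm (F z) <= C * (x * ((1 + M) * (x * y))) ^ k * (norm (f (Yx z)) * norm (g (fst z)))"
  unfolding F \<Phi>fg_def norm_mult by (intro mult_right_mono) auto
 also have "... = C * (1 + M) ^ k * ((y ^ k * norm (f (Yx z))) * (x ^ (2 * k) * norm (g (fst z))))"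
  unfolding x2 by (simp add: power_mult_distrib mult_ac)
 also have "... <= C * (1 + M) ^ k * (D * E)"
  using D(2)[of "Yx z"] E(2)[of "fst z"] C(1) M(1) D(1) xy
  by (intro mult_left_mono mult_mono) (auto simp: x_def y_def)
 finally show ?thesis .
 qed
 thus "EX B. ALL x. norm (F x) <= B" by blast
 fix v :: "(real^'n) \<times> (real^'n)" assume v: "v : Basis"
 have dP: "om (dirD v P)" using om_Dl[OF P, of "[v]"] v by (simp add: Dl_Cons)
 have dY: "has_dir Yx v (dirD v Yx z) z" for z by (rule Cinf_on_has_dir[OF Cinf_Yx v UNIV_I])
 have dYc: "om (%z. cor (dirD v Yx z $ j))" for j
 proof -
 have "dirD v (%z. cor (Yx z $ j)) z = cor (dirD v Yx z $ j)" for z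
  using has_dir_bounded_linear[OF bounded_linear_compose[OF bounded_linear_of_real bounded_linear_vec_nth] dY, of j z]
  by (rule dirD_eq)
 hence "dirD v (%z. cor (Yx z $ j)) = (%z. cor (dirD v Yx z $ j))" by blast
 thus ?thesis using om_Dl[OF om_Yx[of j], of "[v]"] v by (simp add: Dl_Cons)
 qed
 define h where "h z = dirD v P z * \<Phi>fg f g z + ((\<Sum>j\<in>UNIV. (P z * cor (dirD v Yx z $ j)) * \<Phi>fg (dirD (axis j 1) f) g z) + P z * \<Phi>fg f (dirD (fst v) g) z)" for z
 have "has_dir F v (h z) z" for z
 proof -
 have 1: "has_dir (%z. f (Yx z)) v (\<Sum>b\<in>Basis. (dirD v Yx z \<bullet> b) *\<^sub>R dirD b f (Yx z)) z"
  by (rule has_dir_compose[OF open_UNIV schwartzD(1)[OF f] UNIV_I dY])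
 have 2: "has_dir (%z. g (fst z)) v (dirD (fst v) g (fst z)) z"
  using has_dir_any[OF open_UNIV schwartzD(1)[OF g], of "fst z" "fst v"] by (simp add: has_dir_def)
 have 3: "(\<Sum>b\<in>Basis. (dirD v Yx z \<bullet> b) *\<^sub>R dirD b f (Yx z)) = (\<Sum>j\<in>UNIV. cor (dirD v Yx z $ j) * dirD (axis j 1) f (Yx z))"
 proof -
  have "(\<Sum>b\<in>Basis. (dirD v Yx z \<bullet> b) *\<^sub>R dirD b f (Yx z)) = (\<Sum>b\<in>range (%j. axis j 1). (dirD v Yx z \<bullet> b) *\<^sub>R dirD b f (Yx z))"
  by (simp add: Basis_cdir cdir_def[abs_def])
  also have "... = (\<Sum>j\<in>UNIV. (dirD v Yx z \<bullet> axis j 1) *\<^sub>R dirD (axis j 1) f (Yx z))"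
  by (subst sum.reindex) (auto simp: inj_def axis_eq_axis)
  finally show ?thesis by (simp add: inner_axis scaleR_conv_of_real)
 qed
 from has_dir_bilinear[OF bounded_bilinear_mult Cinf_on_has_dir[OF om_Cinf[OF P] v UNIV_I] has_dir_bilinear[OF bounded_bilinear_mult 1 2]]
 show ?thesis unfolding F \<Phi>fg_def[abs_def] h_def 3
  by (simp add: sum_distrib_left sum_distrib_right algebra_simps)
 qed
 moreover have "h : addspan S"
 unfolding h_def[abs_def]
 proof (intro addspan.add addspan_sum finite)
 show "(%z. dirD v P z * \<Phi>fg f g z) : addspan S"
  "(%z. P z * \<Phi>fg f (dirD (fst v) g) z) : addspan S"
  unfolding S_def using dP P f g schwartz_dirD_any[OF g, of "fst v"]
  by (blast intro: addspan.base)+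
 show "(%z. (P z * cor (dirD v Yx z $ j)) * \<Phi>fg (dirD (axis j 1) f) g z) : addspan S" for j
  unfolding S_def using g schwartz_dirD_any[OF f, of "axis j 1"] om_mult[OF P dYc[of j]]
  by (intro addspan.base CollectI exI[of _ "%z. P z * cor (dirD v Yx z $ j)"] exI[of _ "dirD (axis j 1) f"] exI[of _ g]) simp
 qed
 ultimately show "EX h:addspan S. ALL x. has_dir F v (h x) x" by blast
 have "(%z. (z \<bullet> v) *\<^sub>R F z) = (%z. (cor (z \<bullet> v) * P z) * \<Phi>fg f g z)"
 by (simp add: F scaleR_conv_of_real mult.assoc)
 thus "(%z. (z \<bullet> v) *\<^sub>R F z) : S" unfolding S_def using om_mult[OF om_inner P, of v] f g
 by (intro CollectI exI[of _ "%z. cor (z \<bullet> v) * P z"] exI[of _ f] exI[of _ g]) simp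
 qed
 thus ?thesis by simp
qed

text \<open>Substitute y = x - A(x)^T u. Then u . (A(x) \<xi>) = (x - y) . \<xi>, and the Jacobian
  is the determinant on the left.\<close>

lemma pft_\<Phi>fg:
 assumes f: "schwartz f"
 shows "pft (\<Phi>fg f g) (x, A x *v \<xi>) * cor \<bar>det (A x)\<bar> = fourier f \<xi> * cis (2 * pi * (x \<bullet> \<xi>)) * g x"
proof -
 have fm [measurable]: "f : borel_measurable borel" by (rule schwartz_measurable[OF f])
 define B where "B = transpose (A x)"
 have dB: "det B = det (A x)" by (simp add: B_def det_transpose)
 define k where "k y = f y * cis (2 * pi * ((x - y) \<bullet> \<xi>))" for y
 have km: "k : borel_measurable borel" unfolding k_def[abs_def] by measurable
 have adj: "(B *v u) \<bullet> \<xi> = u \<bullet> (A x *v \<xi>)" for u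
 unfolding B_def transpose_matrix_vector by (rule dot_lmul_matrix)
 have "pft (\<Phi>fg f g) (x, A x *v \<xi>) = g x * (LBINT u. k (x - B *v u))"
 by (simp add: pft_def ft_def \<Phi>fg_def Yx_def k_def B_def[symmetric] adj integral_mult_right_zero[symmetric] mult_ac del: integral_mult_right_zero)
 also have "(LBINT u. k (x - B *v u)) * cor \<bar>det B\<bar> = (LBINT y. k (x - y))"
 using integral_matrix[of B "%y. k (x - y)"] dB det_nz[of x] km by (simp add: mult.commute)
 hence "g x * (LBINT u. k (x - B *v u)) * cor \<bar>det (A x)\<bar> = g x * (LBINT y. k (x - y))"
 by (simp add: dB mult.assoc)
 also have "(LBINT y. k (x - y)) = (LBINT y. k y)"
 proof -
 have "(LBINT y. k (x - y)) = cor (\<bar>-1\<bar> ^ DIM(real^'n)) * (LBINT y. k (x - (-1) *\<^sub>R y))"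
 using km by (intro integral_scaleR_arg) auto
 thus ?thesis using integral_translate[OF km, of x] by simp
 qed
 also have "(LBINT y. k y) = cis (2 * pi * (x \<bullet> \<xi>)) * fourier f \<xi>"
 proof -
 have "k y = cis (2 * pi * (x \<bullet> \<xi>)) * (f y * cis (- 2 * pi * (y \<bullet> \<xi>)))" for y
 by (simp add: k_def inner_diff_left algebra_simps cis_mult)
 thus ?thesis by (simp add: fourier_def)
 qed
 finally show ?thesis by (simp add: mult_ac)
qed

lemma Kop_\<Phi>fg:
 assumes a: "om a" and f: "schwartz f" and g: "schwartz g"
 shows "Kop a (\<Phi>fg f g) = (LBINT x. (LBINT \<xi>. a (x, A x *v \<xi>) * fourier f \<xi> * cis (2 * pi * (x \<bullet> \<xi>))) * g x)"
proof -
 have "(LBINT et. a (x, et) * pft (\<Phi>fg f g) (x, et)) = (LBINT \<xi>. a (x, A x *v \<xi>) * fourier f \<xi> * cis (2 * pi * (x \<bullet> \<xi>))) * g x" for x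
 proof -
 have m: "(%et. a (x, et) * pft (\<Phi>fg f g) (x, et)) : borel_measurable borel"
 by (rule schwartz_measurable[OF schwartz_slice[OF schwartz_Kop[OF a schwartz_\<Phi>fg[OF f g]]]])
 have "(LBINT et. a (x, et) * pft (\<Phi>fg f g) (x, et)) =
  (LBINT \<xi>. a (x, A x *v \<xi>) * (pft (\<Phi>fg f g) (x, A x *v \<xi>) * cor \<bar>det (A x)\<bar>))"
 by (subst integral_matrix[OF det_nz[of x] m]) (simp add: integral_mult_right_zero[symmetric] mult_ac del: integral_mult_right_zero)
 also have "... = (LBINT \<xi>. a (x, A x *v \<xi>) * fourier f \<xi> * cis (2 * pi * (x \<bullet> \<xi>))) * g x"
 unfolding pft_\<Phi>fg[OF f] by (simp add: integral_mult_left_zero[symmetric] mult_ac del: integral_mult_left_zero)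
 finally show ?thesis .
 qed
 thus ?thesis by (simp add: Kop_def)
qed

lemma kernel_cond_c_iff: "kernel_cond_c A T K \<longleftrightarrow> (ALL f g. schwartz f & schwartz g --> T f g = K (\<Phi>fg f g))"
 unfolding kernel_cond_c_def inv_Lx \<Phi>fg_def[abs_def] Yx_def by simp

text \<open>Membership becomes condition (c) for the functional \<open>Kop a\<close>; from here on
  the frame is seen only through the test functions \<open>\<Phi>fg\<close>.\<close>

lemma PsiD_iff: "T : PsiD A d n \<longleftrightarrow> (EX a. symb d n a & kernel_cond_c A T (Kop a))"
proof
 assume "T : PsiD A d n"
 then obtain a where a: "Cinf_on UNIV a"
 "!!I al. EX C. ALL x \<xi>. norm (Dl (map xdir I @ map udir al) a (x, \<xi>)) <= C * (1 + anorm d \<xi>) powr (n - wdeg d al)"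
 "!!f g. schwartz f ==> schwartz g ==> T f g = (LBINT x. (LBINT \<xi>. a (x, A x *v \<xi>) * fourier f \<xi> * cis (2 * pi * (x \<bullet> \<xi>))) * g x)"
 unfolding PsiD_def by blast
 have s: "symb d n a" by (rule symbI_PsiD[OF a(1,2)])
 thus "EX a. symb d n a & kernel_cond_c A T (Kop a)"
 unfolding kernel_cond_c_iff using a(3) Kop_\<Phi>fg[OF symb_imp_om[OF s]] by auto
next
 assume "EX a. symb d n a & kernel_cond_c A T (Kop a)"
 then obtain a where s: "symb d n a" and T: "kernel_cond_c A T (Kop a)" by blast
 have "T f g = (LBINT x. (LBINT \<xi>. a (x, A x *v \<xi>) * fourier f \<xi> * cis (2 * pi * (x \<bullet> \<xi>))) * g x)"
 if "schwartz f" "schwartz g" for f g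
 using T that Kop_\<Phi>fg[OF symb_imp_om[OF s] that] unfolding kernel_cond_c_iff by simp
 moreover have "EX C. ALL x \<xi>. norm (Dl (map xdir I @ map udir al) a (x, \<xi>)) <= C * (1 + anorm d \<xi>) powr (n - wdeg d al)" for I al
 using symb_xudir_bound[OF s] by blast
 ultimately show "T : PsiD A d n"
 unfolding PsiD_def using gsym_Cinf[OF s] by blast
qed

end

subsection \<open>The pairing of the kernel with bump functions\<close>

lemma Dl_vanishes:
 assumes "!!u. u : U ==> f u = 0" "open U" "x : U" shows "Dl vs (f :: 'a::real_normed_vector => 'b::real_normed_vector) x = 0"
proof -
 have "Dl vs (%u :: 'a. 0 :: 'b) = (%u. 0)"
 by (induction vs) (auto simp: Dl_Cons dirD_eq[OF has_dir_const])
 moreover have "Dl vs f x = Dl vs (%u. 0) x" by (rule Dl_cong_on[OF assms(2) _ assms(3)]) (rule assms(1))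
 ultimately show ?thesis by simp
qed

lemma open_anorm_gt: "open {u :: real^'n. r < anorm d u}" "open {u :: real^'n. anorm d u < r}"
 using open_Collect_less[OF continuous_on_const continuous_anorm, of r d] open_Collect_less[OF continuous_anorm continuous_on_const, of d r] by auto

text \<open>A single constant for all bumps with the same \<open>Cb\<close>: on the support anorm <=
  1 gives norm <= 2, hence the weight 3 ^ m.\<close>

lemma bump_bound:
 fixes Cb :: "'n::finite list => real"
 shows "EX B. ALL \<phi> vs u. normalized_bump d Cb \<phi> --> set vs <= Basis --> length vs <= k --> (1 + norm u) ^ m * norm (Dl vs \<phi> u) <= B"
proof -
 define B where "B = (\<Sum>al\<in>{al :: 'n list. set al <= UNIV & length al <= k}. \<bar>Cb al\<bar>)"
 have fin: "finite {al :: 'n list. set al <= UNIV & length al <= k}" by (rule finite_lists_length_le) simp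
 have B0: "0 <= B" by (simp add: B_def sum_nonneg)
 have "(1 + norm u) ^ m * norm (Dl vs \<phi> u) <= 3 ^ m * B"
 if \<phi>: "normalized_bump d Cb \<phi>" and vs: "set vs <= Basis" "length vs <= k" for \<phi> vs u
 proof (cases "anorm d u <= 1")
 case True
 obtain al where al: "vs = map cdir al" using vs(1) cdir_lists by blast
 have "norm (Dl vs \<phi> u) <= Cb al" using \<phi> by (simp add: normalized_bump_def al)
 also have "... <= \<bar>Cb al\<bar>" by simp
 also have "... <= B" unfolding B_def using vs(2) al by (intro member_le_sum fin) auto
 finally have 1: "norm (Dl vs \<phi> u) <= B" .
 have "norm u <= 2" using norm_le_anorm[of u d] True power_mono[of "anorm d u" 1 2] by simp
 hence "(1 + norm u) ^ m <= 3 ^ m" by (intro power_mono) auto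
 thus ?thesis using 1 by (intro mult_mono) auto
 next
 case False
 have "Dl vs \<phi> u = 0"
 by (rule Dl_vanishes[OF _ open_anorm_gt(1)[of 1 d]]) (use \<phi> False in "auto simp: normalized_bump_def")
 thus ?thesis using B0 by simp
 qed
 thus ?thesis by blast
qed

lemma schwartz_bump: "normalized_bump d Cb \<phi> ==> schwartz \<phi>"
 unfolding schwartz_def
proof (intro conjI allI impI)
 assume \<phi>: "normalized_bump d Cb \<phi>"
 thus "Cinf_on UNIV \<phi>" by (simp add: normalized_bump_def)
 fix vs :: "(real^'a) list" and k :: nat assume "set vs <= Basis"
 thus "EX C. ALL x. (1 + norm x) ^ k * norm (Dl vs \<phi> x) <= C"
 using bump_bound[of d Cb "length vs" k] \<phi> by blast
qed

lemma norm_dil_bound: "r > 0 ==> EX B. B >= 0 & (ALL u. norm u <= B * norm (dil d r u))"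
proof -
 assume "r > 0"
 obtain B where "B > 0" "!!x. norm (dil d (1 / r) x) <= B * norm x"
 using linear_bounded_pos[OF linear_dil] by blast
 thus ?thesis using dil_dil(1)[of r d] \<open>r > 0\<close> by (metis less_imp_le less_imp_neq)
qed

lemma schwartz_dil: "schwartz \<phi> ==> r > 0 ==> schwartz (%u. \<phi> (dil d r u))"
 using norm_dil_bound[of r d] schwartz_linear[OF _ linear_dil] by blast

lemma ft_dil:
 fixes \<phi> :: "real^'n => complex"
 assumes "schwartz \<phi>" "r > 0"
 shows "ft (%u. \<phi> (dil d r u)) et = cor (r ^ (CARD('n) + 1)) * ft \<phi> (dil d (1 / r) et)"
proof -
 have [measurable]: "\<phi> : borel_measurable borel" by (rule schwartz_measurable[OF assms(1)])
 have "u \<bullet> et = dil d r u \<bullet> dil d (1 / r) et" for u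
 using assms(2) by (simp add: dil_inner dil_dil)
 thus ?thesis
 unfolding ft_def using integral_dil[OF assms(2), of "%v. \<phi> v * cis (2 * pi * (v \<bullet> dil d (1 / r) et))" d] by simp
qed

lemma has_dir_fst_mult:
 assumes "has_dir (%x. f (x, snd z)) (cdir i) f' (fst z)"
 shows "has_dir (%z. f z * g (snd z) :: complex) (xdir i) (f' * g (snd z)) z"
 using has_dir_bounded_linear[OF bounded_linear_mult_left[of "g (snd z)"] assms]
 by (simp add: has_dir_def xdir_def cdir_def case_prod_beta plus_prod_def)

lemma Dl_xdir_mult:
 fixes f :: "(real^'n) \<times> (real^'n) => complex"
 assumes U: "open U" and f: "Cinf_on U f" and z: "z : U"
 shows "Dl (map xdir I) (%z. f z * g (snd z)) z = Dl (map xdir I) f z * g (snd z)"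
 using z
proof (induction I arbitrary: z)
 case (Cons i I)
 have "has_dir (Dl (map xdir I) f) (xdir i) (Dl (map xdir (i # I)) f z) z"
 using has_dir_any[OF U Cinf_Dl_any[OF U f] Cons.prems] by (simp add: Dl_Cons)
 hence "has_dir (%z. Dl (map xdir I) f z * g (snd z)) (xdir i) (Dl (map xdir (i # I)) f z * g (snd z)) z"
 by (intro has_dir_fst_mult) (simp add: has_dir_def xdir_def cdir_def plus_prod_def)
 from dirD_eq[OF this] show ?case using dirD_cong[OF U Cons.prems Cons.IH] by (simp add: Dl_Cons)
qed simp

text \<open>The density is the integral of an x-derivative of the symbol against the transform of
  the dilated bump. Rescaling the frequency moves the dilation into the symbol, where n >= 0 and r <
  1 let r^(-n) be pulled out of (1 + ||zeta|| / r)^n.\<close>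

lemma Kop_cond_b:
 assumes a: "symb d n a" and n: "n >= 0"
 shows "kernel_cond_b d n (Kop a)"
 unfolding kernel_cond_b_def
proof (intro allI)
 fix Cb :: "'a list => real" and I :: "'a list"
 define b where "b = Dl (map xdir I) a"
 obtain C where C: "C >= 0" "!!x \<xi>. norm (b (x, \<xi>)) <= C * (1 + anorm d \<xi>) powr n"
 using symb_xudir_bound[OF a, of I "[]"] by (auto simp: b_def)
 define N where "N = nat \<lceil>\<bar>n\<bar>\<rceil>"
 define D where "D = DIM(real^'a)"
 \<comment> \<open>N derivatives of the bump offset the growth of the symbol and 2 * D more make the
   frequency integral converge; the weight 2 * D makes the integral over u converge.\<close>
 obtain B where B: "!!\<phi> vs u. normalized_bump d Cb \<phi> ==> set vs <= Basis ==> length vs <= N + 2 * D ==> (1 + norm u) ^ (2 * D) * norm (Dl vs \<phi> u) <= B"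
 using bump_bound[of d Cb "N + 2 * D" "2 * D"] by blast
 define J where "J = (LBINT x. 1 / (1 + norm (x::real^'a)) ^ (2 * D))"
 define E where "E = (1 + real D) ^ (N + 2 * D) * (B * J)"
 define C0 where "C0 = C * 3 ^ N * E * J"
 have oa: "om a" by (rule symb_imp_om[OF a])
 have ob: "om b" unfolding b_def using om_Dl[OF oa, of "map xdir I"] set_xudir(1)[of I "[]"] by simp
 show "EX C. ALL \<phi> r. normalized_bump d Cb \<phi> & 0 < r & r < 1 -->
 (EX h. h : borel_measurable lborel & (ALL x. norm (h x) <= C * r powr - n) \<and>
  (ALL \<psi>. schwartz \<psi> --> (-1) ^ length I * Kop a (%p. Dl (map cdir I) \<psi> (fst p) * \<phi> (dil d r (snd p))) = (LBINT x. h x * \<psi> x)))"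
 proof (intro exI[of _ C0] allI impI, elim conjE)
 fix \<phi> :: "real^'a => complex" and r :: real
 assume \<phi>: "normalized_bump d Cb \<phi>" and r: "0 < r" "r < 1"
 have s\<phi>: "schwartz \<phi>" by (rule schwartz_bump[OF \<phi>])
 define g where "g = ft (%u. \<phi> (dil d r u))"
 have sg: "schwartz g" unfolding g_def by (rule schwartz_ft[OF schwartz_dil[OF s\<phi> r(1)]])
 have decay: "(1 + norm \<zeta>) ^ (N + 2 * D) * norm (ft \<phi> \<zeta>) <= E" for \<zeta>
 unfolding E_def J_def D_def by (rule ft_decay[OF s\<phi>]) (use B[OF \<phi>] in "auto simp: D_def")
 define h where "h x = (LBINT et. b (x, et) * g et)" for x
 have PSb: "PS (%z. b z * g (snd z))" by (rule PS_om[OF PS_snd[OF sg] ob])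
 have hm: "h : borel_measurable borel"
 unfolding h_def[abs_def]
 using integral_family(1)[OF PSb] by (intro borel_measurable_continuous_onI Cinf_on_continuous om_Cinf) simp
 have "norm (h x) <= C0 * r powr - n" for x
 proof -
 have bm: "(%et. b (x, et)) : borel_measurable borel"
  using Cinf_on_continuous[OF Cinf_on_slice[OF om_Cinf[OF ob]]] by (rule borel_measurable_continuous_onI)
 have m: "(%\<zeta>. b (x, dil d r \<zeta>) * ft \<phi> \<zeta>) : borel_measurable borel"
  by (intro borel_measurable_times measurable_compose[OF measurable_dil bm] schwartz_measurable[OF schwartz_ft[OF s\<phi>]])
 have "h x = cor (r ^ (CARD('a) + 1)) * (LBINT et. b (x, dil d r (dil d (1 / r) et)) * ft \<phi> (dil d (1 / r) et))"
  unfolding h_def g_def ft_dil[OF s\<phi> r(1)] using r(1)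
  by (simp add: dil_dil integral_mult_right_zero[symmetric] mult_ac del: integral_mult_right_zero)
 also have "... = cor (r ^ (CARD('a) + 1)) * (cor ((1 / r) ^ (CARD('a) + 1)) * (LBINT \<zeta>. b (x, dil d r \<zeta>) * ft \<phi> \<zeta>))"
  using integral_dil[of "1 / r" "%\<zeta>. b (x, dil d r \<zeta>) * ft \<phi> \<zeta>" d] m r(1) by simp
 also have "... = (LBINT \<zeta>. b (x, dil d r \<zeta>) * ft \<phi> \<zeta>)"
  unfolding mult.assoc[symmetric] of_real_mult[symmetric] power_mult_distrib[symmetric] using r(1) by simp
 also have "norm ... <= (C * r powr - n * 3 ^ N * E) * (LBINT x. 1 / (1 + norm (x::real^'a)) ^ (2 * DIM(real^'a)))"
 proof (rule integrable_of_decay(2)[OF m])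
  fix \<zeta> :: "real^'a"
  have "1 + anorm d (dil d r \<zeta>) <= (1 + anorm d \<zeta>) / r"
  using r by (simp add: anorm_dil field_simps)
  hence "(1 + anorm d (dil d r \<zeta>)) powr n <= ((1 + anorm d \<zeta>) / r) powr n" using n by (intro powr_mono2) auto
  also have "... = (1 + anorm d \<zeta>) powr n * r powr - n" using r by (simp add: powr_divide powr_minus_divide)
  also have "(1 + anorm d \<zeta>) powr n <= (1 + anorm d \<zeta>) ^ N" unfolding N_def by (rule powr_le_power) simp
  also have "(1 + anorm d \<zeta>) ^ N <= (3 * (1 + norm \<zeta>)) ^ N"
  using anorm_le_norm[of d \<zeta>] norm_ge_zero[of \<zeta>] by (intro power_mono) (simp_all del: norm_ge_zero)
  finally have "(1 + anorm d (dil d r \<zeta>)) powr n <= (3 * (1 + norm \<zeta>)) ^ N * r powr - n"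
  by (simp add: mult_right_mono)
  hence "C * (1 + anorm d (dil d r \<zeta>)) powr n <= C * ((3 * (1 + norm \<zeta>)) ^ N * r powr - n)"
  by (intro mult_left_mono C)
  hence "norm (b (x, dil d r \<zeta>)) <= C * ((3 * (1 + norm \<zeta>)) ^ N * r powr - n)"
  using C(2)[of x "dil d r \<zeta>"] by linarith
  hence "(1 + norm \<zeta>) ^ (2 * DIM(real^'a)) * norm (b (x, dil d r \<zeta>) * ft \<phi> \<zeta>) <=
   (1 + norm \<zeta>) ^ (2 * D) * ((C * ((3 * (1 + norm \<zeta>)) ^ N * r powr - n)) * norm (ft \<phi> \<zeta>))"
  unfolding norm_mult D_def by (intro mult_left_mono mult_right_mono) auto
  also have "... = C * r powr - n * 3 ^ N * ((1 + norm \<zeta>) ^ (N + 2 * D) * norm (ft \<phi> \<zeta>))"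
  by (simp add: power_mult_distrib power_add mult_ac del: distrib_left_numeral)
  also have "... <= C * r powr - n * 3 ^ N * E" using C(1) by (intro mult_left_mono decay) auto
  finally show "(1 + norm \<zeta>) ^ (2 * DIM(real^'a)) * norm (b (x, dil d r \<zeta>) * ft \<phi> \<zeta>) <= C * r powr - n * 3 ^ N * E" .
 qed
 finally show ?thesis by (simp add: C0_def J_def D_def mult_ac)
 qed
 moreover have "(-1) ^ length I * Kop a (%p. Dl (map cdir I) \<psi> (fst p) * \<phi> (dil d r (snd p))) = (LBINT x. h x * \<psi> x)"
 if \<psi>: "schwartz \<psi>" for \<psi>
 proof -
 define G where "G x = (LBINT et. a (x, et) * g et)" for x
 have PSa: "PS (%z. a z * g (snd z))" by (rule PS_om[OF PS_snd[OF sg] oa])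
 have oG: "om G" unfolding G_def[abs_def] using integral_family(1)[OF PSa] by simp
 have xd: "map (%v. (v, 0)) (map cdir I) = map xdir I" by (simp add: cdir_def xdir_def[abs_def] o_def)
 have "Dl (map cdir I) G = h"
  using integral_family(2)[OF PSa set_xudir(2)[of I]] unfolding xd
  by (simp only: G_def[abs_def] h_def[abs_def] b_def Dl_xdir_mult[OF open_UNIV om_Cinf[OF oa] UNIV_I] snd_conv)
 moreover have "Kop a (%p. Dl (map cdir I) \<psi> (fst p) * \<phi> (dil d r (snd p))) = (LBINT x. G x * Dl (map cdir I) \<psi> x)"
 proof -
  have "Kop a (%p. Dl (map cdir I) \<psi> (fst p) * \<phi> (dil d r (snd p))) = (LBINT x. LBINT et. a (x, et) * (Dl (map cdir I) \<psi> x * g et))"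
  by (simp add: Kop_def pft_def ft_scale g_def)
  also have "... = (LBINT x. G x * Dl (map cdir I) \<psi> x)"
  unfolding G_def by (subst mult.left_commute) (simp add: mult.commute)
  finally show ?thesis .
 qed
 ultimately show ?thesis using integral_by_parts_list[OF oG \<psi> set_xudir(2)[of I]] by simp
 qed
 ultimately show "EX h. h : borel_measurable lborel & (ALL x. norm (h x) <= C0 * r powr - n) \<and>
  (ALL \<psi>. schwartz \<psi> --> (-1) ^ length I * Kop a (%p. Dl (map cdir I) \<psi> (fst p) * \<phi> (dil d r (snd p))) = (LBINT x. h x * \<psi> x))"
 using hm by (intro exI[of _ h]) auto
 qed
qed

subsection \<open>Smooth cutoff functions\<close>

text \<open>The division by t ^ k is there for closure: the derivative of \<open>flat k\<close> is a
  combination of \<open>flat (k + 1)\<close> and \<open>flat (k + 2)\<close>, so the family proves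
  its own smoothness by coinduction.\<close>

definition flat :: "nat => real => real" where
 "flat k t = (if 0 < t then exp (- 1 / t) / t ^ k else 0)"

text \<open>With s = 1 / t this is the bound of s ^ (k + 2) by a multiple of exp s. Being quadratic
  in t, it yields derivative 0 at the origin.\<close>

lemma flat_bound: "\<bar>flat k t\<bar> <= real (k + 2) ^ (k + 2) * t\<^sup>2"
proof (cases "0 < t")
 case True
 define s where "s = 1 / t"
 have s: "s > 0" "t = 1 / s" using True by (auto simp: s_def)
 have "s ^ (k + 2) <= real (k + 2) ^ (k + 2) * exp s" using s by (intro power_le_exp) auto
 hence "s ^ (k + 2) * exp (- s) <= real (k + 2) ^ (k + 2) * exp s * exp (- s)" by (intro mult_right_mono) auto
 also have "... = real (k + 2) ^ (k + 2)" by (simp add: mult.assoc exp_add[symmetric])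
 finally have "s ^ (k + 2) * exp (- s) * t\<^sup>2 <= real (k + 2) ^ (k + 2) * t\<^sup>2" by (intro mult_right_mono) auto
 moreover have "\<bar>flat k t\<bar> = s ^ (k + 2) * exp (- s) * t\<^sup>2"
 proof -
 have "s\<^sup>2 * t\<^sup>2 = 1" "- 1 / t = - s" "1 / t ^ k = s ^ k" using True by (simp_all add: s_def power_one_over)
 hence "flat k t = exp (- s) * s ^ k" using True by (simp add: flat_def divide_inverse)
 moreover have "exp (- s) * s ^ k = s ^ (k + 2) * exp (- s) * t\<^sup>2"
 using \<open>s\<^sup>2 * t\<^sup>2 = 1\<close> by (simp only: power_add mult.assoc mult.commute mult.left_commute)
 ultimately show ?thesis using s(1) by simp
 qed
 ultimately show ?thesis by simp
qed (simp add: flat_def)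

lemma has_dir_real:
 assumes "(g has_vector_derivative g') (at (t :: real))"
 shows "has_dir g 1 g' t"
proof -
 have "((%s. t + s) has_vector_derivative 1) (at 0)" by (auto intro!: derivative_eq_intros)
 from vector_diff_chain_at[OF this, of g g'] assms show ?thesis by (simp add: has_dir_def o_def)
qed

lemma flat_has_dir: "has_dir (flat k) 1 (flat (k + 2) t - real k * flat (k + 1) t) t"
proof (cases t "0 :: real" rule: linorder_cases)
 case equal
 have "((%s. flat k (0 + s *\<^sub>R 1)) has_vector_derivative 0) (at 0)"
 proof (rule has_vector_derivative_quadratic)
 fix s :: real
 show "norm (flat k (0 + s *\<^sub>R 1) - flat k (0 + 0 *\<^sub>R 1) - s *\<^sub>R 0) <= real (k + 2) ^ (k + 2) * s\<^sup>2"
 using flat_bound[of k s] by (simp add: flat_def)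
 qed
 thus ?thesis using equal by (simp add: has_dir_def flat_def)
next
 case less
 have "has_dir (%t. 0) 1 0 t" by (rule has_dir_const)
 hence "has_dir (flat k) 1 0 t"
 by (rule has_dir_cong[of "{..<0}", rotated 3]) (use less in "auto simp: flat_def")
 thus ?thesis using less by (simp add: flat_def)
next
 case greater
 have e: "((%t. exp (- 1 / t)) has_real_derivative (exp (- 1 / t) / t\<^sup>2)) (at t)"
 using greater by (auto intro!: derivative_eq_intros simp: power2_eq_square)
 have p: "((%t. t ^ k) has_real_derivative (real k * t ^ (k - 1))) (at t)"
 by (auto intro!: derivative_eq_intros)
 have "((%t. exp (- 1 / t) / t ^ k) has_real_derivative
 ((exp (- 1 / t) / t\<^sup>2) * t ^ k - exp (- 1 / t) * (real k * t ^ (k - 1))) / (t ^ k * t ^ k)) (at t)"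
 by (rule DERIV_divide[OF e p]) (use greater in simp)
 moreover have "((exp (- 1 / t) / t\<^sup>2) * t ^ k - exp (- 1 / t) * (real k * t ^ (k - 1))) / (t ^ k * t ^ k)
 = exp (- 1 / t) / t ^ (k + 2) - real k * (exp (- 1 / t) / t ^ (k + 1))"
 using greater by (cases k) (simp_all add: field_simps power2_eq_square)
 ultimately have "((%t. exp (- 1 / t) / t ^ k) has_vector_derivative flat (k + 2) t - real k * flat (k + 1) t) (at t)"
 using greater by (simp add: has_real_derivative_iff_has_vector_derivative flat_def)
 hence "has_dir (%t. exp (- 1 / t) / t ^ k) 1 (flat (k + 2) t - real k * flat (k + 1) t) t"
 by (rule has_dir_real)
 thus ?thesis
 by (rule has_dir_cong[of "{0<..}", rotated 3]) (use greater in "auto simp: flat_def")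
qed

lemma Cinf_flat: "Cinf_on UNIV (flat k)"
proof (rule Cinf_on_coinduct_upto[of _ _ "range flat"])
 fix g assume "g : range flat"
 then obtain k where g: "g = flat k" by blast
 show "locally_bounded_on UNIV g" unfolding locally_bounded_on_def g
 proof
 fix x :: real
 have "norm (flat k y) <= real (k + 2) ^ (k + 2) * (\<bar>x\<bar> + 1)\<^sup>2" if "y : ball x 1" for y
 proof -
 have "\<bar>y\<bar> <= \<bar>x\<bar> + 1" using that by (auto simp: dist_real_def)
 hence "y\<^sup>2 <= (\<bar>x\<bar> + 1)\<^sup>2" using power_mono[of "\<bar>y\<bar>" "\<bar>x\<bar> + 1" 2] by simp
 hence "real (k + 2) ^ (k + 2) * y\<^sup>2 <= real (k + 2) ^ (k + 2) * (\<bar>x\<bar> + 1)\<^sup>2" by (rule mult_left_mono) simp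
 from order_trans[OF flat_bound this] show ?thesis unfolding real_norm_def .
 qed
 thus "EX e>0. EX B. ALL y:ball x e. norm (flat k y) <= B" by (meson zero_less_one)
 qed
 fix v :: real assume "v : Basis"
 hence v: "v = 1" by simp
 have "(%t. flat (k + 2) t + (- real k) *\<^sub>R flat (k + 1) t) : smooth_span UNIV (range flat)"
 by (intro smooth_span.add smooth_span_scaleR_const open_UNIV smooth_span.base rangeI)
 thus "EX h:smooth_span UNIV (range flat). ALL x:UNIV. has_dir g v (h x) x"
 unfolding g v using flat_has_dir[of k] by (intro bexI) auto
qed auto

text \<open>The powers of the inverse are closed under differentiation up to constants.\<close>

lemma Cinf_inverse: "Cinf_on (UNIV - {0}) (inverse :: real => real)"
proof -
 have U: "open (UNIV - {0 :: real})" by auto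
 have "Cinf_on (UNIV - {0}) (%t::real. inverse t ^ 1)"
 proof (rule Cinf_on_coinduct_upto[OF U, of _ "range (%k t. inverse t ^ k)"])
 fix g :: "real => real" assume "g : range (%k t. inverse t ^ k)"
 then obtain k where g: "g = (%t. inverse t ^ k)" by blast
 show "locally_bounded_on (UNIV - {0}) g" unfolding g
 by (rule continuous_imp_locally_bounded[OF U]) (auto intro!: continuous_intros)
 fix v :: real assume "v : Basis"
 hence v: "v = 1" by simp
 have "has_dir g v ((- real k) *\<^sub>R inverse t ^ (k + 1)) t" if "t ~= 0" for t
 proof -
 have "((%s. inverse (t + s) ^ k) has_real_derivative (- real k * inverse t ^ (k + 1))) (at 0)"
 proof (cases k)
  case 0 thus ?thesis by simp
 next
  case (Suc j)
  have "((%s. inverse (t + s)) has_real_derivative - (inverse t * inverse t)) (at 0)"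
  using that by (auto intro!: derivative_eq_intros simp: divide_inverse)
  from DERIV_power[OF this, of k] show ?thesis using Suc by (simp add: algebra_simps)
 qed
 thus ?thesis by (simp add: has_dir_def g v has_real_derivative_iff_has_vector_derivative)
 qed
 moreover have "(%t :: real. (- real k) *\<^sub>R inverse t ^ (k + 1)) : smooth_span (UNIV - {0}) (range (%k t. inverse t ^ k))"
 by (rule smooth_span_scaleR_const[OF U smooth_span.base]) (rule rangeI)
 ultimately show "EX h:smooth_span (UNIV - {0}) (range (%k t. inverse t ^ k)). ALL x:UNIV - {0}. has_dir g v (h x) x"
 by (intro bexI) auto
 qed (rule rangeI)
 thus ?thesis by simp
qed

text \<open>The standard smooth transition from 1 on t <= 1/2 to 0 on t >= 1; the two flat functions
  in the denominator never vanish together.\<close>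

definition step :: "real => real" where
 "step t = flat 0 (1 - t) * inverse (flat 0 (1 - t) + flat 0 (t - 1 / 2))"

lemma step_denom_pos: "0 < flat 0 (1 - t) + flat 0 (t - 1 / 2)"
 by (cases "t < 1") (auto simp: flat_def add_pos_nonneg)

lemma step_simps: "t <= 1 / 2 ==> step t = 1" "1 <= t ==> step t = 0" "0 <= step t" "step t <= 1"
proof -
 show "t <= 1 / 2 ==> step t = 1" by (simp add: step_def flat_def)
 show "1 <= t ==> step t = 0" by (simp add: step_def flat_def)
 have nn: "0 <= flat 0 s" for s by (simp add: flat_def)
 show "0 <= step t" unfolding step_def using step_denom_pos[of t] nn by simp
 show "step t <= 1" unfolding step_def using step_denom_pos[of t] nn[of "t - 1 / 2"] by (simp add: field_simps)
qed

lemma Cinf_step: "Cinf_on UNIV step"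
proof -
 have 1: "Cinf_on UNIV (%t. flat 0 (1 - t))" "Cinf_on UNIV (%t. flat 0 (t - 1 / 2))"
 using Cinf_on_affine[OF Cinf_flat open_UNIV open_UNIV linear_uminus, of 1 0]
 Cinf_on_affine[OF Cinf_flat open_UNIV open_UNIV linear_id, of "- 1 / 2" 0] by simp_all
 have "Cinf_on UNIV (%t. inverse (flat 0 (1 - t) + flat 0 (t - 1 / 2)))"
 by (rule Cinf_on_compose[OF open_UNIV _ Cinf_inverse Cinf_on_add(1)[OF open_UNIV 1]])
 (use step_denom_pos in "auto simp: less_imp_neq[symmetric]")
 from Cinf_on_mult[OF open_UNIV 1(1) this] show ?thesis by (simp add: step_def[abs_def])
qed

text \<open>|u'|^4 + u_d^2, a polynomial homogeneous of degree 4 under the dilations, which replaces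
  the nonsmooth \<open>anorm\<close>.\<close>

definition qnorm :: "'n::finite => real^'n => real" where
 "qnorm d u = (\<Sum>i\<in>UNIV - {d}. (u $ i) * (u $ i)) * (\<Sum>i\<in>UNIV - {d}. (u $ i) * (u $ i)) + (u $ d) * (u $ d)"

text \<open>\<open>dil d (1 / 2)\<close> doubles \<open>anorm\<close>: from anorm u > 1 one then
  gets |v'| >= 1 or |v_d| >= 1 for the dilated v, hence qnorm >= 1, so that the cutoff lives in the
  unit ball of \<open>anorm\<close>.\<close>

definition cut :: "'n::finite => real^'n => complex" where
 "cut d u = cor (step (qnorm d (dil d (1 / 2) u)))"

lemma Cinf_qnorm: "Cinf_on UNIV (qnorm d)"
 unfolding qnorm_def[abs_def]
 by (intro Cinf_on_add(1) Cinf_on_mult Cinf_on_sum(1) open_UNIV Cinf_on_linear bounded_linear_vec_nth) auto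

lemma Cinf_cut: "Cinf_on UNIV (cut d)"
proof -
 have "Cinf_on UNIV (%u. step (qnorm d u))"
 by (rule Cinf_on_compose[OF open_UNIV open_UNIV Cinf_step Cinf_qnorm]) simp
 from Cinf_on_affine[OF this open_UNIV open_UNIV linear_dil, of 0 d "1 / 2"]
 have "Cinf_on UNIV (%u. step (qnorm d (dil d (1 / 2) u)))" by simp
 from Cinf_on_linear_image(1)[OF bounded_linear_of_real open_UNIV this] show ?thesis by (simp add: cut_def[abs_def])
qed

lemma cut_outside: "1 < anorm d u ==> cut d u = 0"
proof -
 assume "1 < anorm d u"
 define v where "v = dil d (1 / 2) u"
 define S where "S = (\<Sum>i\<in>UNIV - {d}. (v $ i)\<^sup>2)"
 have S0: "0 <= S" by (simp add: S_def sum_nonneg)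
 have "2 < anorm d v" using \<open>1 < anorm d u\<close> by (simp add: v_def anorm_dil)
 hence "1 <= sqrt S \<or> 1 <= sqrt \<bar>v $ d\<bar>" unfolding anorm_def S_def by linarith
 hence "1 <= S \<or> 1 <= \<bar>v $ d\<bar>" by simp
 hence "1 <= S * S + \<bar>v $ d\<bar> * \<bar>v $ d\<bar>"
 using mult_mono[of 1 S 1 S] mult_mono[of 1 "\<bar>v $ d\<bar>" 1 "\<bar>v $ d\<bar>"] zero_le_square[of S] zero_le_square[of "\<bar>v $ d\<bar>"] S0
 by (smt (verit) abs_ge_zero mult_nonneg_nonneg)
 hence "1 <= qnorm d v" by (simp add: qnorm_def S_def power2_eq_square)
 thus ?thesis by (simp add: cut_def v_def step_simps)
qed

text \<open>For anorm <= 1/8 both parts of \<open>anorm\<close> are at most 1/4 after doubling,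
  which puts \<open>qnorm\<close> below 1/2, where \<open>step\<close> is 1. The same 1/8 marks the
  inner edge R/8 of every shell.\<close>

lemma cut_inside: "anorm d u <= 1 / 8 ==> cut d u = 1"
proof -
 assume "anorm d u <= 1 / 8"
 define v where "v = dil d (1 / 2) u"
 define S where "S = (\<Sum>i\<in>UNIV - {d}. (v $ i)\<^sup>2)"
 have S0: "0 <= S" by (simp add: S_def sum_nonneg)
 have "anorm d v <= 1 / 4" using \<open>anorm d u <= 1 / 8\<close> by (simp add: v_def anorm_dil)
 hence "sqrt S + sqrt \<bar>v $ d\<bar> <= 1 / 4" unfolding anorm_def S_def .
 hence "sqrt S <= 1 / 4" "sqrt \<bar>v $ d\<bar> <= 1 / 4" using S0 real_sqrt_ge_zero[of S] real_sqrt_ge_zero[of "\<bar>v $ d\<bar>"] by linarith+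
 hence "(sqrt S)\<^sup>2 <= (1 / 4)\<^sup>2" "(sqrt \<bar>v $ d\<bar>)\<^sup>2 <= (1 / 4)\<^sup>2"
 using S0 by (intro power_mono; simp)+
 hence "S <= 1 / 2" "\<bar>v $ d\<bar> <= 1 / 2" using S0 by (simp_all add: power2_eq_square)
 hence "S * S + \<bar>v $ d\<bar> * \<bar>v $ d\<bar> <= 1 / 2 * (1 / 2) + 1 / 2 * (1 / 2)"
 using S0 by (intro add_mono mult_mono) auto
 hence "qnorm d v <= 1 / 2" by (simp add: qnorm_def S_def power2_eq_square)
 thus ?thesis by (simp add: cut_def v_def step_simps)
qed

lemma cut_norm_le: "norm (cut d u) <= 1"
 using step_simps(3,4) by (simp add: cut_def)

lemma compactly_supported_bound:
 fixes f :: "'a::euclidean_space => 'b::real_normed_vector"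
 assumes "Cinf_on UNIV f" "!!x. r < norm x ==> f x = 0"
 shows "EX B>=0. ALL x. norm (Dl vs f x) <= B"
proof -
 have "continuous_on (cball 0 r) (Dl vs f)"
 by (rule continuous_on_subset[OF Cinf_on_continuous[OF Cinf_Dl_any[OF open_UNIV assms(1)]]]) simp
 hence "bounded (Dl vs f ` cball 0 r)"
 by (intro compact_imp_bounded compact_continuous_image compact_cball)
 then obtain B where "ALL y:Dl vs f ` cball 0 r. norm y <= B" unfolding bounded_iff by blast
 hence B: "norm (Dl vs f x) <= B" if "norm x <= r" for x using that by simp
 have o: "open {x :: 'a. r < norm x}"
 using open_Collect_less[OF continuous_on_const continuous_on_norm_id, of r] by simp
 have "norm (Dl vs f x) <= \<bar>B\<bar>" for x
 proof (cases "norm x <= r")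
 case True thus ?thesis using B[of x] by linarith
 next
 case False
 have "Dl vs f x = 0" by (rule Dl_vanishes[OF _ o]) (use assms(2) False in auto)
 thus ?thesis by simp
 qed
 thus ?thesis by (intro exI[of _ "\<bar>B\<bar>"]) auto
qed

lemma schwartz_compact:
 fixes f :: "'a::euclidean_space => complex"
 assumes "Cinf_on UNIV f" "!!x. r < norm x ==> f x = 0"
 shows "schwartz f"
 unfolding schwartz_def
proof (intro conjI allI impI assms(1))
 fix vs :: "'a list" and k :: nat
 obtain B where B: "B >= 0" "!!x. norm (Dl vs f x) <= B" using compactly_supported_bound[OF assms] by blast
 have o: "open {x :: 'a. \<bar>r\<bar> < norm x}"
 using open_Collect_less[OF continuous_on_const continuous_on_norm_id, of "\<bar>r\<bar>"] by simp
 have "(1 + norm x) ^ k * norm (Dl vs f x) <= (1 + \<bar>r\<bar>) ^ k * B" for x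
 proof (cases "norm x <= \<bar>r\<bar>")
 case True thus ?thesis using B by (intro mult_mono power_mono) auto
 next
 case False
 have "Dl vs f x = 0" by (rule Dl_vanishes[OF _ o]) (use assms(2) False in auto)
 thus ?thesis using B(1) by simp
 qed
 thus "EX C. ALL x. (1 + norm x) ^ k * norm (Dl vs f x) <= C" by blast
qed

lemma norm_gt_anorm_gt: "2 < norm (u :: real^'n) ==> 1 < anorm d u"
 using norm_le_anorm[of u d] power_mono[of "anorm d u" 1 2] by fastforce

definition cutR :: "'n::finite => real => real^'n => complex" where
 "cutR d R u = cut d (dil d R u)"

lemma cutR_simps:
 "0 < R ==> R < anorm d u ==> cutR d R u = 0"
 "0 < R ==> anorm d u <= R / 8 ==> cutR d R u = 1"
 "norm (cutR d R u) <= 1"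
 by (auto simp: cutR_def cut_norm_le anorm_dil field_simps intro!: cut_outside cut_inside)

lemma Cinf_cutR: "Cinf_on UNIV (cutR d R)"
 using Cinf_on_affine[OF Cinf_cut[of d] open_UNIV open_UNIV linear_dil[of d R], of 0] by (simp add: cutR_def[abs_def])

lemma Dl_scaleR_dirs:
 fixes f :: "'a::euclidean_space => 'b::real_normed_vector"
 assumes "Cinf_on UNIV f"
 shows "Dl (map (%i. c i *\<^sub>R v i) is) f = (%x. (\<Prod>i\<leftarrow>is. c i) *\<^sub>R Dl (map v is) f x)"
proof (induction "is")
 case (Cons i "is")
 have "Dl (map (%i. c i *\<^sub>R v i) (i # is)) f x = (\<Prod>i\<leftarrow>i # is. c i) *\<^sub>R Dl (map v (i # is)) f x" for x
 proof -
 have h: "has_dir (Dl (map v is) f) (v i) (Dl (map v (i # is)) f x) x"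
 using has_dir_any[OF open_UNIV Cinf_Dl_any[OF open_UNIV assms], of x "map v is" "v i"] by (simp add: Dl_Cons)
 have "has_dir (Dl (map v is) f) (c i *\<^sub>R v i) (c i *\<^sub>R Dl (map v (i # is)) f x) x"
 proof -
 have "((%t. t * c i) has_vector_derivative c i) (at 0)" by (auto intro!: derivative_eq_intros)
 from vector_diff_chain_at[OF this, of "%t. Dl (map v is) f (x + t *\<^sub>R v i)" "Dl (map v (i # is)) f x"] h
 show ?thesis by (simp add: has_dir_def o_def)
 qed
 from dirD_eq[OF has_dir_bounded_linear[OF bounded_linear_scaleR_right this]]
 show ?thesis by (simp add: Dl_Cons[of "c i *\<^sub>R v i"] Cons mult.commute)
 qed
 thus ?case by blast
qed simp

lemma cutR_bound:
 "EX B>=0. ALL R>0. ALL u. norm (Dl (map cdir al) (cutR d R) u) <= (if anorm d u <= R then B * R powr (- wdeg d al) else 0)"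
proof -
 obtain B where B: "B >= 0" "!!u. norm (Dl (map cdir al) (cut d) u) <= B"
 using compactly_supported_bound[OF Cinf_cut, of 2 d "map cdir al"] norm_gt_anorm_gt cut_outside by blast
 have "norm (Dl (map cdir al) (cutR d R) u) <= (if anorm d u <= R then B * R powr (- wdeg d al) else 0)" if R: "R > 0" for R u
 proof (cases "anorm d u <= R")
 case True
 have "1 / R ^ wt d i = R powr (- real (wt d i))" for i
 using R by (simp add: powr_minus powr_realpow divide_inverse)
 hence "(\<Prod>i\<leftarrow>al. 1 / R ^ wt d i) = R powr (- wdeg d al)"
 using R by (induction al) (simp_all add: wdeg_Cons powr_add[symmetric])
 moreover have "Dl (map cdir al) (cutR d R) u = (\<Prod>i\<leftarrow>al. 1 / R ^ wt d i) *\<^sub>R Dl (map cdir al) (cut d) (dil d R u)"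
 using Dl_affine'[OF linear_dil, of "map cdir al" "cut d" d R] Dl_scaleR_dirs[OF Cinf_cut, of "%i. 1 / R ^ wt d i" cdir al d]
 by (simp add: cutR_def[abs_def] dil_cdir o_def)
 ultimately show ?thesis using B True R mult_left_mono[OF B(2)[of "dil d R u"], of "R powr (- wdeg d al)"]
 by (simp add: mult.commute)
 next
 case False
 have "Dl (map cdir al) (cutR d R) u = 0"
 by (rule Dl_vanishes[OF _ open_anorm_gt(1)[of R d]]) (use False R cutR_simps(1) in auto)
 thus ?thesis using False by simp
 qed
 thus ?thesis using B(1) by blast
qed

lemma wdeg_nonneg [simp]: "0 <= wdeg d al"
 by (simp add: wdeg_def)

lemma gsym_cdirI:
 fixes F :: "'p => real^'n => complex" and s :: real
 assumes "!!p. p : P ==> Cinf_on U (F p)"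
 and "!!al. EX C. ALL p:P. ALL z:U. norm (Dl (map cdir al) (F p) z) <= C * \<rho> z powr (s - wdeg d al)"
 shows "gsym P U \<rho> (udeg d) s F"
proof (rule gsymI[OF assms(1)])
 fix vs :: "(real^'n) list" assume "set vs <= Basis"
 then obtain al where al: "vs = map cdir al" using cdir_lists by blast
 show "EX C. ALL p:P. ALL z:U. norm (Dl vs (F p) z) <= C * \<rho> z powr (s - (\<Sum>v\<leftarrow>vs. udeg d v))"
 unfolding al wdeg_sum by (rule assms(2))
qed

text \<open>On the support anorm u <= R, so the factor R^(-wdeg) from the chain rule is at most the
  same power of anorm u: the cutoffs are symbols of order 0 uniformly in R.\<close>

lemma gsym_cutR_punctured: "gsym {0<..} (UNIV - {0}) (anorm d) (udeg d) 0 (cutR d)"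
proof (rule gsym_cdirI)
 show "Cinf_on (UNIV - {0}) (cutR d R)" for R by (rule Cinf_on_subset[OF Cinf_cutR]) simp
 fix al
 obtain B where B: "B >= 0" "!!R u. R > 0 ==> norm (Dl (map cdir al) (cutR d R) u) <= (if anorm d u <= R then B * R powr (- wdeg d al) else 0)"
 using cutR_bound[of al d] by blast
 have "norm (Dl (map cdir al) (cutR d R) u) <= B * anorm d u powr (0 - wdeg d al)" if "R > 0" "u ~= 0" for R u
 proof (cases "anorm d u <= R")
 case True
 have "R powr (- wdeg d al) <= anorm d u powr (- wdeg d al)" using True that by (intro powr_mono2') auto
 thus ?thesis using B(2)[OF that(1), of u] True mult_left_mono[OF _ B(1)] by fastforce
 next
 case False thus ?thesis using B(2)[OF that(1), of u] B(1) by (auto intro: order_trans)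
 qed
 thus "EX C. ALL R:{0<..}. ALL u:UNIV - {0}. norm (Dl (map cdir al) (cutR d R) u) <= C * anorm d u powr (0 - wdeg d al)"
 by auto
qed

text \<open>For R >= 1 the support satisfies 1 + anorm u <= 2 R, so the weight may be 1 + anorm at
  the price of a power of 2.\<close>

lemma gsym_cutR: "gsym {1..} UNIV (%u. 1 + anorm d u) (udeg d) 0 (cutR d)"
proof (rule gsym_cdirI)
 show "Cinf_on UNIV (cutR d R)" for R by (rule Cinf_cutR)
 fix al
 obtain B where B: "B >= 0" "!!R u. R > 0 ==> norm (Dl (map cdir al) (cutR d R) u) <= (if anorm d u <= R then B * R powr (- wdeg d al) else 0)"
 using cutR_bound[of al d] by blast
 have "norm (Dl (map cdir al) (cutR d R) u) <= (B * 2 powr (wdeg d al)) * (1 + anorm d u) powr (0 - wdeg d al)" if R: "R >= 1" for R u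
 proof (cases "anorm d u <= R")
 case True
 have "R powr (- wdeg d al) <= ((1 + anorm d u) / 2) powr (- wdeg d al)" using True R by (intro powr_mono2') (auto simp: add_pos_nonneg)
 also have "... = 2 powr (wdeg d al) * (1 + anorm d u) powr (- wdeg d al)"
 proof -
 have "2 powr (- wdeg d al) = inverse (2 powr wdeg d al)" by (rule powr_minus)
 moreover have "((1 + anorm d u) / 2) powr (- wdeg d al) = (1 + anorm d u) powr (- wdeg d al) / 2 powr (- wdeg d al)"
  by (rule powr_divide)
 ultimately show ?thesis by (simp only: divide_inverse inverse_inverse_eq mult.commute)
 qed
 finally have "B * R powr (- wdeg d al) <= B * (2 powr (wdeg d al) * (1 + anorm d u) powr (- wdeg d al))"
 by (rule mult_left_mono[OF _ B(1)])
 thus ?thesis using B(2)[of R u] True R by (simp add: mult.assoc)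
 next
 case False
 hence "norm (Dl (map cdir al) (cutR d R) u) <= 0" using B(2)[of R u] R by simp
 also have "0 <= (B * 2 powr (wdeg d al)) * (1 + anorm d u) powr (0 - wdeg d al)" using B(1) by simp
 finally show ?thesis .
 qed
 thus "EX C. ALL R:{1..}. ALL u:UNIV. norm (Dl (map cdir al) (cutR d R) u) <= C * (1 + anorm d u) powr (0 - wdeg d al)"
 by auto
qed

subsection \<open>Oscillatory integrals of functions with symbol estimates\<close>

lemma one_add_norm_le:
 assumes "0 < r" "r <= anorm d (u :: real^'n)"
 shows "1 + norm u <= (1 / r\<^sup>2 + 1 / r + 1) * (anorm d u)\<^sup>2"
proof -
 have "1 <= (anorm d u)\<^sup>2 / r\<^sup>2" using assms power_mono[of r "anorm d u" 2] by (simp add: field_simps)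
 moreover have "anorm d u <= (anorm d u)\<^sup>2 / r"
 using assms mult_left_mono[of r "anorm d u" "anorm d u"] by (simp add: field_simps power2_eq_square)
 ultimately show ?thesis using norm_le_anorm[of u d] by (simp add: algebra_simps)
qed

definition tail :: "'n::finite => real => real => real^'n => real" where
 "tail d e r u = (if r <= anorm d u then anorm d u powr e else 0)"

lemma tail_nonneg: "0 <= tail d e r u"
 by (simp add: tail_def)

lemma measurable_tail [measurable]: "tail d e r : borel_measurable borel"
 unfolding tail_def[abs_def] by measurable

text \<open>Away from 0, 1 + norm u is at most a multiple of anorm^2, so the integrability weight of
  exponent 2 * D costs 4 * D powers of \<open>anorm\<close>. This is the origin of the threshold -4
  CARD('n) on exponents in the estimates below.\<close>

lemma integrable_tail:
 fixes d :: "'n::finite"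
 assumes r: "0 < r" and e: "e <= - (4 * real CARD('n))"
 shows "integrable lborel (tail d e r)"
proof -
 define D where "D = DIM(real^'n)"
 have D: "D = CARD('n)" by (simp add: D_def)
 define K where "K = 1 / r\<^sup>2 + 1 / r + 1"
 have K: "0 < K" using r by (simp add: K_def add_pos_pos)
 have "(1 + norm u) ^ (2 * D) * tail d e r u <= K ^ (2 * D) * r powr (4 * D + e)" for u
 proof (cases "r <= anorm d u")
 case True
 have "(1 + norm u) ^ (2 * D) <= (K * (anorm d u)\<^sup>2) ^ (2 * D)"
 using one_add_norm_le[OF r True] unfolding K_def by (intro power_mono) auto
 also have "... = K ^ (2 * D) * anorm d u powr (4 * D)"
 proof -
 have "0 < anorm d u" using True r by linarith
 from powr_realpow[OF this, of "4 * D"] show ?thesis by (simp add: power_mult_distrib power_mult[symmetric])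
 qed
 finally have "(1 + norm u) ^ (2 * D) * tail d e r u <= K ^ (2 * D) * anorm d u powr (4 * D) * anorm d u powr e"
 using True by (simp add: tail_def mult_right_mono)
 also have "... = K ^ (2 * D) * anorm d u powr (4 * D + e)" by (simp add: powr_add)
 also have "... <= K ^ (2 * D) * r powr (4 * D + e)"
 using True r K e by (intro mult_left_mono powr_mono2') (auto simp: D)
 finally show ?thesis .
 next
 case False thus ?thesis using K by (simp add: tail_def)
 qed
 hence "integrable lborel (%u. cor (tail d e r u))"
 by (intro integrable_of_decay(1)) (auto simp: D_def tail_nonneg)
 thus ?thesis using complex_of_real_integrable_eq by blast
qed

text \<open>Homogeneity under dilations; the exponent is Q + e.\<close>

lemma integral_tail:
 fixes d :: "'n::finite" and e :: real
 assumes r: "0 < r"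
 shows "(LBINT u. tail d e r u) = r powr (CARD('n) + 1 + e) * (LBINT u. tail d e 1 u)"
proof -
 have "tail d e r u = r powr e * tail d e 1 (dil d r u)" for u
 using r by (simp add: tail_def anorm_dil powr_divide)
 hence "cor (LBINT u. tail d e r u) = cor (r powr e) * (LBINT u. cor (tail d e 1 (dil d r u)))"
 by simp
 also have "(LBINT u. cor (tail d e 1 (dil d r u))) = cor (r ^ (CARD('n) + 1)) * (LBINT u. cor (tail d e 1 u))"
 by (rule integral_dil[OF r, of "%u. cor (tail d e 1 u)"]) measurable
 also have "cor (r powr e) * (cor (r ^ (CARD('n) + 1)) * (LBINT u. cor (tail d e 1 u)))
 = cor (r powr (CARD('n) + 1 + e) * (LBINT u. tail d e 1 u))"
 using r by (simp add: powr_add powr_realpow[symmetric])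
 finally show ?thesis using of_real_eq_iff by blast
qed

lemma ft_Dl_replicate:
 "schwartz f ==> ft (Dl (replicate m v) f) et = (- (2 * pi * \<i>) * (et \<bullet> v)) ^ m * ft f et"
proof (induction m)
 case (Suc m)
 thus ?case using ft_dirD[OF schwartz_Dl_any[OF Suc.prems], of v "replicate m v" et] by (simp add: Dl_Cons mult_ac)
qed simp

text \<open>m integrations by parts produce (2 pi |u_i|)^m, of which the factor (2 pi)^m >= 1 is
  dropped.\<close>

lemma ft_component_bound:
 fixes f :: "real^'n => complex"
 assumes f: "schwartz f"
 shows "\<bar>u $ i\<bar> ^ m * norm (ft f u) <= (LBINT et. norm (Dl (map cdir (replicate m i)) f et))"
proof -
 have "\<bar>u $ i\<bar> ^ m <= (2 * pi * \<bar>u $ i\<bar>) ^ m"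
 using pi_ge_two mult_right_mono[of 1 "2 * pi" "\<bar>u $ i\<bar>"] by (intro power_mono) auto
 hence "\<bar>u $ i\<bar> ^ m * norm (ft f u) <= (2 * pi * \<bar>u $ i\<bar>) ^ m * norm (ft f u)" by (intro mult_right_mono) auto
 also have "... = norm (ft (Dl (map cdir (replicate m i)) f) u)"
 by (simp add: map_replicate_const ft_Dl_replicate[OF f] norm_mult norm_power cdir_def inner_axis)
 also have "... <= (LBINT et. norm (Dl (map cdir (replicate m i)) f et))"
 unfolding ft_def by (rule order_trans[OF integral_norm_bound]) (simp add: norm_mult)
 finally show ?thesis .
qed

text \<open>The difference of cutoffs vanishes near 0, so a product with a function on the punctured
  space extends smoothly by 0.\<close>

lemma schwartz_shell:
 fixes f :: "real^'n => complex"
 assumes U: "U = UNIV \<or> U = UNIV - {0}" and f: "Cinf_on U f" and R: "0 < R" "R <= R'"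
 shows "schwartz (%et. f et * (cutR d R' et - cutR d R et))"
proof (rule schwartz_compact[where r = "R' + R'\<^sup>2"])
 define G where "G et = cutR d R' et - cutR d R et" for et
 have oU: "open U" using U by auto
 have G: "Cinf_on UNIV G" unfolding G_def[abs_def] by (intro Cinf_on_diff(1) Cinf_cutR open_UNIV)
 have 1: "Cinf_on U (%et. f et * G et)" by (rule Cinf_on_mult[OF oU f Cinf_on_subset[OF G]]) simp
 have 2: "Cinf_on {et. anorm d et < R / 8} (%et. f et * G et)"
 by (rule Cinf_on_cong[OF open_anorm_gt(2) _ Cinf_on_const[OF open_anorm_gt(2), of _ _ 0]])
 (use R in "auto simp: G_def cutR_simps(2)")
 have "U \<union> {et. anorm d et < R / 8} = UNIV" using U R by auto
 with Cinf_on_Un[OF 1 2 oU open_anorm_gt(2)]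
 show "Cinf_on UNIV (%et. f et * (cutR d R' et - cutR d R et))" by (simp add: G_def)
 fix et :: "real^'n" assume "R' + R'\<^sup>2 < norm et"
 hence "R' < anorm d et" using norm_le_anorm[of et d] power_mono[of "anorm d et" R' 2] by fastforce
 thus "f et * (cutR d R' et - cutR d R et) = 0" using R by (simp add: cutR_simps(1))
qed

text \<open>m derivatives in coordinate i lower the order to s - m wt_i, and the shell lives in
  anorm >= R/8, so integrating the tail gives the power of R with a bound free of R'. The parameters
  serve both transforms: the whole space, 1 + anorm and R >= 1 for symbols; the punctured space,
  anorm and R > 0 for kernels.\<close>

lemma shell_oscillation:
 fixes F :: "'p => real^'n => complex" and s :: real and \<rho> :: "real^'n => real"
 assumes U: "U = UNIV \<or> U = UNIV - {0}" and F: "gsym P U \<rho> (udeg d) s F"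
 and Q: "Q <= {0<..}" and cut: "gsym Q U \<rho> (udeg d) 0 (cutR d)"
 and \<rho>: "!!et. et : U ==> anorm d et <= \<rho> et"
 and m: "s - real (wt d i * m) <= - (4 * real CARD('n))"
 shows "EX C>=0. ALL p:P. ALL R:Q. ALL R':Q. R <= R' --> (ALL u.
 \<bar>u $ i\<bar> ^ m * norm (ft (%et. F p et * (cutR d R' et - cutR d R et)) u) <= C * R powr (CARD('n) + 1 + s - real (wt d i * m)))"
proof -
 define G where "G p et = F (fst p) et * (cutR d (snd (snd p)) et - cutR d (fst (snd p)) et)" for p et
 have oU: "open U" using U by auto
 have gG: "gsym (P \<times> Q \<times> Q) U \<rho> (udeg d) (s + 0) G" unfolding G_def[abs_def]
 by (intro gsym_mult oU gsym_diff) (auto intro: gsym_reindex[OF F] gsym_reindex[OF cut])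
 define e where "e = s - real (wt d i * m)"
 have deg: "wdeg d (replicate m i) = real (wt d i * m)"
 by (induction m) (auto simp: wdeg_Cons algebra_simps)
 obtain C where C: "C >= 0" "!!p et. p : P \<times> Q \<times> Q ==> et : U ==> norm (Dl (map cdir (replicate m i)) (G p) et) <= C * \<rho> et powr e"
 using gsym_bound[OF gG set_xudir(2)[of "replicate m i"]] unfolding wdeg_sum deg e_def by auto
 define T where "T = (LBINT u. tail d e 1 u)"
 have T: "0 <= T" unfolding T_def by (intro integral_nonneg_AE AE_I2 tail_nonneg)
 have e: "e <= - (4 * real CARD('n))" "e <= 0" using m by (auto simp: e_def)
 define C' where "C' = C * (1 / 8) powr (CARD('n) + 1 + e) * T"
 have "\<bar>u $ i\<bar> ^ m * norm (ft (%et. F p et * (cutR d R' et - cutR d R et)) u) <= C' * R powr (CARD('n) + 1 + s - real (wt d i * m))"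
 if p: "p : P" and R: "R : Q" "R' : Q" "R <= R'" for p R R' u
 proof -
 have R0: "0 < R" using R Q by auto
 have G: "(%et. F p et * (cutR d R' et - cutR d R et)) = G (p, R, R')" by (simp add: G_def[abs_def])
 have sG: "schwartz (G (p, R, R'))" unfolding G[symmetric]
 by (rule schwartz_shell[OF U gsym_Cinf[OF F p] R0 R(3)])
 have le: "norm (Dl (map cdir (replicate m i)) (G (p, R, R')) et) <= C * tail d e (R / 8) et" for et
 proof (cases "anorm d et < R / 8")
 case True
 have "Dl (map cdir (replicate m i)) (G (p, R, R')) et = 0"
  by (rule Dl_vanishes[OF _ open_anorm_gt(2)[of d "R / 8"]])
  (use True R(3) R0 in "auto simp: G_def cutR_simps(2)")
 thus ?thesis using C(1) by (simp add: tail_nonneg)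
 next
 case False
 hence nz: "et ~= 0" using R0 by auto
 hence et: "et : U" using U by auto
 have "\<rho> et powr e <= anorm d et powr e" using \<rho>[OF et] nz e(2) by (intro powr_mono2') auto
 hence "C * \<rho> et powr e <= C * anorm d et powr e" by (rule mult_left_mono[OF _ C(1)])
 thus ?thesis using C(2)[OF _ et, of "(p, R, R')"] p R False by (simp add: tail_def)
 qed
 have "\<bar>u $ i\<bar> ^ m * norm (ft (G (p, R, R')) u) <= (LBINT et. norm (Dl (map cdir (replicate m i)) (G (p, R, R')) et))"
 by (rule ft_component_bound[OF sG])
 also have "... <= (LBINT et. C * tail d e (R / 8) et)"
 using R0 e by (intro integral_mono le integrable_norm schwartz_integrable schwartz_Dl_any sG integrable_mult_right integrable_tail) auto
 also have "... = C * ((R / 8) powr (CARD('n) + 1 + e) * T)"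
 using integral_tail[where r = "R / 8" and d = d and e = e] R0 by (simp add: T_def)
 also have "... = C' * R powr (CARD('n) + 1 + e)"
 using R0 powr_mult[of R "1 / 8" "CARD('n) + 1 + e"] by (simp add: C'_def)
 finally show ?thesis unfolding G by (simp add: e_def algebra_simps)
 qed
 moreover have "0 <= C'" using C(1) T by (simp add: C'_def)
 ultimately show ?thesis by blast
qed

text \<open>For the unit-scale piece, which does not vanish near 0: the weight 1 + anorm gives
  integrability of the derivative over the whole space.\<close>

lemma full_oscillation:
 fixes F :: "'p => real^'n => complex" and s :: real
 assumes F: "gsym P UNIV (%et. 1 + anorm d et) (udeg d) s F" and sF: "!!p. p : P ==> schwartz (F p)"
 and m: "s - real (wt d i * m) <= - (4 * real CARD('n))"
 shows "EX C>=0. ALL p:P. ALL u. \<bar>u $ i\<bar> ^ m * norm (ft (F p) u) <= C"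
proof -
 define e where "e = s - real (wt d i * m)"
 have deg: "wdeg d (replicate m i) = real (wt d i * m)"
 by (induction m) (auto simp: wdeg_Cons algebra_simps)
 obtain C where C: "C >= 0" "!!p et. p : P ==> norm (Dl (map cdir (replicate m i)) (F p) et) <= C * (1 + anorm d et) powr e"
 using gsym_bound[OF F set_xudir(2)[of "replicate m i"]] unfolding wdeg_sum deg e_def by auto
 define w where "w et = 1 / (1 + norm et) ^ (2 * DIM(real^'n))" for et :: "real^'n"
 have "(1 + anorm d et) powr e <= w et" for et
 proof -
 have "1 + norm et <= (1 + anorm d et)\<^sup>2"
 using norm_le_anorm[of et d] anorm_nonneg[of d et] unfolding power2_sum one_power2 mult_1_right by linarith
 hence "(1 + norm et) ^ (2 * CARD('n)) <= ((1 + anorm d et)\<^sup>2) ^ (2 * CARD('n))" by (intro power_mono) auto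
 also have "... = (1 + anorm d et) powr (4 * real CARD('n))"
 proof -
 have "0 < 1 + anorm d et" by (simp add: add_pos_nonneg)
 from powr_realpow[OF this, of "4 * CARD('n)"] show ?thesis by (simp add: power_mult[symmetric])
 qed
 finally have "1 / (1 + anorm d et) powr (4 * real CARD('n)) <= w et"
 unfolding w_def by (intro divide_left_mono mult_pos_pos) (auto simp: add_pos_nonneg add_nonneg_eq_0_iff)
 moreover have "(1 + anorm d et) powr e <= (1 + anorm d et) powr (- (4 * real CARD('n)))"
 using m by (intro powr_mono) (auto simp: e_def)
 ultimately show ?thesis by (simp add: powr_minus_divide)
 qed
 hence le: "norm (Dl (map cdir (replicate m i)) (F p) et) <= C * w et" if "p : P" for p et
 using C(2)[OF that, of et] mult_left_mono[OF _ C(1)] order_trans by blast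
 have iw: "integrable lborel w" unfolding w_def[abs_def] by (rule decay_integrable) simp
 have "\<bar>u $ i\<bar> ^ m * norm (ft (F p) u) <= (LBINT et. C * w et)" if p: "p : P" for p u
 by (rule order_trans[OF ft_component_bound[OF sF[OF p]]])
 (intro integral_mono le p integrable_norm schwartz_integrable schwartz_Dl_any sF integrable_mult_right iw)
 moreover have "0 <= (LBINT et. C * w et)" using C(1) by (intro integral_nonneg_AE AE_I2) (simp add: w_def)
 ultimately show ?thesis by blast
qed

subsection \<open>The kernel of a symbol\<close>

text \<open>Take the coordinate i in which u is large and put w = wt_i m, y = anorm d u R. The
  hypothesis yields (y / N)^w X <= C R^a, and since y >= 1 and m <= w <= 2 m, the exponent of y can
  be lowered to m and that of N raised to 2 m, which removes the dependence on i.\<close>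

lemma anorm_decay:
 fixes u :: "real^'n" and a :: real
 assumes b: "!!i. \<bar>u $ i\<bar> ^ m * X <= C * R powr (a - real (wt d i * m))"
 and C: "0 <= C" and X: "0 <= X" and R: "0 < R" and uR: "1 <= anorm d u * R"
 shows "X <= C * real CARD('n) ^ (2 * m) * R powr a * (anorm d u * R) powr (- real m)"
proof -
 obtain i where i: "(anorm d u / CARD('n)) ^ wt d i <= \<bar>u $ i\<bar>" using anorm_large_component by blast
 define N where "N = real CARD('n)"
 have N: "1 <= N" by (simp add: N_def)
 define w where "w = wt d i * m"
 define y where "y = anorm d u * R"
 have w: "m <= w" "w <= 2 * m" by (auto simp: w_def wt_def)
 have "(anorm d u / N) ^ w <= \<bar>u $ i\<bar> ^ m"
 using power_mono[OF i, of m] by (simp add: w_def N_def power_mult)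
 hence "(anorm d u / N) ^ w * X <= C * R powr (a - real w)"
 using b[of i] mult_right_mono[OF _ X] order_trans unfolding w_def by blast
 also have "... = C * R powr a / R ^ w" using R by (simp add: powr_diff powr_realpow)
 finally have "(anorm d u / N) ^ w * X * R ^ w <= C * R powr a"
 using R by (simp add: pos_le_divide_eq)
 hence "(y / N) ^ w * X <= C * R powr a" by (simp add: y_def power_mult_distrib power_divide mult_ac)
 hence "y ^ w * X <= C * R powr a * N ^ w" using N by (simp add: power_divide field_simps)
 also have "... <= C * R powr a * N ^ (2 * m)"
 using N w C by (intro mult_left_mono power_increasing) auto
 finally have "y ^ w * X <= C * R powr a * N ^ (2 * m)" .
 moreover have "y ^ m * X <= y ^ w * X" using uR w X by (intro mult_right_mono power_increasing) (auto simp: y_def)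
 ultimately have 1: "y ^ m * X <= C * R powr a * N ^ (2 * m)" by linarith
 have y: "0 < y" using uR by (simp add: y_def)
 have "X = y powr (- real m) * (y ^ m * X)" using y by (simp add: powr_minus powr_realpow)
 also have "... <= y powr (- real m) * (C * R powr a * N ^ (2 * m))" by (rule mult_left_mono[OF 1]) simp
 finally show ?thesis by (simp add: y_def N_def mult_ac)
qed

lemma gsym_slice:
 assumes "symb d s b"
 shows "gsym UNIV UNIV (%et. 1 + anorm d et) (udeg d) s (%x et. b (x, et))"
proof (rule gsym_cdirI)
 show "Cinf_on UNIV (%et. b (x, et))" for x by (rule Cinf_on_slice[OF gsym_Cinf[OF assms UNIV_I]])
 fix al
 obtain C where "ALL x \<xi>. norm (Dl (map xdir [] @ map udir al) b (x, \<xi>)) <= C * (1 + anorm d \<xi>) powr (s - wdeg d al)"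
 using symb_xudir_bound[OF assms] by blast
 moreover have "map (Pair 0) (map cdir al) = map xdir [] @ map udir al" by (simp add: cdir_def udir_def[abs_def] o_def)
 ultimately show "EX C. ALL x:UNIV. ALL et:UNIV. norm (Dl (map cdir al) (%et. b (x, et)) et) <= C * (1 + anorm d et) powr (s - wdeg d al)"
 by (intro exI[of _ C]) (simp only: Dl_slice, simp)
qed

lemma schwartz_cutR: "0 < R ==> schwartz (cutR d R)"
proof (rule schwartz_compact[OF Cinf_cutR, of "R + R\<^sup>2"])
 fix u :: "real^'a" assume "0 < R" "R + R\<^sup>2 < norm u"
 have "R < anorm d u"
 proof (rule ccontr)
 assume "\<not> R < anorm d u"
 hence "anorm d u <= R" "(anorm d u)\<^sup>2 <= R\<^sup>2" by (auto intro: power_mono)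
 thus False using norm_le_anorm[of u d] \<open>R + R\<^sup>2 < norm u\<close> by linarith
 qed
 thus "cutR d R u = 0" using \<open>0 < R\<close> by (simp add: cutR_simps(1))
qed

definition kR :: "'n::finite => ((real^'n) \<times> (real^'n) => complex) => real => (real^'n) \<times> (real^'n) => complex" where
 "kR d b R = pft (%z. b z * cutR d R (snd z))"

text \<open>A limit along R = j + 1, which keeps R >= 1; convergence is established for u ~=
  0.\<close>

definition kern :: "'n::finite => ((real^'n) \<times> (real^'n) => complex) => (real^'n) \<times> (real^'n) => complex" where
 "kern d b z = lim (%j. kR d b (real j + 1) z)"

lemma PS_kR: "om b ==> 0 < R ==> PS (%z. b z * cutR d R (snd z))"
 by (rule PS_om[OF PS_snd[OF schwartz_cutR]])

lemma kR_eq: "kR d b R (x, u) = ft (%et. b (x, et) * cutR d R et) u"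
 by (simp add: kR_def pft_def)

lemma schwartz_b_cutR: "om b ==> 0 < R ==> schwartz (%et. b (x, et) * cutR d R et)"
 using PS_slice[OF PS_kR[of b R d], of x] by simp

lemma ft_diff: "schwartz f ==> schwartz g ==> ft (%u. f u - g u) et = ft f et - ft g et"
 unfolding ft_def left_diff_distrib
 by (rule Bochner_Integration.integral_diff) (auto intro!: schwartz_integrable schwartz_cis)

text \<open>\<open>anorm_decay\<close> combines the estimates for the single coordinates; the
  constants of the finitely many coordinates are added.\<close>

lemma kR_diff_bound:
 fixes d :: "'n::finite" and s :: real
 assumes b: "symb d s b" and m: "s - real m <= - (4 * real CARD('n))"
 shows "EX C>=0. ALL x u R R'. 1 <= R --> R <= R' --> 1 <= anorm d u * R -->
 norm (kR d b R' (x, u) - kR d b R (x, u)) <= C * R powr (CARD('n) + 1 + s) * (anorm d u * R) powr (- real m)"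
proof -
 have m': "s - real (wt d i * m) <= - (4 * real CARD('n))" for i
 proof -
 have "m <= wt d i * m" by (simp add: wt_def)
 hence "real m <= real (wt d i * m)" by (rule of_nat_mono)
 thus ?thesis using m by linarith
 qed
 have "ALL i. EX C>=0. ALL x:UNIV. ALL R:{1..}. ALL R':{1..}. R <= R' --> (ALL u.
 \<bar>u $ i\<bar> ^ m * norm (ft (%et. b (x, et) * (cutR d R' et - cutR d R et)) u) <= C * R powr (CARD('n) + 1 + s - real (wt d i * m)))"
 by (rule allI, rule shell_oscillation[OF _ gsym_slice[OF b] _ gsym_cutR _ m']) auto
 from choice[OF this] obtain C where C: "!!i. C i >= 0" "!!i x R R' u. 1 <= R ==> 1 <= R' ==> R <= R' ==>
 \<bar>u $ i\<bar> ^ m * norm (ft (%et. b (x, et) * (cutR d R' et - cutR d R et)) u) <= C i * R powr (CARD('n) + 1 + s - real (wt d i * m))"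
 unfolding atLeast_iff Ball_def by blast
 define C0 where "C0 = (\<Sum>i\<in>UNIV. C i)"
 have le: "C i <= C0" for i unfolding C0_def by (rule member_le_sum) (auto simp: C)
 have C0: "0 <= C0" by (simp add: C0_def sum_nonneg C)
 have "norm (kR d b R' (x, u) - kR d b R (x, u)) <= C0 * real CARD('n) ^ (2 * m) * R powr (CARD('n) + 1 + s) * (anorm d u * R) powr (- real m)"
 if R: "1 <= R" "R <= R'" "1 <= anorm d u * R" for x u R R'
 proof (rule anorm_decay[OF _ C0 norm_ge_zero _ R(3)])
 fix i
 have o: "om b" by (rule symb_imp_om[OF b])
 have "kR d b R' (x, u) - kR d b R (x, u) = ft (%et. b (x, et) * (cutR d R' et - cutR d R et)) u"
 using R ft_diff[OF schwartz_b_cutR[OF o, of R' x d] schwartz_b_cutR[OF o, of R x d], of u]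
 by (simp add: kR_eq right_diff_distrib)
 hence "\<bar>u $ i\<bar> ^ m * norm (kR d b R' (x, u) - kR d b R (x, u)) <= C i * R powr (CARD('n) + 1 + s - real (wt d i * m))"
 using C(2)[of R R' u i x] R by simp
 also have "... <= C0 * R powr (CARD('n) + 1 + s - real (wt d i * m))" by (rule mult_right_mono[OF le]) simp
 finally show "\<bar>u $ i\<bar> ^ m * norm (kR d b R' (x, u) - kR d b R (x, u)) <= C0 * R powr (CARD('n) + 1 + s - real (wt d i * m))" .
 qed (use R in simp)
 thus ?thesis using C0 by (intro exI[of _ "C0 * real CARD('n) ^ (2 * m)"]) auto
qed

lemma exponent_exists: "EX m::nat. s - real m <= - (4 * real CARD('n::finite)) & t <= real m"
proof -
 obtain m :: nat where "max t (s + 4 * real CARD('n)) <= real m" using real_arch_simple by blast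
 thus ?thesis by (intro exI[of _ m]) auto
qed

text \<open>The condition on m leaves the exponent CARD('n) + 1 + s - m <= -1, so for fixed u ~= 0
  the truncations differ by O(1 / R) and form a Cauchy sequence; the bound persists as R' tends to
  infinity.\<close>

lemma kR_limit:
 fixes d :: "'n::finite" and s :: real
 assumes b: "symb d s b" and m: "s - real m <= - (4 * real CARD('n))"
 shows kR_tendsto: "!!x u. u ~= 0 ==> (%j. kR d b (real j + 1) (x, u)) \<longlonglongrightarrow> kern d b (x, u)"
 and kern_diff: "EX C>=0. ALL x u R. 1 <= R --> 1 <= anorm d u * R -->
 norm (kern d b (x, u) - kR d b R (x, u)) <= C * R powr (CARD('n) + 1 + s) * (anorm d u * R) powr (- real m)"
proof -
 obtain C where C: "C >= 0" "!!x u R R'. 1 <= R ==> R <= R' ==> 1 <= anorm d u * R ==>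
 norm (kR d b R' (x, u) - kR d b R (x, u)) <= C * R powr (CARD('n) + 1 + s) * (anorm d u * R) powr (- real m)"
 using kR_diff_bound[OF b m] by blast
 show lim: "(%j. kR d b (real j + 1) (x, u)) \<longlonglongrightarrow> kern d b (x, u)" if u: "u ~= 0" for x u
 proof -
 define c where "c = anorm d u"
 have c: "0 < c" using u by (simp add: c_def)
 have bd: "norm (kR d b R' (x, u) - kR d b R (x, u)) <= C * c powr (- real m) / R"
 if "1 <= R" "R <= R'" "1 <= c * R" for R R'
 proof -
 have "R powr (CARD('n) + 1 + s) * (c * R) powr (- real m) = c powr (- real m) * R powr (CARD('n) + 1 + s - real m)"
  using that c by (simp add: powr_mult powr_diff powr_minus divide_inverse)
 also have "... <= c powr (- real m) * R powr (- 1)"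
 proof -
  have "1 <= real CARD('n)" by simp
  hence "CARD('n) + 1 + s - real m <= - 1" using m by linarith
  thus ?thesis using that by (intro mult_left_mono powr_mono) auto
 qed
 finally have "C * (R powr (CARD('n) + 1 + s) * (c * R) powr (- real m)) <= C * (c powr (- real m) * R powr (- 1))"
  by (rule mult_left_mono[OF _ C(1)])
 thus ?thesis using C(2)[of R R' u x] that by (simp add: powr_minus divide_inverse mult.assoc c_def)
 qed
 have "Cauchy (%j. kR d b (real j + 1) (x, u))"
 proof (rule CauchyI')
 fix e :: real assume e: "0 < e"
 obtain M :: nat where M: "max (1 / c) (C * c powr (- real m) / e) < real M" using reals_Archimedean2 by blast
 have "norm (kR d b (real i + 1) (x, u) - kR d b (real j + 1) (x, u)) < e" if ij: "M <= i" "i < j" for i j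
 proof -
  have "real M < real i + 1" using ij by simp
  hence R: "1 / c < real i + 1" "C * c powr (- real m) / e < real i + 1" using M by linarith+
  have "norm (kR d b (real j + 1) (x, u) - kR d b (real i + 1) (x, u)) <= C * c powr (- real m) / (real i + 1)"
  using R c ij by (intro bd) (auto simp: field_simps)
  also have "... < e" using R e by (simp add: field_simps)
  finally show ?thesis by (simp add: norm_minus_commute)
 qed
 thus "EX M. ALL i>=M. ALL j>i. dist (kR d b (real i + 1) (x, u)) (kR d b (real j + 1) (x, u)) < e"
  unfolding dist_norm by blast
 qed
 thus ?thesis unfolding kern_def using Cauchy_convergent_iff convergent_LIMSEQ_iff by blast
 qed
 have "norm (kern d b (x, u) - kR d b R (x, u)) <= C * R powr (CARD('n) + 1 + s) * (anorm d u * R) powr (- real m)"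
 if R: "1 <= R" "1 <= anorm d u * R" for x u R
 proof (rule tendsto_upperbound)
 have "u ~= 0" using R by auto
 thus "(%j. norm (kR d b (real j + 1) (x, u) - kR d b R (x, u))) \<longlonglongrightarrow> norm (kern d b (x, u) - kR d b R (x, u))"
 by (intro tendsto_intros lim)
 obtain M :: nat where "R <= real M" using real_arch_simple by blast
 hence "!!j. M <= j ==> R <= real j + 1" by linarith
 thus "\<forall>\<^sub>F j in sequentially. norm (kR d b (real j + 1) (x, u) - kR d b R (x, u)) <= C * R powr (CARD('n) + 1 + s) * (anorm d u * R) powr (- real m)"
 using R by (intro eventually_sequentiallyI[of M] C(2)) auto
 qed simp
 thus "EX C>=0. ALL x u R. 1 <= R --> 1 <= anorm d u * R -->
 norm (kern d b (x, u) - kR d b R (x, u)) <= C * R powr (CARD('n) + 1 + s) * (anorm d u * R) powr (- real m)"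
 using C(1) by blast
qed

text \<open>Rescaling by R turns the truncation into the unit cutoff and contributes R^Q; on its
  support (1 + R anorm v)^s <= (2 R)^s, because s >= 0 and R >= 1.\<close>

lemma kR_bound:
 fixes d :: "'n::finite" and s :: real
 assumes b: "symb d s b" and s: "0 <= s"
 shows "EX C>=0. ALL x u R. 1 <= R --> norm (kR d b R (x, u)) <= C * R powr (CARD('n) + 1 + s)"
proof -
 obtain C where C: "C >= 0" "!!x et. norm (b (x, et)) <= C * (1 + anorm d et) powr s"
 using symb_xudir_bound[OF b, of "[]" "[]"] by auto
 define T where "T = (LBINT v. norm (cut d v))"
 have "dil d 1 u = u" for u by (simp add: vec_eq_iff dil_def)
 hence scut: "schwartz (cut d)" using schwartz_cutR[of 1 d] by (simp add: cutR_def[abs_def])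
 have T0: "0 <= T" unfolding T_def by (intro integral_nonneg_AE AE_I2) auto
 have "norm (kR d b R (x, u)) <= (C * 2 powr s * T) * R powr (CARD('n) + 1 + s)" if R: "1 <= R" for x u R
 proof -
 define f where "f v = b (x, dil d (1 / R) v) * cut d v * cis (2 * pi * (dil d (1 / R) v \<bullet> u))" for v
 have [measurable]: "(%et. b (x, et)) : borel_measurable borel" "cut d : borel_measurable borel"
 by (auto intro!: borel_measurable_continuous_onI Cinf_on_continuous[OF gsym_Cinf[OF gsym_slice[OF b]]] Cinf_on_continuous[OF Cinf_cut])
 have [measurable]: "(%v. b (x, dil d (1 / R) v)) : borel_measurable borel"
 by (rule measurable_compose[OF measurable_dil]) measurable
 have f[measurable]: "f : borel_measurable borel" unfolding f_def by measurable
 have "kR d b R (x, u) = (LBINT et. f (dil d R et))"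
 using R by (simp add: kR_eq ft_def f_def cutR_def dil_dil)
 also have "... = cor (R ^ (CARD('n) + 1)) * (LBINT v. f v)"
 by (rule integral_dil) (use R f in auto)
 finally have 1: "norm (kR d b R (x, u)) = R ^ (CARD('n) + 1) * norm (LBINT v. f v)"
 using R by (simp add: norm_mult norm_power)
 have fb: "norm (f v) <= C * (2 * R) powr s * norm (cut d v)" for v
 proof (cases "anorm d v <= 1")
 case True
 have "anorm d (dil d (1 / R) v) = R * anorm d v" using R by (simp add: anorm_dil)
 also have "... <= R * 1" using True R by (intro mult_left_mono) auto
 finally have "(1 + anorm d (dil d (1 / R) v)) powr s <= (2 * R) powr s" using R s by (intro powr_mono2) auto
 hence "norm (b (x, dil d (1 / R) v)) <= C * (2 * R) powr s"
  using C(2)[of x "dil d (1 / R) v"] mult_left_mono[OF _ C(1)] order_trans by blast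
 thus ?thesis by (simp add: f_def norm_mult mult_right_mono)
 qed (simp add: f_def cut_outside)
 have ic: "integrable lborel (%v. norm (cut d v))" by (rule integrable_norm[OF schwartz_integrable[OF scut]])
 have "norm (LBINT v. f v) <= (LBINT v. C * (2 * R) powr s * norm (cut d v))"
 proof (rule order_trans[OF integral_norm_bound])
 have "integrable lborel f"
  by (rule Bochner_Integration.integrable_bound[OF integrable_mult_right[OF ic, of "C * (2 * R) powr s"]])
  (use fb C(1) in "auto intro!: AE_I2")
 thus "(LBINT v. norm (f v)) <= (LBINT v. C * (2 * R) powr s * norm (cut d v))"
  by (intro integral_mono integrable_norm integrable_mult_right ic fb)
 qed
 also have "... = C * 2 powr s * T * R powr s" using R by (simp add: T_def powr_mult)
 finally have "R ^ (CARD('n) + 1) * norm (LBINT v. f v) <= R ^ (CARD('n) + 1) * (C * 2 powr s * T * R powr s)"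
 using R by (intro mult_left_mono) auto
 moreover have "R powr (CARD('n) + 1 + s) = R ^ (CARD('n) + 1) * R powr s"
 using R powr_realpow[of R "CARD('n) + 1"] by (simp only: powr_add)
 ultimately show ?thesis unfolding 1 by (simp only: mult_ac)
 qed
 thus ?thesis using C(1) T0 by (intro exI[of _ "C * 2 powr s * T"]) auto
qed

text \<open>For anorm u <= 1, R = 1 / anorm u balances truncation and remainder, and the extra M is
  free. For larger u, R = 1 is used, and the unit piece decays by integration by parts; m >= Q + s +
  M makes both terms small enough.\<close>

lemma kern_bound:
 fixes d :: "'n::finite" and s :: real
 assumes b: "symb d s b" and s: "0 <= s" and M: "0 <= M"
 shows "EX C>=0. ALL x u. u ~= 0 --> norm (kern d b (x, u)) <= C * anorm d u powr (- (real CARD('n) + 1) - s - M)"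
proof -
 obtain m :: nat where m: "s - real m <= - (4 * real CARD('n))" "real CARD('n) + 1 + s + M <= real m"
 using exponent_exists by blast
 obtain C1 where C1: "C1 >= 0" "!!x u R. 1 <= R ==> 1 <= anorm d u * R ==>
 norm (kern d b (x, u) - kR d b R (x, u)) <= C1 * R powr (CARD('n) + 1 + s) * (anorm d u * R) powr (- real m)"
 using kern_diff[OF b m(1)] by blast
 obtain C2 where C2: "C2 >= 0" "!!x u R. 1 <= R ==> norm (kR d b R (x, u)) <= C2 * R powr (CARD('n) + 1 + s)"
 using kR_bound[OF b s] by blast
 have "EX C>=0. ALL x:UNIV. ALL u. \<bar>u $ i\<bar> ^ m * norm (ft (%et. b (x, et) * cutR d 1 et) u) <= C" for i :: 'n
 proof (rule full_oscillation)
 show "gsym UNIV UNIV (%et. 1 + anorm d et) (udeg d) (s + 0) (%x et. b (x, et) * cutR d 1 et)"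
 by (rule gsym_mult[OF open_UNIV gsym_slice[OF b] gsym_reindex[OF gsym_cutR]]) simp
 show "schwartz (%et. b (x, et) * cutR d 1 et)" for x by (rule schwartz_b_cutR[OF symb_imp_om[OF b]]) simp
 have "m <= wt d i * m" by (simp add: wt_def)
 hence "real m <= real (wt d i * m)" by (rule of_nat_mono)
 thus "s + 0 - real (wt d i * m) <= - (4 * real CARD('n))" using m by linarith
 qed
 hence "ALL i. EX C>=0. ALL x:UNIV. ALL u. \<bar>u $ i\<bar> ^ m * norm (kR d b 1 (x, u)) <= C" by (simp only: kR_eq) blast
 from choice[OF this] obtain C3 where C3: "!!i. C3 i >= 0" "!!i x u. \<bar>u $ i\<bar> ^ m * norm (kR d b 1 (x, u)) <= C3 i"
 unfolding Ball_def by blast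
 define C4 where "C4 = (\<Sum>i\<in>UNIV. C3 i)"
 have le: "C3 i <= C4" for i unfolding C4_def by (rule member_le_sum) (auto simp: C3)
 have C4: "0 <= C4" by (simp add: C4_def sum_nonneg C3)
 define C where "C = C1 + C2 + C4 * real CARD('n) ^ (2 * m)"
 have C: "0 <= C" using C1 C2 C4 by (simp add: C_def)
 have "norm (kern d b (x, u)) <= C * anorm d u powr (- (real CARD('n) + 1) - s - M)" if u: "u ~= 0" for x u
 proof (cases "anorm d u <= 1")
 case True
 define R where "R = 1 / anorm d u"
 have R: "1 <= R" "anorm d u * R = 1" using True u by (auto simp: R_def field_simps)
 have "norm (kern d b (x, u)) <= C1 * R powr (CARD('n) + 1 + s) + C2 * R powr (CARD('n) + 1 + s)"
 using C1(2)[of R u x] C2(2)[of R x u] R norm_triangle_sub[of "kern d b (x, u)" "kR d b R (x, u)"] by simp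
 also have "... <= C * R powr (CARD('n) + 1 + s)"
 using C4 by (simp add: C_def distrib_right)
 also have "R powr (CARD('n) + 1 + s) = anorm d u powr (- (real CARD('n) + 1) - s)"
 using u by (simp add: R_def powr_divide powr_minus_divide[symmetric] algebra_simps)
 also have "... <= anorm d u powr (- (real CARD('n) + 1) - s - M)"
 using True M u by (intro powr_mono') auto
 finally show ?thesis using C by (simp add: mult_left_mono)
 next
 case False
 have "norm (kR d b 1 (x, u)) <= C4 * real CARD('n) ^ (2 * m) * 1 powr 0 * (anorm d u * 1) powr (- real m)"
 by (rule anorm_decay) (use order_trans[OF C3(2)[of u _ x] le] C4 False in auto)
 hence "norm (kern d b (x, u)) <= C1 * anorm d u powr (- real m) + C4 * real CARD('n) ^ (2 * m) * anorm d u powr (- real m)"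
 using C1(2)[of 1 u x] False norm_triangle_sub[of "kern d b (x, u)" "kR d b 1 (x, u)"] by simp
 also have "... <= C * anorm d u powr (- real m)" using C2 by (simp add: C_def distrib_right)
 also have "... <= C * anorm d u powr (- (real CARD('n) + 1) - s - M)"
 using False m C by (intro mult_left_mono powr_mono) auto
 finally show ?thesis .
 qed
 thus ?thesis using C by blast
qed

lemma has_dir_limit:
 fixes f :: "nat => 'a::euclidean_space => complex"
 assumes U: "open U" and d: "!!n y. y : U ==> has_dir (f n) v (f' n y) y"
 and l: "!!y. y : U ==> (%n. f n y) \<longlonglongrightarrow> g y"
 and u: "uniform_limit U f' g' sequentially" and x: "x : U"
 shows "has_dir g v (g' x) x"
proof -
 have o: "open {t. x + t *\<^sub>R v : U}" by (rule open_line_preimage[OF U])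
 have "0 : {t. x + t *\<^sub>R v : U}" using x by simp
 then obtain e where e: "e > 0" "ball 0 e <= {t. x + t *\<^sub>R v : U}" by (rule openE[OF o])
 have in_U: "x + t *\<^sub>R v : U" if "t : ball 0 e" for t using that e by auto
 have "EX h. ALL t:ball 0 e. (%n. f n (x + t *\<^sub>R v)) \<longlonglongrightarrow> h t & (h has_derivative (%s. s *\<^sub>R g' (x + t *\<^sub>R v))) (at t within ball 0 e)"
 proof (rule has_derivative_sequence[where f' = "%n t s. s *\<^sub>R f' n (x + t *\<^sub>R v)"])
 show "((%t. f n (x + t *\<^sub>R v)) has_derivative (%s. s *\<^sub>R f' n (x + t *\<^sub>R v))) (at t within ball 0 e)" if "t : ball 0 e" for n t
 using has_dir_line[OF d[OF in_U[OF that]]] has_derivative_at_withinI unfolding has_vector_derivative_def by blast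
 show "\<forall>\<^sub>F n in sequentially. ALL t:ball 0 e. ALL s. norm (s *\<^sub>R f' n (x + t *\<^sub>R v) - s *\<^sub>R g' (x + t *\<^sub>R v)) <= ep * norm s" if "ep > 0" for ep
 proof (rule eventually_mono[OF uniform_limitD[OF u that]], intro ballI allI)
 fix n and t s :: real
 assume a: "ALL y:U. dist (f' n y) (g' y) < ep" and t: "t : ball 0 e"
 have "norm (f' n (x + t *\<^sub>R v) - g' (x + t *\<^sub>R v)) <= ep" using a in_U[OF t] by (auto simp: dist_norm less_imp_le)
 hence "\<bar>s\<bar> * norm (f' n (x + t *\<^sub>R v) - g' (x + t *\<^sub>R v)) <= \<bar>s\<bar> * ep" by (rule mult_left_mono) simp
 thus "norm (s *\<^sub>R f' n (x + t *\<^sub>R v) - s *\<^sub>R g' (x + t *\<^sub>R v)) <= ep * norm s"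
  by (simp add: scaleR_diff_right[symmetric] mult.commute)
 qed
 show "(0::real) : ball 0 e" using e by simp
 show "(%n. f n (x + 0 *\<^sub>R v)) \<longlonglongrightarrow> g x" using l[OF x] by simp
 qed simp
 then obtain h where h: "!!t. t : ball 0 e ==> (%n. f n (x + t *\<^sub>R v)) \<longlonglongrightarrow> h t"
 "(h has_derivative (%s. s *\<^sub>R g' (x + 0 *\<^sub>R v))) (at 0 within ball 0 e)" using e(1) centre_in_ball by blast
 have "h t = g (x + t *\<^sub>R v)" if "t : ball 0 e" for t
 using LIMSEQ_unique[OF h(1)[OF that] l[OF in_U[OF that]]] .
 hence "((%t. g (x + t *\<^sub>R v)) has_vector_derivative g' x) (at 0 within ball 0 e)"
 using h(2) e(1) by (intro has_vector_derivative_transform[of 0 "ball 0 e" "%t. g (x + t *\<^sub>R v)" h]) (auto simp: has_vector_derivative_def)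
 thus ?thesis using e(1) by (simp add: has_dir_def at_within_open[of 0 "ball 0 e"])
qed

lemma symb_dirD: "symb d s b ==> v : Basis ==> symb d (s - xudeg d v) (dirD v b)"
 by (rule gsym_dirD)

text \<open>The first derivative of a linear function is constant and all later ones vanish, so
  degrees matter only in directions with L v ~= 0. Coordinates are the intended instances.\<close>

lemma gsym_linear:
 fixes L :: "'a::euclidean_space => complex"
 assumes bl: "bounded_linear L" and U: "open U" and \<rho>: "!!z. z : U ==> 0 < \<rho> z"
 and C: "!!z. z : U ==> norm (L z) <= C * \<rho> z powr t" and dg: "!!v. v : Basis ==> L v ~= 0 ==> dg v = t"
 shows "gsym P U \<rho> dg t (%_. L)"
proof (rule gsymI)
 show "Cinf_on U L" by (rule Cinf_on_linear[OF bl U])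
 have d1: "dirD v L = (%z. L v)" for v using dirD_eq[OF has_dir_linear[OF bl]] by blast
 have d2: "Dl (u # us) (%z :: 'a. a :: complex) z = 0" for u us a z
 using Dl_vanishes[of UNIV "dirD u (%z. a)" z us] Dl_append[of us "[u]" "%z. a"] dirD_eq[OF has_dir_const, of u a]
 Dl_perm[OF open_UNIV Cinf_on_const[OF open_UNIV], of "u # us" "us @ [u]" z a]
 by (simp add: Dl_Cons)
 fix vs :: "'a list" assume vs: "set vs <= Basis"
 show "EX C. ALL p:P. ALL z:U. norm (Dl vs L z) <= C * \<rho> z powr (t - (\<Sum>v\<leftarrow>vs. dg v))"
 proof (cases vs rule: rev_cases)
 case Nil thus ?thesis using C by auto
 next
 case (snoc ws w)
 show ?thesis
 proof (cases "ws = [] & L w ~= 0")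
 case True
 hence "dg w = t" using dg vs snoc by simp
 thus ?thesis using snoc True \<rho>
  by (intro exI[of _ "norm (L w)"]) (auto simp: Dl_Cons d1 dest: less_imp_neq[OF \<rho>])
 next
 case False
 hence "Dl vs L z = 0" for z
  using snoc d2[of "hd ws" "tl ws" "L w" z] by (cases ws) (auto simp: Dl_append Dl_Cons d1)
 thus ?thesis by (intro exI[of _ 0]) simp
 qed
 qed
qed

lemma symb_coordinate:
 fixes d :: "'n::finite"
 shows "symb d (wt d i) (%z. c * cor (snd z $ i))"
proof (rule gsym_linear[where C = "norm c"])
 show "bounded_linear (%z :: (real^'n) \<times> (real^'n). c * cor (snd z $ i))"
 by (intro bounded_linear_compose[OF bounded_linear_mult_right] bounded_linear_compose[OF bounded_linear_of_real]
 bounded_linear_compose[OF bounded_linear_vec_nth] bounded_linear_snd)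
 show p: "0 < 1 + anorm d (snd z)" for z :: "(real^'n) \<times> (real^'n)" by (rule add_pos_nonneg) auto
 show "norm (c * cor (snd z $ i)) <= norm c * (1 + anorm d (snd z)) powr real (wt d i)" for z :: "(real^'n) \<times> (real^'n)"
 proof -
 have "\<bar>snd z $ i\<bar> <= (1 + anorm d (snd z)) ^ wt d i"
 by (rule order_trans[OF component_le_anorm[of _ _ d] power_mono]) auto
 thus ?thesis using p[of z] by (simp add: norm_mult powr_realpow mult_left_mono)
 qed
 show "v : Basis ==> c * cor (snd v $ i) ~= 0 ==> xudeg d v = real (wt d i)" for v
 by (auto simp: Basis_xudir xdir_def) (auto simp: udir_def axis_def split: if_splits)
qed simp

text \<open>An x-derivative of the kernel differentiates the symbol and a u-derivative multiplies it
  by 2 pi i eta_i, so derivatives of kernels are kernels of symbols.\<close>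

lemma kR_has_dir:
 assumes b: "om b" and R: "0 < R"
 shows "has_dir (kR d b R) (xdir i) (kR d (dirD (xdir i) b) R z) z"
 and "has_dir (kR d b R) (udir i) (kR d (%z. \<i> * (2 * pi) * cor (snd z $ i) * b z) R z) z"
proof -
 define \<Phi> where "\<Phi> z = b z * cutR d R (snd z)" for z
 have P: "has_dir (kR d b R) v (pft (%z. dirD (fst v, 0) \<Phi> z + \<i> * (2 * pi * (snd z \<bullet> snd v)) * \<Phi> z) z) z" for v
 using pft_PS(2)[OF PS_kR[OF b R]] unfolding kR_def \<Phi>_def[abs_def] by blast
 have c: "has_dir (%z. cutR d R (snd z)) (xdir i) 0 z" for z :: "(real^'a) \<times> (real^'a)"
 using has_dir_const[of "cutR d R (snd z)" 0 "xdir i"] by (simp add: has_dir_def xdir_def)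
 have "has_dir \<Phi> (xdir i) (dirD (xdir i) b z * cutR d R (snd z) + b z * 0) z" for z
 unfolding \<Phi>_def
 by (rule has_dir_bilinear[OF bounded_bilinear_mult has_dir_any[OF open_UNIV om_Cinf[OF b] UNIV_I] c])
 hence "dirD (xdir i) \<Phi> z = dirD (xdir i) b z * cutR d R (snd z)" for z using dirD_eq by fastforce
 thus "has_dir (kR d b R) (xdir i) (kR d (dirD (xdir i) b) R z) z"
 using P[of "xdir i"] unfolding xdir_def by (simp add: kR_def)
 have "dirD 0 \<Phi> z = 0" for z by (simp add: dirD_def)
 hence "dirD (fst (udir i), 0) \<Phi> z = 0" for z by (simp add: udir_def zero_prod_def)
 thus "has_dir (kR d b R) (udir i) (kR d (%z. \<i> * (2 * pi) * cor (snd z $ i) * b z) R z) z"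
 using P[of "udir i"] by (simp add: kR_def udir_def inner_axis \<Phi>_def mult_ac)
qed

lemma kern_uniform:
 fixes d :: "'n::finite" and s :: real
 assumes b: "symb d s b" and de: "0 < de"
 shows "uniform_limit {z. de < anorm d (snd z)} (%j. kR d b (real j + 1)) (kern d b) sequentially"
proof (rule uniform_limitI)
 fix e :: real assume e: "0 < e"
 obtain m :: nat where m: "s - real m <= - (4 * real CARD('n))" using exponent_exists by blast
 obtain C where C: "C >= 0" "!!x u R. 1 <= R ==> 1 <= anorm d u * R ==>
 norm (kern d b (x, u) - kR d b R (x, u)) <= C * R powr (CARD('n) + 1 + s) * (anorm d u * R) powr (- real m)"
 using kern_diff[OF b m] by blast
 obtain M :: nat where M: "max (1 / de) (C * de powr (- real m) / e) < real M" using reals_Archimedean2 by blast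
 have "dist (kR d b (real j + 1) (x, u)) (kern d b (x, u)) < e" if j: "M <= j" and u: "de < anorm d u" for j x u
 proof -
 define R where "R = real j + 1"
 have "real M < R" using j by (simp add: R_def)
 hence R: "1 / de < R" "C * de powr (- real m) / e < R" "1 <= R" using M by (auto simp: R_def)
 have uR: "1 < de * R" "de * R <= anorm d u * R" using R de u by (auto simp: field_simps)
 have "norm (kern d b (x, u) - kR d b R (x, u)) <= C * R powr (CARD('n) + 1 + s) * (anorm d u * R) powr (- real m)"
 by (rule C(2)) (use R uR in linarith)+
 also have "... <= C * R powr (CARD('n) + 1 + s) * (de * R) powr (- real m)"
 using C uR by (intro mult_left_mono powr_mono2') auto
 also have "... = C * de powr (- real m) * R powr (CARD('n) + 1 + s - real m)"
 using R de by (simp add: powr_mult powr_diff powr_minus divide_inverse)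
 also have "... <= C * de powr (- real m) * R powr (- 1)"
 proof -
 have "1 <= real CARD('n)" by simp
 hence "CARD('n) + 1 + s - real m <= - 1" using m by linarith
 thus ?thesis using R C by (intro mult_left_mono powr_mono) auto
 qed
 also have "... < e"
 proof -
 have "A * R powr (- 1) < e" if "A / e < R" for A
 proof -
  have "A < R * e" using that e by (simp add: pos_divide_less_eq)
  thus ?thesis using R by (simp add: powr_minus field_simps)
 qed
 from this[OF R(2)] show ?thesis .
 qed
 finally show ?thesis by (simp add: R_def dist_norm norm_minus_commute)
 qed
 thus "\<forall>\<^sub>F j in sequentially. ALL z:{z. de < anorm d (snd z)}. dist (kR d b (real j + 1) z) (kern d b z) < e"
 by (intro eventually_sequentiallyI[of M]) auto
qed

lemma open_snd_anorm: "open {z :: (real^'n) \<times> (real^'n). r < anorm d (snd z)}"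
 using open_vimage_snd[OF open_anorm_gt(1)[of r d]] by (simp add: vimage_def)

lemma open_punctured: "open (UNIV \<times> (UNIV - {0}) :: ((real^'n) \<times> (real^'n)) set)"
 by (intro open_Times) auto

text \<open>Since derivatives of kernels are kernels, \<open>kern_bound\<close> alone will control
  all of them. The limit is differentiated on the region where anorm exceeds half its value at z, on
  which convergence is uniform.\<close>

lemma kern_has_dir:
 fixes d :: "'n::finite" and s :: real
 assumes b: "symb d s b" and v: "v : Basis"
 shows "EX b'. symb d (s + xudeg d v) b' & (ALL z:UNIV \<times> (UNIV - {0}). has_dir (kern d b) v (kern d b' z) z)"
proof -
 have o: "om b" by (rule symb_imp_om[OF b])
 have lim: "has_dir (kern d b) v (kern d b' z) z"
 if b': "symb d s' b'" and h: "!!R z. 0 < R ==> has_dir (kR d b R) v (kR d b' R z) z" and z: "z : UNIV \<times> (UNIV - {0})" for s' b' z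
 proof (rule has_dir_limit[OF open_snd_anorm[of "anorm d (snd z) / 2" d]])
 have z0: "0 < anorm d (snd z)" using z by auto
 show "has_dir (kR d b (real j + 1)) v (kR d b' (real j + 1) y) y" for j y by (rule h) simp
 obtain m :: nat where m: "s - real m <= - (4 * real CARD('n))" using exponent_exists by blast
 show "(%j. kR d b (real j + 1) y) \<longlonglongrightarrow> kern d b y" if "y : {y. anorm d (snd z) / 2 < anorm d (snd y)}" for y
 proof -
 have "anorm d (snd z) / 2 < anorm d (snd y)" using that by simp
 hence "0 < anorm d (snd y)" using z0 by linarith
 thus ?thesis using kR_tendsto[OF b m, of "snd y" "fst y"] by simp
 qed
 show "uniform_limit {y. anorm d (snd z) / 2 < anorm d (snd y)} (%j. kR d b' (real j + 1)) (kern d b') sequentially"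
 using z0 by (intro kern_uniform[OF b']) simp
 show "z : {y. anorm d (snd z) / 2 < anorm d (snd y)}" using z0 by simp
 qed
 from v consider i where "v = xdir i" | i where "v = udir i" unfolding Basis_xudir by blast
 thus ?thesis
 proof cases
 case 1
 have "symb d (s - xudeg d v) (dirD v b)" by (rule symb_dirD[OF b v])
 hence "symb d (s + xudeg d v) (dirD v b)" using 1 by simp
 with lim[OF this] kR_has_dir(1)[OF o] 1 show ?thesis by blast
 next
 case 2
 have "symb d (real (wt d i) + s) (%z. \<i> * (2 * pi) * cor (snd z $ i) * b z)"
 by (rule gsym_mult[OF open_UNIV symb_coordinate b])
 hence "symb d (s + xudeg d v) (%z. \<i> * (2 * pi) * cor (snd z $ i) * b z)" using 2 by (simp add: add.commute)
 with lim[OF this] kR_has_dir(2)[OF o] 2 show ?thesis by blast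
 qed
qed

lemma kern_Dl:
 fixes d :: "'n::finite" and s :: real
 assumes b: "symb d s b" and vs: "set vs <= Basis"
 shows "EX b'. symb d (s + (\<Sum>v\<leftarrow>vs. xudeg d v)) b' & (ALL z:UNIV \<times> (UNIV - {0}). Dl vs (kern d b) z = kern d b' z)"
 using vs
proof (induction vs)
 case Nil thus ?case using b by auto
next
 case (Cons v vs)
 then obtain b' where b': "symb d (s + (\<Sum>v\<leftarrow>vs. xudeg d v)) b'" "!!z. z : UNIV \<times> (UNIV - {0}) ==> Dl vs (kern d b) z = kern d b' z" by auto
 have "v : Basis" using Cons.prems by simp
 from kern_has_dir[OF b'(1) this] obtain b'' where b'': "symb d (s + (\<Sum>v\<leftarrow>vs. xudeg d v) + xudeg d v) b''"
 "!!z. z : UNIV \<times> (UNIV - {0}) ==> has_dir (kern d b') v (kern d b'' z) z" by blast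
 have "Dl (v # vs) (kern d b) z = kern d b'' z" if z: "z : UNIV \<times> (UNIV - {0})" for z
 unfolding Dl_Cons using dirD_cong[OF open_punctured z b'(2), where v = v] dirD_eq[OF b''(2)[OF z]] by simp
 moreover have "s + (\<Sum>v\<leftarrow>v # vs. xudeg d v) = s + (\<Sum>v\<leftarrow>vs. xudeg d v) + xudeg d v" by simp
 ultimately show ?case using b''(1) by (simp only:) blast
qed

text \<open>Kernels of symbols of nonnegative order are closed under differentiation, and
  \<open>kern_bound\<close> makes them locally bounded off u = 0.\<close>

lemma Cinf_kern:
 fixes d :: "'n::finite" and s :: real
 assumes b: "symb d s b" and s: "0 <= s"
 shows "Cinf_on (UNIV \<times> (UNIV - {0})) (kern d b)"
proof (rule Cinf_on_coinduct[OF open_punctured, of _ "{kern d b |b. EX s>=0. symb d s b}"])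
 show "kern d b : {kern d b |b. EX s>=0. symb d s b}" using b s by blast
 fix g assume "g : {kern d b |b. EX s>=0. symb d s b}"
 then obtain b s where b: "symb d s b" and s: "0 <= s" and g: "g = kern d b" by blast
 show "locally_bounded_on (UNIV \<times> (UNIV - {0})) g" unfolding locally_bounded_on_def
 proof
 fix z :: "(real^'n) \<times> (real^'n)" assume "z : UNIV \<times> (UNIV - {0})"
 hence z: "0 < anorm d (snd z)" by auto
 define V where "V = {y :: (real^'n) \<times> (real^'n). anorm d (snd z) / 2 < anorm d (snd y)}"
 have "open V" "z : V" using z open_snd_anorm[of "anorm d (snd z) / 2" d] by (simp_all add: V_def)
 then obtain e where e: "e > 0" "ball z e <= V" by (rule openE)
 obtain C where C: "C >= 0" "!!x u. u ~= 0 ==> norm (kern d b (x, u)) <= C * anorm d u powr (- (real CARD('n) + 1) - s - 0)"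
 using kern_bound[OF b s order_refl] by blast
 have "norm (g y) <= C * (anorm d (snd z) / 2) powr (- (real CARD('n) + 1) - s - 0)" if "y : ball z e" for y
 proof -
 have y: "anorm d (snd z) / 2 < anorm d (snd y)" using that e by (auto simp: V_def)
 hence "0 < anorm d (snd y)" using z by linarith
 hence "norm (g y) <= C * anorm d (snd y) powr (- (real CARD('n) + 1) - s - 0)" using C(2)[of "snd y" "fst y"] g by simp
 also have "... <= C * (anorm d (snd z) / 2) powr (- (real CARD('n) + 1) - s - 0)"
  using y z C s by (intro mult_left_mono powr_mono2') auto
 finally show ?thesis .
 qed
 thus "EX e>0. EX B. ALL y:ball z e. norm (g y) <= B" using e(1) by blast
 qed
 fix v :: "(real^'n) \<times> (real^'n)" assume v: "v : Basis"
 obtain b' where "symb d (s + xudeg d v) b'" "ALL z:UNIV \<times> (UNIV - {0}). has_dir g v (kern d b' z) z"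
 using kern_has_dir[OF b v] g by blast
 moreover have "0 <= s + xudeg d v" using s by (simp add: xudeg_def)
 ultimately show "EX h:{kern d b |b. EX s>=0. symb d s b}. ALL z:UNIV \<times> (UNIV - {0}). has_dir g v (h z) z" by blast
qed

text \<open>The multiplication formula: Fubini, and symmetry of the exponential in its two
  variables.\<close>

lemma ft_exchange:
 fixes f g :: "'a::euclidean_space => complex"
 assumes f: "schwartz f" and g: "schwartz g"
 shows "(LBINT et. f et * ft g et) = (LBINT u. ft f u * g u)"
proof -
 define H where "H z = cis (2 * pi * (snd z \<bullet> fst z)) * (f (fst z) * g (snd z))" for z :: "'a \<times> 'a"
 have "schwartz H" unfolding H_def
 by (intro schwartz_om schwartz_tensor f g om_cis_inner bounded_linear_fst_snd)
 hence i: "integrable (lborel \<Otimes>\<^sub>M lborel) (%(x, y). H (x, y))" using schwartz_integrable[of H] by (simp add: lborel_prod)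
 have "(LBINT et. f et * ft g et) = (LBINT et. LBINT u. H (et, u))"
 unfolding ft_def H_def by (simp add: mult_ac flip: integral_mult_right_zero)
 also have "... = (LBINT u. LBINT et. H (et, u))" using lborel_pair.Fubini_integral[OF i] by simp
 also have "... = (LBINT u. ft f u * g u)"
 unfolding ft_def H_def by (subst integral_mult_left_zero[symmetric]) (simp add: mult_ac inner_commute)
 finally show ?thesis .
qed

lemma Kop_cutR:
 assumes b: "om b" and \<phi>: "schwartz \<phi>" and R: "0 < R"
 shows "(LBINT z. cutR d R (snd z) * (b z * pft \<phi> z)) = (LBINT z. kR d b R z * \<phi> z)"
proof -
 have c: "om (%z. cutR d R (snd z))"
 by (rule om_linear_compose[OF schwartz_imp_om[OF schwartz_cutR[OF R]] linear_snd])
 have i1: "schwartz (%z. cutR d R (snd z) * (b z * pft \<phi> z))" by (rule schwartz_om[OF schwartz_Kop[OF b \<phi>] c])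
 have k: "om (kR d b R)" unfolding kR_def by (rule pft_PS(1)[OF PS_kR[OF b R]])
 have i2: "schwartz (%z. kR d b R z * \<phi> z)" by (rule schwartz_om[OF \<phi> k])
 have "(LBINT et. cutR d R et * (b (x, et) * pft \<phi> (x, et))) = (LBINT u. kR d b R (x, u) * \<phi> (x, u))" for x
 using ft_exchange[OF schwartz_b_cutR[OF b R] schwartz_slice[OF \<phi>], of x d x] by (simp add: kR_eq pft_def mult_ac)
 thus ?thesis unfolding integral_lborel_prod[OF schwartz_integrable[OF i1]] integral_lborel_prod[OF schwartz_integrable[OF i2]]
 by simp
qed

text \<open>Both sides are limits of the same truncated pairings: by dominated convergence in
  frequency on one side, and on the other because the truncated kernels converge uniformly where
  \<phi> does not vanish.\<close>

lemma Kop_kern: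
 fixes d :: "'n::finite" and s de :: real
 assumes b: "symb d s b" and s: "0 <= s" and \<phi>: "schwartz \<phi>" and de: "0 < de" and supp: "!!z. anorm d (snd z) <= de ==> \<phi> z = 0"
 shows "Kop b \<phi> = (LBINT z. kern d b z * \<phi> z)"
proof (rule LIMSEQ_unique)
 have o: "om b" by (rule symb_imp_om[OF b])
 have i: "integrable lborel (%z. b z * pft \<phi> z)" by (rule schwartz_integrable[OF schwartz_Kop[OF o \<phi>]])
 have m1: "(%z. b z * pft \<phi> z) : borel_measurable lborel" by (rule borel_measurable_integrable[OF i])
 have mc: "(%z :: (real^'n) \<times> (real^'n). cutR d R (snd z)) : borel_measurable borel" if "0 < R" for R :: real
 by (intro borel_measurable_continuous_onI Cinf_on_continuous[OF om_Cinf]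
 om_linear_compose[OF schwartz_imp_om[OF schwartz_cutR[OF that]] linear_snd])
 have "(%j. LBINT z. cutR d (real j + 1) (snd z) * (b z * pft \<phi> z)) \<longlonglongrightarrow> (LBINT z. b z * pft \<phi> z)"
 proof (rule integral_dominated_convergence[OF m1 _ integrable_norm[OF i]])
 show "(%z. cutR d (real j + 1) (snd z) * (b z * pft \<phi> z)) : borel_measurable lborel" for j
 using mc[of "real j + 1"] m1 by simp
 show "AE z in lborel. (%j. cutR d (real j + 1) (snd z) * (b z * pft \<phi> z)) \<longlonglongrightarrow> b z * pft \<phi> z"
 proof (rule AE_I2)
 fix z :: "(real^'n) \<times> (real^'n)"
 obtain M :: nat where M: "8 * anorm d (snd z) <= real M" using real_arch_simple by blast
 have "cutR d (real j + 1) (snd z) = 1" if "M <= j" for j using M that by (intro cutR_simps(2)) auto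
 thus "(%j. cutR d (real j + 1) (snd z) * (b z * pft \<phi> z)) \<longlonglongrightarrow> b z * pft \<phi> z"
  by (intro tendsto_eventually eventually_sequentiallyI[of M]) simp
 qed
 show "AE z in lborel. norm (cutR d (real j + 1) (snd z) * (b z * pft \<phi> z)) <= norm (b z * pft \<phi> z)" for j
 proof (rule AE_I2)
 fix z :: "(real^'n) \<times> (real^'n)"
 show "norm (cutR d (real j + 1) (snd z) * (b z * pft \<phi> z)) <= norm (b z * pft \<phi> z)"
  using mult_right_mono[OF cutR_simps(3)[of d "real j + 1" "snd z"] norm_ge_zero[of "b z * pft \<phi> z"]]
  by (simp add: norm_mult)
 qed
 qed
 thus "(%j. LBINT z. kR d b (real j + 1) z * \<phi> z) \<longlonglongrightarrow> Kop b \<phi>"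
 by (simp add: Kop_cutR[OF o \<phi>] Kop_eq[OF o \<phi>])
 obtain C where C: "C >= 0" "!!x u. u ~= 0 ==> norm (kern d b (x, u)) <= C * anorm d u powr (- (real CARD('n) + 1) - s - 0)"
 using kern_bound[OF b s order_refl] by blast
 define B where "B = C * de powr (- (real CARD('n) + 1) - s - 0)"
 have kB: "norm (kern d b z) <= B" if "de < anorm d (snd z)" for z
 proof -
 have "snd z ~= 0" using that de by auto
 hence "norm (kern d b z) <= C * anorm d (snd z) powr (- (real CARD('n) + 1) - s - 0)" using C(2)[of "snd z" "fst z"] by simp
 also have "... <= B" unfolding B_def using that de C s by (intro mult_left_mono powr_mono2') auto
 finally show ?thesis .
 qed
 obtain M where "ALL j>=M. ALL z:{z. de < anorm d (snd z)}. dist (kR d b (real j + 1) z) (kern d b z) < 1"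
 using uniform_limitD[OF kern_uniform[OF b de] zero_less_one] unfolding eventually_sequentially by blast
 hence M: "!!j z. M <= j ==> de < anorm d (snd z) ==> dist (kR d b (real j + 1) z) (kern d b z) < 1" by blast
 have lim: "(%j. kR d b (real j + 1) z * \<phi> z) \<longlonglongrightarrow> kern d b z * \<phi> z" for z
 proof (cases "anorm d (snd z) <= de")
 case True thus ?thesis by (simp add: supp)
 next
 case False
 obtain m :: nat where m: "s - real m <= - (4 * real CARD('n))" using exponent_exists by blast
 have "snd z ~= 0" using False de by auto
 from kR_tendsto[OF b m this, of "fst z"] show ?thesis by (intro tendsto_mult tendsto_const) simp
 qed
 have meas: "(%z. kR d b (real j + 1) z * \<phi> z) : borel_measurable lborel" for j
 proof -
 have "om (kR d b (real j + 1))" unfolding kR_def by (intro pft_PS(1) PS_kR o) simp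
 from schwartz_measurable[OF schwartz_om[OF \<phi> this]] show ?thesis by simp
 qed
 \<comment> \<open>The first M truncations are dropped: the later ones are within 1 of the limit on
   the region in question, which supplies the dominating function.\<close>
 have "(%j. LBINT z. kR d b (real (j + M) + 1) z * \<phi> z) \<longlonglongrightarrow> (LBINT z. kern d b z * \<phi> z)"
 proof (rule integral_dominated_convergence[where w = "%z. (B + 1) * norm (\<phi> z)"])
 show "(%z. kern d b z * \<phi> z) : borel_measurable lborel" by (rule borel_measurable_LIMSEQ_metric[OF meas lim])
 show "(%z. kR d b (real (j + M) + 1) z * \<phi> z) : borel_measurable lborel" for j by (rule meas)
 show "integrable lborel (%z. (B + 1) * norm (\<phi> z))" by (intro integrable_mult_right integrable_norm schwartz_integrable \<phi>)
 show "AE z in lborel. (%j. kR d b (real (j + M) + 1) z * \<phi> z) \<longlonglongrightarrow> kern d b z * \<phi> z"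
 using LIMSEQ_ignore_initial_segment[OF lim, of M] by simp
 show "AE z in lborel. norm (kR d b (real (j + M) + 1) z * \<phi> z) <= (B + 1) * norm (\<phi> z)" for j
 proof (rule AE_I2)
 fix z :: "(real^'n) \<times> (real^'n)"
 show "norm (kR d b (real (j + M) + 1) z * \<phi> z) <= (B + 1) * norm (\<phi> z)"
 proof (cases "anorm d (snd z) <= de")
  case False
  hence "norm (kR d b (real (j + M) + 1) z) <= B + 1"
  using M[of "j + M" z] kB[of z] norm_triangle_sub[of "kR d b (real (j + M) + 1) z" "kern d b z"] by (simp add: dist_norm)
  thus ?thesis unfolding norm_mult by (rule mult_right_mono) simp
 qed (simp add: supp)
 qed
 qed
 thus "(%j. LBINT z. kR d b (real j + 1) z * \<phi> z) \<longlonglongrightarrow> (LBINT z. kern d b z * \<phi> z)"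
 by (rule LIMSEQ_offset)
qed

text \<open>On the compact support the continuous function \<open>anorm\<close> of u attains a
  positive minimum, of which half is taken.\<close>

lemma support_away:
 fixes \<phi> :: "(real^'n) \<times> (real^'n) => complex"
 assumes "compact (closure {p. \<phi> p ~= 0})" "closure {p. \<phi> p ~= 0} <= UNIV \<times> (UNIV - {0})"
 shows "EX de>0. ALL z. anorm d (snd z) <= de --> \<phi> z = 0"
proof (cases "closure {p. \<phi> p ~= 0} = {}")
 case True thus ?thesis by (intro exI[of _ 1]) auto
next
 case False
 have "continuous_on (closure {p. \<phi> p ~= 0}) (%z. anorm d (snd z))"
 by (rule continuous_on_compose2[OF continuous_anorm continuous_on_snd[OF continuous_on_id]]) simp
 from continuous_attains_inf[OF assms(1) False this]
 obtain p where p: "p : closure {p. \<phi> p ~= 0}" "!!z. z : closure {p. \<phi> p ~= 0} ==> anorm d (snd p) <= anorm d (snd z)" by blast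
 have "0 < anorm d (snd p)" using p(1) assms(2) by auto
 moreover have "\<phi> z = 0" if "anorm d (snd z) <= anorm d (snd p) / 2" for z
 using p(2)[of z] that calculation closure_subset[of "{p. \<phi> p ~= 0}"] by force
 ultimately show ?thesis by (intro exI[of _ "anorm d (snd p) / 2"]) auto
qed

lemma Kop_cond_a:
 fixes d :: "'n::finite"
 assumes a: "symb d n a" and n: "0 <= n"
 shows "kernel_cond_a d n (Kop a)"
 unfolding kernel_cond_a_def
proof (intro exI[of _ "kern d a"] conjI allI impI)
 show "Cinf_on (UNIV \<times> (UNIV - {0})) (kern d a)" by (rule Cinf_kern[OF a n])
 show "Kop a \<phi> = (LBINT p. kern d a p * \<phi> p)"
 if "schwartz \<phi> & compact (closure {p. \<phi> p ~= 0}) & closure {p. \<phi> p ~= 0} <= UNIV \<times> (UNIV - {0})" for \<phi>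
 using support_away[of \<phi> d] that Kop_kern[OF a n] by blast
 fix I \<gamma> :: "'n list" and M :: real assume M: "0 <= M"
 have "n + (\<Sum>v\<leftarrow>map xdir I @ map udir \<gamma>. xudeg d v) = n + wdeg d \<gamma>" by (simp only: map_append sum_list_append wdeg_sum)
 with kern_Dl[OF a set_xudir(1)[of I \<gamma>]] obtain b where b: "symb d (n + wdeg d \<gamma>) b"
 "!!z. z : UNIV \<times> (UNIV - {0}) ==> Dl (map xdir I @ map udir \<gamma>) (kern d a) z = kern d b z" by auto
 obtain C where C: "!!x u. u ~= 0 ==> norm (kern d b (x, u)) <= C * anorm d u powr (- (real CARD('n) + 1) - (n + wdeg d \<gamma>) - M)"
 using kern_bound[OF b(1) _ M] n by (meson add_nonneg_nonneg wdeg_nonneg)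
 show "EX C. ALL x u. u ~= 0 --> norm (Dl (map xdir I @ map udir \<gamma>) (kern d a) (x, u))
 <= C * anorm d u powr (- (real CARD('n) + 1) - n - wdeg d \<gamma> - M)"
 using C b(2) by (intro exI[of _ C]) (simp add: algebra_simps)
qed

subsection \<open>From a kernel to a symbol: weak estimates\<close>

definition umon :: "'n::finite list => real^'n => complex" where
 "umon al u = (\<Prod>i\<leftarrow>al. - (2 * pi * \<i>) * cor (u $ i))"

text \<open>The \<xi>-derivative of order \<open>al\<close> of exp(-2 pi i u . \<xi>), as a function
  of (\<xi>, u); \<open>umon\<close> collects the factors brought down.\<close>

definition osc :: "'n::finite list => (real^'n) \<times> (real^'n) => complex" where
 "osc al z = umon al (snd z) * cis (- (2 * pi) * (snd z \<bullet> fst z))"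

lemma umon_simps [simp]: "umon [] u = 1" "umon (i # al) u = - (2 * pi * \<i>) * cor (u $ i) * umon al u"
 by (simp_all add: umon_def)

lemma om_umon:
 fixes al :: "'n::finite list"
 shows "om (umon al)"
proof (induction al)
 case Nil
 have "umon [] = (%u :: real^'n. 1)" by (simp add: fun_eq_iff)
 thus ?case using om_const[of 1] by metis
next
 case (Cons i al)
 have "umon (i # al) = (%u. - (2 * pi * \<i>) * cor (u $ i) * umon al u)" by (simp add: fun_eq_iff)
 thus ?case using om_mult[OF om_mult[OF om_const om_linear[OF bounded_linear_vec_nth]] Cons] by metis
qed

lemma om_osc: "om (osc al)"
 unfolding osc_def[abs_def]
 by (intro om_mult om_cis_inner bounded_linear_fst_snd om_linear_compose[OF om_umon linear_snd])

lemma om_osc_slice: "om (%u. osc al (\<xi>, u))"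
 unfolding osc_def fst_conv snd_conv
 by (intro om_mult om_umon om_cis om_linear bounded_linear_const_mult bounded_linear_inner_left)

lemma osc_has_dir: "has_dir (%\<xi>. c * osc al (\<xi>, u)) (cdir i) (c * osc (i # al) (\<xi>, u)) \<xi>"
 using has_dir_cis_inner[of "c * umon al u" "- (2 * pi)" u "cdir i" \<xi>]
 by (simp add: osc_def cdir_def inner_axis mult_ac)

lemma Dl_osc: "Dl (map cdir al) (%\<xi>. c * osc [] (\<xi>, u)) = (%\<xi>. c * osc al (\<xi>, u))"
 by (induction al) (simp_all add: Dl_Cons dirD_eq[OF osc_has_dir])

lemma Dl_tensor:
 fixes f g :: "real^'n => complex"
 assumes f: "Cinf_on UNIV f" and g: "Cinf_on UNIV g"
 shows "Dl (map xdir I @ map udir al) (%z. f (fst z) * g (snd z)) = (%z. Dl (map cdir I) f (fst z) * Dl (map cdir al) g (snd z))"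
proof -
 have h: "has_dir (Dl (map cdir J) F) (cdir i) (Dl (map cdir (i # J)) F x) x" if "Cinf_on UNIV F" for F :: "real^'n => complex" and i J x
 using has_dir_any[OF open_UNIV Cinf_Dl_any[OF open_UNIV that] UNIV_I] by (simp add: Dl_Cons)
 have u: "Dl (map udir al) (%z. f (fst z) * g (snd z)) = (%z. f (fst z) * Dl (map cdir al) g (snd z))"
 proof (induction al)
 case (Cons i al)
 have "has_dir (%z. f (fst z) * Dl (map cdir al) g (snd z)) (udir i) (f (fst z) * Dl (map cdir (i # al)) g (snd z)) z" for z
 using has_dir_bounded_linear[OF bounded_linear_mult_right[of "f (fst z)"] h[OF g, of al i "snd z"]]
 by (simp add: has_dir_def udir_def cdir_def)
 from dirD_eq[OF this] Cons show ?case by (simp add: Dl_Cons)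
 qed simp
 have "Dl (map xdir I) (%z. f (fst z) * G (snd z)) = (%z. Dl (map cdir I) f (fst z) * G (snd z))" for G :: "real^'n => complex"
 proof (induction I)
 case (Cons i I)
 have "has_dir (%z. Dl (map cdir I) f (fst z) * G (snd z)) (xdir i) (Dl (map cdir (i # I)) f (fst z) * G (snd z)) z" for z
 using h[OF f, of I i "fst z"] by (intro has_dir_fst_mult) simp
 from dirD_eq[OF this] Cons show ?case by (simp add: Dl_Cons)
 qed simp
 with u show ?thesis by (simp add: Dl_append)
qed

text \<open>Compact support is what allows \<open>K\<close> to be replaced by integration against
  \<open>k\<close> off u = 0.\<close>

definition bump :: "('a::euclidean_space => complex) => bool" where
 "bump \<psi> \<longleftrightarrow> Cinf_on UNIV \<psi> & (EX B. ALL x. B < norm x --> \<psi> x = 0)"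

lemma bump_schwartz: "bump \<psi> ==> schwartz \<psi>"
 using schwartz_compact unfolding bump_def by blast

lemma open_norm_gt: "open {x :: 'a::real_normed_vector. B < norm x}"
 using open_Collect_less[OF continuous_on_const continuous_on_norm_id, of B] by simp

lemma bump_Dl: "bump \<psi> ==> bump (Dl vs \<psi>)"
 unfolding bump_def using Cinf_Dl_any[OF open_UNIV] Dl_vanishes[OF _ open_norm_gt] by (metis mem_Collect_eq)

lemma bounded_integral_le:
 fixes h \<psi> :: "'a::euclidean_space => complex"
 assumes h: "h : borel_measurable lborel" "!!x. norm (h x) <= B" and \<psi>: "integrable lborel \<psi>"
 shows "norm (LBINT x. h x * \<psi> x) <= B * (LBINT x. norm (\<psi> x))"
proof -
 have i: "integrable lborel (%x. B * norm (\<psi> x))" using \<psi> by (intro integrable_mult_right integrable_norm)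
 have le: "norm (h x * \<psi> x) <= B * norm (\<psi> x)" for x unfolding norm_mult by (rule mult_right_mono[OF h(2)]) simp
 have m: "(%x. h x * \<psi> x) : borel_measurable lborel" using h(1) borel_measurable_integrable[OF \<psi>] by simp
 have "integrable lborel (%x. h x * \<psi> x)"
 by (rule Bochner_Integration.integrable_bound[OF i m]) (use le order_trans[OF _ abs_ge_self] in "auto intro!: AE_I2")
 hence "(LBINT x. norm (h x * \<psi> x)) <= (LBINT x. B * norm (\<psi> x))"
 by (intro integral_mono integrable_norm i le)
 thus ?thesis using order_trans[OF integral_norm_bound] by fastforce
qed

lemma gsym_umon:
 fixes d :: "'n::finite"
 shows "gsym P (UNIV - {0}) (anorm d) (udeg d) (wdeg d al) (%_. umon al)"
proof (induction al)
 case Nil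
 have "gsym P (UNIV - {0}) (anorm d) (udeg d) 0 (%p z. 1)" by (rule gsym_const) auto
 thus ?case by simp
next
 case (Cons i al)
 have "gsym P (UNIV - {0}) (anorm d) (udeg d) (wt d i) (%_ u. - (2 * pi * \<i>) * cor (u $ i))"
 proof (rule gsym_linear[where C = "2 * pi"])
 show "bounded_linear (%u :: real^'n. - (2 * pi * \<i>) * cor (u $ i))"
 by (intro bounded_linear_compose[OF bounded_linear_mult_right] bounded_linear_compose[OF bounded_linear_of_real] bounded_linear_vec_nth)
 show "norm (- (2 * pi * \<i>) * cor (u $ i)) <= 2 * pi * anorm d u powr real (wt d i)" if "u : UNIV - {0}" for u
 using component_le_anorm[of u i d] that by (simp add: norm_mult powr_realpow)
 show "v : Basis ==> - (2 * pi * \<i>) * cor (v $ i) ~= 0 ==> udeg d v = real (wt d i)" for v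
 by (auto simp: Basis_cdir) (auto simp: cdir_def axis_def split: if_splits)
 qed auto
 from gsym_mult[OF open_delete[OF open_UNIV] this Cons.IH] show ?case by (simp add: wdeg_Cons)
qed

lemma umon_dil: "0 < r ==> umon al u = cor (r powr wdeg d al) * umon al (dil d r u)"
 by (induction al) (simp_all add: wdeg_Cons powr_add powr_realpow dil_component)

locale kernel =
 fixes d :: "'n::finite" and n :: real and K :: "((real^'n) \<times> (real^'n) => complex) => complex"
 and k :: "(real^'n) \<times> (real^'n) => complex"
 assumes n: "0 <= n" and K: "tempered K" and Cinf_k: "Cinf_on (UNIV \<times> (UNIV - {0})) k"
 and K_k: "!!\<phi>. schwartz \<phi> ==> compact (closure {p. \<phi> p ~= 0}) ==> closure {p. \<phi> p ~= 0} <= UNIV \<times> (UNIV - {0})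
   ==> K \<phi> = (LBINT p. k p * \<phi> p)"
 and k_bound: "!!I \<gamma> M. M >= 0 ==> EX C. ALL x u. u ~= 0 -->
  norm (Dl (map xdir I @ map udir \<gamma>) k (x, u)) <= C * anorm d u powr (- (real CARD('n) + 1) - n - wdeg d \<gamma> - M)"
 and cond_b: "kernel_cond_b d n K"
begin

text \<open>Condition (b) at scale r. Measuring u in units of r turns u . \<xi> into v .
  \<open>de\<close>, with anorm of \<open>de\<close> at most 1 because r anorm \<xi> <= 1. Hence the
  functions cut(v) osc(\<open>de\<close>, v) are normalized bumps for one sequence
  \<open>Cb\<close>; the monomial contributes r^(wdeg d al).\<close>

lemma near:
 "EX C>=0. ALL \<xi> r \<psi>. 0 < r --> r < 1 --> r * anorm d \<xi> <= 1 --> schwartz \<psi> -->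
 norm (K (%q. Dl (map cdir I) \<psi> (fst q) * (cutR d r (snd q) * osc al (\<xi>, snd q)))) <= C * r powr (wdeg d al - n) * (LBINT x. norm (\<psi> x))"
proof -
 define H where "H z = osc al z * cut d (snd z)" for z :: "(real^'n) \<times> (real^'n)"
 have c1: "cutR d 1 = cut d"
 proof -
 have "dil d 1 u = u" for u by (simp add: vec_eq_iff dil_def)
 thus ?thesis by (simp add: cutR_def[abs_def])
 qed
 hence scut: "schwartz (cut d)" using schwartz_cutR[of 1 d] by simp
 have PH: "PS H" unfolding H_def by (rule PS_om[OF PS_snd[OF scut] om_osc])
 \<comment> \<open>One constant for each \<gamma>, uniform in \<open>de\<close>; these constants
   form the sequence \<open>Cb\<close>.\<close>
 have "EX C. ALL de v. norm de <= 2 --> norm (Dl (map cdir \<gamma>) (%v. H (de, v)) v) <= C" for \<gamma>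
 proof -
 obtain C l where C: "C >= 0" "!!p q. (1 + norm q) ^ 0 * norm (Dl (map (Pair 0) (map cdir \<gamma>)) H (p, q)) <= C * (1 + norm p) ^ l"
 using PS_bound[OF PH Pair0_Basis(1)[OF set_xudir(2)[of \<gamma>]], of 0] by blast
 have "norm (Dl (map cdir \<gamma>) (%v. H (de, v)) v) <= C * 3 ^ l" if "norm de <= 2" for de v
 proof -
 have "C * (1 + norm de) ^ l <= C * 3 ^ l" using that C by (intro mult_left_mono power_mono) auto
 thus ?thesis using C(2)[of v de] by (simp only: Dl_slice) simp
 qed
 thus ?thesis by blast
 qed
 hence "ALL \<gamma>. EX C. ALL de v. norm de <= 2 --> norm (Dl (map cdir \<gamma>) (%v. H (de, v)) v) <= C" by blast
 from choice[OF this] obtain Cb where Cb: "!!\<gamma> de v. norm de <= 2 ==> norm (Dl (map cdir \<gamma>) (%v. H (de, v)) v) <= Cb \<gamma>" by blast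
 have bump: "normalized_bump d Cb (%v. H (de, v))" if "norm de <= 2" for de
 unfolding normalized_bump_def
 using Cinf_on_slice[of H de] PH Cb that by (auto simp: PS_def H_def cut_outside)
 obtain C where C: "ALL \<phi> r. normalized_bump d Cb \<phi> & 0 < r & r < 1 -->
 (EX h :: real^'n => complex. h : borel_measurable lborel & (ALL x. norm (h x) <= C * r powr (- n)) \<and>
  (ALL \<psi>. schwartz \<psi> -->
   (-1) ^ length I * K (%p. Dl (map cdir I) \<psi> (fst p) * \<phi> (dil d r (snd p))) = (LBINT x. h x * \<psi> x)))"
 using cond_b[unfolded kernel_cond_b_def, rule_format, of Cb I] by (rule exE)
 have "norm (K (%q. Dl (map cdir I) \<psi> (fst q) * (cutR d r (snd q) * osc al (\<xi>, snd q)))) <= \<bar>C\<bar> * r powr (wdeg d al - n) * (LBINT x. norm (\<psi> x))"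
 if r: "0 < r" "r < 1" "r * anorm d \<xi> <= 1" and \<psi>: "schwartz \<psi>" for \<xi> r \<psi>
 proof -
 define de where "de = dil d (1 / r) \<xi>"
 define w where "w = r powr wdeg d al"
 define X where "X q = Dl (map cdir I) \<psi> (fst q) * H (de, dil d r (snd q))" for q :: "(real^'n) \<times> (real^'n)"
 have "anorm d de <= 1" using r by (simp add: de_def anorm_dil mult.commute)
 moreover have "(anorm d de)\<^sup>2 <= 1" using calculation by (intro power_le_one) auto
 ultimately have de: "norm de <= 2" using norm_le_anorm[of de d] by linarith
 obtain h where h: "h : borel_measurable lborel" "!!x. norm (h x) <= C * r powr (- n)"
 "(-1) ^ length I * K X = (LBINT x. h x * \<psi> x)"
 using C[rule_format, OF conjI[OF bump[OF de] conjI[OF r(1,2)]]] \<psi> unfolding X_def[abs_def] by blast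
 have "cutR d r u * osc al (\<xi>, u) = cor w * H (de, dil d r u)" for u
 proof -
 have "dil d r u \<bullet> de = u \<bullet> \<xi>" using r by (simp add: de_def dil_inner dil_dil)
 thus ?thesis using umon_dil[OF r(1), of al u d] by (simp add: H_def osc_def cutR_def w_def)
 qed
 hence "(%q. Dl (map cdir I) \<psi> (fst q) * (cutR d r (snd q) * osc al (\<xi>, snd q))) = (%q. cor w * X q)"
 by (simp add: X_def mult_ac)
 moreover have "schwartz X" unfolding X_def
 by (intro schwartz_tensor[where g = "%u. H (de, dil d r u)"] schwartz_Dl_any \<psi> schwartz_dil r PS_slice[OF PH])
 ultimately have "K (%q. Dl (map cdir I) \<psi> (fst q) * (cutR d r (snd q) * osc al (\<xi>, snd q))) = cor w * K X"
 using tempered_scale[OF K] by simp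
 moreover have "norm (K X) = norm (LBINT x. h x * \<psi> x)" using h(3)[symmetric] by (simp add: norm_mult norm_power)
 moreover have "... <= C * r powr (- n) * (LBINT x. norm (\<psi> x))"
 by (rule bounded_integral_le[OF h(1,2) schwartz_integrable[OF \<psi>]])
 moreover have "... <= \<bar>C\<bar> * r powr (- n) * (LBINT x. norm (\<psi> x))"
 by (intro mult_right_mono integral_nonneg_AE AE_I2) auto
 ultimately have "norm (K (%q. Dl (map cdir I) \<psi> (fst q) * (cutR d r (snd q) * osc al (\<xi>, snd q)))) <= w * (\<bar>C\<bar> * r powr (- n) * (LBINT x. norm (\<psi> x)))"
 by (simp add: norm_mult w_def mult_left_mono)
 thus ?thesis by (simp add: w_def powr_diff powr_minus divide_inverse mult_ac)
 qed
 thus ?thesis by (intro exI[of _ "\<bar>C\<bar>"]) auto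
qed

lemma gsym_k: "0 <= M ==> gsym P (UNIV \<times> (UNIV - {0})) (%z. anorm d (snd z)) (xudeg d) (- (real CARD('n) + 1) - n - M) (%_. k)"
proof (rule gsym_xudirI[OF open_punctured Cinf_k])
 fix I al :: "'n list" assume "0 <= M"
 then obtain C where "!!x u. u ~= 0 ==> norm (Dl (map xdir I @ map udir al) k (x, u)) <= C * anorm d u powr (- (real CARD('n) + 1) - n - wdeg d al - M)"
 using k_bound by blast
 thus "EX C. ALL p:P. ALL z:UNIV \<times> (UNIV - {0}). norm (Dl (map xdir I @ map udir al) k z) <= C * anorm d (snd z) powr (- (real CARD('n) + 1) - n - M - wdeg d al)"
 by (intro exI[of _ C]) (auto simp: algebra_simps)
qed

text \<open>The integrand against exp(-2 pi i u . \<xi>) once the amplitude has been differentiated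
  by I in x and by \<open>al\<close> in \<xi>.\<close>

definition kI :: "'n list => 'n list => real^'n => real^'n => complex" where
 "kI I al x u = Dl (map xdir I) k (x, u) * umon al u"

text \<open>The monomial raises the order by its weighted degree. M stays free: a large M gives
  decay at infinity, M = 0 the sharp order near u = 0.\<close>

lemma gsym_kI:
 assumes M: "0 <= M"
 shows "gsym UNIV (UNIV - {0}) (anorm d) (udeg d) (- (real CARD('n) + 1) - n - M + wdeg d al) (kI I al)"
 unfolding kI_def[abs_def]
proof (rule gsym_mult[OF _ gsym_cdirI gsym_umon])
 show "open (UNIV - {0 :: real^'n})" by auto
 show "Cinf_on (UNIV - {0}) (%u. Dl (map xdir I) k (x, u))" for x
 using Cinf_on_affine[OF Cinf_Dl_any[OF open_punctured Cinf_k] open_punctured open_delete[OF open_UNIV, of 0] linear_Pair0(1), of "(x, 0)" "map xdir I"]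
 by simp
 fix \<gamma>
 obtain C where C: "!!x u. u ~= 0 ==> norm (Dl (map xdir I @ map udir \<gamma>) k (x, u)) <= C * anorm d u powr (- (real CARD('n) + 1) - n - wdeg d \<gamma> - M)"
 using k_bound[OF M] by blast
 have "map (Pair 0) (map cdir \<gamma>) = map udir \<gamma>" by (simp add: cdir_def udir_def[abs_def] o_def)
 hence "Dl (map cdir \<gamma>) (%u. Dl (map xdir I) k (x, u)) u = Dl (map udir \<gamma> @ map xdir I) k (x, u)" for x u
 by (simp only: Dl_slice Dl_append)
 moreover have "Dl (map udir \<gamma> @ map xdir I) k (x, u) = Dl (map xdir I @ map udir \<gamma>) k (x, u)" if "u ~= 0" for x u
 by (rule Dl_perm[OF open_punctured Cinf_k]) (use that in auto)
 ultimately show "EX C. ALL x:UNIV. ALL u:UNIV - {0}. norm (Dl (map cdir \<gamma>) (%u. Dl (map xdir I) k (x, u)) u) <= C * anorm d u powr (- (real CARD('n) + 1) - n - M - wdeg d \<gamma>)"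
 using C by (intro exI[of _ C]) (simp add: algebra_simps)
qed

text \<open>The difference of cutoffs removes both the singularity at u = 0 and the region of large
  u. In x only boundedness is available, hence \<open>PS\<close> instead of a Schwartz
  function.\<close>

lemma PS_shell:
 assumes r: "0 < r" "r <= R"
 shows "PS (%z. k z * (cutR d R (snd z) - cutR d r (snd z)))"
 unfolding PS_def
proof (intro conjI allI impI)
 define F where "F z = k z * (cutR d R (snd z) - cutR d r (snd z))" for z
 define U :: "((real^'n) \<times> (real^'n)) set" where "U = UNIV \<times> (UNIV - {0})"
 have oU: "open U" unfolding U_def by (rule open_punctured)
 have o8: "open {z :: (real^'n) \<times> (real^'n). anorm d (snd z) < r / 8}"
 using open_vimage_snd[OF open_anorm_gt(2)[of d "r / 8"]] by (simp add: vimage_def)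
 have c: "Cinf_on UNIV (%z :: (real^'n) \<times> (real^'n). cutR d R (snd z) - cutR d r (snd z))"
 using Cinf_on_affine[OF Cinf_on_diff(1)[OF open_UNIV Cinf_cutR[of d R] Cinf_cutR[of d r]] open_UNIV open_UNIV linear_snd, of 0] by simp
 have FU: "Cinf_on U F" unfolding F_def U_def
 by (rule Cinf_on_mult[OF open_punctured Cinf_k Cinf_on_subset[OF c]]) simp
 have Fin: "F z = 0" if "anorm d (snd z) < r / 8" for z using that r by (simp add: F_def cutR_simps(2))
 have Fout: "F z = 0" if "R < anorm d (snd z)" for z using that r by (simp add: F_def cutR_simps(1))
 have F8: "Cinf_on {z. anorm d (snd z) < r / 8} F"
 by (rule Cinf_on_cong[OF o8 _ Cinf_on_const[OF o8, of 0]]) (simp add: Fin)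
 have "U \<union> {z. anorm d (snd z) < r / 8} = UNIV" using r by (auto simp: U_def)
 thus CF: "Cinf_on UNIV F" using Cinf_on_Un[OF FU F8 oU o8] by simp
 fix vs :: "((real^'n) \<times> (real^'n)) list" and l :: nat assume vs: "set vs <= Basis"
 have "EX C. ALL i:UNIV :: unit set. ALL z:{z. r / 8 <= anorm d (snd z) & anorm d (snd z) <= R}.
 norm (Dl vs (%z. k z * (cutR d R (snd z) - cutR d r (snd z))) z) <= C * 1"
 proof (rule Leibniz_bound[OF oU _ _ vs])
 show "Cinf_on U k" by (simp add: U_def Cinf_k)
 show "Cinf_on U (%z. cutR d R (snd z) - cutR d r (snd z))" by (rule Cinf_on_subset[OF c]) simp
 show "{z. r / 8 <= anorm d (snd z) & anorm d (snd z) <= R} <= U" using r by (auto simp: U_def)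
 fix a b :: "((real^'n) \<times> (real^'n)) list" assume a: "set a <= Basis" and b: "set b <= Basis"
 obtain C1 where C1: "C1 >= 0" "!!z. z : U ==> norm (Dl a k z) <= C1 * anorm d (snd z) powr (- (real CARD('n) + 1) - n - 0 - (\<Sum>v\<leftarrow>a. xudeg d v))"
 using gsym_bound[OF gsym_k[OF order_refl, of "UNIV :: unit set"] a] unfolding U_def by blast
 define e where "e = - (real CARD('n) + 1) - n - 0 - (\<Sum>v\<leftarrow>a. xudeg d v)"
 have "0 <= (\<Sum>v\<leftarrow>a. xudeg d v)" by (intro sum_list_nonneg) (auto simp: xudeg_def)
 hence e: "e <= 0" using n by (simp add: e_def)
 obtain C2 where C2: "C2 >= 0" "!!z. (1 + norm (snd z)) ^ 0 * norm (Dl b (%z. cutR d R (snd z) - cutR d r (snd z)) z) <= C2 * (1 + norm (fst z)) ^ 0"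
 proof -
 have s: "schwartz (%u. cutR d R u - cutR d r u)" using r by (intro schwartz_diff schwartz_cutR) auto
 have "EX C>=0. ALL z. norm (Dl b (%z :: (real^'n) \<times> (real^'n). cutR d R (snd z) - cutR d r (snd z)) z) <= C"
 proof -
  obtain C where "C >= 0" "!!x. (1 + norm x) ^ 0 * norm (Dl (map snd b) (%u. cutR d R u - cutR d r u) x) <= C"
  using schwartz_bound[OF schwartz_Dl_any[OF s, of "map snd b"], of "[]" 0] by auto
  thus ?thesis
  by (intro exI[of _ C]) (simp add: Dl_affine'[OF linear_snd, of b "%u. cutR d R u - cutR d r u"])
 qed
 thus ?thesis using that by auto
 qed
 have "norm (Dl a k z) * norm (Dl b (%z. cutR d R (snd z) - cutR d r (snd z)) z) <= C1 * (r / 8) powr e * C2 * 1"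
 if "r / 8 <= anorm d (snd z)" for z
 proof -
 have "z : U" using that r by (cases z) (auto simp: U_def)
 hence "norm (Dl a k z) <= C1 * anorm d (snd z) powr e" using C1 by (simp add: e_def)
 also have "... <= C1 * (r / 8) powr e" using that r e C1 by (intro mult_left_mono powr_mono2') auto
 finally have "norm (Dl a k z) <= C1 * (r / 8) powr e" .
 thus ?thesis using C2(1) C2(2)[of z] C1(1) by (simp add: mult_mono)
 qed
 thus "EX C. ALL i:UNIV :: unit set. ALL z:{z. r / 8 <= anorm d (snd z) & anorm d (snd z) <= R}.
  norm (Dl a k z) * norm (Dl b (%z. cutR d R (snd z) - cutR d r (snd z)) z) <= C * 1" by blast
 qed
 then obtain C where "ALL z:{z. r / 8 <= anorm d (snd z) & anorm d (snd z) <= R}. norm (Dl vs F z) <= C * 1"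
 unfolding F_def[abs_def] by blast
 hence C: "!!z. r / 8 <= anorm d (snd z) ==> anorm d (snd z) <= R ==> norm (Dl vs F z) <= C"
 unfolding mult_1_right by blast
 have "(1 + norm q) ^ l * norm (Dl vs F (p, q)) <= ((1 + (R + R\<^sup>2)) ^ l * \<bar>C\<bar>) * (1 + norm p) ^ 0" for p q
 proof (cases "r / 8 <= anorm d q & anorm d q <= R")
 case True
 hence "(anorm d q)\<^sup>2 <= R\<^sup>2" by (intro power_mono) auto
 hence "norm q <= R + R\<^sup>2" using True norm_le_anorm[of q d] by linarith
 moreover have "norm (Dl vs F (p, q)) <= \<bar>C\<bar>" using C[of "(p, q)"] True by auto
 ultimately have "(1 + norm q) ^ l * norm (Dl vs F (p, q)) <= (1 + (R + R\<^sup>2)) ^ l * \<bar>C\<bar>"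
 using r by (intro mult_mono power_mono) auto
 thus ?thesis by simp
 next
 case False
 hence "Dl vs F (p, q) = 0"
 using Dl_vanishes[OF Fin o8, where x = "(p, q)" and vs = vs] Dl_vanishes[OF Fout open_snd_anorm[of R d], where x = "(p, q)" and vs = vs] by force
 thus ?thesis using r by simp
 qed
 thus "EX C m. ALL p q. (1 + norm q) ^ l * norm (Dl vs F (p, q)) <= C * (1 + norm p) ^ m" by blast
qed

text \<open>Off u = 0, \<open>K\<close> is integration against \<open>k\<close>. Integration by
  parts moves the x-derivatives from \<psi> to \<open>k\<close>, and the u-integral becomes a
  transform at -\<xi>, since \<open>ft\<close> carries the sign plus.\<close>

lemma far:
 assumes r: "0 < r" "r <= R" and \<psi>: "bump \<psi>"
 and B: "!!y. norm (ft (%u. kI I al y u * (cutR d R u - cutR d r u)) (- \<xi>)) <= B"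
 shows "norm (K (%q. Dl (map cdir I) \<psi> (fst q) * ((cutR d R (snd q) - cutR d r (snd q)) * osc al (\<xi>, snd q)))) <= B * (LBINT x. norm (\<psi> x))"
proof -
 define C where "C u = cutR d R u - cutR d r u" for u
 define c where "c u = C u * osc al (\<xi>, u)" for u
 define E where "E z = k z * c (snd z)" for z
 define D where "D = Dl (map cdir I) \<psi>"
 define \<phi> where "\<phi> q = D (fst q) * c (snd q)" for q :: "(real^'n) \<times> (real^'n)"
 have "bump D" unfolding D_def by (rule bump_Dl[OF \<psi>])
 then obtain B0 where B0: "!!x. B0 < norm x ==> D x = 0" and sD: "schwartz D" using bump_schwartz unfolding bump_def by blast
 have sC: "schwartz C" unfolding C_def using r by (intro schwartz_diff schwartz_cutR) auto
 have sc: "schwartz c" using schwartz_om[OF sC om_osc_slice[of al \<xi>]] by (simp add: c_def[abs_def] mult.commute)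
 have s\<phi>: "schwartz \<phi>" unfolding \<phi>_def by (rule schwartz_tensor[OF sD sc])
 have c_in: "c u = 0" if "anorm d u < r / 8" for u using that r by (simp add: c_def C_def cutR_simps(2))
 have c_out: "c u = 0" if "R + R\<^sup>2 < norm u" for u
 proof -
 have "\<not> anorm d u <= R"
 proof
 assume "anorm d u <= R"
 hence "(anorm d u)\<^sup>2 <= R\<^sup>2" by (intro power_mono) auto
 thus False using \<open>anorm d u <= R\<close> norm_le_anorm[of u d] that by linarith
 qed
 thus ?thesis using r by (simp add: c_def C_def cutR_simps(1))
 qed
 have E_eq: "E = (%z. osc al (\<xi>, snd z) * (k z * (cutR d R (snd z) - cutR d r (snd z))))" by (simp add: E_def c_def C_def fun_eq_iff)
 have PE: "PS E" unfolding E_eq by (rule PS_om[OF PS_shell[OF r] om_linear_compose[OF om_osc_slice linear_snd]])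
 have "K \<phi> = (LBINT z. k z * \<phi> z)"
 proof (rule K_k[OF s\<phi>])
 have "{p. \<phi> p ~= 0} <= cball 0 B0 \<times> cball 0 (R + R\<^sup>2)" using B0 c_out by (force simp: \<phi>_def not_le[symmetric])
 thus "compact (closure {p. \<phi> p ~= 0})" unfolding compact_closure by (rule bounded_subset[rotated]) (intro bounded_Times bounded_cball)
 have "closed {z :: (real^'n) \<times> (real^'n). r / 8 <= anorm d (snd z)}"
 using open_vimage_snd[OF open_anorm_gt(2)[of d "r / 8"]] by (simp add: closed_def vimage_def Compl_eq not_le)
 moreover have "{p. \<phi> p ~= 0} <= {z. r / 8 <= anorm d (snd z)}" using c_in by (force simp: \<phi>_def not_less[symmetric])
 ultimately have "closure {p. \<phi> p ~= 0} <= {z. r / 8 <= anorm d (snd z)}" by (rule closure_minimal[rotated])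
 also have "... <= UNIV \<times> (UNIV - {0})" using r by auto
 finally show "closure {p. \<phi> p ~= 0} <= UNIV \<times> (UNIV - {0})" .
 qed
 also have "... = (LBINT z. D (fst z) * E z)" by (simp add: \<phi>_def E_def mult_ac)
 also have "... = (LBINT y. LBINT u. D y * E (y, u))"
 proof -
 have "schwartz (%z. D (fst z) * E z)"
 proof (rule schwartz_compact)
 show "Cinf_on UNIV (%z. D (fst z) * E z)"
  using PE by (intro Cinf_on_mult open_UNIV om_Cinf[OF om_linear_compose[OF schwartz_imp_om[OF sD] linear_fst]]) (simp add: PS_def)
 fix z :: "(real^'n) \<times> (real^'n)" assume "B0 + (R + R\<^sup>2) < norm z"
 hence "B0 + (R + R\<^sup>2) < norm (fst z) + norm (snd z)" using norm_Pair_le[of "fst z" "snd z"] by simp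
 hence "B0 < norm (fst z) \<or> R + R\<^sup>2 < norm (snd z)" by linarith
 thus "D (fst z) * E z = 0" using B0 c_out by (auto simp: E_def)
 qed
 from integral_lborel_prod[OF schwartz_integrable[OF this]] show ?thesis by simp
 qed
 also have "... = (LBINT y. (LBINT u. E (y, u)) * D y)" by (simp add: mult.commute)
 finally have K\<phi>: "K \<phi> = (LBINT y. (LBINT u. E (y, u)) * D y)" .
 define G where "G y = (LBINT u. E (y, u))" for y
 have omG: "om G" unfolding G_def[abs_def] by (rule integral_family(1)[OF PE])
 have "(-1) ^ length (map cdir I) * K \<phi> = (LBINT y. Dl (map cdir I) G y * \<psi> y)"
 unfolding K\<phi> G_def[symmetric] D_def by (rule integral_by_parts_list[OF omG bump_schwartz[OF \<psi>] set_xudir(2)])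
 hence "norm ((-1) ^ length (map cdir I) * K \<phi>) = norm (LBINT y. Dl (map cdir I) G y * \<psi> y)" by (rule arg_cong)
 hence "norm (K \<phi>) = norm (LBINT y. Dl (map cdir I) G y * \<psi> y)" by (simp only: norm_mult norm_power norm_minus_cancel norm_one power_one mult_1)
 also have "... <= B * (LBINT x. norm (\<psi> x))"
 proof (rule bounded_integral_le)
 show "Dl (map cdir I) G : borel_measurable lborel"
 using borel_measurable_continuous_onI[OF Cinf_on_continuous[OF om_Cinf[OF om_Dl[OF omG set_xudir(2)]]]] by simp
 show "integrable lborel \<psi>" by (rule schwartz_integrable[OF bump_schwartz[OF \<psi>]])
 fix y
 have xd: "map (%v. (v, 0)) (map cdir I) = map xdir I" by (simp add: cdir_def xdir_def[abs_def] o_def)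
 have "Dl (map xdir I) E (y, u) = kI I al y u * C u * cis (2 * pi * (u \<bullet> - \<xi>))" for u
 proof (cases "u = 0")
 case False
 thus ?thesis unfolding E_def[abs_def] using Dl_xdir_mult[OF open_punctured Cinf_k, of "(y, u)" I c]
  by (simp add: kI_def c_def osc_def)
 next
 case True
 have "Dl (map xdir I) E (y, u) = 0"
  by (rule Dl_vanishes[of "{z. anorm d (snd z) < r / 8}"])
  (use open_vimage_snd[OF open_anorm_gt(2)[of d "r / 8"]] c_in r True in "auto simp: vimage_def E_def")
 thus ?thesis using True r by (simp add: C_def cutR_simps(2))
 qed
 hence "Dl (map cdir I) G y = ft (%u. kI I al y u * C u) (- \<xi>)"
 unfolding G_def[abs_def] integral_family(2)[OF PE set_xudir(2)] xd ft_def by simp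
 thus "norm (Dl (map cdir I) G y) <= B" using B[of y] by (simp add: C_def)
 qed
 finally show ?thesis unfolding \<phi>_def[abs_def] D_def c_def C_def .
qed

text \<open>With M large, \<open>kI\<close> is integrable at infinity with room to spare, so
  absolute values suffice and the bound is uniform in \<xi>.\<close>

lemma far_tail:
 "EX C>=0. ALL y \<xi> r R. 1 / 2 <= r --> r <= R --> norm (ft (%u. kI I al y u * (cutR d R u - cutR d r u)) \<xi>) <= C / r"
proof -
 define N where "N = real CARD('n)"
 \<comment> \<open>Chosen so that e meets the integrability threshold and the scaled tail has
   exponent Q + e <= -1.\<close>
 define M where "M = wdeg d al + 4 * N + 1"
 define e where "e = - (real CARD('n) + 1) - n - M + wdeg d al"
 have N: "0 <= N" by (simp add: N_def)
 have M: "0 <= M" using N by (simp add: M_def)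
 have e: "e <= - (4 * real CARD('n))" "CARD('n) + 1 + e <= - 1" using n N by (auto simp: e_def M_def N_def)
 obtain C0 where C0: "C0 >= 0" "!!y u. u ~= 0 ==> norm (kI I al y u) <= C0 * anorm d u powr e"
 using gsym_bound[OF gsym_kI[OF M, of al I], of "[]"] by (auto simp: e_def)
 define T where "T = (LBINT u. tail d e 1 u)"
 have T: "0 <= T" unfolding T_def by (intro integral_nonneg_AE AE_I2 tail_nonneg)
 \<comment> \<open>One power of 1 / r is split off; the remaining exponent is nonpositive, so its
   base r / 8 is replaced by the smallest value allowed, 1/16.\<close>
 define C where "C = C0 * 2 * 8 * (1 / 16) powr (CARD('n) + 2 + e) * T"
 have "norm (ft (%u. kI I al y u * (cutR d R u - cutR d r u)) \<xi>) <= C / r" if r: "1 / 2 <= r" "r <= R" for y \<xi> r R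
 proof -
 have le: "norm (kI I al y u * (cutR d R u - cutR d r u) * cis (2 * pi * (u \<bullet> \<xi>))) <= C0 * 2 * tail d e (r / 8) u" for u
 proof (cases "anorm d u < r / 8")
 case True thus ?thesis using r C0 by (simp add: cutR_simps(2) tail_nonneg)
 next
 case False
 hence "u ~= 0" using r by auto
 moreover have "norm (cutR d R u - cutR d r u) <= 2"
  using norm_triangle_ineq4[of "cutR d R u" "cutR d r u"] cutR_simps(3)[of d R u] cutR_simps(3)[of d r u] by linarith
 ultimately have "norm (kI I al y u) * norm (cutR d R u - cutR d r u) <= C0 * anorm d u powr e * 2"
  using C0 by (intro mult_mono) auto
 thus ?thesis using False by (simp add: norm_mult tail_def mult_ac)
 qed
 have it: "integrable lborel (%u. C0 * 2 * tail d e (r / 8) u)" using r e by (intro integrable_mult_right integrable_tail) auto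
 have "norm (ft (%u. kI I al y u * (cutR d R u - cutR d r u)) \<xi>) <= (LBINT u. C0 * 2 * tail d e (r / 8) u)"
 unfolding ft_def by (rule Bochner_Integration.integral_norm_bound_integral[OF _ it le])
  (rule Bochner_Integration.integrable_bound[OF it], 
  use le order_trans[OF _ abs_ge_self] schwartz_measurable[OF schwartz_cis[OF schwartz_shell[where U = "UNIV - {0}" and R = r and R' = R, OF _ gsym_Cinf[OF gsym_kI[OF M] UNIV_I]]]] r in "auto intro!: AE_I2")
 also have "... = C0 * 2 * ((r / 8) powr (CARD('n) + 1 + e) * T)"
 using integral_tail[where r = "r / 8" and d = d and e = e] r by (simp add: T_def)
 also have "... <= C0 * 2 * (8 / r * (1 / 16) powr (CARD('n) + 2 + e) * T)"
 proof (intro mult_left_mono mult_right_mono T)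
 have "(r / 8) powr (CARD('n) + 1 + e) = (r / 8) powr (- 1 + (CARD('n) + 2 + e))" by (simp add: add_ac)
 also have "... = (r / 8) powr (- 1) * (r / 8) powr (CARD('n) + 2 + e)" by (rule powr_add)
 also have "... = 8 / r * (r / 8) powr (CARD('n) + 2 + e)" using r by (simp add: powr_minus)
 also have "... <= 8 / r * (1 / 16) powr (CARD('n) + 2 + e)"
  using r e by (intro mult_left_mono powr_mono2') auto
 finally show "(r / 8) powr (CARD('n) + 1 + e) <= 8 / r * (1 / 16) powr (CARD('n) + 2 + e)" .
 qed (use C0 in auto)
 also have "... = C / r" by (simp add: C_def)
 finally show ?thesis .
 qed
 moreover have "0 <= C" using C0 T by (simp add: C_def)
 ultimately show ?thesis by blast
qed

text \<open>The truncated amplitude, differentiated by \<open>al\<close> in \<xi> and tested weakly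
  in x; the x-derivatives stand on \<psi> without the sign (-1)^|I|.\<close>

definition W :: "'n list => 'n list => real^'n => real => (real^'n => complex) => complex" where
 "W I al \<xi> R \<psi> = K (%q. Dl (map cdir I) \<psi> (fst q) * (cutR d R (snd q) * osc al (\<xi>, snd q)))"

lemma schwartz_cut_osc: "0 < R ==> schwartz (%u. cutR d R u * osc al (\<xi>, u))"
 using schwartz_om[OF schwartz_cutR om_osc_slice[of al \<xi>], of R d] by (simp add: mult.commute)

lemma schwartz_W: "schwartz \<psi> ==> 0 < R ==> schwartz (%q. Dl (map cdir I) \<psi> (fst q) * (cutR d R (snd q) * osc al (\<xi>, snd q)))"
 using schwartz_tensor[OF schwartz_Dl_any schwartz_cut_osc] by blast

lemma W_diff:
 assumes "0 < r" "0 < R" "schwartz \<psi>"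
 shows "W I al \<xi> R \<psi> - W I al \<xi> r \<psi> = K (%q. Dl (map cdir I) \<psi> (fst q) * ((cutR d R (snd q) - cutR d r (snd q)) * osc al (\<xi>, snd q)))"
 unfolding W_def tempered_diff[OF K schwartz_W[OF assms(3,2)] schwartz_W[OF assms(3,1)], symmetric]
 by (simp add: algebra_simps)

lemma W_tail:
 "EX C>=0. ALL \<xi> r R \<psi>. 1 / 2 <= r --> r <= R --> bump \<psi> --> norm (W I al \<xi> R \<psi> - W I al \<xi> r \<psi>) <= C / r * (LBINT x. norm (\<psi> x))"
proof -
 obtain C where C: "C >= 0" "!!y \<xi> r R. 1 / 2 <= r ==> r <= R ==> norm (ft (%u. kI I al y u * (cutR d R u - cutR d r u)) \<xi>) <= C / r"
 using far_tail[of I al] by blast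
 have "norm (W I al \<xi> R \<psi> - W I al \<xi> r \<psi>) <= C / r * (LBINT x. norm (\<psi> x))" if r: "1 / 2 <= r" "r <= R" "bump \<psi>" for \<xi> r R \<psi>
 proof -
 have r0: "0 < r" "0 < R" using r by auto
 show ?thesis unfolding W_diff[OF r0 bump_schwartz[OF r(3)]] by (rule far[OF r0(1) r(2,3) C(2)[OF r(1,2)]])
 qed
 thus ?thesis using C(1) by blast
qed

text \<open>Allows anorm \<xi> and 1 + anorm \<xi> to be exchanged for exponents of either
  sign.\<close>

lemma powr_comparable:
 assumes "0 < (y :: real)" "y <= x" "x <= 2 * y" shows "y powr t <= 2 powr \<bar>t\<bar> * x powr t"
proof (cases "0 <= t")
 case True
 have "y powr t <= x powr t" using assms True by (intro powr_mono2) auto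
 also have "... <= 2 powr \<bar>t\<bar> * x powr t" using ge_one_powr_ge_zero[of 2 "\<bar>t\<bar>"] mult_right_mono[of 1 "2 powr \<bar>t\<bar>" "x powr t"] by simp
 finally show ?thesis .
next
 case False
 hence "2 powr \<bar>t\<bar> * (2 * y) powr t <= 2 powr \<bar>t\<bar> * x powr t" using assms by (intro mult_left_mono powr_mono2') auto
 moreover have "2 powr \<bar>t\<bar> * (2 * y) powr t = y powr t"
 using False assms by (simp add: powr_mult mult.assoc[symmetric] powr_add[symmetric])
 ultimately show ?thesis by simp
qed

text \<open>For anorm \<xi> > 1 the split at r = 1 / anorm \<xi> makes anorm (-\<xi>) r = 1, so the
  shell estimate loses nothing and matches \<open>near\<close>. For anorm \<xi> <= 1 oscillation has
  nothing to offer: \<open>near\<close> at r = 1/2 and \<open>W_tail\<close> suffice.\<close>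

lemma W_bound:
 "EX C>=0. ALL \<xi> R \<psi>. 1 <= R --> bump \<psi> --> norm (W I al \<xi> R \<psi>) <= C * (1 + anorm d \<xi>) powr (n - wdeg d al) * (LBINT x. norm (\<psi> x))"
proof -
 \<comment> \<open>The order of \<open>kI\<close> for M = 0. Then Q + s = - t, so the inner and
   outer parts scale alike.\<close>
 define s where "s = - (real CARD('n) + 1) - n - 0 + wdeg d al"
 define t where "t = n - wdeg d al"
 obtain C1 where C1: "C1 >= 0" "!!\<xi> r \<psi>. 0 < r ==> r < 1 ==> r * anorm d \<xi> <= 1 ==> schwartz \<psi> ==>
 norm (W I al \<xi> r \<psi>) <= C1 * r powr (wdeg d al - n) * (LBINT x. norm (\<psi> x))"
 using near[of I al] unfolding W_def by blast
 obtain C2 where C2: "C2 >= 0" "!!\<xi> r R \<psi>. 1 / 2 <= r ==> r <= R ==> bump \<psi> ==>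
 norm (W I al \<xi> R \<psi> - W I al \<xi> r \<psi>) <= C2 / r * (LBINT x. norm (\<psi> x))"
 using W_tail[of I al] by blast
 obtain m :: nat where m: "s - real m <= - (4 * real CARD('n))" using exponent_exists by blast
 have "ALL i. EX C>=0. ALL y:UNIV. ALL r:{0<..}. ALL R:{0<..}. r <= R --> (ALL u.
 \<bar>u $ i\<bar> ^ m * norm (ft (%et. kI I al y et * (cutR d R et - cutR d r et)) u) <= C * r powr (CARD('n) + 1 + s - real (wt d i * m)))"
 proof
 fix i
 have "m <= wt d i * m" by (simp add: wt_def)
 hence "real m <= real (wt d i * m)" by (rule of_nat_mono)
 hence m': "s - real (wt d i * m) <= - (4 * real CARD('n))" using m by linarith
 show "EX C>=0. ALL y:UNIV. ALL r:{0<..}. ALL R:{0<..}. r <= R --> (ALL u.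
 \<bar>u $ i\<bar> ^ m * norm (ft (%et. kI I al y et * (cutR d R et - cutR d r et)) u) <= C * r powr (CARD('n) + 1 + s - real (wt d i * m)))"
 by (rule shell_oscillation[OF _ gsym_kI[OF order_refl, of al I, folded s_def] _ gsym_cutR_punctured _ m']) auto
 qed
 from choice[OF this] obtain C3 where C3: "!!i. C3 i >= 0" "!!i y r R u. 0 < r ==> 0 < R ==> r <= R ==>
 \<bar>u $ i\<bar> ^ m * norm (ft (%et. kI I al y et * (cutR d R et - cutR d r et)) u) <= C3 i * r powr (CARD('n) + 1 + s - real (wt d i * m))"
 unfolding greaterThan_iff Ball_def by blast
 define C4 where "C4 = (\<Sum>i\<in>UNIV. C3 i)"
 have le: "C3 i <= C4" for i unfolding C4_def by (rule member_le_sum) (auto simp: C3)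
 have C4: "0 <= C4" by (simp add: C4_def sum_nonneg C3)
 define C5 where "C5 = C4 * real CARD('n) ^ (2 * m)"
 have C5: "0 <= C5" using C4 by (simp add: C5_def)
 define C where "C = (C1 * (1 / 2) powr (wdeg d al - n) + C2 * 2 + C1 + C5) * 2 powr \<bar>t\<bar>"
 have "norm (W I al \<xi> R \<psi>) <= C * (1 + anorm d \<xi>) powr t * (LBINT x. norm (\<psi> x))" if R: "1 <= R" and \<psi>: "bump \<psi>" for \<xi> R \<psi>
 proof -
 define J where "J = (LBINT x. norm (\<psi> x))"
 have J: "0 <= J" unfolding J_def by (intro integral_nonneg_AE AE_I2) auto
 have tri: "norm (W I al \<xi> R \<psi>) <= norm (W I al \<xi> r \<psi>) + norm (W I al \<xi> R \<psi> - W I al \<xi> r \<psi>)" for r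
 by (metis norm_triangle_sub)
 show ?thesis
 proof (cases "anorm d \<xi> <= 1")
 case True
 have "norm (W I al \<xi> R \<psi>) <= C1 * (1 / 2) powr (wdeg d al - n) * J + C2 / (1 / 2) * J"
  using tri[of "1 / 2"] C1(2)[of "1 / 2" \<xi> \<psi>] C2(2)[of "1 / 2" R \<psi> \<xi>] True R \<psi> bump_schwartz[OF \<psi>] unfolding J_def by linarith
 also have "... = (C1 * (1 / 2) powr (wdeg d al - n) + C2 * 2) * J * 1" by (simp add: distrib_right)
 also have "... <= (C1 * (1 / 2) powr (wdeg d al - n) + C2 * 2 + C1 + C5) * J * (2 powr \<bar>t\<bar> * (1 + anorm d \<xi>) powr t)"
  using powr_comparable[of 1 "1 + anorm d \<xi>" t] True C1(1) C2(1) C5 J by (intro mult_mono) auto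
 finally show ?thesis by (simp add: C_def J_def mult_ac)
 next
 case False
 define r where "r = 1 / anorm d \<xi>"
 have "1 < anorm d \<xi>" using False by simp
 hence r: "0 < r" "r < 1" "anorm d \<xi> * r = 1" unfolding r_def by (auto simp: divide_less_eq)
 have an: "anorm d (- \<xi>) = anorm d \<xi>" by (simp add: anorm_def)
 have "norm (ft (%u. kI I al y u * (cutR d R u - cutR d r u)) (- \<xi>)) <= C5 * r powr (CARD('n) + 1 + s) * (anorm d (- \<xi>) * r) powr (- real m)" for y
  unfolding C5_def
 proof (rule anorm_decay[OF _ C4 norm_ge_zero r(1)])
  fix i
  show "\<bar>(- \<xi>) $ i\<bar> ^ m * norm (ft (%u. kI I al y u * (cutR d R u - cutR d r u)) (- \<xi>)) <= C4 * r powr (CARD('n) + 1 + s - real (wt d i * m))"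
  by (rule order_trans[OF C3(2) mult_right_mono[OF le]]) (use r R in auto)
 qed (use an r in simp)
 hence "norm (W I al \<xi> R \<psi> - W I al \<xi> r \<psi>) <= C5 * r powr (CARD('n) + 1 + s) * J"
  unfolding W_diff[OF r(1) less_le_trans[OF zero_less_one R] bump_schwartz[OF \<psi>]] J_def
  using far[OF r(1) _ \<psi>, of R I al \<xi> "C5 * r powr (CARD('n) + 1 + s)"] r R an by simp
 moreover have "CARD('n) + 1 + s = - t" "wdeg d al - n = - t" by (auto simp: s_def t_def)
 moreover have "r powr (- t) = anorm d \<xi> powr t" using False by (simp add: r_def powr_divide powr_minus)
 ultimately have "norm (W I al \<xi> R \<psi>) <= C1 * anorm d \<xi> powr t * J + C5 * anorm d \<xi> powr t * J"
  using tri[of r] C1(2)[OF r(1,2), of \<xi> \<psi>] r(3) bump_schwartz[OF \<psi>] by (simp add: J_def mult.commute[of r])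
 also have "... = (C1 + C5) * J * anorm d \<xi> powr t" by (simp add: algebra_simps)
 also have "... <= (C1 * (1 / 2) powr (wdeg d al - n) + C2 * 2 + C1 + C5) * J * (2 powr \<bar>t\<bar> * (1 + anorm d \<xi>) powr t)"
 proof -
  have "\<xi> ~= 0" using False by auto
  thus ?thesis
  using powr_comparable[of "anorm d \<xi>" "1 + anorm d \<xi>" t] False C1(1) C2(1) C5 J by (intro mult_mono) auto
 qed
 finally show ?thesis by (simp add: C_def J_def mult_ac)
 qed
 qed
 moreover have "0 <= C" using C1 C2 C5 by (simp add: C_def)
 ultimately show ?thesis unfolding t_def by blast
qed

end

subsection \<open>Mollification\<close>

lemma cut_real: "cut d u = cor (norm (cut d u))"
 using step_simps(3)[of "qnorm d (dil d (1 / 2) u)"] by (simp add: cut_def)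

lemma schwartz_cut: "schwartz (cut d)"
proof -
 have "dil d 1 u = u" for u by (simp add: vec_eq_iff dil_def)
 thus ?thesis using schwartz_cutR[of 1 d] by (simp add: cutR_def[abs_def])
qed

text \<open>\<open>cut\<close> is nonnegative and equals 1 on a neighbourhood of 0.\<close>

lemma integral_cut: "EX c>0. (LBINT v. cut d v) = cor c"
proof (intro exI conjI)
 have "open {u. anorm d u < 1 / 8}" by (rule open_anorm_gt(2))
 moreover have "0 : {u. anorm d u < 1 / 8}" by simp
 ultimately
 obtain e where e: "e > 0" "ball 0 e <= {u. anorm d u < 1 / 8}" by (rule openE)
 have "0 < measure lborel (ball (0 :: real^'a) e)" by (rule content_ball_pos[OF e(1)])
 also have "... = (LBINT v. indicator (ball 0 e) (v :: real^'a))" by simp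
 also have "... <= (LBINT v. norm (cut d v))"
 proof (rule integral_mono)
 show "integrable lborel (indicator (ball (0 :: real^'a) e) :: _ => real)"
 using emeasure_bounded_finite[OF bounded_ball, of 0 e] by (intro integrable_real_indicator) auto
 show "integrable lborel (%v. norm (cut d v))" by (intro integrable_norm schwartz_integrable schwartz_cut)
 show "indicator (ball 0 e) v <= norm (cut d v)" for v
 using e(2) cut_inside[of d v] by (auto simp: indicator_def subset_eq less_imp_le)
 qed
 finally show "0 < (LBINT v. norm (cut d v))" .
 show "(LBINT v. cut d v) = cor (LBINT v. norm (cut d v))"
 by (subst cut_real) simp
qed

lemma integral_reflect_translate:
 fixes f :: "'a::euclidean_space => complex"
 assumes [measurable]: "f : borel_measurable borel"
 shows "(LBINT y. f (x - y)) = (LBINT y. f y)"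
 using integral_translate[OF assms, of x] integral_scaleR_arg[of "- 1" "%y. f (x + y)"] by simp

text \<open>The dilated cutoff divided by its integral, which is positive; as \<open>cut\<close> is
  nonnegative, the L1 norm is 1 as well.\<close>

definition mol :: "'n::finite => real => real^'n => complex" where
 "mol d ep y = (1 / (cor (ep ^ (CARD('n) + 1)) * (LBINT v. cut d v))) * cutR d ep y"

lemma schwartz_mol: "0 < ep ==> schwartz (mol d ep)"
 unfolding mol_def[abs_def] by (intro schwartz_scale schwartz_cutR)

lemma mol_outside: "0 < ep ==> ep < anorm d y ==> mol d ep y = 0"
 by (simp add: mol_def cutR_simps(1))

lemma mol_outside_norm:
 assumes "0 < ep" "ep + ep\<^sup>2 < norm y" shows "mol d ep y = 0"
proof (rule mol_outside[OF assms(1)], rule ccontr)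
 assume "\<not> ep < anorm d y"
 hence "anorm d y <= ep" "(anorm d y)\<^sup>2 <= ep\<^sup>2" by (auto intro: power_mono)
 thus False using norm_le_anorm[of y d] assms(2) by linarith
qed

lemma integral_mol:
 fixes d :: "'n::finite"
 assumes "0 < ep" shows "(LBINT y. mol d ep (x - y)) = 1" "(LBINT y. norm (mol d ep (x - y))) = 1"
 "(LBINT y. mol d ep y) = 1" "(LBINT y. norm (mol d ep y)) = 1"
proof -
 obtain c where c: "0 < c" "(LBINT v. cut d v) = cor c" using integral_cut by blast
 show 1: "(LBINT y. mol d ep y) = 1"
 using integral_dil[OF assms schwartz_measurable[OF schwartz_cut[of d]], of d] assms c by (simp add: mol_def cutR_def)
 show 2: "(LBINT y. mol d ep (x - y)) = 1" for x
 using integral_reflect_translate[OF schwartz_measurable[OF schwartz_mol[OF assms]], of d x] 1 by simp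
 have "cor (norm (mol d ep y)) = mol d ep y" for y
 using cut_real[of d "dil d ep y"] assms c(1) by (simp add: mol_def c(2) cutR_def norm_mult norm_divide norm_power)
 hence "cor (LBINT y. norm (mol d ep (x - y))) = (LBINT y. mol d ep (x - y))" for x
 by (simp flip: integral_complex_of_real)
 hence "cor (LBINT y. norm (mol d ep (x - y))) = 1" for x using 2 by simp
 thus "(LBINT y. norm (mol d ep (x - y))) = 1" by (metis of_real_eq_1_iff)
 have "cor (LBINT y. norm (mol d ep y)) = (LBINT y. mol d ep y)"
 using \<open>!!y. cor (norm (mol d ep y)) = mol d ep y\<close> by (simp flip: integral_complex_of_real)
 thus "(LBINT y. norm (mol d ep y)) = 1" using 1 by (metis of_real_eq_1_iff)
qed

lemma Dl_reflect:
 fixes f :: "real^'n => complex"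
 assumes "Cinf_on UNIV f"
 shows "Dl (map cdir I) (%y. f (x - y)) y = (-1) ^ length I * Dl (map cdir I) f (x - y)"
proof -
 have "(\<Prod>i\<leftarrow>I. - 1 :: real) = (-1) ^ length I" by (induction I) auto
 moreover have "map uminus (map cdir I) = map (%i. (- 1) *\<^sub>R cdir i) I" by simp
 ultimately show ?thesis
 using Dl_affine[OF linear_uminus, of "map cdir I" f x] Dl_scaleR_dirs[OF assms, of "%_. - 1" cdir I]
 by (simp add: scaleR_conv_of_real o_def)
qed

lemma bump_mol:
 fixes d :: "'n::finite"
 assumes "0 < ep" shows "bump (%y. mol d ep (x - y))"
 unfolding bump_def
proof (intro conjI exI[of _ "norm x + (ep + ep\<^sup>2)"] allI impI)
 show "Cinf_on UNIV (%y. mol d ep (x - y))"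
 using Cinf_on_affine[OF schwartzD(1)[OF schwartz_mol[OF assms, of d]] open_UNIV open_UNIV linear_uminus, of x] by simp
 fix y :: "real^'n" assume "norm x + (ep + ep\<^sup>2) < norm y"
 thus "mol d ep (x - y) = 0" using norm_triangle_ineq2[of y x] by (intro mol_outside_norm[OF assms]) (simp add: norm_minus_commute)
qed

lemma anorm_small:
 assumes "0 < de" "de <= 1" "anorm d (w :: real^'n) <= de" shows "norm w <= 2 * de"
proof -
 have "de\<^sup>2 <= de" using assms by (simp add: power2_eq_square mult_left_le)
 moreover have "(anorm d w)\<^sup>2 <= de\<^sup>2" using assms by (intro power_mono) auto
 ultimately show ?thesis using assms norm_le_anorm[of w d] by linarith
qed

text \<open>An average against a probability density supported in anorm <= de.\<close>

lemma mol_integral_le: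
 fixes F :: "real^'n => complex"
 assumes de: "0 < de" and F: "continuous_on UNIV F" and B: "0 <= B" "!!w. anorm d w <= de ==> norm (F w) <= B"
 shows "norm (LBINT w. mol d de w * F w) <= B"
proof -
 define h where "h w = (if anorm d w <= de then F w else 0)" for w
 have [measurable]: "F : borel_measurable borel" by (rule borel_measurable_continuous_onI[OF F])
 have "(LBINT w. mol d de w * F w) = (LBINT w. h w * mol d de w)"
 by (intro Bochner_Integration.integral_cong) (auto simp: h_def mol_outside de)
 moreover have "norm (LBINT w. h w * mol d de w) <= B * (LBINT w. norm (mol d de w))"
 proof (rule bounded_integral_le)
 show "h : borel_measurable lborel" unfolding h_def by measurable
 show "norm (h w) <= B" for w using B by (simp add: h_def)
 qed (intro schwartz_integrable schwartz_mol de)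
 ultimately show ?thesis using integral_mol(4)[OF de, of d] by simp
qed

text \<open>The convolution of two mollifiers; its symmetry in the two widths makes amplitudes of
  different widths comparable.\<close>

definition mconv :: "'n::finite => real => real => real^'n => complex" where
 "mconv d de ep v = (LBINT w. mol d de w * mol d ep (v - w))"

lemma mconv_commute:
 assumes "0 < de" "0 < ep" shows "mconv d de ep = mconv d ep de"
proof
 fix v
 have "schwartz (%w. mol d de (v - w))" "schwartz (mol d ep)" using assms by (auto intro!: bump_schwartz bump_mol schwartz_mol)
 from integral_reflect_translate[of "%w. mol d ep w * mol d de (v - w)" v] schwartz_measurable[OF this(1)] schwartz_measurable[OF this(2)]
 show "mconv d de ep v = mconv d ep de v" by (simp add: mconv_def mult.commute)
qed

lemma Dl_mconv:
 assumes "0 < de" "0 < ep"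
 shows "Dl (map cdir I) (mconv d de ep) v = (LBINT w. mol d de w * Dl (map cdir I) (mol d ep) (v - w))"
proof -
 define H where "H z = mol d de (fst z) * mol d ep (snd z - fst z)" for z
 have sH: "schwartz H"
 proof -
 have "schwartz (%z. (%z. mol d de (fst z) * mol d ep (snd z)) ((%z. (fst z, snd z - fst z)) z))"
 proof (rule schwartz_linear[OF schwartz_tensor[OF schwartz_mol schwartz_mol]])
 show "linear (%z :: (real^'a) \<times> (real^'a). (fst z, snd z - fst z))" by (auto intro!: linearI simp: algebra_simps)
 fix z :: "(real^'a) \<times> (real^'a)"
 have "norm z <= norm (fst z) + norm (snd z)" using norm_Pair_le[of "fst z" "snd z"] by simp
 also have "norm (snd z) <= norm (snd z - fst z) + norm (fst z)" using norm_triangle_ineq[of "snd z - fst z" "fst z"] by simp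
 finally show "norm z <= 3 * norm (fst z, snd z - fst z)"
  using norm_fst_le[of "fst z" "snd z - fst z"] norm_snd_le[of "snd z - fst z" "fst z"] by simp
 qed (use assms in auto)
 thus ?thesis by (simp add: H_def[abs_def])
 qed
 have c: "Cinf_on UNIV (mol d ep)" by (rule schwartzD(1)[OF schwartz_mol[OF assms(2)]])
 have a: "Cinf_on UNIV (%v. mol d ep (v - w))" "Dl vs (%v. mol d ep (v - w)) v = Dl vs (mol d ep) (v - w)" for w vs v
 using Cinf_on_affine[OF c open_UNIV open_UNIV linear_id, of "- w"] Dl_affine[OF linear_id, of vs "mol d ep" "- w"] by auto
 have "Dl (map (Pair 0) (map cdir I)) H (w, v) = mol d de w * Dl (map cdir I) (mol d ep) (v - w)" for w
 unfolding Dl_slice[symmetric] H_def fst_conv snd_conv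
 by (simp add: Cinf_on_scale(2)[OF open_UNIV a(1) set_xudir(2)] a(2))
 thus ?thesis
 using schwartz_integral_fst(2)[OF sH set_xudir(2)[of I], of v] by (simp add: H_def mconv_def[abs_def])
qed

section \<open>Mollified and truncated amplitudes\<close>

context kernel
begin

text \<open>The variables are ((x, \<xi>), (y, u)). As a family in \<open>PS\<close> over (x, \<xi>)
  it makes the amplitude \<open>A\<close> smooth by \<open>tempered_family\<close>.\<close>

definition HH :: "real => real => ((real^'n) \<times> (real^'n)) \<times> ((real^'n) \<times> (real^'n)) => complex" where
 "HH ep R z = osc [] (snd (fst z), snd (snd z)) * (mol d ep (fst (fst z) - fst (snd z)) * cutR d R (snd (snd z)))"

definition A :: "real => real => (real^'n) \<times> (real^'n) => complex" where
 "A ep R p = K (%q. HH ep R (p, q))"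

lemma PS_HH:
 assumes "0 < ep" "0 < R" shows "PS (HH ep R)"
 unfolding HH_def[abs_def]
proof (rule PS_om)
 have "linear (%z :: ((real^'n) \<times> (real^'n)) \<times> ((real^'n) \<times> (real^'n)). (snd (fst z), snd (snd z)))" by (auto intro!: linearI)
 from om_linear_compose[OF om_osc this] show "om (%z :: ((real^'n) \<times> (real^'n)) \<times> ((real^'n) \<times> (real^'n)). osc [] (snd (fst z), snd (snd z)))" .
 have "PS (%z. (%z. mol d ep (fst z) * cutR d R (snd z)) ((%z :: ((real^'n) \<times> (real^'n)) \<times> ((real^'n) \<times> (real^'n)). (fst (fst z) - fst (snd z), snd (snd z))) z))"
 proof (rule PS_linear[OF schwartz_tensor[OF schwartz_mol[OF assms(1)] schwartz_cutR[OF assms(2)]]])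
 show "linear (%z :: ((real^'n) \<times> (real^'n)) \<times> ((real^'n) \<times> (real^'n)). (fst (fst z) - fst (snd z), snd (snd z)))"
 by (auto intro!: linearI simp: algebra_simps)
 fix p q :: "(real^'n) \<times> (real^'n)"
 have "norm q <= norm (fst q) + norm (snd q)" using norm_Pair_le[of "fst q" "snd q"] by simp
 also have "norm (fst q) <= norm (fst p - fst q) + norm (fst p)" using norm_triangle_ineq4[of "fst p - fst q" "fst p"] by simp
 finally show "norm q <= 2 * (norm (fst (fst (p, q)) - fst (snd (p, q)), snd (snd (p, q))) + norm p)"
 using norm_fst_le[of "fst p - fst q" "snd q"] norm_snd_le[of "snd q" "fst p - fst q"] norm_fst_le[of "fst p" "snd p"] norm_ge_zero[of "fst p"]
 by (simp del: norm_ge_zero)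
 qed simp
 thus "PS (%z :: ((real^'n) \<times> (real^'n)) \<times> ((real^'n) \<times> (real^'n)). mol d ep (fst (fst z) - fst (snd z)) * cutR d R (snd (snd z)))" by simp
qed

lemma om_A: "0 < ep ==> 0 < R ==> om (A ep R)"
 unfolding A_def[abs_def] by (rule tempered_family(1)[OF K PS_HH])

lemma Dl_A:
 assumes ep: "0 < ep" and R: "0 < R"
 shows "Dl (map xdir I @ map udir al) (A ep R) (x, \<xi>) = K (%q. Dl (map cdir I) (mol d ep) (x - fst q) * (cutR d R (snd q) * osc al (\<xi>, snd q)))"
proof -
 have c: "Cinf_on UNIV (mol d ep)" by (rule schwartzD(1)[OF schwartz_mol[OF ep]])
 have a: "Cinf_on UNIV (%v. mol d ep (v - w))" "Dl vs (%v. mol d ep (v - w)) v = Dl vs (mol d ep) (v - w)" for w vs v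
 using Cinf_on_affine[OF c open_UNIV open_UNIV linear_id, of "- w"] Dl_affine[OF linear_id, of vs "mol d ep" "- w"] by auto
 have o: "Cinf_on UNIV (%\<xi>. b * osc [] (\<xi>, u))" for u :: "real^'n" and b
 using Cinf_on_scale(1)[OF open_UNIV Cinf_on_affine[OF om_Cinf[OF om_osc[of "[]"]] open_UNIV open_UNIV linear_Pair0(2), of "(0, u)"]] by simp
 have "Dl (map (%v. (v, 0)) (map xdir I @ map udir al)) (HH ep R) ((x, \<xi>), q)
 = Dl (map cdir I) (mol d ep) (x - fst q) * (cutR d R (snd q) * osc al (\<xi>, snd q))" for q
 proof -
 have "(%p. HH ep R (p, q)) = (%p. mol d ep (fst p - fst q) * (cutR d R (snd q) * osc [] (snd p, snd q)))"
 by (simp add: HH_def fun_eq_iff)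
 thus ?thesis unfolding Dl_slice_fst[symmetric]
 by (simp add: Dl_tensor[OF a(1) o] a(2) Dl_osc)
 qed
 thus ?thesis unfolding A_def[abs_def] tempered_family(2)[OF K PS_HH[OF assms] set_xudir(1)] by simp
qed

text \<open>Each x-derivative of mol(x - y) is minus a y-derivative, hence the sign.\<close>

lemma Dl_A_W:
 assumes ep: "0 < ep" and R: "0 < R"
 shows "Dl (map xdir I @ map udir al) (A ep R) (x, \<xi>) = (-1) ^ length I * W I al \<xi> R (%y. mol d ep (x - y))"
proof -
 have "(-1) ^ length I * W I al \<xi> R (%y. mol d ep (x - y))
 = K (%q. (-1) ^ length I * (Dl (map cdir I) (%y. mol d ep (x - y)) (fst q) * (cutR d R (snd q) * osc al (\<xi>, snd q))))"
 unfolding W_def by (rule tempered_scale[OF K schwartz_W[OF bump_schwartz[OF bump_mol[OF ep]] R], symmetric])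
 thus ?thesis unfolding Dl_A[OF assms] Dl_reflect[OF schwartzD(1)[OF schwartz_mol[OF ep]]]
 by (simp add: mult.assoc[symmetric] power_mult_distrib[symmetric])
qed

text \<open>The weak bound is taken at the mollifier centred at x, whose L1 norm is 1; hence the
  uniformity in ep.\<close>

lemma A_bound:
 "EX C>=0. ALL ep R x \<xi>. 0 < ep --> 1 <= R --> norm (Dl (map xdir I @ map udir al) (A ep R) (x, \<xi>)) <= C * (1 + anorm d \<xi>) powr (n - wdeg d al)"
proof -
 obtain C where C: "C >= 0" "!!\<xi> R \<psi>. 1 <= R ==> bump \<psi> ==> norm (W I al \<xi> R \<psi>) <= C * (1 + anorm d \<xi>) powr (n - wdeg d al) * (LBINT x. norm (\<psi> x))"
 using W_bound[of I al] by blast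
 have "norm (Dl (map xdir I @ map udir al) (A ep R) (x, \<xi>)) <= C * (1 + anorm d \<xi>) powr (n - wdeg d al)" if "0 < ep" "1 <= R" for ep R x \<xi>
 using C(2)[OF that(2) bump_mol[OF that(1)], of \<xi> d x] that by (simp add: Dl_A_W norm_mult norm_power integral_mol(2)[OF that(1)])
 thus ?thesis using C(1) by blast
qed

lemma A_tail:
 "EX C>=0. ALL ep r R x \<xi>. 0 < ep --> 1 / 2 <= r --> r <= R -->
 norm (Dl (map xdir I @ map udir al) (A ep R) (x, \<xi>) - Dl (map xdir I @ map udir al) (A ep r) (x, \<xi>)) <= C / r"
proof -
 obtain C where C: "C >= 0" "!!\<xi> r R \<psi>. 1 / 2 <= r ==> r <= R ==> bump \<psi> ==> norm (W I al \<xi> R \<psi> - W I al \<xi> r \<psi>) <= C / r * (LBINT x. norm (\<psi> x))"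
 using W_tail[of I al] by blast
 have "norm (Dl (map xdir I @ map udir al) (A ep R) (x, \<xi>) - Dl (map xdir I @ map udir al) (A ep r) (x, \<xi>)) <= C / r"
 if "0 < ep" "1 / 2 <= r" "r <= R" for ep r R x \<xi>
 proof -
 have "0 < r" "0 < R" using that by auto
 thus ?thesis using C(2)[OF that(2,3) bump_mol[OF that(1)], of \<xi> d x] that
 by (simp add: Dl_A_W right_diff_distrib[symmetric] norm_mult norm_power integral_mol(2)[OF that(1)])
 qed
 thus ?thesis using C(1) by blast
qed

text \<open>\<open>tempered_Fubini\<close> pulls the average over w into \<open>K\<close>, where it
  convolves the mollifier of width ep with the one of width de.\<close>

lemma A_mollified:
 assumes "0 < de" "0 < ep" "0 < R"
 shows "(LBINT w. mol d de w * Dl (map xdir I @ map udir al) (A ep R) (x - w, \<xi>))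
 = K (%q. Dl (map cdir I) (mconv d de ep) (x - fst q) * (cutR d R (snd q) * osc al (\<xi>, snd q)))"
proof -
 define D where "D = Dl (map cdir I) (mol d ep)"
 define c where "c u = cutR d R u * osc al (\<xi>, u)" for u
 define H where "H z = mol d de (fst z) * (D (x - fst z - fst (snd z)) * c (snd (snd z)))" for z :: "(real^'n) \<times> (real^'n) \<times> (real^'n)"
 have sc: "schwartz c" unfolding c_def by (rule schwartz_cut_osc[OF assms(3)])
 have sD: "schwartz D" unfolding D_def by (rule schwartz_Dl_any[OF schwartz_mol[OF assms(2)]])
 have sH: "schwartz H"
 proof -
 define L where "L z = (fst z, - fst z - fst (snd z), snd (snd z))" for z :: "(real^'n) \<times> (real^'n) \<times> (real^'n)"
 define \<theta> where "\<theta> z = mol d de (fst z) * (%q. D (fst q) * c (snd q)) (snd z)" for z :: "(real^'n) \<times> (real^'n) \<times> (real^'n)"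
 have "schwartz \<theta>" unfolding \<theta>_def by (intro schwartz_tensor[OF schwartz_mol[OF assms(1)]] schwartz_tensor sD sc)
 hence "schwartz (%z. \<theta> ((0, x, 0) + L z))"
 proof (rule schwartz_affine_gen)
 show "linear L" unfolding L_def by (auto intro!: linearI simp: algebra_simps)
 fix z :: "(real^'n) \<times> (real^'n) \<times> (real^'n)"
 obtain w y u where z: "z = (w, y, u)" by (cases z)
 define e where "e = norm ((0, x, 0) + L z)"
 have "(0, x, 0) + L z = (w, x - w - y, u)" by (simp add: L_def z)
 hence e: "norm w <= e" "norm (x - w - y) <= e" "norm u <= e" unfolding e_def
  using norm_fst_le[of w "(x - w - y, u)"] norm_snd_le[of "(x - w - y, u)" w] norm_fst_le[of "x - w - y" u] norm_snd_le[of u "x - w - y"] by auto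
 have "norm z <= norm w + (norm y + norm u)" using norm_Pair_le[of w "(y, u)"] norm_Pair_le[of y u] by (simp add: z)
 moreover have "norm y <= norm x + norm w + norm (x - w - y)"
  using norm_triangle_ineq4[of "x - w" "x - w - y"] norm_triangle_ineq4[of x w] by simp
 ultimately have "norm z <= norm x + 4 * e" using e by linarith
 also have "... <= (4 + norm x) * (1 + e)" using mult_nonneg_nonneg[OF norm_ge_zero[of x] norm_ge_zero, of "(0, x, 0) + L z"] norm_ge_zero[of "(0, x, 0) + L z"]
  by (simp add: algebra_simps e_def del: norm_ge_zero)
 finally show "norm z <= (4 + norm x) * (1 + norm ((0, x, 0) + L z))" by (simp add: e_def)
 qed simp
 moreover have "x + (- fst z - fst (snd z)) = x - fst z - fst (snd z)" for z :: "(real^'n) \<times> (real^'n) \<times> (real^'n)" by simp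
 ultimately show ?thesis by (simp only: H_def[abs_def] \<theta>_def L_def plus_prod_def fst_conv snd_conv add_0_left)
 qed
 have s: "schwartz (%q. D (x - w - fst q) * c (snd q))" for w
 by (rule schwartz_tensor[OF schwartz_shift'[OF sD] sc])
 have "mol d de w * Dl (map xdir I @ map udir al) (A ep R) (x - w, \<xi>) = K (%q. H (w, q))" for w
 unfolding Dl_A[OF assms(2,3)] using tempered_scale[OF K s, of "mol d de w" w] by (simp add: H_def D_def c_def)
 hence "(LBINT w. mol d de w * Dl (map xdir I @ map udir al) (A ep R) (x - w, \<xi>)) = K (%q. LBINT w. H (w, q))"
 using tempered_Fubini[OF K sH] by simp
 moreover have "(LBINT w. H (w, q)) = Dl (map cdir I) (mconv d de ep) (x - fst q) * c (snd q)" for q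
 unfolding Dl_mconv[OF assms(1,2)] H_def D_def fst_conv snd_conv mult.assoc[symmetric]
 by (simp add: diff_diff_eq add.commute)
 ultimately show ?thesis by (simp add: c_def)
qed

text \<open>Averaging the amplitude of width ep at scale de changes it by O(de) times a bound on one
  more x-derivative, uniform in ep. The averages for (ep, de) and (de, ep) coincide by
  \<open>mconv_commute\<close>, so both amplitudes are close to the same function.\<close>

lemma A_moll:
 "EX C>=0. ALL ep de R x \<xi>. 0 < ep --> ep <= 1 --> 0 < de --> de <= 1 --> 1 <= R -->
 norm (Dl (map xdir I @ map udir al) (A ep R) (x, \<xi>) - Dl (map xdir I @ map udir al) (A de R) (x, \<xi>))
 <= C * (1 + anorm d \<xi>) powr (n - wdeg d al) * (ep + de)"
proof -
 define vs where "vs = map xdir I @ map udir al"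
 have "ALL i. EX C>=0. ALL ep R x \<xi>. 0 < ep --> 1 <= R --> norm (Dl (map xdir (i # I) @ map udir al) (A ep R) (x, \<xi>)) <= C * (1 + anorm d \<xi>) powr (n - wdeg d al)"
 using A_bound by blast
 from choice[OF this] obtain C where C: "!!i. C i >= 0" "!!i ep R x \<xi>. 0 < ep ==> 1 <= R ==>
 norm (Dl (map xdir (i # I) @ map udir al) (A ep R) (x, \<xi>)) <= C i * (1 + anorm d \<xi>) powr (n - wdeg d al)" by blast
 define C0 where "C0 = (\<Sum>i\<in>UNIV. C i)"
 have le: "C i <= C0" for i unfolding C0_def by (rule member_le_sum) (auto simp: C)
 have C0: "0 <= C0" by (simp add: C0_def sum_nonneg C)
 define C1 where "C1 = C0 * DIM(real^'n) * 2"
 have one: "norm (Dl vs (A ep R) (x, \<xi>) - (LBINT w. mol d de w * Dl vs (A ep R) (x - w, \<xi>))) <= C1 * (1 + anorm d \<xi>) powr (n - wdeg d al) * de"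
 if ep: "0 < ep" and de: "0 < de" "de <= 1" and R: "1 <= R" for ep de R x \<xi>
 proof -
 define G where "G = C0 * (1 + anorm d \<xi>) powr (n - wdeg d al)"
 have G: "0 <= G" using C0 by (simp add: G_def)
 define F where "F y = Dl vs (A ep R) (y, \<xi>)" for y
 have cA: "Cinf_on UNIV (Dl vs (A ep R))" using R by (intro Cinf_Dl_any om_Cinf om_A ep) auto
 have cF: "Cinf_on UNIV F" unfolding F_def
 using Cinf_on_affine[OF cA open_UNIV open_UNIV linear_Pair0(2), of "(0, \<xi>)"] by simp
 have F': "has_dir F (cdir i) (Dl (map xdir (i # I) @ map udir al) (A ep R) (y, \<xi>)) y" for i y
 using has_dir_any[OF open_UNIV cA UNIV_I, where x = "(y, \<xi>)" and w = "xdir i"]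
 by (simp add: has_dir_def F_def xdir_def cdir_def vs_def Dl_Cons)
 have lip: "norm (F (x - w) - F x) <= G * DIM(real^'n) * norm w" for w
 proof -
 have "norm (F (x - w) - F x) <= G * DIM(real^'n) * norm ((x - w) - x)"
 proof (rule lipschitz_ball[where e = "norm w + 1" and g = "%b y. dirD b F y"])
  fix z b :: "real^'n" assume "b : Basis"
  then obtain i where i: "b = cdir i" by (auto simp: Basis_cdir)
  show "has_dir F b (dirD b F z) z" using F'[of i z] dirD_eq[OF F'[of i z]] i by simp
  show "norm (dirD b F z) <= G" using dirD_eq[OF F'[of i z]] i C(2)[OF ep R, of i z \<xi>]
   mult_right_mono[OF le[of i], of "(1 + anorm d \<xi>) powr (n - wdeg d al)"] by (simp add: G_def)
 qed (simp add: dist_norm)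
 thus ?thesis by simp
 qed
 have sw: "schwartz (%w. mol d de w * F (x - w))"
 proof (rule schwartz_compact)
 show "Cinf_on UNIV (%w. mol d de w * F (x - w))"
  using Cinf_on_affine[OF cF open_UNIV open_UNIV linear_uminus, of x]
  by (intro Cinf_on_mult open_UNIV schwartzD(1)[OF schwartz_mol[OF de(1)]]) simp
 show "de + de\<^sup>2 < norm w ==> mol d de w * F (x - w) = 0" for w by (simp add: mol_outside_norm de)
 qed
 have "F x - (LBINT w. mol d de w * F (x - w)) = (LBINT w. mol d de w * F x) - (LBINT w. mol d de w * F (x - w))"
 by (simp add: integral_mol(3)[OF de(1)])
 also have "... = (LBINT w. mol d de w * F x - mol d de w * F (x - w))"
 by (intro Bochner_Integration.integral_diff[symmetric] integrable_mult_left schwartz_integrable schwartz_mol de sw)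
 also have "... = (LBINT w. mol d de w * (F x - F (x - w)))" by (simp add: right_diff_distrib)
 also have "norm ... <= G * DIM(real^'n) * (2 * de)"
 proof (rule mol_integral_le[OF de(1)])
 show "continuous_on UNIV (%w. F x - F (x - w))"
  by (intro continuous_intros continuous_on_compose2[OF Cinf_on_continuous[OF cF]]) auto
 show "0 <= G * DIM(real^'n) * (2 * de)" using G de by simp
 fix w assume "anorm d w <= de"
 hence "G * DIM(real^'n) * norm w <= G * DIM(real^'n) * (2 * de)" using G anorm_small[OF de] by (intro mult_left_mono) auto
 thus "norm (F x - F (x - w)) <= G * DIM(real^'n) * (2 * de)" using lip[of w] by (simp add: norm_minus_commute)
 qed
 finally show ?thesis by (simp add: F_def C1_def G_def mult_ac)
 qed
 have "norm (Dl vs (A ep R) (x, \<xi>) - Dl vs (A de R) (x, \<xi>)) <= C1 * (1 + anorm d \<xi>) powr (n - wdeg d al) * (ep + de)"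
 if a: "0 < ep" "ep <= 1" "0 < de" "de <= 1" "1 <= R" for ep de R x \<xi>
 proof -
 have R: "0 < R" using a by simp
 have "(LBINT w. mol d de w * Dl vs (A ep R) (x - w, \<xi>)) = (LBINT w. mol d ep w * Dl vs (A de R) (x - w, \<xi>))"
 unfolding vs_def A_mollified[OF a(3,1) R] A_mollified[OF a(1,3) R] mconv_commute[OF a(1,3)] ..
 with one[OF a(1,3,4,5), of x \<xi>] one[OF a(3,1,2,5), of x \<xi>]
 have "norm (Dl vs (A ep R) (x, \<xi>) - Dl vs (A de R) (x, \<xi>)) <= C1 * (1 + anorm d \<xi>) powr (n - wdeg d al) * de + C1 * (1 + anorm d \<xi>) powr (n - wdeg d al) * ep"
 by (smt (verit) norm_triangle_ineq4 diff_diff_eq2 diff_add_cancel diff_diff_add add_diff_cancel_left')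
 thus ?thesis by (simp add: distrib_left)
 qed
 thus ?thesis using C0 unfolding vs_def C1_def by (intro exI[of _ "C0 * DIM(real^'n) * 2"]) auto
qed

text \<open>Width 1 / (j + 1) and truncation j + 1 are coupled so that both errors are O(1 / (j +
  1)).\<close>

definition aj :: "nat => (real^'n) \<times> (real^'n) => complex" where
 "aj j = A (1 / (real j + 1)) (real j + 1)"

lemma om_aj: "om (aj j)"
 unfolding aj_def by (rule om_A) auto

lemma aj_bound:
 "EX C>=0. ALL j x \<xi>. norm (Dl (map xdir I @ map udir al) (aj j) (x, \<xi>)) <= C * (1 + anorm d \<xi>) powr (n - wdeg d al)"
proof -
 obtain C where C: "C >= 0" "!!ep R x \<xi>. 0 < ep ==> 1 <= R ==> norm (Dl (map xdir I @ map udir al) (A ep R) (x, \<xi>)) <= C * (1 + anorm d \<xi>) powr (n - wdeg d al)"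
 using A_bound[of I al] by blast
 show ?thesis unfolding aj_def by (intro exI[of _ C] conjI C(1) allI C(2)) auto
qed

text \<open>From l to j the truncation is lowered first, at width 1 / (l + 1), and then the width is
  enlarged at truncation j + 1. Only the rate matters here, so t may be any nonnegative exponent
  that dominates n - wdeg.\<close>

lemma aj_Cauchy:
 assumes vs: "set vs <= Basis"
 shows "EX C t. C >= 0 & t >= 0 & (ALL j l z. j <= l --> norm (Dl vs (aj l) z - Dl vs (aj j) z) <= C * (1 + anorm d (snd z)) powr t / (real j + 1))"
proof -
 obtain I al where m: "mset vs = mset (map xdir I @ map udir al)" using sort_directions[OF vs] .
 define ws where "ws = map xdir I @ map udir al"
 have e: "Dl vs (aj j) z = Dl ws (aj j) z" for j z
 unfolding ws_def by (rule Dl_perm[OF open_UNIV om_Cinf[OF om_aj] m UNIV_I])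
 define t where "t = \<bar>n - wdeg d al\<bar>"
 obtain C1 where C1: "C1 >= 0" "!!ep r R x \<xi>. 0 < ep ==> 1 / 2 <= r ==> r <= R ==> norm (Dl ws (A ep R) (x, \<xi>) - Dl ws (A ep r) (x, \<xi>)) <= C1 / r"
 using A_tail[of I al] unfolding ws_def by blast
 obtain C2 where C2: "C2 >= 0" "!!ep de R x \<xi>. 0 < ep ==> ep <= 1 ==> 0 < de ==> de <= 1 ==> 1 <= R ==>
 norm (Dl ws (A ep R) (x, \<xi>) - Dl ws (A de R) (x, \<xi>)) <= C2 * (1 + anorm d \<xi>) powr (n - wdeg d al) * (ep + de)"
 using A_moll[of I al] unfolding ws_def by blast
 have "norm (Dl vs (aj l) (x, \<xi>) - Dl vs (aj j) (x, \<xi>)) <= (C1 + C2 * 2) * (1 + anorm d \<xi>) powr t / (real j + 1)" if jl: "j <= l" for j l x \<xi>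
 proof -
 define r where "r = real j + 1"
 define R where "R = real l + 1"
 define y where "y = (1 + anorm d \<xi>) powr t"
 have rR: "1 <= r" "r <= R" "1 <= R" using jl by (auto simp: r_def R_def)
 have y: "1 <= y" unfolding y_def by (rule ge_one_powr_ge_zero) (auto simp: t_def)
 have y': "(1 + anorm d \<xi>) powr (n - wdeg d al) <= y" unfolding y_def by (intro powr_mono) (auto simp: t_def)
 have "norm (Dl ws (A (1 / R) R) (x, \<xi>) - Dl ws (A (1 / R) r) (x, \<xi>)) <= C1 / r" using rR by (intro C1(2)) auto
 also have "... <= C1 * y / r" using C1(1) y rR by (intro divide_right_mono) (auto simp: mult_le_cancel_left1)
 finally have 1: "norm (Dl ws (A (1 / R) R) (x, \<xi>) - Dl ws (A (1 / R) r) (x, \<xi>)) <= C1 * y / r" .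
 have "norm (Dl ws (A (1 / R) r) (x, \<xi>) - Dl ws (A (1 / r) r) (x, \<xi>)) <= C2 * (1 + anorm d \<xi>) powr (n - wdeg d al) * (1 / R + 1 / r)"
 using rR by (intro C2(2)) auto
 also have "... <= C2 * y * (2 / r)"
 proof (intro mult_mono mult_left_mono y' C2(1))
 have "1 / R <= 1 / r" using rR by (intro divide_left_mono) auto
 thus "1 / R + 1 / r <= 2 / r" by simp
 qed (use rR y C2 in auto)
 finally have 2: "norm (Dl ws (A (1 / R) r) (x, \<xi>) - Dl ws (A (1 / r) r) (x, \<xi>)) <= C2 * y * (2 / r)" .
 have "norm (Dl ws (aj l) (x, \<xi>) - Dl ws (aj j) (x, \<xi>)) <= C1 * y / r + C2 * y * (2 / r)"
 unfolding aj_def r_def[symmetric] R_def[symmetric]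
 using norm_triangle_ineq[of "Dl ws (A (1 / R) R) (x, \<xi>) - Dl ws (A (1 / R) r) (x, \<xi>)" "Dl ws (A (1 / R) r) (x, \<xi>) - Dl ws (A (1 / r) r) (x, \<xi>)"] 1 2 by simp
 also have "... = (C1 + C2 * 2) * y / r" using rR by (simp add: field_simps)
 finally show ?thesis unfolding e y_def r_def .
 qed
 thus ?thesis using C1(1) C2(1) by (intro exI[of _ "C1 + C2 * 2"] exI[of _ t]) (auto simp: t_def)
qed

end

subsection \<open>The limit symbol\<close>

lemma integrable_anorm_schwartz:
 fixes f :: "(real^'n::finite) \<times> (real^'n) => complex"
 assumes f: "schwartz f" shows "integrable lborel (%z. (1 + anorm d (snd z)) powr t * norm (f z))"
proof -
 define N where "N = nat \<lceil>\<bar>t\<bar>\<rceil>"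
 let ?D = "2 * DIM((real^'n) \<times> (real^'n))"
 obtain C where C: "C >= 0" "!!z. (1 + norm z) ^ (?D + N) * norm (f z) <= C" using schwartz_bound[OF f, of "[]" "?D + N"] by auto
 have "(1 + norm z) ^ ?D * norm (cor ((1 + anorm d (snd z)) powr t * norm (f z))) <= 3 ^ N * C" for z
 proof -
 have "(1 + anorm d (snd z)) powr t <= (1 + anorm d (snd z)) ^ N" unfolding N_def by (rule powr_le_power) simp
 also have "... <= (3 * (1 + norm z)) ^ N"
 using anorm_le_norm[of d "snd z"] norm_snd_le[of "snd z" "fst z"] norm_ge_zero[of z]
 by (intro power_mono) (simp_all del: norm_ge_zero)
 finally have "(1 + norm z) ^ ?D * ((1 + anorm d (snd z)) powr t * norm (f z)) <= (1 + norm z) ^ ?D * ((3 * (1 + norm z)) ^ N * norm (f z))"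
 by (intro mult_left_mono mult_right_mono) auto
 also have "... = 3 ^ N * ((1 + norm z) ^ (?D + N) * norm (f z))" by (simp only: power_mult_distrib power_add mult_ac)
 also have "... <= 3 ^ N * C" using C(2) by (intro mult_left_mono) auto
 finally show ?thesis by (simp add: norm_mult)
 qed
 moreover have "(%z. cor ((1 + anorm d (snd z)) powr t * norm (f z))) : borel_measurable borel"
 proof -
 have [measurable]: "(%z :: (real^'n) \<times> (real^'n). anorm d (snd z)) : borel_measurable borel" "f : borel_measurable borel"
 by (auto intro!: borel_measurable_continuous_onI continuous_on_compose2[OF continuous_anorm] continuous_intros schwartz_measurable[OF f])
 show ?thesis by measurable
 qed
 ultimately have "integrable lborel (%z. cor ((1 + anorm d (snd z)) powr t * norm (f z)))"
 by (intro integrable_of_decay(1))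
 thus ?thesis using complex_of_real_integrable_eq by blast
qed

context kernel
begin

text \<open>Candidates for all derivatives of the limit symbol at once; \<open>P []\<close> is the
  symbol itself.\<close>

definition P :: "((real^'n) \<times> (real^'n)) list => (real^'n) \<times> (real^'n) => complex" where
 "P vs z = lim (%j. Dl vs (aj j) z)"

lemma P_lim: 
 assumes vs: "set vs <= Basis" shows "(%j. Dl vs (aj j) z) \<longlonglongrightarrow> P vs z"
proof -
 obtain C t where C: "C >= 0" "!!j l z. j <= l ==> norm (Dl vs (aj l) z - Dl vs (aj j) z) <= C * (1 + anorm d (snd z)) powr t / (real j + 1)"
 using aj_Cauchy[OF vs] by blast
 define c where "c = C * (1 + anorm d (snd z)) powr t"
 have "Cauchy (%j. Dl vs (aj j) z)"
 proof (rule CauchyI')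
 fix e :: real assume e: "0 < e"
 obtain M :: nat where M: "c / e < real M" using reals_Archimedean2 by blast
 have "dist (Dl vs (aj j) z) (Dl vs (aj l) z) < e" if "M <= j" "j < l" for j l
 proof -
 have "norm (Dl vs (aj l) z - Dl vs (aj j) z) <= c / (real j + 1)" using C(2)[of j l z] that by (simp add: c_def)
 also have "... < e"
 proof -
  have "c / e < real j + 1" using M that by linarith
  thus ?thesis using e by (simp add: field_simps)
 qed
 finally show ?thesis by (simp add: dist_norm norm_minus_commute)
 qed
 thus "EX M. ALL j>=M. ALL l>j. dist (Dl vs (aj j) z) (Dl vs (aj l) z) < e" by blast
 qed
 thus ?thesis unfolding P_def using Cauchy_convergent_iff convergent_LIMSEQ_iff by blast
qed

lemma P_diff:
 assumes vs: "set vs <= Basis"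
 shows "EX C t. C >= 0 & t >= 0 & (ALL j z. norm (Dl vs (aj j) z - P vs z) <= C * (1 + anorm d (snd z)) powr t / (real j + 1))"
proof -
 obtain C t where C: "C >= 0" "t >= 0" "!!j l z. j <= l ==> norm (Dl vs (aj l) z - Dl vs (aj j) z) <= C * (1 + anorm d (snd z)) powr t / (real j + 1)"
 using aj_Cauchy[OF vs] by blast
 have "norm (P vs z - Dl vs (aj j) z) <= C * (1 + anorm d (snd z)) powr t / (real j + 1)" for j z
 proof (rule tendsto_upperbound)
 show "(%l. norm (Dl vs (aj l) z - Dl vs (aj j) z)) \<longlonglongrightarrow> norm (P vs z - Dl vs (aj j) z)"
 by (intro tendsto_intros P_lim[OF vs])
 qed (auto intro!: eventually_sequentiallyI[of j] C(3))
 thus ?thesis using C(1,2) by (intro exI[of _ C] exI[of _ t]) (simp add: norm_minus_commute)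
qed

lemma open_snd_anorm_less: "open {z :: (real^'n) \<times> (real^'n). anorm d (snd z) < B}"
 using open_vimage_snd[OF open_anorm_gt(2)[of d B]] by (simp add: vimage_def)

text \<open>The error bound grows polynomially in \<xi>, so uniformity is obtained on strips of
  bounded anorm \<xi>, which suffices for local statements.\<close>

lemma P_uniform:
 assumes vs: "set vs <= Basis"
 shows "uniform_limit {z. anorm d (snd z) < B} (%j. Dl vs (aj j)) (P vs) sequentially"
proof (rule uniform_limitI)
 fix e :: real assume e: "0 < e"
 obtain C t where C: "C >= 0" "t >= 0" "!!j z. norm (Dl vs (aj j) z - P vs z) <= C * (1 + anorm d (snd z)) powr t / (real j + 1)"
 using P_diff[OF vs] by blast
 obtain M :: nat where M: "C * (1 + \<bar>B\<bar>) powr t / e < real M" using reals_Archimedean2 by blast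
 have "dist (Dl vs (aj j) z) (P vs z) < e" if "M <= j" "anorm d (snd z) < B" for j z
 proof -
 have "norm (Dl vs (aj j) z - P vs z) <= C * (1 + anorm d (snd z)) powr t / (real j + 1)" by (rule C(3))
 also have "... <= C * (1 + \<bar>B\<bar>) powr t / (real j + 1)"
 using that C by (intro divide_right_mono mult_left_mono powr_mono2) auto
 also have "... < e"
 proof -
 have "C * (1 + \<bar>B\<bar>) powr t / e < real j + 1" using M that by linarith
 thus ?thesis using e by (simp add: field_simps)
 qed
 finally show ?thesis by (simp add: dist_norm)
 qed
 thus "\<forall>\<^sub>F j in sequentially. ALL z:{z. anorm d (snd z) < B}. dist (Dl vs (aj j) z) (P vs z) < e"
 by (intro eventually_sequentiallyI[of M]) auto
qed

lemma P_has_dir: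
 assumes vs: "set vs <= Basis" and v: "v : Basis" shows "has_dir (P vs) v (P (v # vs) z) z"
proof (rule has_dir_limit[OF open_snd_anorm_less[of "anorm d (snd z) + 1"]])
 show "has_dir (Dl vs (aj j)) v (Dl (v # vs) (aj j) y) y" for j y
 by (rule Cinf_on_Dl_has_dir[OF om_Cinf[OF om_aj] vs v UNIV_I])
 show "uniform_limit {y. anorm d (snd y) < anorm d (snd z) + 1} (%j. Dl (v # vs) (aj j)) (P (v # vs)) sequentially"
 using vs v by (intro P_uniform) auto
qed (auto intro: P_lim[OF vs])

lemma P_continuous:
 assumes vs: "set vs <= Basis" shows "continuous_on UNIV (P vs)"
proof -
 have "continuous_on (\<Union>B::nat. {z. anorm d (snd z) < real B}) (P vs)"
 proof (rule continuous_on_open_UN)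
 show "continuous_on {z. anorm d (snd z) < real B} (P vs)" for B :: nat
 by (rule uniform_limit_theorem[OF _ P_uniform[OF vs]])
  (auto intro!: always_eventually continuous_on_subset[OF Cinf_on_Dl_continuous[OF om_Cinf[OF om_aj] vs]])
 qed (rule open_snd_anorm_less)
 moreover have "(\<Union>B::nat. {z :: (real^'n) \<times> (real^'n). anorm d (snd z) < real B}) = UNIV" using reals_Archimedean2 by auto
 ultimately show ?thesis by simp
qed

text \<open>Locally uniform convergence of every derivative makes \<open>P\<close> consistent in the
  sense of \<open>Cinf_on_seqI\<close>, and the symbol bounds, uniform in j, pass to the pointwise
  limit.\<close>

lemma symb_P: "symb d n (P [])"
proof (rule symbI_PsiD)
 show "Cinf_on UNIV (P [])"
 by (rule Cinf_on_seqI(1)[OF open_UNIV, where P = P]) (auto intro: P_has_dir P_continuous)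
 fix I al :: "'n list"
 obtain C where C: "!!j x \<xi>. norm (Dl (map xdir I @ map udir al) (aj j) (x, \<xi>)) <= C * (1 + anorm d \<xi>) powr (n - wdeg d al)"
 using aj_bound[of I al] by blast
 have "norm (P (map xdir I @ map udir al) (x, \<xi>)) <= C * (1 + anorm d \<xi>) powr (n - wdeg d al)" for x \<xi>
 by (rule tendsto_upperbound[OF tendsto_norm[OF P_lim[OF set_xudir(1)]]]) (use C in "auto intro: always_eventually")
 moreover have "Dl (map xdir I @ map udir al) (P []) z = P (map xdir I @ map udir al) z" for z
 by (rule Cinf_on_seqI(2)[OF open_UNIV, where P = P]) (rule P_has_dir P_continuous refl set_xudir UNIV_I | assumption)+
 ultimately show "EX C. ALL x \<xi>. norm (Dl (map xdir I @ map udir al) (P []) (x, \<xi>)) <= C * (1 + anorm d \<xi>) powr (n - wdeg d al)"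
 by (intro exI[of _ C]) simp
qed

lemma tendsto_inverse_bound:
 fixes f :: "nat => complex"
 assumes "!!j. norm (f j - l) <= C / (real j + 1)" shows "f \<longlonglongrightarrow> l"
proof (rule LIM_zero_cancel, rule Lim_null_comparison)
 show "\<forall>\<^sub>F j in sequentially. norm (f j - l) <= C * inverse (real (Suc j))"
 using assms by (intro always_eventually allI) (simp add: divide_inverse add.commute)
 show "(%j. C * inverse (real (Suc j))) \<longlonglongrightarrow> 0"
 using tendsto_mult_right_zero[OF LIMSEQ_inverse_real_of_nat, of C] by simp
qed

text \<open>The polynomial loss in \<xi> is absorbed by the Schwartz function
  \<open>pft \<Phi>\<close>.\<close>

lemma aj_integral_lim:
 assumes \<Phi>: "schwartz \<Phi>"
 shows "(%j. LBINT z. aj j z * pft \<Phi> z) \<longlonglongrightarrow> Kop (P []) \<Phi>"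
proof -
 have "set [] <= (Basis :: ((real^'n) \<times> (real^'n)) set)" by simp
 from P_diff[OF this, unfolded Dl_Nil]
 obtain C t where C: "C >= 0" "!!j z. norm (aj j z - P [] z) <= C * (1 + anorm d (snd z)) powr t / (real j + 1)" by blast
 have oP: "om (P [])" by (rule symb_imp_om[OF symb_P])
 define J where "J = (LBINT z. (1 + anorm d (snd z)) powr t * norm (pft \<Phi> z))"
 have i: "integrable lborel (%z. a z * pft \<Phi> z)" if "om a" for a by (rule schwartz_integrable[OF schwartz_Kop[OF that \<Phi>]])
 show ?thesis
 proof (rule tendsto_inverse_bound[where C = "C * J"])
 fix j
 have "(LBINT z. aj j z * pft \<Phi> z) - Kop (P []) \<Phi> = (LBINT z. (aj j z - P [] z) * pft \<Phi> z)"
 unfolding Kop_eq[OF oP \<Phi>] left_diff_distrib by (rule Bochner_Integration.integral_diff[symmetric, OF i[OF om_aj] i[OF oP]])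
 also have "norm ... <= (LBINT z. C / (real j + 1) * ((1 + anorm d (snd z)) powr t * norm (pft \<Phi> z)))"
 proof (rule Bochner_Integration.integral_norm_bound_integral)
 show "integrable lborel (%z. (aj j z - P [] z) * pft \<Phi> z)"
  unfolding left_diff_distrib by (intro Bochner_Integration.integrable_diff i om_aj oP)
 show "integrable lborel (%z. C / (real j + 1) * ((1 + anorm d (snd z)) powr t * norm (pft \<Phi> z)))"
  by (intro integrable_mult_right integrable_anorm_schwartz schwartz_pft \<Phi>)
 show "norm ((aj j z - P [] z) * pft \<Phi> z) <= C / (real j + 1) * ((1 + anorm d (snd z)) powr t * norm (pft \<Phi> z))" for z
  using mult_right_mono[OF C(2)[of j z] norm_ge_zero[of "pft \<Phi> z"]] by (simp add: norm_mult)
 qed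
 finally show "norm ((LBINT z. aj j z * pft \<Phi> z) - Kop (P []) \<Phi>) <= C * J / (real j + 1)" by (simp add: J_def)
 qed
qed

text \<open>The average runs over y + w: in the pairing, mol(x - y) is integrated in x against
  \<Phi>(x, u), and x = y + w.\<close>

definition M :: "real => ((real^'n) \<times> (real^'n) => complex) => (real^'n) \<times> (real^'n) => complex" where
 "M ep \<Phi> q = (LBINT w. mol d ep w * \<Phi> ((w, 0) + q))"

lemma M_props:
 assumes \<Phi>: "schwartz \<Phi>" and ep: "0 < ep"
 shows "schwartz (M ep \<Phi>)" and "set vs <= Basis ==> Dl vs (M ep \<Phi>) = M ep (Dl vs \<Phi>)"
proof -
 define H where "H z = mol d ep (fst z) * \<Phi> ((fst z, 0) + snd z)" for z :: "(real^'n) \<times> (real^'n) \<times> (real^'n)"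
 have sH: "schwartz H"
 proof -
 have "schwartz (%z. (%z. mol d ep (fst z) * \<Phi> (snd z)) ((%z. (fst z, (fst z, 0) + snd z)) z))"
 proof (rule schwartz_linear[OF schwartz_tensor[OF schwartz_mol[OF ep] \<Phi>]])
 show "linear (%z :: (real^'n) \<times> (real^'n) \<times> (real^'n). (fst z, (fst z, 0 :: real^'n) + snd z))" by (auto intro!: linearI simp: algebra_simps)
 fix z :: "(real^'n) \<times> (real^'n) \<times> (real^'n)"
 have "norm z <= norm (fst z) + norm (snd z)" using norm_Pair_le[of "fst z" "snd z"] by simp
 also have "norm (snd z) <= norm ((fst z, 0) + snd z) + norm (fst z)"
  using norm_triangle_ineq4[of "(fst z, 0) + snd z" "(fst z, 0)"] by simp
 finally show "norm z <= 3 * norm (fst z, (fst z, 0) + snd z)"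
  using norm_fst_le[of "fst z" "(fst z, 0) + snd z"] norm_snd_le[of "(fst z, 0) + snd z" "fst z"] by simp
 qed simp
 thus ?thesis by (simp add: H_def[abs_def])
 qed
 have eq: "M ep \<Phi> = (%q. LBINT w. H (w, q))" by (simp add: M_def H_def fun_eq_iff)
 show "schwartz (M ep \<Phi>)" unfolding eq by (rule schwartz_integral_fst(1)[OF sH])
 assume vs: "set vs <= Basis"
 have "Dl (map (Pair 0) vs) H (w, q) = mol d ep w * Dl vs \<Phi> ((w, 0) + q)" for w q
 proof -
 have "Cinf_on UNIV (%q. \<Phi> ((w, 0) + q))" using schwartzD(1)[OF schwartz_shift[OF \<Phi>]] .
 thus ?thesis unfolding Dl_slice[symmetric] H_def fst_conv snd_conv
 using Dl_affine[OF linear_id, of vs \<Phi> "(w, 0)"] by (simp add: Cinf_on_scale(2)[OF open_UNIV _ vs])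
 qed
 thus "Dl vs (M ep \<Phi>) = M ep (Dl vs \<Phi>)"
 unfolding eq using schwartz_integral_fst(2)[OF sH vs] by (simp add: M_def fun_eq_iff)
qed

text \<open>A Lipschitz estimate in the ball of radius 3 about z, on which weights are comparable up
  to 4 ^ m; it contains the shifted point because norm w <= 2 ep <= 2.\<close>

lemma M_diff:
 assumes \<Phi>: "schwartz \<Phi>"
 shows "EX C>=0. ALL ep z. 0 < ep --> ep <= 1 --> (1 + norm z) ^ m * norm (\<Phi> z - M ep \<Phi> z) <= C * ep"
proof -
 have "ALL b:Basis. EX C>=0. ALL x. (1 + norm x) ^ m * norm (dirD b \<Phi> x) <= C"
 using schwartz_bound[OF \<Phi>, of "[_]"] by (auto simp: Dl_Cons)
 from bchoice[OF this] obtain C where C: "!!b. b : Basis ==> C b >= 0" "!!b x. b : Basis ==> (1 + norm x) ^ m * norm (dirD b \<Phi> x) <= C b" by blast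
 define C0 where "C0 = (\<Sum>b\<in>Basis. C b)"
 have C0: "0 <= C0" by (simp add: C0_def sum_nonneg C)
 have le: "C b <= C0" if "b : Basis" for b unfolding C0_def by (rule member_le_sum) (use C that in auto)
 define N where "N = real DIM((real^'n) \<times> (real^'n))"
 have N: "0 <= N" by (simp add: N_def)
 have "(1 + norm z) ^ m * norm (\<Phi> z - M ep \<Phi> z) <= (C0 * 4 ^ m * N * 2) * ep" if ep: "0 < ep" "ep <= 1" for ep z
 proof -
 define B where "B = C0 * 4 ^ m / (1 + norm z) ^ m"
 have z: "0 < (1 + norm z) ^ m" by (intro zero_less_power add_pos_nonneg) auto
 have B: "0 <= B" using C0 z by (simp add: B_def)
 have lip: "norm (\<Phi> ((w, 0) + z) - \<Phi> z) <= B * N * (2 * ep)" if w: "anorm d w <= ep" for w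
 proof -
 have nw: "norm w <= 2 * ep" by (rule anorm_small[OF ep w])
 have "norm (\<Phi> ((w, 0) + z) - \<Phi> z) <= B * N * norm ((w, 0) + z - z)" unfolding N_def
 proof (rule lipschitz_ball[where e = 3 and g = "%b. dirD b \<Phi>"])
  fix y b :: "(real^'n) \<times> (real^'n)" assume b: "b : Basis" and y: "y : ball z 3"
  show "has_dir \<Phi> b (dirD b \<Phi> y) y" by (rule Cinf_on_has_dir[OF schwartzD(1)[OF \<Phi>] b UNIV_I])
  have "norm z <= norm y + 3" using y norm_triangle_ineq2[of z y] by (simp add: dist_norm)
  hence "1 + norm z <= 4 * (1 + norm y)" by (smt (verit) norm_ge_zero)
  hence "(1 + norm z) ^ m <= (4 * (1 + norm y)) ^ m" by (intro power_mono) auto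
  hence "(1 + norm z) ^ m * norm (dirD b \<Phi> y) <= (4 * (1 + norm y)) ^ m * norm (dirD b \<Phi> y)" by (rule mult_right_mono) simp
  also have "... = 4 ^ m * ((1 + norm y) ^ m * norm (dirD b \<Phi> y))" by (simp only: power_mult_distrib mult.assoc)
  also have "... <= 4 ^ m * C0" using C(2)[OF b, of y] le[OF b] by (intro mult_left_mono) auto
  finally show "norm (dirD b \<Phi> y) <= B" using z by (simp add: B_def field_simps)
 next
  have "norm ((w, 0) + z - z) < 3" using nw ep by simp
  thus "(w, 0) + z : ball z 3" by (simp add: dist_norm norm_minus_commute del: add_diff_cancel)
 qed
 also have "... <= B * N * (2 * ep)" using nw B N by (intro mult_left_mono) auto
 finally show ?thesis .
 qed
 have s: "schwartz (%w. mol d ep w * \<Phi> ((w, 0) + z))"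
 proof (rule schwartz_compact)
 show "Cinf_on UNIV (%w. mol d ep w * \<Phi> ((w, 0) + z))"
  using Cinf_on_affine[OF schwartzD(1)[OF \<Phi>] open_UNIV open_UNIV linear_Pair0(2), of z]
  by (intro Cinf_on_mult open_UNIV schwartzD(1)[OF schwartz_mol[OF ep(1)]]) (simp add: add.commute)
 show "ep + ep\<^sup>2 < norm w ==> mol d ep w * \<Phi> ((w, 0) + z) = 0" for w by (simp add: mol_outside_norm ep)
 qed
 have "\<Phi> z - M ep \<Phi> z = (LBINT w. mol d ep w * \<Phi> z) - (LBINT w. mol d ep w * \<Phi> ((w, 0) + z))"
 by (simp add: integral_mol(3)[OF ep(1)] M_def)
 also have "... = (LBINT w. mol d ep w * \<Phi> z - mol d ep w * \<Phi> ((w, 0) + z))"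
 by (intro Bochner_Integration.integral_diff[symmetric] integrable_mult_left schwartz_integrable schwartz_mol ep s)
 also have "... = (LBINT w. mol d ep w * (\<Phi> z - \<Phi> ((w, 0) + z)))" by (simp add: right_diff_distrib)
 also have "norm ... <= B * N * (2 * ep)"
 proof (rule mol_integral_le[OF ep(1)])
 show "continuous_on UNIV (%w. \<Phi> z - \<Phi> ((w, 0) + z))"
  by (intro continuous_intros continuous_on_compose2[OF Cinf_on_continuous[OF schwartzD(1)[OF \<Phi>]]]) auto
 show "norm (\<Phi> z - \<Phi> ((w, 0) + z)) <= B * N * (2 * ep)" if "anorm d w <= ep" for w
  using lip[OF that] by (simp add: norm_minus_commute)
 qed (use B N ep in auto)
 finally have "(1 + norm z) ^ m * norm (\<Phi> z - M ep \<Phi> z) <= (1 + norm z) ^ m * (B * N * (2 * ep))" using z by (intro mult_left_mono) auto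
 also have "... = (C0 * 4 ^ m * N * 2) * ep"
 proof -
 have "x * (C0 * 4 ^ m / x * N * (2 * ep)) = (C0 * 4 ^ m * N * 2) * ep" if "0 < x" for x using that by simp
 from this[OF z] show ?thesis by (simp only: B_def)
 qed
 finally show ?thesis .
 qed
 thus ?thesis using C0 N by (intro exI[of _ "C0 * 4 ^ m * N * 2"]) auto
qed

text \<open>Fubini carries the integral over (x, \<xi>) into \<open>K\<close>; there the
  \<xi>-integral is Fourier inversion in u and the x-integral is the mollification. Pairing with a
  regularized amplitude is thus \<open>K\<close> at a regularized test function.\<close>

lemma K_HH:
 assumes \<Phi>: "schwartz \<Phi>" and ep: "0 < ep" and R: "0 < R"
 shows "(LBINT p. A ep R p * pft \<Phi> p) = K (%q. cutR d R (snd q) * M ep \<Phi> q)"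
proof -
 define H where "H z = HH ep R z * pft \<Phi> (fst z)" for z
 have sH: "schwartz H"
 proof -
 define L where "L z = (fst z, fst (fst z) - fst (snd z), snd (snd z))" for z :: "((real^'n) \<times> (real^'n)) \<times> (real^'n) \<times> (real^'n)"
 define \<theta> where "\<theta> z = pft \<Phi> (fst z) * (%q. mol d ep (fst q) * cutR d R (snd q)) (snd z)" for z :: "((real^'n) \<times> (real^'n)) \<times> (real^'n) \<times> (real^'n)"
 have "schwartz (%z. \<theta> (L z))"
 proof (rule schwartz_linear[where \<theta> = \<theta> and L = L and A = 5])
 show "schwartz \<theta>" unfolding \<theta>_def
  by (intro schwartz_tensor[OF schwartz_pft[OF \<Phi>]] schwartz_tensor[OF schwartz_mol[OF ep] schwartz_cutR[OF R]])
 show "linear L" unfolding L_def by (auto intro!: linearI simp: algebra_simps)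
 fix z :: "((real^'n) \<times> (real^'n)) \<times> (real^'n) \<times> (real^'n)"
 obtain x \<xi> y u where z: "z = ((x, \<xi>), (y, u))" by (metis surj_pair)
 define e where "e = norm (L z)"
 have e: "norm (x, \<xi>) <= e" "norm (x - y) <= e" "norm u <= e" unfolding e_def z L_def fst_conv snd_conv
  using norm_fst_le[of "(x, \<xi>)" "(x - y, u)"] norm_snd_le[of "(x - y, u)" "(x, \<xi>)"] norm_fst_le[of "x - y" u] norm_snd_le[of u "x - y"] by linarith+
 have "norm z <= norm (x, \<xi>) + (norm y + norm u)" using norm_Pair_le[of "(x, \<xi>)" "(y, u)"] norm_Pair_le[of y u] by (simp add: z)
 moreover have "norm y <= norm (x - y) + norm (x, \<xi>)" using norm_triangle_ineq4[of x "x - y"] norm_fst_le[of x \<xi>] by simp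
 ultimately show "norm z <= 5 * norm (L z)" using e norm_ge_zero[of "L z"] unfolding e_def by linarith
 qed simp
 moreover have "linear (%z :: ((real^'n) \<times> (real^'n)) \<times> ((real^'n) \<times> (real^'n)). (snd (fst z), snd (snd z)))" by (auto intro!: linearI)
 ultimately have "schwartz (%z. osc [] (snd (fst z), snd (snd z)) * \<theta> (L z))" by (intro schwartz_om om_linear_compose[OF om_osc])
 thus ?thesis by (simp add: H_def[abs_def] HH_def \<theta>_def L_def mult_ac)
 qed
 have "A ep R p * pft \<Phi> p = K (%q. H (p, q))" for p
 using tempered_scale[OF K PS_slice[OF PS_HH[OF ep R]], of "pft \<Phi> p" p] by (simp add: A_def H_def mult.commute)
 hence "(LBINT p. A ep R p * pft \<Phi> p) = K (%q. LBINT p. H (p, q))" using tempered_Fubini[OF K sH] by simp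
 moreover have "(LBINT p. H (p, q)) = cutR d R (snd q) * M ep \<Phi> q" for q
 proof -
 obtain y u where q: "q = (y, u)" by (cases q)
 have sl: "schwartz (%p. H (p, q))" using schwartz_slice[OF schwartz_swap[OF sH], of q] by simp
 have "(LBINT \<xi>. H ((x, \<xi>), q)) = cutR d R u * (mol d ep (x - y) * \<Phi> (x, u))" for x
 proof -
 have "H ((x, \<xi>), q) = cutR d R u * mol d ep (x - y) * (ft (%u. \<Phi> (x, u)) \<xi> * cis (- (2 * pi) * (u \<bullet> \<xi>)))" for \<xi>
  by (simp add: H_def HH_def q pft_def osc_def mult_ac)
 thus ?thesis using ft_inversion[OF schwartz_slice[OF \<Phi>], of x u] by (simp add: mult.assoc)
 qed
 hence "(LBINT p. H (p, q)) = cutR d R u * (LBINT x. mol d ep (x - y) * \<Phi> (x, u))"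
 unfolding integral_lborel_prod[OF schwartz_integrable[OF sl]] by simp
 also have "(LBINT x. mol d ep (x - y) * \<Phi> (x, u)) = (LBINT w. mol d ep (y + w - y) * \<Phi> (y + w, u))"
 proof (rule integral_translate[symmetric])
 have "schwartz (%x. \<Phi> (x, u))" using schwartz_slice[OF schwartz_swap[OF \<Phi>], of u] by simp
 moreover have "schwartz (%x. mol d ep (x - y))" using schwartz_shift[OF schwartz_mol[OF ep], of d "- y"] by simp
 ultimately show "(%x. mol d ep (x - y) * \<Phi> (x, u)) : borel_measurable borel" using schwartz_measurable by simp
 qed
 finally show ?thesis by (simp add: M_def q add.commute)
 qed
 ultimately show ?thesis by simp
qed

end

subsection \<open>Representation of the kernel\<close>

text \<open>The cutoff is treated as a tensor product with the constant 1 in x; R >= 1 makes every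
  factor R^(-wdeg) at most 1.\<close>

lemma Dl_snd_bound:
 fixes d :: "'n::finite"
 assumes vs: "set vs <= Basis"
 shows "EX C>=0. ALL R z. 1 <= R --> norm (Dl vs (%z :: (real^'n) \<times> (real^'n). cutR d R (snd z)) z) <= C"
proof -
 obtain I al where m: "mset vs = mset (map xdir I @ map udir al)" using sort_directions[OF vs] .
 have "gsym (UNIV :: unit set) UNIV (%z :: real^'n. 1) (udeg d) 0 (%p z. 1)" by (rule gsym_const) auto
 from gsym_bound[OF this set_xudir(2)[of I]]
 obtain C1 where C1: "C1 >= 0" "!!x. norm (Dl (map cdir I) (%z :: real^'n. 1 :: complex) x) <= C1" by auto
 obtain B where B: "B >= 0" "!!R u. R > 0 ==> norm (Dl (map cdir al) (cutR d R) u) <= (if anorm d u <= R then B * R powr (- wdeg d al) else 0)"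
 using cutR_bound[of al d] by blast
 have "norm (Dl vs (%z :: (real^'n) \<times> (real^'n). cutR d R (snd z)) z) <= C1 * B" if R: "1 <= R" for R z
 proof -
 have c: "Cinf_on UNIV (%z :: (real^'n) \<times> (real^'n). cutR d R (snd z))"
 using Cinf_on_affine[OF Cinf_cutR[of d R] open_UNIV open_UNIV linear_snd, of 0] by simp
 have "Dl vs (%z. cutR d R (snd z)) z = Dl (map cdir I) (%_. 1) (fst z) * Dl (map cdir al) (cutR d R) (snd z)"
 using Dl_tensor[OF Cinf_on_const[OF open_UNIV] Cinf_cutR, of I al 1 d R] Dl_perm[OF open_UNIV c m UNIV_I] by simp
 moreover have "norm (Dl (map cdir al) (cutR d R) (snd z)) <= B"
 proof -
 have "R powr (- wdeg d al) <= 1" using R powr_mono[of "- wdeg d al" 0 R] by simp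
 hence "B * R powr (- wdeg d al) <= B" using B(1) mult_left_mono[of _ 1 B] by fastforce
 thus ?thesis using B(2)[of R "snd z"] R B(1) by (auto split: if_splits)
 qed
 ultimately show ?thesis using C1 by (simp add: norm_mult mult_mono)
 qed
 thus ?thesis using C1(1) B(1) by (intro exI[of _ "C1 * B"]) auto
qed

context kernel
begin

definition cj :: "nat => (real^'n) \<times> (real^'n) => complex" where
 "cj j z = cutR d (real j + 1) (snd z)"

lemma Cinf_cj: "Cinf_on UNIV (cj j)"
 unfolding cj_def using Cinf_on_affine[OF Cinf_cutR open_UNIV open_UNIV linear_snd, of 0 d "real j + 1"] by simp

lemma cj_bound: "set vs <= Basis ==> EX C>=0. ALL j z. norm (Dl vs (cj j) z) <= C"
 using Dl_snd_bound[of vs d] unfolding cj_def[abs_def] by (metis le_add_same_cancel2 of_nat_0_le_iff)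

text \<open>Mollification commutes with derivatives, so \<open>M_diff\<close> applies to each
  derivative of \<Phi>; the product rule adds only the uniform bounds on the cutoffs.\<close>

lemma inner_error:
 assumes \<Phi>: "schwartz \<Phi>" and vs: "set vs <= Basis"
 shows "EX C. ALL j z. (1 + norm z) ^ m * norm (Dl vs (%z. cj j z * (\<Phi> z - M (1 / (real j + 1)) \<Phi> z)) z) <= C / (real j + 1)"
proof -
 have sM: "schwartz (M (1 / (real j + 1)) \<Phi>)" for j by (rule M_props(1)[OF \<Phi>]) simp
 have "EX C. ALL j:UNIV. ALL z:UNIV. norm (Dl vs (%z. cj j z * (\<Phi> z - M (1 / (real j + 1)) \<Phi> z)) z) <= C * (1 / (real j + 1) / (1 + norm z) ^ m)"
 proof (rule Leibniz_bound[OF open_UNIV Cinf_cj _ vs])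
 show "Cinf_on UNIV (%z. \<Phi> z - M (1 / (real j + 1)) \<Phi> z)" for j by (rule schwartzD(1)[OF schwartz_diff[OF \<Phi> sM]])
 fix a b :: "((real^'n) \<times> (real^'n)) list" assume a: "set a <= Basis" and b: "set b <= Basis"
 obtain C1 where C1: "C1 >= 0" "!!j z. norm (Dl a (cj j) z) <= C1" using cj_bound[OF a] by blast
 obtain C2 where C2: "C2 >= 0" "!!ep z. 0 < ep ==> ep <= 1 ==> (1 + norm z) ^ m * norm (Dl b \<Phi> z - M ep (Dl b \<Phi>) z) <= C2 * ep"
 using M_diff[OF schwartz_Dl[OF \<Phi> b], of m] by blast
 have "norm (Dl a (cj j) z) * norm (Dl b (%z. \<Phi> z - M (1 / (real j + 1)) \<Phi> z) z) <= C1 * C2 * (1 / (real j + 1) / (1 + norm z) ^ m)" for j z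
 proof -
 define ep where "ep = 1 / (real j + 1)"
 have ep: "0 < ep" "ep <= 1" by (auto simp: ep_def)
 have z: "0 < (1 + norm z) ^ m" by (intro zero_less_power add_pos_nonneg) auto
 have "Dl b (%z. \<Phi> z - M ep \<Phi> z) z = Dl b \<Phi> z - M ep (Dl b \<Phi>) z"
  using Cinf_on_diff(2)[OF open_UNIV schwartzD(1)[OF \<Phi>] schwartzD(1)[OF M_props(1)[OF \<Phi> ep(1)]] b UNIV_I] M_props(2)[OF \<Phi> ep(1) b] by simp
 hence "norm (Dl b (%z. \<Phi> z - M ep \<Phi> z) z) <= C2 * ep / (1 + norm z) ^ m"
  using C2(2)[OF ep, of z] z by (simp add: pos_le_divide_eq mult.commute)
 with C1 have "norm (Dl a (cj j) z) * norm (Dl b (%z. \<Phi> z - M ep \<Phi> z) z) <= C1 * (C2 * ep / (1 + norm z) ^ m)"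
  by (intro mult_mono) auto
 thus ?thesis by (simp add: ep_def)
 qed
 thus "EX C. ALL j:UNIV. ALL z:UNIV. norm (Dl a (cj j) z) * norm (Dl b (%z. \<Phi> z - M (1 / (real j + 1)) \<Phi> z) z)
 <= C * (1 / (real j + 1) / (1 + norm z) ^ m)" by blast
 qed auto
 then obtain C where C: "!!j z. norm (Dl vs (%z. cj j z * (\<Phi> z - M (1 / (real j + 1)) \<Phi> z)) z) <= C * (1 / (real j + 1) / (1 + norm z) ^ m)" by blast
 have "(1 + norm z) ^ m * norm (Dl vs (%z. cj j z * (\<Phi> z - M (1 / (real j + 1)) \<Phi> z)) z) <= C / (real j + 1)" for j z
 proof -
 have z: "0 < (1 + norm z) ^ m" by (intro zero_less_power add_pos_nonneg) auto
 have "norm (Dl vs (%z. cj j z * (\<Phi> z - M (1 / (real j + 1)) \<Phi> z)) z) <= C / (real j + 1) / (1 + norm z) ^ m" using C[of j z] by simp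
 thus ?thesis by (simp only: pos_le_divide_eq[OF z] mult.commute)
 qed
 thus ?thesis by blast
qed

text \<open>Where 1 - cj j does not vanish, anorm u >= (j + 1) / 8, hence j + 1 <= 16 (1 + norm z),
  and one extra power of Schwartz decay buys the factor 1 / (j + 1).\<close>

lemma outer_error:
 assumes \<Phi>: "schwartz \<Phi>" and vs: "set vs <= Basis"
 shows "EX C. ALL j z. (1 + norm z) ^ m * norm (Dl vs (%z. (1 - cj j z) * \<Phi> z) z) <= C / (real j + 1)"
proof -
 define X where "X j = {z :: (real^'n) \<times> (real^'n). (real j + 1) / 8 <= anorm d (snd z)}" for j
 have c1: "Cinf_on UNIV (%z. 1 - cj j z)" for j by (intro Cinf_on_diff(1) open_UNIV Cinf_on_const Cinf_cj)
 have "EX C. ALL j:UNIV. ALL z:X j. norm (Dl vs (%z. (1 - cj j z) * \<Phi> z) z) <= C * (1 / (real j + 1) / (1 + norm z) ^ m)"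
 proof (rule Leibniz_bound[OF open_UNIV c1 schwartzD(1)[OF \<Phi>] vs])
 fix a b :: "((real^'n) \<times> (real^'n)) list" assume a: "set a <= Basis" and b: "set b <= Basis"
 obtain C1 where C1: "C1 >= 0" "!!j z. norm (Dl a (cj j) z) <= C1" using cj_bound[OF a] by blast
 have "gsym (UNIV :: unit set) UNIV (%z :: (real^'n) \<times> (real^'n). 1) (xudeg d) 0 (%p z. 1)" by (rule gsym_const) auto
 from gsym_bound[OF this a]
 obtain C3 where C3: "C3 >= 0" "!!x. norm (Dl a (%z. 1 :: complex) x) <= C3" by auto
 obtain C2 where C2: "C2 >= 0" "!!z. (1 + norm z) ^ (m + 1) * norm (Dl b \<Phi> z) <= C2" using schwartz_bound[OF \<Phi> b] by blast
 have "norm (Dl a (%z. 1 - cj j z) z) * norm (Dl b \<Phi> z) <= (C3 + C1) * (16 * C2) * (1 / (real j + 1) / (1 + norm z) ^ m)" if "z : X j" for j z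
 proof -
 have z: "0 < (1 + norm z) ^ m" by (intro zero_less_power add_pos_nonneg) auto
 have eq: "Dl a (%z. 1 - cj j z) z = Dl a (%z. 1) z - Dl a (cj j) z"
  by (rule Cinf_on_diff(2)[OF open_UNIV Cinf_on_const[OF open_UNIV] Cinf_cj a UNIV_I])
 have 1: "norm (Dl a (%z. 1 - cj j z) z) <= C3 + C1"
  unfolding eq using norm_triangle_ineq4[of "Dl a (%z. 1) z" "Dl a (cj j) z"] C3(2)[of z] C1(2)[of j z] by linarith
 have "real j + 1 <= 16 * (1 + norm z)"
  using that anorm_le_norm[of d "snd z"] norm_snd_le[of "snd z" "fst z"] by (simp add: X_def)
 hence "(real j + 1) * ((1 + norm z) ^ m * norm (Dl b \<Phi> z)) <= 16 * (1 + norm z) * ((1 + norm z) ^ m * norm (Dl b \<Phi> z))"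
  using z by (intro mult_right_mono) auto
 also have "... = 16 * ((1 + norm z) ^ (m + 1) * norm (Dl b \<Phi> z))" by (simp only: power_add power_one_right mult_ac)
 also have "... <= 16 * C2" using C2(2)[of z] by simp
 finally have "norm (Dl b \<Phi> z) <= 16 * C2 * (1 / (real j + 1) / (1 + norm z) ^ m)"
  using z by (simp add: pos_le_divide_eq mult_ac)
 hence "norm (Dl a (%z. 1 - cj j z) z) * norm (Dl b \<Phi> z) <= (C3 + C1) * (16 * C2 * (1 / (real j + 1) / (1 + norm z) ^ m))"
  using 1 C1(1) C3(1) by (intro mult_mono) auto
 thus ?thesis by (simp only: mult.assoc)
 qed
 thus "EX C. ALL j:UNIV. ALL z:X j. norm (Dl a (%z. 1 - cj j z) z) * norm (Dl b \<Phi> z) <= C * (1 / (real j + 1) / (1 + norm z) ^ m)" by blast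
 qed auto
 then obtain C where C: "!!j z. z : X j ==> norm (Dl vs (%z. (1 - cj j z) * \<Phi> z) z) <= C * (1 / (real j + 1) / (1 + norm z) ^ m)" by blast
 have "(1 + norm z) ^ m * norm (Dl vs (%z. (1 - cj j z) * \<Phi> z) z) <= \<bar>C\<bar> / (real j + 1)" for j z
 proof (cases "z : X j")
 case True
 have z: "0 < (1 + norm z) ^ m" by (intro zero_less_power add_pos_nonneg) auto
 have "C * (1 / (real j + 1) / (1 + norm z) ^ m) <= \<bar>C\<bar> * (1 / (real j + 1) / (1 + norm z) ^ m)" using z by (intro mult_right_mono) auto
 with C[OF True] have "norm (Dl vs (%z. (1 - cj j z) * \<Phi> z) z) <= \<bar>C\<bar> / (real j + 1) / (1 + norm z) ^ m" by simp
 thus ?thesis using z by (simp add: pos_le_divide_eq mult.commute)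
 next
 case False
 have "Dl vs (%z. (1 - cj j z) * \<Phi> z) z = 0"
 by (rule Dl_vanishes[OF _ open_snd_anorm_less[of "(real j + 1) / 8"]])
  (use False in "auto simp: X_def cj_def cutR_simps(2)")
 thus ?thesis by simp
 qed
 thus ?thesis by blast
qed

text \<open>\<open>K\<close> at the regularized test functions \<Psi> j has two limits. Through the
  amplitudes it tends to \<open>Kop (P [])\<close>; and \<Phi> - \<Psi> j, the sum of the inner and
  the outer error, tends to 0 in the seminorm that bounds \<open>K\<close>.\<close>

lemma K_eq_Kop:
 assumes \<Phi>: "schwartz \<Phi>" shows "K \<Phi> = Kop (P []) \<Phi>"
proof (rule LIMSEQ_unique)
 define \<Psi> where "\<Psi> j z = cj j z * M (1 / (real j + 1)) \<Phi> z" for j z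
 have K\<Psi>: "K (\<Psi> j) = (LBINT z. aj j z * pft \<Phi> z)" for j
 using K_HH[OF \<Phi>, of "1 / (real j + 1)" "real j + 1"] by (simp add: aj_def \<Psi>_def[abs_def] cj_def)
 show "(%j. K (\<Psi> j)) \<longlonglongrightarrow> Kop (P []) \<Phi>" unfolding K\<Psi> by (rule aj_integral_lim[OF \<Phi>])
 have sM: "schwartz (M (1 / (real j + 1)) \<Phi>)" for j by (rule M_props(1)[OF \<Phi>]) simp
 have oc: "om (cj j)" for j
 unfolding cj_def by (rule om_linear_compose[OF schwartz_imp_om[OF schwartz_cutR] linear_snd]) simp
 have s\<Psi>: "schwartz (\<Psi> j)" for j unfolding \<Psi>_def by (rule schwartz_om[OF sM oc])
 obtain C0 m where C0: "C0 >= 0" "!!f B. schwartz f ==>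
 (ALL vs x. set vs <= Basis & length vs <= m --> (1 + norm x) ^ m * norm (Dl vs f x) <= B) ==> norm (K f) <= C0 * B"
 using tempered_bound[OF K] by blast
 have "ALL vs. EX C. set vs <= Basis --> (ALL j z. (1 + norm z) ^ m * norm (Dl vs (%z. \<Psi> j z - \<Phi> z) z) <= C / (real j + 1))"
 proof (intro allI)
 fix vs :: "((real^'n) \<times> (real^'n)) list"
 show "EX C. set vs <= Basis --> (ALL j z. (1 + norm z) ^ m * norm (Dl vs (%z. \<Psi> j z - \<Phi> z) z) <= C / (real j + 1))"
 proof (cases "set vs <= Basis")
 case True
 obtain C1 where C1: "!!j z. (1 + norm z) ^ m * norm (Dl vs (%z. cj j z * (\<Phi> z - M (1 / (real j + 1)) \<Phi> z)) z) <= C1 / (real j + 1)"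
  using inner_error[OF \<Phi> True] by blast
 obtain C2 where C2: "!!j z. (1 + norm z) ^ m * norm (Dl vs (%z. (1 - cj j z) * \<Phi> z) z) <= C2 / (real j + 1)"
  using outer_error[OF \<Phi> True] by blast
 have "(1 + norm z) ^ m * norm (Dl vs (%z. \<Psi> j z - \<Phi> z) z) <= (C1 + C2) / (real j + 1)" for j z
 proof -
  define f where "f z = cj j z * (\<Phi> z - M (1 / (real j + 1)) \<Phi> z)" for z
  define g where "g z = (1 - cj j z) * \<Phi> z" for z
  have s: "schwartz f" "schwartz g" unfolding f_def g_def left_diff_distrib mult_1
  by (intro schwartz_om schwartz_diff \<Phi> sM oc)+
  have "(%z. \<Psi> j z - \<Phi> z) = (%z. (-1) * (f z + g z))" by (simp add: \<Psi>_def f_def g_def fun_eq_iff algebra_simps)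
  hence "Dl vs (%z. \<Psi> j z - \<Phi> z) z = (-1) * (Dl vs f z + Dl vs g z)"
  by (simp only: Cinf_on_scale(2)[OF open_UNIV Cinf_on_add(1)[OF open_UNIV schwartzD(1)[OF s(1)] schwartzD(1)[OF s(2)]] True UNIV_I]
   Cinf_on_add(2)[OF open_UNIV schwartzD(1)[OF s(1)] schwartzD(1)[OF s(2)] True UNIV_I])
  hence "norm (Dl vs (%z. \<Psi> j z - \<Phi> z) z) <= norm (Dl vs f z) + norm (Dl vs g z)"
  using norm_triangle_ineq[of "Dl vs f z" "Dl vs g z"] by (simp only: norm_mult norm_minus_cancel norm_one mult_1)
  hence "(1 + norm z) ^ m * norm (Dl vs (%z. \<Psi> j z - \<Phi> z) z) <= (1 + norm z) ^ m * (norm (Dl vs f z) + norm (Dl vs g z))"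
  by (rule mult_left_mono) simp
  also have "... <= C1 / (real j + 1) + C2 / (real j + 1)" unfolding distrib_left f_def[abs_def] g_def[abs_def] by (intro add_mono C1 C2)
  finally show ?thesis by (simp add: add_divide_distrib)
 qed
 thus ?thesis by blast
 qed auto
 qed
 from choice[OF this] obtain B where B: "!!vs j z. set vs <= Basis ==> (1 + norm z) ^ m * norm (Dl vs (%z. \<Psi> j z - \<Phi> z) z) <= B vs / (real j + 1)" by blast
 \<comment> \<open>Only the finitely many derivatives of length at most m enter the bound on
   \<open>K\<close>, so their constants can be added.\<close>
 define B0 where "B0 = (\<Sum>vs\<in>{vs. set vs <= (Basis :: ((real^'n) \<times> (real^'n)) set) & length vs <= m}. \<bar>B vs\<bar>)"
 show "(%j. K (\<Psi> j)) \<longlonglongrightarrow> K \<Phi>"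
 proof (rule tendsto_inverse_bound[where C = "C0 * B0"])
 fix j
 have "norm (K (%z. \<Psi> j z - \<Phi> z)) <= C0 * (B0 / (real j + 1))"
 proof (rule C0(2)[OF schwartz_diff[OF s\<Psi> \<Phi>]], intro allI impI)
 fix vs :: "((real^'n) \<times> (real^'n)) list" and z assume vs: "set vs <= Basis & length vs <= m"
 have "\<bar>B vs\<bar> <= B0" unfolding B0_def by (rule member_le_sum) (use vs in "auto intro: finite_short_lists")
 hence "B vs / (real j + 1) <= B0 / (real j + 1)" by (intro divide_right_mono) auto
 thus "(1 + norm z) ^ m * norm (Dl vs (%z. \<Psi> j z - \<Phi> z) z) <= B0 / (real j + 1)" using B[of vs z j] vs by simp
 qed
 thus "norm (K (\<Psi> j) - K \<Phi>) <= C0 * B0 / (real j + 1)" by (simp add: tempered_diff[OF K s\<Psi> \<Phi>])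
 qed
qed

end

theorem theorem6p2:
  fixes A :: "real^'n \<Rightarrow> real^'n^'n::finite" and d :: 'n and c n :: real
    and T :: "(real^'n \<Rightarrow> complex) \<Rightarrow> (real^'n \<Rightarrow> complex) \<Rightarrow> complex"
  assumes smoothA: "\<forall>i j. Cinf_on UNIV (\<lambda>x. A x $ i $ j)"
    and boundedA: "\<forall>i j vs. set vs \<subseteq> Basis \<longrightarrow> (\<exists>C. \<forall>x. \<bar>Dl vs (\<lambda>x. A x $ i $ j) x\<bar> \<le> C)"
    and c_pos: "c > 0"
    and detA: "\<forall>x. \<bar>det (A x)\<bar> \<ge> c"
    and n_nonneg: "n \<ge> 0"
  shows "T \<in> PsiD A d n \<longleftrightarrow>
    (\<exists>K. tempered K \<and> kernel_cond_a d n K \<and> kernel_cond_b d n K \<and> kernel_cond_c A T K)"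
proof -
 interpret fr: frame A c using smoothA boundedA c_pos detA by unfold_locales auto
 show ?thesis
 proof
 assume "T : PsiD A d n"
 then obtain a where "symb d n a" "kernel_cond_c A T (Kop a)" unfolding fr.PsiD_iff by blast
 thus "EX K. tempered K & kernel_cond_a d n K & kernel_cond_b d n K & kernel_cond_c A T K"
 using tempered_Kop[OF symb_imp_om] Kop_cond_a Kop_cond_b n_nonneg by blast
 next
 assume "EX K. tempered K & kernel_cond_a d n K & kernel_cond_b d n K & kernel_cond_c A T K"
 then obtain K where L: "tempered K" "kernel_cond_a d n K" "kernel_cond_b d n K" "kernel_cond_c A T K" by blast
 obtain k where "Cinf_on (UNIV \<times> (UNIV - {0})) k"
 "ALL \<phi>. schwartz \<phi> & compact (closure {p. \<phi> p ~= 0}) & closure {p. \<phi> p ~= 0} <= UNIV \<times> (UNIV - {0})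
  --> K \<phi> = (LBINT p. k p * \<phi> p)"
 "ALL I \<gamma> (M::real). M >= 0 --> (EX C. ALL x u. u ~= 0 -->
  norm (Dl (map xdir I @ map udir \<gamma>) k (x, u)) <= C * anorm d u powr (- (real CARD('n) + 1) - n - wdeg d \<gamma> - M))"
 using L(2) unfolding kernel_cond_a_def by blast
 then interpret kernel d n K k using L n_nonneg by unfold_locales blast+
 \<comment> \<open>\<open>K\<close> and \<open>Kop (P [])\<close> agree on all Schwartz functions,
   in particular on the test functions of (c).\<close>
 have "kernel_cond_c A T (Kop (P []))"
 using L(4) K_eq_Kop[OF fr.schwartz_\<Phi>fg] unfolding fr.kernel_cond_c_iff by simp
 thus "T : PsiD A d n" unfolding fr.PsiD_iff using symb_P by blast
 qed
qed

end
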